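(* The following construction defines a functor $$\mathbf{IesqSesq}\longrightarrow\mathbf{Decomp}^{\mathrm{culf}}$$ from the category of iesq sesquicartesian fibrations to the category of decomposition spaces and CULF functors. To an iesq sesquicartesian fibration $p:X\to\underline\Delta$ with fibres $X_n$ over $\underline n$ one assigns the simplicial groupoid whose value at $[n]$ is the maximal subgroupoid $X_n^{\mathrm{iso}}$, on which a generic map $g:[n]\to[m]$ of $\Delta$ acts by the cocartesian pushforward $\underline g_!:X_m^{\mathrm{iso}}\to X_n^{\mathrm{iso}}$ along the corresponding map $\underline g:\underline m\to\underline n$ of $\underline\Delta$, and a free map $f:[n]\to[m]$ acts by the cartesian pullback $\underline f^{*}:X_m^{\mathrm{iso}}\to X_n^{\mathrm{iso}}$ along the corresponding convex map $\underline f:\underline n\to\underline m$. To a morphism $c:X\to Y$ of $\mathbf{IesqSesq}$ one assigns the simplicial map with components induced by $c$ on fibres.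
   Context: Conventions: simplicial groupoids are pseudo-functors $\Delta^{\mathrm{op}}\to\mathbf{Grpd}$, maps between them are pseudo-natural transformations, and pullbacks of groupoids are homotopy pullbacks. $\Delta$ is the category of nonempty finite ordinals $[n]=\{0,\dots,n\}$ and monotone maps. A map $a:[m]\to[n]$ is generic if $a(0)=0$ and $a(m)=n$, and free if $a(i+1)=a(i)+1$ for $0\le i\le m-1$; every map factors uniquely as a generic map followed by a free map, and generic and free maps admit pushouts along each other in $\Delta$. A decomposition space is a simplicial groupoid sending generic–free pushouts in $\Delta$ to pullbacks. A simplicial map is CULF if its naturality squares on all generic maps are pullbacks. $\underline{\Delta}$ is the category with objects $\underline n=\{1,\dots,n\}$, $n\ge 0$, and monotone maps. There is an isomorphism $\Delta_{\mathrm{gen}}^{\mathrm{op}}\cong\underline\Delta$, $[n]\leftrightarrow\underline n$: a generic map $g:[n]\to[m]$ corresponds to $\underline g:\underline m\to\underline n$ sending $j$ to the unique $i$ with $g(i-1)<j\le g(i)$. A map $j$ in $\underline\Delta$ is convex if $j(x+1)=j(x)+1$ for all $x$ for which this makes sense. A free map $f:[n]\to[m]$, $f(i)=i+c$, with $n\ge1$, corresponds to the convex map $\underline f:\underline n\to\underline m$, $i\mapsto i+c$; every map $[0]\to[m]$ corresponds to the unique map $\underline 0\to\underline m$. An identity-extension square is a commutative square in $\underline\Delta$ consisting of $f:\underline n\to\underline k$, $g=\mathrm{id}_a+f+\mathrm{id}_b:\underline a+\underline n+\underline b\to\underline a+\underline k+\underline b$ and the canonical convex inclusions $j:\underline n\to\underline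 a+\underline n+\underline b$, $i:\underline k\to\underline a+\underline k+\underline b$. A sesquicartesian fibration is a cocartesian fibration $X\to\underline\Delta$ that is also cartesian over the subcategory of convex maps and satisfies Beck–Chevalley: for each pullback square $\tau\sigma'=\sigma\tau'$ in $\underline\Delta$ with $\tau$ (hence $\tau'$) convex, the comparison map $\sigma'_!\tau'^*\to\tau^*\sigma_!$ is an isomorphism (lower shriek: cocartesian pushforward; upper star: cartesian pullback). It is iesq if for every identity-extension square, consisting of $f:\underline n\to\underline k$, $g=\mathrm{id}_a+f+\mathrm{id}_b:\underline a+\underline n+\underline b\to\underline a+\underline k+\underline b$ and the canonical convex inclusions $j:\underline n\to\underline a+\underline n+\underline b$, $i:\underline k\to\underline a+\underline k+\underline b$, the square with sides $j^*:X_{a+n+b}\to X_n$, $f_!:X_n\to X_k$, $g_!:X_{a+n+b}\to X_{a+k+b}$, $i^*:X_{a+k+b}\to X_k$ is a homotopy pullback of categories (equivalent to an iso-comma square). $\mathbf{IesqSesq}$ has as objects iesq sesquicartesian fibrations, and as morphisms functors $c:X\to Y$ over $\underline\Delta$ that preserve cocartesian arrows and cartesian arrows over convex maps, and such that for every $f:\underline n\to\underline k$ in $\underline\Delta$ the square formed by $f_!:X_n\to X_k$, $f_!:Y_n\to Y_k$ and the components of $c$ is a homotopy pullback of categories. *)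

theory Defs
  imports Main "HOL-Library.FuncSet"
begin

section \<open>Categories, functors, natural isomorphisms\<close>

record ('o, 'a) cat =
  Ob :: "'o set"
  Ar :: "'a set"
  Src :: "'a \<Rightarrow> 'o"
  Tgt :: "'a \<Rightarrow> 'o"
  Ident :: "'o \<Rightarrow> 'a"
  Cmp :: "'a \<Rightarrow> 'a \<Rightarrow> 'a"

abbreviation cmp_in :: "'a \<Rightarrow> ('o, 'a) cat \<Rightarrow> 'a \<Rightarrow> 'a"
    (\<open>(_ \<cdot>\<^bsub>_\<^esub> _)\<close> [66, 0, 65] 65)
  where "g \<cdot>\<^bsub>C\<^esub> f \<equiv> Cmp C g f"

definition hom :: "('o, 'a) cat \<Rightarrow> 'o \<Rightarrow> 'o \<Rightarrow> 'a set" where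
  "hom C x y = {f \<in> Ar C. Src C f = x \<and> Tgt C f = y}"

definition category :: "('o, 'a) cat \<Rightarrow> bool" where
  "category C \<longleftrightarrow>
     (\<forall>f \<in> Ar C. Src C f \<in> Ob C \<and> Tgt C f \<in> Ob C) \<and>
     (\<forall>x \<in> Ob C. Ident C x \<in> hom C x x) \<and>
     (\<forall>f \<in> Ar C. \<forall>g \<in> Ar C. Tgt C f = Src C g \<longrightarrow> g \<cdot>\<^bsub>C\<^esub> f \<in> hom C (Src C f) (Tgt C g)) \<and>
     (\<forall>f \<in> Ar C. f \<cdot>\<^bsub>C\<^esub> Ident C (Src C f) = f \<and> Ident C (Tgt C f) \<cdot>\<^bsub>C\<^esub> f = f) \<and>
     (\<forall>f \<in> Ar C. \<forall>g \<in> Ar C. \<forall>h \<in> Ar C. Tgt C f = Src C g \<and> Tgt C g = Src C h \<longrightarrow>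
        h \<cdot>\<^bsub>C\<^esub> (g \<cdot>\<^bsub>C\<^esub> f) = (h \<cdot>\<^bsub>C\<^esub> g) \<cdot>\<^bsub>C\<^esub> f)"

definition inverse_ars :: "('o, 'a) cat \<Rightarrow> 'a \<Rightarrow> 'a \<Rightarrow> bool" where
  "inverse_ars C f g \<longleftrightarrow> f \<in> Ar C \<and> g \<in> hom C (Tgt C f) (Src C f) \<and>
     g \<cdot>\<^bsub>C\<^esub> f = Ident C (Src C f) \<and> f \<cdot>\<^bsub>C\<^esub> g = Ident C (Tgt C f)"

definition is_iso :: "('o, 'a) cat \<Rightarrow> 'a \<Rightarrow> bool" where
  "is_iso C f \<longleftrightarrow> (\<exists>g. inverse_ars C f g)"

definition inv_ar :: "('o, 'a) cat \<Rightarrow> 'a \<Rightarrow> 'a" where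
  "inv_ar C f = (THE g. inverse_ars C f g)"

definition groupoid :: "('o, 'a) cat \<Rightarrow> bool" where
  "groupoid C \<longleftrightarrow> category C \<and> (\<forall>f \<in> Ar C. is_iso C f)"

text \<open>The maximal subgroupoid.\<close>

definition core :: "('o, 'a) cat \<Rightarrow> ('o, 'a) cat" where
  "core C = C\<lparr>Ar := {f \<in> Ar C. is_iso C f}\<rparr>"

text \<open>
  Functors are extensional (undefined off the source category), so that equality of
  records is equality of functors.
\<close>

record ('o, 'a, 'p, 'b) func =
  FOb :: "'o \<Rightarrow> 'p"
  FAr :: "'a \<Rightarrow> 'b"

definition is_functor :: "('o, 'a) cat \<Rightarrow> ('p, 'b) cat \<Rightarrow> ('o, 'a, 'p, 'b) func \<Rightarrow> bool" where
  "is_functor C D F \<longleftrightarrow> category C \<and> category D \<and>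
     FOb F \<in> Ob C \<rightarrow>\<^sub>E Ob D \<and> FAr F \<in> Ar C \<rightarrow>\<^sub>E Ar D \<and>
     (\<forall>f \<in> Ar C. Src D (FAr F f) = FOb F (Src C f) \<and> Tgt D (FAr F f) = FOb F (Tgt C f)) \<and>
     (\<forall>x \<in> Ob C. FAr F (Ident C x) = Ident D (FOb F x)) \<and>
     (\<forall>f \<in> Ar C. \<forall>g \<in> Ar C. Tgt C f = Src C g \<longrightarrow>
        FAr F (g \<cdot>\<^bsub>C\<^esub> f) = FAr F g \<cdot>\<^bsub>D\<^esub> FAr F f)"

definition idf :: "('o, 'a) cat \<Rightarrow> ('o, 'a, 'o, 'a) func" where
  "idf C = \<lparr>FOb = restrict (\<lambda>x. x) (Ob C), FAr = restrict (\<lambda>f. f) (Ar C)\<rparr>"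

definition fcomp :: "('o, 'a) cat \<Rightarrow> ('p, 'b, 'q, 'c) func \<Rightarrow> ('o, 'a, 'p, 'b) func \<Rightarrow>
    ('o, 'a, 'q, 'c) func" where
  "fcomp C G F = \<lparr>FOb = restrict (FOb G \<circ> FOb F) (Ob C), FAr = restrict (FAr G \<circ> FAr F) (Ar C)\<rparr>"

definition nat_iso :: "('o, 'a) cat \<Rightarrow> ('p, 'b) cat \<Rightarrow> ('o, 'a, 'p, 'b) func \<Rightarrow>
    ('o, 'a, 'p, 'b) func \<Rightarrow> ('o \<Rightarrow> 'b) \<Rightarrow> bool" where
  "nat_iso C D F G \<alpha> \<longleftrightarrow> is_functor C D F \<and> is_functor C D G \<and>
     (\<forall>x \<in> Ob C. \<alpha> x \<in> hom D (FOb F x) (FOb G x) \<and> is_iso D (\<alpha> x)) \<and>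
     (\<forall>f \<in> Ar C. \<alpha> (Tgt C f) \<cdot>\<^bsub>D\<^esub> FAr F f = FAr G f \<cdot>\<^bsub>D\<^esub> \<alpha> (Src C f))"

definition is_equivalence :: "('o, 'a) cat \<Rightarrow> ('p, 'b) cat \<Rightarrow> ('o, 'a, 'p, 'b) func \<Rightarrow> bool" where
  "is_equivalence C D F \<longleftrightarrow> is_functor C D F \<and>
     (\<exists>G \<eta> \<epsilon>. is_functor D C G \<and> nat_iso C C (idf C) (fcomp C G F) \<eta> \<and>
        nat_iso D D (fcomp D F G) (idf D) \<epsilon>)"

definition pullback_square :: "('o, 'a) cat \<Rightarrow> 'a \<Rightarrow> 'a \<Rightarrow> 'a \<Rightarrow> 'a \<Rightarrow> bool" where
  "pullback_square C t s s' t' \<longleftrightarrow> t \<in> Ar C \<and> s \<in> Ar C \<and> s' \<in> Ar C \<and> t' \<in> Ar C \<and>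
     Tgt C t = Tgt C s \<and> Src C s' = Src C t' \<and> Tgt C s' = Src C t \<and> Tgt C t' = Src C s \<and>
     t \<cdot>\<^bsub>C\<^esub> s' = s \<cdot>\<^bsub>C\<^esub> t' \<and>
     (\<forall>z \<in> Ob C. \<forall>u \<in> hom C z (Src C t). \<forall>v \<in> hom C z (Src C s). t \<cdot>\<^bsub>C\<^esub> u = s \<cdot>\<^bsub>C\<^esub> v \<longrightarrow>
        (\<exists>!w. w \<in> hom C z (Src C s') \<and> s' \<cdot>\<^bsub>C\<^esub> w = u \<and> t' \<cdot>\<^bsub>C\<^esub> w = v))"

definition pushout_square :: "('o, 'a) cat \<Rightarrow> 'a \<Rightarrow> 'a \<Rightarrow> 'a \<Rightarrow> 'a \<Rightarrow> bool" where
  "pushout_square C g f f' g' \<longleftrightarrow> g \<in> Ar C \<and> f \<in> Ar C \<and> f' \<in> Ar C \<and> g' \<in> Ar C \<and>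
     Src C g = Src C f \<and> Tgt C f' = Tgt C g' \<and> Src C f' = Tgt C g \<and> Src C g' = Tgt C f \<and>
     f' \<cdot>\<^bsub>C\<^esub> g = g' \<cdot>\<^bsub>C\<^esub> f \<and>
     (\<forall>z \<in> Ob C. \<forall>u \<in> hom C (Tgt C g) z. \<forall>v \<in> hom C (Tgt C f) z. u \<cdot>\<^bsub>C\<^esub> g = v \<cdot>\<^bsub>C\<^esub> f \<longrightarrow>
        (\<exists>!w. w \<in> hom C (Tgt C f') z \<and> w \<cdot>\<^bsub>C\<^esub> f' = u \<and> w \<cdot>\<^bsub>C\<^esub> g' = v))"


section \<open>Homotopy pullbacks\<close>

text \<open>
  Objects of the iso-comma category are triples (a, b, c) with c : F a \<rightarrow> G b invertible;
  an arrow records its source and target triples along with the pair of arrows.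
\<close>

type_synonym ('oa, 'ob, 'ac) ic_ob = "'oa \<times> 'ob \<times> 'ac"
type_synonym ('oa, 'aa, 'ob, 'ab, 'ac) ic_ar =
  "('oa, 'ob, 'ac) ic_ob \<times> ('oa, 'ob, 'ac) ic_ob \<times> 'aa \<times> 'ab"

definition iso_comma_obs :: "('oa, 'aa) cat \<Rightarrow> ('ob, 'ab) cat \<Rightarrow> ('oc, 'ac) cat \<Rightarrow>
    ('oa, 'aa, 'oc, 'ac) func \<Rightarrow> ('ob, 'ab, 'oc, 'ac) func \<Rightarrow> ('oa, 'ob, 'ac) ic_ob set" where
  "iso_comma_obs A B C F G =
     {(a, b, c). a \<in> Ob A \<and> b \<in> Ob B \<and> c \<in> hom C (FOb F a) (FOb G b) \<and> is_iso C c}"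

definition iso_comma :: "('oa, 'aa) cat \<Rightarrow> ('ob, 'ab) cat \<Rightarrow> ('oc, 'ac) cat \<Rightarrow>
    ('oa, 'aa, 'oc, 'ac) func \<Rightarrow> ('ob, 'ab, 'oc, 'ac) func \<Rightarrow>
    (('oa, 'ob, 'ac) ic_ob, ('oa, 'aa, 'ob, 'ab, 'ac) ic_ar) cat" where
  "iso_comma A B C F G =
     \<lparr>Ob = iso_comma_obs A B C F G,
      Ar = {((a, b, c), (a', b', c'), u, v).
              (a, b, c) \<in> iso_comma_obs A B C F G \<and> (a', b', c') \<in> iso_comma_obs A B C F G \<and>
              u \<in> hom A a a' \<and> v \<in> hom B b b' \<and> c' \<cdot>\<^bsub>C\<^esub> FAr F u = FAr G v \<cdot>\<^bsub>C\<^esub> c},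
      Src = (\<lambda>(s, t, u, v). s),
      Tgt = (\<lambda>(s, t, u, v). t),
      Ident = (\<lambda>(a, b, c). ((a, b, c), (a, b, c), Ident A a, Ident B b)),
      Cmp = (\<lambda>(s', t', u', v') (s, t, u, v). (s, t', u' \<cdot>\<^bsub>A\<^esub> u, v' \<cdot>\<^bsub>B\<^esub> v))\<rparr>"

definition comparison :: "('op, 'ap) cat \<Rightarrow> ('op, 'ap, 'oa, 'aa) func \<Rightarrow>
    ('op, 'ap, 'ob, 'ab) func \<Rightarrow> ('op \<Rightarrow> 'ac) \<Rightarrow>
    ('op, 'ap, ('oa, 'ob, 'ac) ic_ob, ('oa, 'aa, 'ob, 'ab, 'ac) ic_ar) func" where
  "comparison P K H \<alpha> =
     (let ob = (\<lambda>x. (FOb K x, FOb H x, \<alpha> x)) in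
      \<lparr>FOb = restrict ob (Ob P),
       FAr = restrict (\<lambda>w. (ob (Src P w), ob (Tgt P w), FAr K w, FAr H w)) (Ar P)\<rparr>)"

text \<open>
  The square with K : P \<rightarrow> A, H : P \<rightarrow> B, F : A \<rightarrow> C, G : B \<rightarrow> C, commuting up to the
  invertible 2-cell \<open>\<alpha>\<close> : F K \<Rightarrow> G H.
\<close>

definition homotopy_pullback :: "('op, 'ap) cat \<Rightarrow> ('oa, 'aa) cat \<Rightarrow> ('ob, 'ab) cat \<Rightarrow>
    ('oc, 'ac) cat \<Rightarrow> ('op, 'ap, 'oa, 'aa) func \<Rightarrow> ('op, 'ap, 'ob, 'ab) func \<Rightarrow>
    ('oa, 'aa, 'oc, 'ac) func \<Rightarrow> ('ob, 'ab, 'oc, 'ac) func \<Rightarrow> ('op \<Rightarrow> 'ac) \<Rightarrow> bool" where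
  "homotopy_pullback P A B C K H F G \<alpha> \<longleftrightarrow>
     is_functor P A K \<and> is_functor P B H \<and> is_functor A C F \<and> is_functor B C G \<and>
     nat_iso P C (fcomp P F K) (fcomp P G H) \<alpha> \<and>
     is_equivalence P (iso_comma A B C F G) (comparison P K H \<alpha>)"


section \<open>The categories of ordinals\<close>

record omap =
  osrc :: nat
  otgt :: nat
  ofun :: "nat \<Rightarrow> nat"

text \<open>The object n stands for the ordinal {l, ..., n}.\<close>

definition ordinals :: "nat \<Rightarrow> (nat, omap) cat" where
  "ordinals l =
     \<lparr>Ob = UNIV,
      Ar = {h. ofun h \<in> {l..osrc h} \<rightarrow>\<^sub>E {l..otgt h} \<and> mono_on {l..osrc h} (ofun h)},
      Src = osrc,
      Tgt = otgt,
      Ident = (\<lambda>n. \<lparr>osrc = n, otgt = n, ofun = restrict (\<lambda>i. i) {l..n}\<rparr>),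
      Cmp = (\<lambda>g f. \<lparr>osrc = osrc f, otgt = otgt g, ofun = compose {l..osrc f} (ofun g) (ofun f)\<rparr>)\<rparr>"

definition Delta :: "(nat, omap) cat" where "Delta = ordinals 0"

definition uDelta :: "(nat, omap) cat" where "uDelta = ordinals 1"

definition generic :: "omap \<Rightarrow> bool" where
  "generic g \<longleftrightarrow> g \<in> Ar Delta \<and> ofun g 0 = 0 \<and> ofun g (osrc g) = otgt g"

definition free :: "omap \<Rightarrow> bool" where
  "free f \<longleftrightarrow> f \<in> Ar Delta \<and> (\<forall>i < osrc f. ofun f (i + 1) = ofun f i + 1)"

definition convex :: "omap \<Rightarrow> bool" where
  "convex j \<longleftrightarrow> j \<in> Ar uDelta \<and> (\<forall>x. 1 \<le> x \<and> x < osrc j \<longrightarrow> ofun j (x + 1) = ofun j x + 1)"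

definition gen_part :: "omap \<Rightarrow> omap" where
  "gen_part h = \<lparr>osrc = osrc h, otgt = ofun h (osrc h) - ofun h 0,
                 ofun = restrict (\<lambda>i. ofun h i - ofun h 0) {0..osrc h}\<rparr>"

definition free_part :: "omap \<Rightarrow> omap" where
  "free_part h = \<lparr>osrc = ofun h (osrc h) - ofun h 0, otgt = otgt h,
                  ofun = restrict (\<lambda>i. i + ofun h 0) {0..ofun h (osrc h) - ofun h 0}\<rparr>"

definition under_gen :: "omap \<Rightarrow> omap" where
  "under_gen g = \<lparr>osrc = otgt g, otgt = osrc g,
     ofun = restrict (\<lambda>j. THE i. i \<in> {1..osrc g} \<and> ofun g (i - 1) < j \<and> j \<le> ofun g i) {1..otgt g}\<rparr>"

definition under_free :: "omap \<Rightarrow> omap" where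
  "under_free f = \<lparr>osrc = osrc f, otgt = otgt f, ofun = restrict (\<lambda>i. i + ofun f 0) {1..osrc f}\<rparr>"

definition id_ext :: "nat \<Rightarrow> omap \<Rightarrow> nat \<Rightarrow> omap" where
  "id_ext a f b = \<lparr>osrc = a + osrc f + b, otgt = a + otgt f + b,
     ofun = restrict (\<lambda>i. if i \<le> a then i
                          else if i \<le> a + osrc f then a + ofun f (i - a)
                          else a + otgt f + (i - (a + osrc f))) {1..a + osrc f + b}\<rparr>"

definition incl :: "nat \<Rightarrow> nat \<Rightarrow> nat \<Rightarrow> omap" where
  "incl a n b = \<lparr>osrc = n, otgt = a + n + b, ofun = restrict (\<lambda>i. a + i) {1..n}\<rparr>"


section \<open>Sesquicartesian fibrations\<close>

record ('o, 'a) fib =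
  total :: "('o, 'a) cat"
  proj :: "('o, 'a, nat, omap) func"

definition over_uDelta :: "('o, 'a) fib \<Rightarrow> bool" where
  "over_uDelta X \<longleftrightarrow> is_functor (total X) uDelta (proj X)"

definition fibre :: "('o, 'a) fib \<Rightarrow> nat \<Rightarrow> ('o, 'a) cat" where
  "fibre X n = (total X)\<lparr>Ob := {x \<in> Ob (total X). FOb (proj X) x = n},
                         Ar := {v \<in> Ar (total X). FAr (proj X) v = Ident uDelta n}\<rparr>"

definition cocartesian :: "('o, 'a) fib \<Rightarrow> 'a \<Rightarrow> bool" where
  "cocartesian X \<psi> \<longleftrightarrow> \<psi> \<in> Ar (total X) \<and>
     (\<forall>z \<in> Ob (total X). \<forall>\<xi> \<in> hom (total X) (Src (total X) \<psi>) z.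
      \<forall>h \<in> hom uDelta (FOb (proj X) (Tgt (total X) \<psi>)) (FOb (proj X) z).
        FAr (proj X) \<xi> = h \<cdot>\<^bsub>uDelta\<^esub> FAr (proj X) \<psi> \<longrightarrow>
        (\<exists>!\<chi>. \<chi> \<in> hom (total X) (Tgt (total X) \<psi>) z \<and> FAr (proj X) \<chi> = h \<and>
              \<chi> \<cdot>\<^bsub>total X\<^esub> \<psi> = \<xi>))"

definition cartesian :: "('o, 'a) fib \<Rightarrow> 'a \<Rightarrow> bool" where
  "cartesian X \<phi> \<longleftrightarrow> \<phi> \<in> Ar (total X) \<and>
     (\<forall>z \<in> Ob (total X). \<forall>\<xi> \<in> hom (total X) z (Tgt (total X) \<phi>).
      \<forall>h \<in> hom uDelta (FOb (proj X) z) (FOb (proj X) (Src (total X) \<phi>)).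
        FAr (proj X) \<xi> = FAr (proj X) \<phi> \<cdot>\<^bsub>uDelta\<^esub> h \<longrightarrow>
        (\<exists>!\<chi>. \<chi> \<in> hom (total X) z (Src (total X) \<phi>) \<and> FAr (proj X) \<chi> = h \<and>
              \<phi> \<cdot>\<^bsub>total X\<^esub> \<chi> = \<xi>))"

definition cocart_lift :: "('o, 'a) fib \<Rightarrow> omap \<Rightarrow> 'o \<Rightarrow> 'a \<Rightarrow> bool" where
  "cocart_lift X f x \<psi> \<longleftrightarrow> cocartesian X \<psi> \<and> Src (total X) \<psi> = x \<and> FAr (proj X) \<psi> = f"

definition cart_lift :: "('o, 'a) fib \<Rightarrow> omap \<Rightarrow> 'o \<Rightarrow> 'a \<Rightarrow> bool" where
  "cart_lift X f x \<phi> \<longleftrightarrow> cartesian X \<phi> \<and> Tgt (total X) \<phi> = x \<and> FAr (proj X) \<phi> = f"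

definition cocartesian_fibration :: "('o, 'a) fib \<Rightarrow> bool" where
  "cocartesian_fibration X \<longleftrightarrow> over_uDelta X \<and>
     (\<forall>f \<in> Ar uDelta. \<forall>x \<in> Ob (fibre X (osrc f)). \<exists>\<psi>. cocart_lift X f x \<psi>)"

definition cartesian_over_convex :: "('o, 'a) fib \<Rightarrow> bool" where
  "cartesian_over_convex X \<longleftrightarrow> over_uDelta X \<and>
     (\<forall>f. convex f \<longrightarrow> (\<forall>x \<in> Ob (fibre X (otgt f)). \<exists>\<phi>. cart_lift X f x \<phi>))"

text \<open>A choice of lifts, needed to speak of the functors \<open>f\<^sub>!\<close> and \<open>f\<^sup>*\<close>.\<close>

record ('o, 'a) cleavage =
  cocart :: "omap \<Rightarrow> 'o \<Rightarrow> 'a"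
  cart :: "omap \<Rightarrow> 'o \<Rightarrow> 'a"

definition is_cleavage :: "('o, 'a) fib \<Rightarrow> ('o, 'a) cleavage \<Rightarrow> bool" where
  "is_cleavage X \<kappa> \<longleftrightarrow>
     (\<forall>f \<in> Ar uDelta. \<forall>x \<in> Ob (fibre X (osrc f)). cocart_lift X f x (cocart \<kappa> f x)) \<and>
     (\<forall>f. convex f \<longrightarrow> (\<forall>x \<in> Ob (fibre X (otgt f)). cart_lift X f x (cart \<kappa> f x)))"

definition normal_cleavage :: "('o, 'a) fib \<Rightarrow> ('o, 'a) cleavage \<Rightarrow> bool" where
  "normal_cleavage X \<kappa> \<longleftrightarrow> is_cleavage X \<kappa> \<and>
     (\<forall>n. \<forall>x \<in> Ob (fibre X n). cocart \<kappa> (Ident uDelta n) x = Ident (total X) x \<and>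
                                 cart \<kappa> (Ident uDelta n) x = Ident (total X) x)"

text \<open>The functors \<open>f\<^sub>!\<close> and \<open>f\<^sup>*\<close>.\<close>

definition push :: "('o, 'a) fib \<Rightarrow> ('o, 'a) cleavage \<Rightarrow> omap \<Rightarrow> ('o, 'a, 'o, 'a) func" where
  "push X \<kappa> f =
     (let ob = (\<lambda>x. Tgt (total X) (cocart \<kappa> f x)) in
      \<lparr>FOb = restrict ob (Ob (fibre X (osrc f))),
       FAr = restrict (\<lambda>v. let x = Src (total X) v; x' = Tgt (total X) v in
               THE t. t \<in> hom (fibre X (otgt f)) (ob x) (ob x') \<and>
                 t \<cdot>\<^bsub>total X\<^esub> cocart \<kappa> f x = cocart \<kappa> f x' \<cdot>\<^bsub>total X\<^esub> v) (Ar (fibre X (osrc f)))\<rparr>)"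

definition pull :: "('o, 'a) fib \<Rightarrow> ('o, 'a) cleavage \<Rightarrow> omap \<Rightarrow> ('o, 'a, 'o, 'a) func" where
  "pull X \<kappa> f =
     (let ob = (\<lambda>x. Src (total X) (cart \<kappa> f x)) in
      \<lparr>FOb = restrict ob (Ob (fibre X (otgt f))),
       FAr = restrict (\<lambda>v. let x = Src (total X) v; x' = Tgt (total X) v in
               THE t. t \<in> hom (fibre X (osrc f)) (ob x) (ob x') \<and>
                 cart \<kappa> f x' \<cdot>\<^bsub>total X\<^esub> t = v \<cdot>\<^bsub>total X\<^esub> cart \<kappa> f x) (Ar (fibre X (otgt f)))\<rparr>)"

text \<open>
  For \<open>\<tau> \<sigma>' = \<sigma> \<tau>'\<close>, with \<open>\<tau>\<close> and \<open>\<tau>'\<close> convex, the component at x of the comparison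
  \<open>\<sigma>'\<^sub>! \<tau>'\<^sup>* \<Rightarrow> \<tau>\<^sup>* \<sigma>\<^sub>!\<close>: the factorization of the composite \<open>\<tau>'\<^sup>* x \<rightarrow> x \<rightarrow> \<sigma>\<^sub>! x\<close>
  through \<open>\<tau>'\<^sup>* x \<rightarrow> \<sigma>'\<^sub>! \<tau>'\<^sup>* x\<close> and \<open>\<tau>\<^sup>* \<sigma>\<^sub>! x \<rightarrow> \<sigma>\<^sub>! x\<close>.
\<close>

definition bc_map :: "('o, 'a) fib \<Rightarrow> ('o, 'a) cleavage \<Rightarrow> omap \<Rightarrow> omap \<Rightarrow> omap \<Rightarrow> omap \<Rightarrow> 'o \<Rightarrow> 'a"
  where
  "bc_map X \<kappa> \<tau> \<sigma> \<sigma>' \<tau>' x =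
     (let y = FOb (push X \<kappa> \<sigma>) x; x' = FOb (pull X \<kappa> \<tau>') x in
      THE t. t \<in> hom (fibre X (osrc \<tau>)) (FOb (push X \<kappa> \<sigma>') x') (FOb (pull X \<kappa> \<tau>) y) \<and>
        cart \<kappa> \<tau> y \<cdot>\<^bsub>total X\<^esub> t \<cdot>\<^bsub>total X\<^esub> cocart \<kappa> \<sigma>' x'
          = cocart \<kappa> \<sigma> x \<cdot>\<^bsub>total X\<^esub> cart \<kappa> \<tau>' x)"

definition beck_chevalley :: "('o, 'a) fib \<Rightarrow> bool" where
  "beck_chevalley X \<longleftrightarrow>
     (\<forall>\<tau> \<sigma> \<sigma>' \<tau>'. pullback_square uDelta \<tau> \<sigma> \<sigma>' \<tau>' \<and> convex \<tau> \<longrightarrow>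
        (\<forall>\<kappa>. is_cleavage X \<kappa> \<longrightarrow>
           (\<forall>x \<in> Ob (fibre X (osrc \<sigma>)). is_iso (fibre X (osrc \<tau>)) (bc_map X \<kappa> \<tau> \<sigma> \<sigma>' \<tau>' x))))"

definition sesquicartesian :: "('o, 'a) fib \<Rightarrow> bool" where
  "sesquicartesian X \<longleftrightarrow> cocartesian_fibration X \<and> cartesian_over_convex X \<and> beck_chevalley X"

text \<open>In particular, normal cleavages exist.\<close>

lemma convex_Ident: "convex (Ident uDelta n)"
  by (auto simp: convex_def uDelta_def ordinals_def mono_on_def)

lemma cocart_lift_Ident:
  assumes "over_uDelta X" "x \<in> Ob (fibre X n)"
  shows "cocart_lift X (Ident uDelta n) x (Ident (total X) x)"
proof -
  let ?E = "total X" and ?i = "Ident (total X) x"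
  have F: "is_functor ?E uDelta (proj X)" and C: "category ?E" and D: "category uDelta"
    using assms(1) by (auto simp: over_uDelta_def is_functor_def)
  have x: "x \<in> Ob ?E" "FOb (proj X) x = n" using assms(2) by (auto simp: fibre_def)
  have i: "?i \<in> Ar ?E" "Src ?E ?i = x" "Tgt ?E ?i = x"
    using C x(1) by (auto simp: category_def hom_def)
  have pi: "FAr (proj X) ?i = Ident uDelta n" using F x by (auto simp: is_functor_def)
  have r: "f \<cdot>\<^bsub>?E\<^esub> ?i = f" if "f \<in> hom ?E x z" for f z
    using C that by (auto simp: category_def hom_def)
  have r': "h \<cdot>\<^bsub>uDelta\<^esub> Ident uDelta n = h" if "h \<in> hom uDelta n m" for h m
    using D that by (auto simp: category_def hom_def)
  show ?thesis
    unfolding cocart_lift_def cocartesian_def i(2,3) pi x(2)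
    using i(1) r r' by metis
qed

lemma cart_lift_Ident:
  assumes "over_uDelta X" "x \<in> Ob (fibre X n)"
  shows "cart_lift X (Ident uDelta n) x (Ident (total X) x)"
proof -
  let ?E = "total X" and ?i = "Ident (total X) x"
  have F: "is_functor ?E uDelta (proj X)" and C: "category ?E" and D: "category uDelta"
    using assms(1) by (auto simp: over_uDelta_def is_functor_def)
  have x: "x \<in> Ob ?E" "FOb (proj X) x = n" using assms(2) by (auto simp: fibre_def)
  have i: "?i \<in> Ar ?E" "Src ?E ?i = x" "Tgt ?E ?i = x"
    using C x(1) by (auto simp: category_def hom_def)
  have pi: "FAr (proj X) ?i = Ident uDelta n" using F x by (auto simp: is_functor_def)
  have r: "?i \<cdot>\<^bsub>?E\<^esub> f = f" if "f \<in> hom ?E z x" for f z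
    using C that by (auto simp: category_def hom_def)
  have r': "Ident uDelta n \<cdot>\<^bsub>uDelta\<^esub> h = h" if "h \<in> hom uDelta m n" for h m
    using D that by (auto simp: category_def hom_def)
  show ?thesis
    unfolding cart_lift_def cartesian_def i(2,3) pi x(2)
    using i(1) r r' by metis
qed

lemma normal_cleavage_exists:
  assumes "sesquicartesian X"
  shows "\<exists>\<kappa>. normal_cleavage X \<kappa>"
proof -
  have X: "over_uDelta X" "cocartesian_fibration X" "cartesian_over_convex X"
    using assms by (auto simp: sesquicartesian_def cocartesian_fibration_def)
  have ob: "osrc (Ident uDelta n) = n" "otgt (Ident uDelta n) = n" for n
    by (auto simp: uDelta_def ordinals_def)
  let ?\<kappa> = "\<lparr>cocart = (\<lambda>f x. if f = Ident uDelta (osrc f) then Ident (total X) x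
                                else SOME \<psi>. cocart_lift X f x \<psi>),
             cart = (\<lambda>f x. if f = Ident uDelta (otgt f) then Ident (total X) x
                                else SOME \<phi>. cart_lift X f x \<phi>)\<rparr>"
  have "cocart_lift X f x (cocart ?\<kappa> f x)" if "f \<in> Ar uDelta" "x \<in> Ob (fibre X (osrc f))" for f x
  proof (cases "f = Ident uDelta (osrc f)")
    case True
    then show ?thesis using cocart_lift_Ident[OF X(1) that(2)] by simp
  next
    case False
    then show ?thesis using X(2) that by (auto simp: cocartesian_fibration_def intro: someI_ex)
  qed
  moreover have "cart_lift X f x (cart ?\<kappa> f x)" if "convex f" "x \<in> Ob (fibre X (otgt f))" for f x
  proof (cases "f = Ident uDelta (otgt f)")
    case True
    then show ?thesis using cart_lift_Ident[OF X(1) that(2)] by simp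
  next
    case False
    then show ?thesis using X(3) that by (auto simp: cartesian_over_convex_def intro: someI_ex)
  qed
  ultimately have "normal_cleavage X ?\<kappa>"
    unfolding normal_cleavage_def is_cleavage_def by (auto simp: ob)
  then show ?thesis by blast
qed

text \<open>Identity-extension squares are pullbacks, so their 2-cell is the Beck--Chevalley one.\<close>

definition iesq :: "('o, 'a) fib \<Rightarrow> bool" where
  "iesq X \<longleftrightarrow>
     (\<forall>f \<in> Ar uDelta. \<forall>a b \<kappa>. is_cleavage X \<kappa> \<longrightarrow>
        (let n = osrc f; k = otgt f; g = id_ext a f b; j = incl a n b; i = incl a k b in
         homotopy_pullback (fibre X (a + n + b)) (fibre X n) (fibre X (a + k + b)) (fibre X k)
           (pull X \<kappa> j) (push X \<kappa> g) (push X \<kappa> f) (pull X \<kappa> i) (bc_map X \<kappa> i g f j)))"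


section \<open>The category of iesq sesquicartesian fibrations\<close>

record ('o, 'a) fib_map =
  fsrc :: "('o, 'a) fib"
  ftgt :: "('o, 'a) fib"
  fmap :: "('o, 'a, 'o, 'a) func"

definition fibre_func :: "('o, 'a) fib_map \<Rightarrow> nat \<Rightarrow> ('o, 'a, 'o, 'a) func" where
  "fibre_func c n = \<lparr>FOb = restrict (FOb (fmap c)) (Ob (fibre (fsrc c) n)),
                     FAr = restrict (FAr (fmap c)) (Ar (fibre (fsrc c) n))\<rparr>"

text \<open>The component at x of the canonical 2-cell \<open>f\<^sub>! c\<^sub>n \<Rightarrow> c\<^sub>k f\<^sub>!\<close>.\<close>

definition push_cell :: "('o, 'a) fib_map \<Rightarrow> ('o, 'a) cleavage \<Rightarrow> ('o, 'a) cleavage \<Rightarrow> omap \<Rightarrow>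
    'o \<Rightarrow> 'a" where
  "push_cell c \<kappa> \<kappa>' f x =
     (let cx = FOb (fmap c) x in
      THE t. t \<in> hom (fibre (ftgt c) (otgt f)) (FOb (push (ftgt c) \<kappa>' f) cx)
                     (FOb (fmap c) (FOb (push (fsrc c) \<kappa> f) x)) \<and>
        t \<cdot>\<^bsub>total (ftgt c)\<^esub> cocart \<kappa>' f cx = FAr (fmap c) (cocart \<kappa> f x))"

definition sesq_functor :: "('o, 'a) fib_map \<Rightarrow> bool" where
  "sesq_functor c \<longleftrightarrow>
     is_functor (total (fsrc c)) (total (ftgt c)) (fmap c) \<and>
     fcomp (total (fsrc c)) (proj (ftgt c)) (fmap c) = proj (fsrc c) \<and>
     (\<forall>\<psi>. cocartesian (fsrc c) \<psi> \<longrightarrow> cocartesian (ftgt c) (FAr (fmap c) \<psi>)) \<and>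
     (\<forall>\<phi>. cartesian (fsrc c) \<phi> \<and> convex (FAr (proj (fsrc c)) \<phi>) \<longrightarrow>
           cartesian (ftgt c) (FAr (fmap c) \<phi>)) \<and>
     (\<forall>f \<in> Ar uDelta. \<forall>\<kappa> \<kappa>'. is_cleavage (fsrc c) \<kappa> \<and> is_cleavage (ftgt c) \<kappa>' \<longrightarrow>
        homotopy_pullback (fibre (fsrc c) (osrc f)) (fibre (ftgt c) (osrc f))
          (fibre (fsrc c) (otgt f)) (fibre (ftgt c) (otgt f))
          (fibre_func c (osrc f)) (push (fsrc c) \<kappa> f) (push (ftgt c) \<kappa>' f) (fibre_func c (otgt f))
          (push_cell c \<kappa> \<kappa>' f))"

definition IesqSesq :: "(('o, 'a) fib, ('o, 'a) fib_map) cat" where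
  "IesqSesq =
     \<lparr>Ob = {X. sesquicartesian X \<and> iesq X},
      Ar = {c. sesquicartesian (fsrc c) \<and> iesq (fsrc c) \<and>
               sesquicartesian (ftgt c) \<and> iesq (ftgt c) \<and> sesq_functor c},
      Src = fsrc,
      Tgt = ftgt,
      Ident = (\<lambda>X. \<lparr>fsrc = X, ftgt = X, fmap = idf (total X)\<rparr>),
      Cmp = (\<lambda>d c. \<lparr>fsrc = fsrc c, ftgt = ftgt d,
                     fmap = fcomp (total (fsrc c)) (fmap d) (fmap c)\<rparr>)\<rparr>"


section \<open>Decomposition spaces and CULF maps\<close>

text \<open>
  A pseudo-functor from the opposite of \<open>\<Delta>\<close> to groupoids: \<open>sact S h : S\<^sub>m \<rightarrow> S\<^sub>n\<close> for
  \<open>h : [n] \<rightarrow> [m]\<close>, with structure isomorphisms \<open>scmp S h' h : S (h' h) \<Rightarrow> S h \<circ> S h'\<close> and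
  \<open>suni S n : id \<Rightarrow> S id\<close>.
\<close>

record ('o, 'a) sgpd =
  sgrp :: "nat \<Rightarrow> ('o, 'a) cat"
  sact :: "omap \<Rightarrow> ('o, 'a, 'o, 'a) func"
  scmp :: "omap \<Rightarrow> omap \<Rightarrow> 'o \<Rightarrow> 'a"
  suni :: "nat \<Rightarrow> 'o \<Rightarrow> 'a"

definition simplicial_groupoid :: "('o, 'a) sgpd \<Rightarrow> bool" where
  "simplicial_groupoid S \<longleftrightarrow>
     (\<forall>n. groupoid (sgrp S n)) \<and>
     (\<forall>h \<in> Ar Delta. is_functor (sgrp S (otgt h)) (sgrp S (osrc h)) (sact S h)) \<and>
     (\<forall>h \<in> Ar Delta. \<forall>h' \<in> Ar Delta. otgt h = osrc h' \<longrightarrow>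
        nat_iso (sgrp S (otgt h')) (sgrp S (osrc h)) (sact S (h' \<cdot>\<^bsub>Delta\<^esub> h))
          (fcomp (sgrp S (otgt h')) (sact S h) (sact S h')) (scmp S h' h)) \<and>
     (\<forall>n. nat_iso (sgrp S n) (sgrp S n) (idf (sgrp S n)) (sact S (Ident Delta n)) (suni S n)) \<and>
     (\<forall>h \<in> Ar Delta. \<forall>h' \<in> Ar Delta. \<forall>h'' \<in> Ar Delta. otgt h = osrc h' \<and> otgt h' = osrc h'' \<longrightarrow>
        (\<forall>x \<in> Ob (sgrp S (otgt h'')).
           FAr (sact S h) (scmp S h'' h' x) \<cdot>\<^bsub>sgrp S (osrc h)\<^esub> scmp S (h'' \<cdot>\<^bsub>Delta\<^esub> h') h x
           = scmp S h' h (FOb (sact S h'') x) \<cdot>\<^bsub>sgrp S (osrc h)\<^esub> scmp S h'' (h' \<cdot>\<^bsub>Delta\<^esub> h) x)) \<and>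
     (\<forall>h \<in> Ar Delta. \<forall>x \<in> Ob (sgrp S (otgt h)).
        scmp S h (Ident Delta (osrc h)) x = suni S (osrc h) (FOb (sact S h) x) \<and>
        scmp S (Ident Delta (otgt h)) h x = FAr (sact S h) (suni S (otgt h) x))"

definition decomposition_space :: "('o, 'a) sgpd \<Rightarrow> bool" where
  "decomposition_space S \<longleftrightarrow> simplicial_groupoid S \<and>
     (\<forall>g f f' g'. pushout_square Delta g f f' g' \<and> generic g \<and> free f \<longrightarrow>
        homotopy_pullback (sgrp S (otgt f')) (sgrp S (otgt g)) (sgrp S (otgt f)) (sgrp S (osrc g))
          (sact S f') (sact S g') (sact S g) (sact S f)
          (\<lambda>x. scmp S g' f x \<cdot>\<^bsub>sgrp S (osrc g)\<^esub> inv_ar (sgrp S (osrc g)) (scmp S f' g x)))"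

text \<open>
  Pseudo-natural transformations \<open>S \<Rightarrow> T\<close>: functors \<open>\<alpha>\<^sub>n : S\<^sub>n \<rightarrow> T\<^sub>n\<close> and, for
  \<open>h : [n] \<rightarrow> [m]\<close>, 2-cells \<open>T h \<circ> \<alpha>\<^sub>m \<Rightarrow> \<alpha>\<^sub>n \<circ> S h\<close>.
\<close>

record ('o, 'a) smap =
  ssrc :: "('o, 'a) sgpd"
  stgt :: "('o, 'a) sgpd"
  scomponent :: "nat \<Rightarrow> ('o, 'a, 'o, 'a) func"
  scell :: "omap \<Rightarrow> 'o \<Rightarrow> 'a"

definition restrict_cells :: "('o, 'a) sgpd \<Rightarrow> (omap \<Rightarrow> 'o \<Rightarrow> 'a) \<Rightarrow> omap \<Rightarrow> 'o \<Rightarrow> 'a" where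
  "restrict_cells S cl = restrict (\<lambda>h. restrict (cl h) (Ob (sgrp S (otgt h)))) (Ar Delta)"

definition simplicial_map :: "('o, 'a) smap \<Rightarrow> bool" where
  "simplicial_map \<alpha> \<longleftrightarrow>
     (let S = ssrc \<alpha>; T = stgt \<alpha> in
      simplicial_groupoid S \<and> simplicial_groupoid T \<and>
      restrict_cells S (scell \<alpha>) = scell \<alpha> \<and>
      (\<forall>n. is_functor (sgrp S n) (sgrp T n) (scomponent \<alpha> n)) \<and>
      (\<forall>h \<in> Ar Delta. nat_iso (sgrp S (otgt h)) (sgrp T (osrc h))
         (fcomp (sgrp S (otgt h)) (sact T h) (scomponent \<alpha> (otgt h)))
         (fcomp (sgrp S (otgt h)) (scomponent \<alpha> (osrc h)) (sact S h)) (scell \<alpha> h)) \<and>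
      (\<forall>h \<in> Ar Delta. \<forall>h' \<in> Ar Delta. otgt h = osrc h' \<longrightarrow>
         (\<forall>x \<in> Ob (sgrp S (otgt h')).
            FAr (scomponent \<alpha> (osrc h)) (scmp S h' h x)
              \<cdot>\<^bsub>sgrp T (osrc h)\<^esub> scell \<alpha> (h' \<cdot>\<^bsub>Delta\<^esub> h) x
            = scell \<alpha> h (FOb (sact S h') x)
              \<cdot>\<^bsub>sgrp T (osrc h)\<^esub> FAr (sact T h) (scell \<alpha> h' x)
              \<cdot>\<^bsub>sgrp T (osrc h)\<^esub> scmp T h' h (FOb (scomponent \<alpha> (otgt h')) x))) \<and>
      (\<forall>n. \<forall>x \<in> Ob (sgrp S n).
         FAr (scomponent \<alpha> n) (suni S n x)
         = scell \<alpha> (Ident Delta n) x \<cdot>\<^bsub>sgrp T n\<^esub> suni T n (FOb (scomponent \<alpha> n) x)))"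

definition culf :: "('o, 'a) smap \<Rightarrow> bool" where
  "culf \<alpha> \<longleftrightarrow> simplicial_map \<alpha> \<and>
     (\<forall>g. generic g \<longrightarrow>
        homotopy_pullback (sgrp (ssrc \<alpha>) (otgt g)) (sgrp (stgt \<alpha>) (otgt g))
          (sgrp (ssrc \<alpha>) (osrc g)) (sgrp (stgt \<alpha>) (osrc g))
          (scomponent \<alpha> (otgt g)) (sact (ssrc \<alpha>) g) (sact (stgt \<alpha>) g) (scomponent \<alpha> (osrc g))
          (scell \<alpha> g))"

definition DecompCulf :: "(('o, 'a) sgpd, ('o, 'a) smap) cat" where
  "DecompCulf =
     \<lparr>Ob = {S. decomposition_space S},
      Ar = {\<alpha>. decomposition_space (ssrc \<alpha>) \<and> decomposition_space (stgt \<alpha>) \<and> culf \<alpha>},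
      Src = ssrc,
      Tgt = stgt,
      Ident = (\<lambda>S. \<lparr>ssrc = S, stgt = S, scomponent = (\<lambda>n. idf (sgrp S n)),
                     scell = restrict_cells S (\<lambda>h x. Ident (sgrp S (osrc h)) (FOb (sact S h) x))\<rparr>),
      Cmp = (\<lambda>\<beta> \<alpha>. \<lparr>ssrc = ssrc \<alpha>, stgt = stgt \<beta>,
               scomponent = (\<lambda>n. fcomp (sgrp (ssrc \<alpha>) n) (scomponent \<beta> n) (scomponent \<alpha> n)),
               scell = restrict_cells (ssrc \<alpha>) (\<lambda>h x.
                 FAr (scomponent \<beta> (osrc h)) (scell \<alpha> h x)
                 \<cdot>\<^bsub>sgrp (stgt \<beta>) (osrc h)\<^esub> scell \<beta> h (FOb (scomponent \<alpha> (otgt h)) x))\<rparr>)\<rparr>"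


section \<open>The construction\<close>

definition core_func :: "('o, 'a) cat \<Rightarrow> ('o, 'a, 'p, 'b) func \<Rightarrow> ('o, 'a, 'p, 'b) func" where
  "core_func C F = \<lparr>FOb = restrict (FOb F) (Ob (core C)), FAr = restrict (FAr F) (Ar (core C))\<rparr>"

text \<open>
  A map h of \<open>\<Delta>\<close>, factored as a generic map g followed by a free map f, acts on x by
  \<open>g\<^sub>! f\<^sup>*\<close> (with the underlined versions of g and f), through the chosen span
  \<open>x \<leftarrow> f\<^sup>* x \<rightarrow> g\<^sub>! f\<^sup>* x\<close> of a cartesian and a cocartesian arrow.
\<close>

definition act :: "('o, 'a) fib \<Rightarrow> ('o, 'a) cleavage \<Rightarrow> omap \<Rightarrow> ('o, 'a, 'o, 'a) func" where
  "act X \<kappa> h = fcomp (fibre X (otgt h)) (push X \<kappa> (under_gen (gen_part h)))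
                                         (pull X \<kappa> (under_free (free_part h)))"

definition span_left :: "('o, 'a) cleavage \<Rightarrow> omap \<Rightarrow> 'o \<Rightarrow> 'a" where
  "span_left \<kappa> h x = cart \<kappa> (under_free (free_part h)) x"

definition span_right :: "('o, 'a) fib \<Rightarrow> ('o, 'a) cleavage \<Rightarrow> omap \<Rightarrow> 'o \<Rightarrow> 'a" where
  "span_right X \<kappa> h x = cocart \<kappa> (under_gen (gen_part h)) (Src (total X) (span_left \<kappa> h x))"

text \<open>
  The canonical isomorphism \<open>(h' h) \<cdot> x \<rightarrow> h \<cdot> (h' \<cdot> x)\<close>. The span of \<open>h' h\<close> at x maps,
  by the cartesian property, to the two consecutive spans \<open>x \<leftarrow> \<bullet> \<rightarrow> h' \<cdot> x \<leftarrow> \<bullet> \<rightarrow> h \<cdot> (h' \<cdot> x)\<close>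
  via u and v, and t is the map induced on the final ends. The projections of u and v to the
  base are forced, since convex maps are monomorphisms.
\<close>

definition compositor :: "('o, 'a) fib \<Rightarrow> ('o, 'a) cleavage \<Rightarrow> omap \<Rightarrow> omap \<Rightarrow> 'o \<Rightarrow> 'a" where
  "compositor X \<kappa> h' h x =
     (let k = h' \<cdot>\<^bsub>Delta\<^esub> h; y = FOb (act X \<kappa> h') x; E = total X in
      THE t. t \<in> hom (fibre X (osrc h)) (FOb (act X \<kappa> k) x) (FOb (act X \<kappa> h) y) \<and>
        (\<exists>u v. u \<in> hom E (Src E (span_left \<kappa> k x)) (Src E (span_left \<kappa> h' x)) \<and>
               v \<in> hom E (Src E (span_left \<kappa> k x)) (Src E (span_left \<kappa> h y)) \<and>
               span_left \<kappa> h' x \<cdot>\<^bsub>E\<^esub> u = span_left \<kappa> k x \<and>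
               span_left \<kappa> h y \<cdot>\<^bsub>E\<^esub> v = span_right X \<kappa> h' x \<cdot>\<^bsub>E\<^esub> u \<and>
               t \<cdot>\<^bsub>E\<^esub> span_right X \<kappa> k x = span_right X \<kappa> h y \<cdot>\<^bsub>E\<^esub> v))"

text \<open>For a normal cleavage, identities act as identities, whence the trivial unit.\<close>

definition decomp_of :: "('o, 'a) fib \<Rightarrow> ('o, 'a) cleavage \<Rightarrow> ('o, 'a) sgpd" where
  "decomp_of X \<kappa> =
     \<lparr>sgrp = (\<lambda>n. core (fibre X n)),
      sact = (\<lambda>h. core_func (fibre X (otgt h)) (act X \<kappa> h)),
      scmp = compositor X \<kappa>,
      suni = (\<lambda>n x. Ident (total X) x)\<rparr>"

text \<open>
  The 2-cell \<open>h \<cdot> c x \<rightarrow> c (h \<cdot> x)\<close> comparing the chosen span at \<open>c x\<close> with the image under c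
  of the chosen span at x; here u is vertical.
\<close>

definition act_cell :: "('o, 'a) fib_map \<Rightarrow> ('o, 'a) cleavage \<Rightarrow> ('o, 'a) cleavage \<Rightarrow> omap \<Rightarrow>
    'o \<Rightarrow> 'a" where
  "act_cell c \<kappa> \<kappa>' h x =
     (let X = fsrc c; Y = ftgt c; E = total Y; cx = FOb (fmap c) x in
      THE t. t \<in> hom (fibre Y (osrc h)) (FOb (act Y \<kappa>' h) cx)
                     (FOb (fmap c) (FOb (act X \<kappa> h) x)) \<and>
        (\<exists>u. u \<in> hom E (Src E (span_left \<kappa>' h cx)) (Src E (FAr (fmap c) (span_left \<kappa> h x))) \<and>
             FAr (fmap c) (span_left \<kappa> h x) \<cdot>\<^bsub>E\<^esub> u = span_left \<kappa>' h cx \<and>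
             t \<cdot>\<^bsub>E\<^esub> span_right Y \<kappa>' h cx = FAr (fmap c) (span_right X \<kappa> h x) \<cdot>\<^bsub>E\<^esub> u))"

definition decomp_map :: "('o, 'a) fib_map \<Rightarrow> ('o, 'a) cleavage \<Rightarrow> ('o, 'a) cleavage \<Rightarrow>
    ('o, 'a) smap" where
  "decomp_map c \<kappa> \<kappa>' =
     \<lparr>ssrc = decomp_of (fsrc c) \<kappa>,
      stgt = decomp_of (ftgt c) \<kappa>',
      scomponent = (\<lambda>n. core_func (fibre (fsrc c) n) (fibre_func c n)),
      scell = restrict_cells (decomp_of (fsrc c) \<kappa>) (act_cell c \<kappa> \<kappa>')\<rparr>"

definition decomp_functor :: "(('o, 'a) fib \<Rightarrow> ('o, 'a) cleavage) \<Rightarrow>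
    (('o, 'a) fib, ('o, 'a) fib_map, ('o, 'a) sgpd, ('o, 'a) smap) func" where
  "decomp_functor \<kappa> =
     \<lparr>FOb = restrict (\<lambda>X. decomp_of X (\<kappa> X)) (Ob IesqSesq),
      FAr = restrict (\<lambda>c. decomp_map c (\<kappa> (fsrc c)) (\<kappa> (ftgt c))) (Ar IesqSesq)\<rparr>"

end

theory Submission
  imports Defs
begin

text \<open>
  A map of \<open>\<Delta>\<close> factors as a generic map followed by a free one, and so acts on the fibres of \<open>X\<close>
  by a span: a cartesian arrow over a convex map, followed by a cocartesian arrow. Cartesian arrows
  over convex maps are monic, since convex maps are, and arrows in the fibres are determined by
  their composites with cocartesian arrows. Hence a map between chains of spans is determined by
  the map between their starting points, and every coherence law of the pseudo-functor and of the
  pseudo-natural transformations is such a uniqueness statement. That the comparison for a composite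
  exists and is invertible is the Beck--Chevalley condition.

  The pushout of a generic and a free map in \<open>\<Delta>\<close> corresponds to an identity-extension square,
  so the iesq condition gives the decomposition property, and the pullback condition on a
  morphism gives the CULF property. Both conditions concern categories; they pass to the maximal
  subgroupoids because forming these commutes with iso-comma categories.
\<close>

section \<open>Categories and functors\<close>

text \<open>The cells of all structures are definite descriptions, so the work lies in showing that
  the described arrows exist. Uniqueness is cheap because a filler through a left leg is determined
  by its composite alone, whatever its projection to the base. Existence for composites requires a
  certain arrow between apexes to be cocartesian; Beck--Chevalley, which is stated for chosen lifts,
  is therefore first turned into a statement about arbitrary lifts. Pushouts in \<Delta> are given
  only by their universal property. Since ordinals have no nontrivial automorphisms, they coincide
  with an explicit gluing, and the squares of \<open>iesq\<close> appear literally. Normality of the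
  cleavage makes generic maps act exactly by \<open>push\<close> and free maps exactly by
  \<open>pull\<close>. It also turns one of the two compositors in the decomposition square into an
  identity, so that the other one is the 2-cell \<open>bc_map\<close> of \<open>iesq\<close>.
  Homotopy pullbacks are handled through full faithfulness and essential surjectivity of the
  comparison functor: in this form they paste, and restrict to maximal subgroupoids, by lifting
  arrows and objects.\<close>

lemma in_hom: "f \<in> hom C x y \<longleftrightarrow> f \<in> Ar C \<and> Src C f = x \<and> Tgt C f = y"
  by (auto simp: hom_def)

lemma homI: "f \<in> Ar C \<Longrightarrow> Src C f = x \<Longrightarrow> Tgt C f = y \<Longrightarrow> f \<in> hom C x y"
  by (auto simp: hom_def)

context
  fixes C :: "('o, 'a) cat"
  assumes C: "category C"
begin

lemma Src_Ob: "f \<in> Ar C \<Longrightarrow> Src C f \<in> Ob C"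
  and Tgt_Ob: "f \<in> Ar C \<Longrightarrow> Tgt C f \<in> Ob C"
  and Ident_Ar: "x \<in> Ob C \<Longrightarrow> Ident C x \<in> Ar C"
  and Src_Ident: "x \<in> Ob C \<Longrightarrow> Src C (Ident C x) = x"
  and Tgt_Ident: "x \<in> Ob C \<Longrightarrow> Tgt C (Ident C x) = x"
  and cmp_Ar: "f \<in> Ar C \<Longrightarrow> g \<in> Ar C \<Longrightarrow> Tgt C f = Src C g \<Longrightarrow> g \<cdot>\<^bsub>C\<^esub> f \<in> Ar C"
  and Src_cmp: "f \<in> Ar C \<Longrightarrow> g \<in> Ar C \<Longrightarrow> Tgt C f = Src C g \<Longrightarrow> Src C (g \<cdot>\<^bsub>C\<^esub> f) = Src C f"
  and Tgt_cmp: "f \<in> Ar C \<Longrightarrow> g \<in> Ar C \<Longrightarrow> Tgt C f = Src C g \<Longrightarrow> Tgt C (g \<cdot>\<^bsub>C\<^esub> f) = Tgt C g"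
  and cmp_Ident: "f \<in> Ar C \<Longrightarrow> Src C f = x \<Longrightarrow> f \<cdot>\<^bsub>C\<^esub> Ident C x = f"
  and Ident_cmp: "f \<in> Ar C \<Longrightarrow> Tgt C f = x \<Longrightarrow> Ident C x \<cdot>\<^bsub>C\<^esub> f = f"
  using C unfolding category_def hom_def by (simp_all, auto)

text \<open>Oriented opposite to \<open>category_def\<close>: the simplifier thereby brings
  composites into right-nested form, which is also how the notation parses.\<close>

lemma cmp_assoc: "f \<in> Ar C \<Longrightarrow> g \<in> Ar C \<Longrightarrow> h \<in> Ar C \<Longrightarrow> Tgt C f = Src C g \<Longrightarrow>
    Tgt C g = Src C h \<Longrightarrow> (h \<cdot>\<^bsub>C\<^esub> g) \<cdot>\<^bsub>C\<^esub> f = h \<cdot>\<^bsub>C\<^esub> (g \<cdot>\<^bsub>C\<^esub> f)"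
  using C unfolding category_def by simp

lemmas cat_simps = Src_Ob Tgt_Ob Ident_Ar Src_Ident Tgt_Ident cmp_Ar Src_cmp Tgt_cmp
  cmp_Ident Ident_cmp cmp_assoc

lemma Ident_hom: "x \<in> Ob C \<Longrightarrow> Ident C x \<in> hom C x x"
  by (simp add: in_hom cat_simps)

lemma cmp_hom: "f \<in> hom C x y \<Longrightarrow> g \<in> hom C y z \<Longrightarrow> g \<cdot>\<^bsub>C\<^esub> f \<in> hom C x z"
  by (simp add: in_hom cat_simps)

lemma hom_assoc: "f \<in> hom C x y \<Longrightarrow> g \<in> hom C y z \<Longrightarrow> h \<in> hom C z w \<Longrightarrow>
    (h \<cdot>\<^bsub>C\<^esub> g) \<cdot>\<^bsub>C\<^esub> f = h \<cdot>\<^bsub>C\<^esub> (g \<cdot>\<^bsub>C\<^esub> f)"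
  by (simp add: in_hom cat_simps)

lemma hom_Ident: "f \<in> hom C x y \<Longrightarrow> f \<cdot>\<^bsub>C\<^esub> Ident C x = f"
  and Ident_hom_cmp: "f \<in> hom C x y \<Longrightarrow> Ident C y \<cdot>\<^bsub>C\<^esub> f = f"
  by (simp_all add: in_hom cat_simps)

lemma hom_Ob: "f \<in> hom C x y \<Longrightarrow> x \<in> Ob C" "f \<in> hom C x y \<Longrightarrow> y \<in> Ob C"
  by (auto simp: in_hom cat_simps)

lemma inverse_ars_unique:
  assumes "inverse_ars C f g" "inverse_ars C f g'"
  shows "g = g'"
proof -
  have "g = g \<cdot>\<^bsub>C\<^esub> (f \<cdot>\<^bsub>C\<^esub> g')" using assms by (simp add: inverse_ars_def in_hom cat_simps)
  also have "\<dots> = (g \<cdot>\<^bsub>C\<^esub> f) \<cdot>\<^bsub>C\<^esub> g'"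
    using assms by (intro cmp_assoc[symmetric]) (auto simp: inverse_ars_def in_hom)
  also have "\<dots> = g'" using assms by (simp add: inverse_ars_def in_hom cat_simps)
  finally show ?thesis .
qed

lemma inv_ar_eq: "inverse_ars C f g \<Longrightarrow> inv_ar C f = g"
  unfolding inv_ar_def using inverse_ars_unique by blast

lemma inverse_inv_ar: "is_iso C f \<Longrightarrow> inverse_ars C f (inv_ar C f)"
  using inv_ar_eq by (auto simp: is_iso_def)

lemma is_iso_Ar: "is_iso C f \<Longrightarrow> f \<in> Ar C"
  by (auto simp: is_iso_def inverse_ars_def)

lemma inv_ar_simps:
  assumes "is_iso C f"
  shows "inv_ar C f \<in> Ar C" "Src C (inv_ar C f) = Tgt C f" "Tgt C (inv_ar C f) = Src C f"
    "inv_ar C f \<cdot>\<^bsub>C\<^esub> f = Ident C (Src C f)" "f \<cdot>\<^bsub>C\<^esub> inv_ar C f = Ident C (Tgt C f)"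
  using inverse_inv_ar[OF assms] by (auto simp: inverse_ars_def in_hom)

lemma inv_ar_hom: "is_iso C f \<Longrightarrow> f \<in> hom C x y \<Longrightarrow> inv_ar C f \<in> hom C y x"
  by (simp add: in_hom inv_ar_simps)

text \<open>In a right-nested composite an arrow and its inverse are separated by the bracket around
  a further factor \<open>g\<close>, so cancellation needs this form and its mirror image
  \<open>cmp_inv_ar_cancel\<close>.\<close>

lemma inv_ar_cmp_cancel: "is_iso C f \<Longrightarrow> g \<in> Ar C \<Longrightarrow> Tgt C g = Src C f \<Longrightarrow>
    inv_ar C f \<cdot>\<^bsub>C\<^esub> (f \<cdot>\<^bsub>C\<^esub> g) = g"
  by (subst cmp_assoc[symmetric]) (simp_all add: inv_ar_simps is_iso_Ar Ident_cmp)

lemma cmp_inv_ar_cancel: "is_iso C f \<Longrightarrow> g \<in> Ar C \<Longrightarrow> Tgt C g = Tgt C f \<Longrightarrow>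
    f \<cdot>\<^bsub>C\<^esub> (inv_ar C f \<cdot>\<^bsub>C\<^esub> g) = g"
  by (subst cmp_assoc[symmetric]) (simp_all add: inv_ar_simps is_iso_Ar Ident_cmp)

lemma is_iso_inv_ar: "is_iso C f \<Longrightarrow> is_iso C (inv_ar C f)"
  unfolding is_iso_def[of _ "inv_ar C f"] inverse_ars_def
  by (rule exI[of _ f]) (simp add: in_hom inv_ar_simps is_iso_Ar)

lemma is_iso_Ident: "x \<in> Ob C \<Longrightarrow> is_iso C (Ident C x)"
  unfolding is_iso_def inverse_ars_def
  by (rule exI[of _ "Ident C x"]) (simp add: in_hom cat_simps)

lemma is_isoI: "f \<in> hom C x y \<Longrightarrow> g \<in> hom C y x \<Longrightarrow> g \<cdot>\<^bsub>C\<^esub> f = Ident C x \<Longrightarrow>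
    f \<cdot>\<^bsub>C\<^esub> g = Ident C y \<Longrightarrow> is_iso C f"
  by (auto simp: is_iso_def inverse_ars_def in_hom)

lemma is_iso_cmp:
  assumes "is_iso C f" "is_iso C g" "Tgt C f = Src C g"
  shows "is_iso C (g \<cdot>\<^bsub>C\<^esub> f)"
proof (rule is_isoI[of _ "Src C f" "Tgt C g" "inv_ar C f \<cdot>\<^bsub>C\<^esub> inv_ar C g"])
  note [simp] = assms is_iso_Ar inv_ar_simps inv_ar_cmp_cancel cmp_inv_ar_cancel cat_simps
  show "g \<cdot>\<^bsub>C\<^esub> f \<in> hom C (Src C f) (Tgt C g)" "inv_ar C f \<cdot>\<^bsub>C\<^esub> inv_ar C g \<in> hom C (Tgt C g) (Src C f)"
    by (auto simp: in_hom)
  show "(inv_ar C f \<cdot>\<^bsub>C\<^esub> inv_ar C g) \<cdot>\<^bsub>C\<^esub> g \<cdot>\<^bsub>C\<^esub> f = Ident C (Src C f)"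
    using assms by simp
  show "(g \<cdot>\<^bsub>C\<^esub> f) \<cdot>\<^bsub>C\<^esub> inv_ar C f \<cdot>\<^bsub>C\<^esub> inv_ar C g = Ident C (Tgt C g)"
    using assms by simp
qed

lemma iso_left_cancel: "is_iso C f \<Longrightarrow> f \<cdot>\<^bsub>C\<^esub> g = f \<cdot>\<^bsub>C\<^esub> h \<Longrightarrow> g \<in> Ar C \<Longrightarrow> h \<in> Ar C \<Longrightarrow>
    Tgt C g = Src C f \<Longrightarrow> Tgt C h = Src C f \<Longrightarrow> g = h"
  using inv_ar_cmp_cancel by metis

lemma iso_right_cancel:
  assumes "is_iso C f" "g \<cdot>\<^bsub>C\<^esub> f = h \<cdot>\<^bsub>C\<^esub> f" "g \<in> Ar C" "h \<in> Ar C"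
    "Src C g = Tgt C f" "Src C h = Tgt C f"
  shows "g = h"
proof -
  have "(g \<cdot>\<^bsub>C\<^esub> f) \<cdot>\<^bsub>C\<^esub> inv_ar C f = (h \<cdot>\<^bsub>C\<^esub> f) \<cdot>\<^bsub>C\<^esub> inv_ar C f" using assms(2) by simp
  then show ?thesis using assms(1,3-) by (simp add: cat_simps inv_ar_simps is_iso_Ar)
qed

end

lemma functor_cats: "is_functor C D F \<Longrightarrow> category C" "is_functor C D F \<Longrightarrow> category D"
  by (auto simp: is_functor_def)

lemma functor_simps:
  assumes "is_functor C D F"
  shows "x \<in> Ob C \<Longrightarrow> FOb F x \<in> Ob D"
    and "f \<in> Ar C \<Longrightarrow> FAr F f \<in> Ar D"
    and "f \<in> Ar C \<Longrightarrow> Src D (FAr F f) = FOb F (Src C f)"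
    and "f \<in> Ar C \<Longrightarrow> Tgt D (FAr F f) = FOb F (Tgt C f)"
    and "x \<in> Ob C \<Longrightarrow> FAr F (Ident C x) = Ident D (FOb F x)"
    and "f \<in> Ar C \<Longrightarrow> g \<in> Ar C \<Longrightarrow> Tgt C f = Src C g \<Longrightarrow>
      FAr F (g \<cdot>\<^bsub>C\<^esub> f) = FAr F g \<cdot>\<^bsub>D\<^esub> FAr F f"
  using assms by (auto simp: is_functor_def)

lemma functor_hom: "is_functor C D F \<Longrightarrow> f \<in> hom C x y \<Longrightarrow> FAr F f \<in> hom D (FOb F x) (FOb F y)"
  by (auto simp: in_hom functor_simps)

lemma functor_inverse_ars:
  assumes "is_functor C D F" "inverse_ars C f g"
  shows "inverse_ars D (FAr F f) (FAr F g)"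
proof -
  note [simp] = functor_simps[OF assms(1)] functor_cats[OF assms(1)] cat_simps
  have "FAr F g \<cdot>\<^bsub>D\<^esub> FAr F f = Ident D (FOb F (Src C f))" "FAr F f \<cdot>\<^bsub>D\<^esub> FAr F g = Ident D (FOb F (Tgt C f))"
    using assms(2) by (auto simp: inverse_ars_def in_hom simp flip: functor_simps(6)[OF assms(1)])
  then show ?thesis
    using assms(2) by (auto simp: inverse_ars_def in_hom)
qed

lemma functor_iso: "is_functor C D F \<Longrightarrow> is_iso C f \<Longrightarrow> is_iso D (FAr F f)"
  by (auto simp: is_iso_def intro: functor_inverse_ars)

lemma functor_inv_ar: "is_functor C D F \<Longrightarrow> is_iso C f \<Longrightarrow> FAr F (inv_ar C f) = inv_ar D (FAr F f)"
  by (metis functor_cats functor_inverse_ars inv_ar_eq inverse_inv_ar)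

lemma is_functorI:
  assumes "category C" "category D"
    "\<And>x. x \<in> Ob C \<Longrightarrow> FOb F x \<in> Ob D" "FOb F \<in> extensional (Ob C)"
    "FAr F \<in> extensional (Ar C)"
    "\<And>f x y. f \<in> hom C x y \<Longrightarrow> FAr F f \<in> hom D (FOb F x) (FOb F y)"
    "\<And>x. x \<in> Ob C \<Longrightarrow> FAr F (Ident C x) = Ident D (FOb F x)"
    "\<And>f g x y z. f \<in> hom C x y \<Longrightarrow> g \<in> hom C y z \<Longrightarrow> FAr F (g \<cdot>\<^bsub>C\<^esub> f) = FAr F g \<cdot>\<^bsub>D\<^esub> FAr F f"
  shows "is_functor C D F"
  unfolding is_functor_def using assms by (auto simp: hom_def PiE_iff)

lemma functor_ext: "is_functor C D F \<Longrightarrow> FOb F \<in> extensional (Ob C)"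
    "is_functor C D F \<Longrightarrow> FAr F \<in> extensional (Ar C)"
  by (auto simp: is_functor_def PiE_iff)

text \<open>Extensionality reduces equality of records to agreement on the source. The domains
  \<open>A\<close> and \<open>B\<close> are independent parameters because a maximal subgroupoid has
  the objects of the category but fewer arrows.\<close>

lemma func_eqI:
  fixes F G :: "('o, 'a, 'p, 'b) func"
  assumes "FOb F \<in> extensional A" "FOb G \<in> extensional A" "FAr F \<in> extensional B" "FAr G \<in> extensional B"
    "\<And>x. x \<in> A \<Longrightarrow> FOb F x = FOb G x" "\<And>f. f \<in> B \<Longrightarrow> FAr F f = FAr G f"
  shows "F = G"
  using assms by (intro func.equality extensionalityI[of _ A] extensionalityI[of _ B]) auto

lemma fcomp_simps:
  "x \<in> Ob C \<Longrightarrow> FOb (fcomp C G F) x = FOb G (FOb F x)"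
  "f \<in> Ar C \<Longrightarrow> FAr (fcomp C G F) f = FAr G (FAr F f)"
  "FOb (fcomp C G F) \<in> extensional (Ob C)" "FAr (fcomp C G F) \<in> extensional (Ar C)"
  by (auto simp: fcomp_def)

lemma idf_simps:
  "x \<in> Ob C \<Longrightarrow> FOb (idf C) x = x"
  "f \<in> Ar C \<Longrightarrow> FAr (idf C) f = f"
  "FOb (idf C) \<in> extensional (Ob C)" "FAr (idf C) \<in> extensional (Ar C)"
  by (auto simp: idf_def)

lemma idf_functor: "category C \<Longrightarrow> is_functor C C (idf C)"
  by (rule is_functorI) (auto simp: idf_simps in_hom cat_simps)

lemma fcomp_functor:
  assumes "is_functor C D F" "is_functor D E G"
  shows "is_functor C E (fcomp C G F)"
  by (rule is_functorI)
    (auto simp: fcomp_simps in_hom cat_simps functor_cats[OF assms(1)] functor_cats[OF assms(2)]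
      functor_simps[OF assms(1)] functor_simps[OF assms(2)])

lemma nat_isoI:
  assumes "is_functor C D F" "is_functor C D G"
    "\<And>x. x \<in> Ob C \<Longrightarrow> \<alpha> x \<in> hom D (FOb F x) (FOb G x)"
    "\<And>x. x \<in> Ob C \<Longrightarrow> is_iso D (\<alpha> x)"
    "\<And>f x y. f \<in> hom C x y \<Longrightarrow> \<alpha> y \<cdot>\<^bsub>D\<^esub> FAr F f = FAr G f \<cdot>\<^bsub>D\<^esub> \<alpha> x"
  shows "nat_iso C D F G \<alpha>"
  using assms by (auto simp: nat_iso_def hom_def)

lemma nat_isoD:
  assumes "nat_iso C D F G \<alpha>"
  shows "is_functor C D F" "is_functor C D G"
    "x \<in> Ob C \<Longrightarrow> \<alpha> x \<in> hom D (FOb F x) (FOb G x)"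
    "x \<in> Ob C \<Longrightarrow> is_iso D (\<alpha> x)"
    "x \<in> Ob C \<Longrightarrow> \<alpha> x \<in> Ar D" "x \<in> Ob C \<Longrightarrow> Src D (\<alpha> x) = FOb F x"
    "x \<in> Ob C \<Longrightarrow> Tgt D (\<alpha> x) = FOb G x"
    "f \<in> hom C x y \<Longrightarrow> \<alpha> y \<cdot>\<^bsub>D\<^esub> FAr F f = FAr G f \<cdot>\<^bsub>D\<^esub> \<alpha> x"
  using assms by (auto simp: nat_iso_def hom_def)

text \<open>Values off the objects of \<open>C\<close> are irrelevant, so the restricted cells
  stored in a simplicial map can be exchanged with unrestricted ones such as
  \<open>act_cell\<close>.\<close>

lemma nat_iso_cong:
  assumes "nat_iso C D F G \<alpha>" "\<And>x. x \<in> Ob C \<Longrightarrow> \<alpha> x = \<beta> x"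
  shows "nat_iso C D F G \<beta>"
proof -
  have "category C" using assms(1) by (auto simp: nat_iso_def is_functor_def)
  then show ?thesis using assms by (auto simp: nat_iso_def cat_simps)
qed

section \<open>Equivalences of categories\<close>

definition fully_faithful :: "('o, 'a) cat \<Rightarrow> ('p, 'b) cat \<Rightarrow> ('o, 'a, 'p, 'b) func \<Rightarrow> bool" where
  "fully_faithful C D F \<longleftrightarrow> (\<forall>x \<in> Ob C. \<forall>y \<in> Ob C. \<forall>v \<in> hom D (FOb F x) (FOb F y).
     \<exists>!w. w \<in> hom C x y \<and> FAr F w = v)"

definition essentially_surjective :: "('o, 'a) cat \<Rightarrow> ('p, 'b) cat \<Rightarrow> ('o, 'a, 'p, 'b) func \<Rightarrow> bool" where
  "essentially_surjective C D F \<longleftrightarrow>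
     (\<forall>d \<in> Ob D. \<exists>x \<in> Ob C. \<exists>e \<in> hom D (FOb F x) d. is_iso D e)"

text \<open>Naturality expresses \<open>\<eta> y\<close> after \<open>w\<close> through
  \<open>FAr F w\<close>, and the invertible \<open>\<eta> y\<close> cancels. The argument is
  phrased for one natural isomorphism so that it applies to the quasi-inverse as well, with the
  inverse of the counit in place of \<eta>.\<close>

lemma faithful_of_left_inverse:
  assumes F: "is_functor C D F"
    and \<eta>: "nat_iso C C (idf C) (fcomp C G F) \<eta>"
    and w: "w \<in> hom C x y" "w' \<in> hom C x y" and eq: "FAr F w = FAr F w'"
  shows "w = w'"
proof -
  note [simp] = functor_cats[OF F] nat_isoD[OF \<eta>] fcomp_simps idf_simps
  have xy: "x \<in> Ob C" "y \<in> Ob C" using w(1) by (auto simp: hom_Ob[of C])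
  have "\<eta> y \<cdot>\<^bsub>C\<^esub> w = \<eta> y \<cdot>\<^bsub>C\<^esub> w'"
    using nat_isoD(8)[OF \<eta> w(1)] nat_isoD(8)[OF \<eta> w(2)] w eq by (simp add: in_hom)
  then show ?thesis using w xy by (intro iso_left_cancel[of C "\<eta> y" w w']) (auto simp: in_hom)
qed

lemma nat_iso_inverse:
  assumes "nat_iso C D F G \<alpha>"
  shows "nat_iso C D G F (\<lambda>x. inv_ar D (\<alpha> x))"
proof (rule nat_isoI)
  have D: "category D" and C: "category C" using assms by (auto simp: nat_iso_def is_functor_def)
  note \<alpha> = nat_isoD[OF assms]
  note [simp] = functor_simps[OF \<alpha>(1)] functor_simps[OF \<alpha>(2)]
  fix f x y assume f: "f \<in> hom C x y"
  have [simp]: "x \<in> Ob C" "y \<in> Ob C" "f \<in> Ar C" "Src C f = x" "Tgt C f = y"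
    using f by (auto simp: hom_Ob[OF C] in_hom)
  have "inv_ar D (\<alpha> y) \<cdot>\<^bsub>D\<^esub> FAr G f = inv_ar D (\<alpha> y) \<cdot>\<^bsub>D\<^esub> (FAr G f \<cdot>\<^bsub>D\<^esub> \<alpha> x) \<cdot>\<^bsub>D\<^esub> inv_ar D (\<alpha> x)"
    by (simp add: \<alpha>(1-7) D cat_simps inv_ar_simps)
  also have "\<dots> = inv_ar D (\<alpha> y) \<cdot>\<^bsub>D\<^esub> (\<alpha> y \<cdot>\<^bsub>D\<^esub> FAr F f) \<cdot>\<^bsub>D\<^esub> inv_ar D (\<alpha> x)"
    using \<alpha>(8)[OF f] by simp
  also have "\<dots> = FAr F f \<cdot>\<^bsub>D\<^esub> inv_ar D (\<alpha> x)"
    by (simp add: \<alpha>(1-7) D cat_simps inv_ar_simps inv_ar_cmp_cancel)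
  finally show "inv_ar D (\<alpha> y) \<cdot>\<^bsub>D\<^esub> FAr G f = FAr F f \<cdot>\<^bsub>D\<^esub> inv_ar D (\<alpha> x)" .
qed (use assms in \<open>auto simp: nat_iso_def is_functor_def intro: inv_ar_hom is_iso_inv_ar\<close>)

lemma equivalence_fully_faithful:
  assumes "is_equivalence C D F"
  shows "fully_faithful C D F"
  unfolding fully_faithful_def
proof (intro ballI ex_ex1I)
  obtain G \<eta> \<epsilon> where F: "is_functor C D F" and G: "is_functor D C G"
    and \<eta>: "nat_iso C C (idf C) (fcomp C G F) \<eta>" and \<epsilon>: "nat_iso D D (fcomp D F G) (idf D) \<epsilon>"
    using assms by (auto simp: is_equivalence_def)
  have C: "category C" and D: "category D" using functor_cats[OF F] by auto
  fix x y v assume x: "x \<in> Ob C" and y: "y \<in> Ob C" and v: "v \<in> hom D (FOb F x) (FOb F y)"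
  show "w = w'" if "w \<in> hom C x y \<and> FAr F w = v" "w' \<in> hom C x y \<and> FAr F w' = v" for w w'
    using faithful_of_left_inverse[OF F \<eta>, of w x y w'] that by auto
  note [simp] = C D functor_simps[OF F] functor_simps[OF G] x y cat_simps nat_isoD(1-7)[OF \<eta>]
    fcomp_simps idf_simps inv_ar_simps
  have [simp]: "v \<in> Ar D" "Src D v = FOb F x" "Tgt D v = FOb F y" using v by (auto simp: in_hom)
  \<comment> \<open>The conjugate of \<open>G v\<close> by \<eta>, the only candidate that
    naturality of \<eta> allows.\<close>
  define w where "w = inv_ar C (\<eta> y) \<cdot>\<^bsub>C\<^esub> FAr G v \<cdot>\<^bsub>C\<^esub> \<eta> x"
  have w: "w \<in> hom C x y" by (auto simp: w_def in_hom)
  have "FAr G (FAr F w) \<cdot>\<^bsub>C\<^esub> \<eta> x = \<eta> y \<cdot>\<^bsub>C\<^esub> w"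
    using nat_isoD(8)[OF \<eta> w] w by (simp add: in_hom)
  also have "\<dots> = FAr G v \<cdot>\<^bsub>C\<^esub> \<eta> x" by (simp add: w_def cmp_inv_ar_cancel)
  finally have "FAr G (FAr F w) = FAr G v"
    using w by (intro iso_right_cancel[of C "\<eta> x" "FAr G (FAr F w)" "FAr G v"]) (auto simp: in_hom)
  moreover have "FAr F w \<in> hom D (FOb F x) (FOb F y)" using functor_hom[OF F w] .
  \<comment> \<open>\<open>G\<close> is faithful because the inverse of \<epsilon> is a natural
    isomorphism from the identity to \<open>F\<close> after \<open>G\<close>.\<close>
  ultimately have "FAr F w = v"
    using faithful_of_left_inverse[OF G nat_iso_inverse[OF \<epsilon>]] v by blast
  then show "\<exists>w. w \<in> hom C x y \<and> FAr F w = v" using w by blast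
qed

lemma equivalence_essentially_surjective:
  assumes "is_equivalence C D F"
  shows "essentially_surjective C D F"
  unfolding essentially_surjective_def
proof
  obtain G \<eta> \<epsilon> where G: "is_functor D C G" and \<epsilon>: "nat_iso D D (fcomp D F G) (idf D) \<epsilon>"
    using assms by (auto simp: is_equivalence_def)
  fix d assume d: "d \<in> Ob D"
  have "\<epsilon> d \<in> hom D (FOb F (FOb G d)) d" "is_iso D (\<epsilon> d)"
    using nat_isoD(3,4)[OF \<epsilon> d] d by (auto simp: fcomp_simps idf_simps)
  then show "\<exists>x\<in>Ob C. \<exists>e\<in>hom D (FOb F x) d. is_iso D e"
    using functor_simps(1)[OF G d] by blast
qed

text \<open>Choose for each object \<open>d\<close> an object \<open>r d\<close> and an isomorphism
  \<open>e d\<close> from \<open>F (r d)\<close> to \<open>d\<close>. Conjugation by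
  \<open>e\<close> moves arrows of \<open>D\<close> between objects in the image of
  \<open>F\<close>, where they have unique preimages; the laws of the quasi-inverse and of \<eta>
  are checked after applying the faithful \<open>F\<close>.\<close>

lemma fully_faithful_equivalence:
  assumes F: "is_functor C D F" and ff: "fully_faithful C D F" and es: "essentially_surjective C D F"
  shows "is_equivalence C D F"
proof -
  have C: "category C" and D: "category D" using functor_cats[OF F] by auto
  note [simp] = C D functor_simps[OF F] cat_simps inv_ar_simps
  have "\<forall>d \<in> Ob D. \<exists>x e. x \<in> Ob C \<and> e \<in> hom D (FOb F x) d \<and> is_iso D e"
    using es unfolding essentially_surjective_def by blast
  then obtain r e where re: "\<And>d. d \<in> Ob D \<Longrightarrow> r d \<in> Ob C \<and>
      e d \<in> hom D (FOb F (r d)) d \<and> is_iso D (e d)" by metis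
  have r[simp]: "r d \<in> Ob C" and e[simp]: "e d \<in> Ar D" "Src D (e d) = FOb F (r d)" "Tgt D (e d) = d"
      "is_iso D (e d)" if "d \<in> Ob D" for d
    using re[OF that] by (auto simp: in_hom)
  define L where "L x y v = (THE w. w \<in> hom C x y \<and> FAr F w = v)" for x y v
  have L: "L x y v \<in> hom C x y" "FAr F (L x y v) = v"
    if "x \<in> Ob C" "y \<in> Ob C" "v \<in> hom D (FOb F x) (FOb F y)" for x y v
    using theI'[of "\<lambda>w. w \<in> hom C x y \<and> FAr F w = v"] ff that
    unfolding fully_faithful_def L_def by blast+
  have faith: "w = w'" if "w \<in> hom C x y" "w' \<in> hom C x y" "FAr F w = FAr F w'" for w w' x y
  proof -
    have "x \<in> Ob C" "y \<in> Ob C" using that(1) by (auto simp: in_hom)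
    moreover have "FAr F w \<in> hom D (FOb F x) (FOb F y)" by (rule functor_hom[OF F that(1)])
    ultimately show ?thesis using ff that unfolding fully_faithful_def by metis
  qed
  define a where "a v = inv_ar D (e (Tgt D v)) \<cdot>\<^bsub>D\<^esub> v \<cdot>\<^bsub>D\<^esub> e (Src D v)" for v
  have a: "a v \<in> hom D (FOb F (r x)) (FOb F (r y))" if "v \<in> hom D x y" for v x y
    using that by (auto simp: a_def in_hom)
  define G where "G = \<lparr>FOb = restrict r (Ob D),
    FAr = restrict (\<lambda>v. L (r (Src D v)) (r (Tgt D v)) (a v)) (Ar D)\<rparr>"
  have GOb[simp]: "FOb G d = r d" if "d \<in> Ob D" for d using that by (simp add: G_def)
  have GAr: "FAr G v \<in> hom C (r x) (r y)" "FAr F (FAr G v) = a v" if "v \<in> hom D x y" for v x y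
  proof -
    have "FAr G v = L (r x) (r y) (a v)" using that by (auto simp: G_def in_hom)
    moreover have "x \<in> Ob D" "y \<in> Ob D" using that by (auto simp: in_hom)
    ultimately show "FAr G v \<in> hom C (r x) (r y)" "FAr F (FAr G v) = a v"
      using L[of "r x" "r y" "a v"] a[OF that] by auto
  qed
  have G: "is_functor D C G"
  proof (rule is_functorI)
    show "FAr G f \<in> hom C (FOb G x) (FOb G y)" if "f \<in> hom D x y" for f x y
      using GAr[OF that] hom_Ob[OF D that] by auto
    show "FAr G (Ident D x) = Ident C (FOb G x)" if "x \<in> Ob D" for x
    proof (rule faith[of _ "r x" "r x"])
      have i: "Ident D x \<in> hom D x x" using that by (auto simp: in_hom)
      show "FAr G (Ident D x) \<in> hom C (r x) (r x)" using GAr(1)[OF i] .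
      show "FAr F (FAr G (Ident D x)) = FAr F (Ident C (FOb G x))"
        using that GAr(2)[OF i] by (simp add: a_def)
      show "Ident C (FOb G x) \<in> hom C (r x) (r x)" using that by (auto simp: in_hom)
    qed
    show "FAr G (g \<cdot>\<^bsub>D\<^esub> f) = FAr G g \<cdot>\<^bsub>C\<^esub> FAr G f" if f: "f \<in> hom D x y" and g: "g \<in> hom D y z" for f g x y z
    proof (rule faith[of _ "r x" "r z"])
      have gf: "g \<cdot>\<^bsub>D\<^esub> f \<in> hom D x z" using cmp_hom[OF D f g] .
      show "FAr G (g \<cdot>\<^bsub>D\<^esub> f) \<in> hom C (r x) (r z)" using GAr(1)[OF gf] .
      show "FAr G g \<cdot>\<^bsub>C\<^esub> FAr G f \<in> hom C (r x) (r z)" using cmp_hom[OF C GAr(1)[OF f] GAr(1)[OF g]] .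
      have "FAr F (FAr G g \<cdot>\<^bsub>C\<^esub> FAr G f) = a g \<cdot>\<^bsub>D\<^esub> a f"
        using GAr[OF f] GAr[OF g] by (simp add: in_hom)
      also have "\<dots> = a (g \<cdot>\<^bsub>D\<^esub> f)"
        using f g by (auto simp: in_hom a_def cmp_inv_ar_cancel)
      finally show "FAr F (FAr G (g \<cdot>\<^bsub>D\<^esub> f)) = FAr F (FAr G g \<cdot>\<^bsub>C\<^esub> FAr G f)"
        using GAr(2)[OF gf] by simp
    qed
  qed (auto simp: G_def)
  have \<epsilon>: "nat_iso D D (fcomp D F G) (idf D) e"
  proof (rule nat_isoI)
    fix v x y assume v: "v \<in> hom D x y"
    have "x \<in> Ob D" "y \<in> Ob D" using hom_Ob[OF D v] by auto
    then show "e y \<cdot>\<^bsub>D\<^esub> FAr (fcomp D F G) v = FAr (idf D) v \<cdot>\<^bsub>D\<^esub> e x"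
      using v GAr(2)[OF v] by (auto simp: fcomp_simps idf_simps in_hom a_def cmp_inv_ar_cancel)
  qed (auto simp: fcomp_functor[OF G F] idf_functor in_hom fcomp_simps idf_simps)
  \<comment> \<open>Preimage of the inverse of \<open>e\<close>; the preimage of \<open>e\<close>
    itself will be its inverse, again by faithfulness.\<close>
  define \<eta> where "\<eta> x = L x (r (FOb F x)) (inv_ar D (e (FOb F x)))" for x
  have \<eta>: "\<eta> x \<in> hom C x (r (FOb F x))" "FAr F (\<eta> x) = inv_ar D (e (FOb F x))" if "x \<in> Ob C" for x
    using that L[of x "r (FOb F x)"] by (auto simp: \<eta>_def in_hom)
  have "nat_iso C C (idf C) (fcomp C G F) \<eta>"
  proof (rule nat_isoI)
    fix x assume x: "x \<in> Ob C"
    let ?\<theta> = "L (r (FOb F x)) x (e (FOb F x))"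
    have \<theta>: "?\<theta> \<in> hom C (r (FOb F x)) x" "FAr F ?\<theta> = e (FOb F x)"
      using x L[of "r (FOb F x)" x "e (FOb F x)"] by (auto simp: in_hom)
    show "is_iso C (\<eta> x)"
    proof (rule is_isoI[OF C \<eta>(1)[OF x] \<theta>(1)])
      show "?\<theta> \<cdot>\<^bsub>C\<^esub> \<eta> x = Ident C x"
        using \<eta>[OF x] \<theta> x by (intro faith[of _ x x] cmp_hom[OF C]) (auto simp: in_hom)
      show "\<eta> x \<cdot>\<^bsub>C\<^esub> ?\<theta> = Ident C (r (FOb F x))"
        using \<eta>[OF x] \<theta> x by (intro faith[of _ "r (FOb F x)" "r (FOb F x)"] cmp_hom[OF C]) (auto simp: in_hom)
    qed
  next
    fix w x y assume w: "w \<in> hom C x y"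
    have x: "x \<in> Ob C" and y: "y \<in> Ob C" using hom_Ob[OF C w] by auto
    have Fw: "FAr F w \<in> hom D (FOb F x) (FOb F y)" using functor_hom[OF F w] .
    have "\<eta> y \<cdot>\<^bsub>C\<^esub> w = FAr G (FAr F w) \<cdot>\<^bsub>C\<^esub> \<eta> x"
    proof (rule faith)
      show "\<eta> y \<cdot>\<^bsub>C\<^esub> w \<in> hom C x (r (FOb F y))" using cmp_hom[OF C w \<eta>(1)[OF y]] .
      show "FAr G (FAr F w) \<cdot>\<^bsub>C\<^esub> \<eta> x \<in> hom C x (r (FOb F y))" using cmp_hom[OF C \<eta>(1)[OF x] GAr(1)[OF Fw]] .
      show "FAr F (\<eta> y \<cdot>\<^bsub>C\<^esub> w) = FAr F (FAr G (FAr F w) \<cdot>\<^bsub>C\<^esub> \<eta> x)"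
        using w x y \<eta>(1)[OF x] \<eta>(1)[OF y] GAr(1)[OF Fw]
        by (simp add: in_hom \<eta>(2) GAr(2)[OF Fw] a_def)
    qed
    then show "\<eta> y \<cdot>\<^bsub>C\<^esub> FAr (idf C) w = FAr (fcomp C G F) w \<cdot>\<^bsub>C\<^esub> \<eta> x"
      using w by (simp add: idf_simps fcomp_simps in_hom)
  qed (use \<eta>(1) in \<open>auto simp: fcomp_functor[OF F G] idf_functor fcomp_simps idf_simps\<close>)
  then show ?thesis using F G \<epsilon> by (auto simp: is_equivalence_def)
qed

text \<open>The form in which equivalences are used from here on: unlike a quasi-inverse, these two
  properties can be transferred along pastings and to maximal subgroupoids by direct lifting
  arguments.\<close>

lemma is_equivalence_iff:
  "is_equivalence C D F \<longleftrightarrow> is_functor C D F \<and> fully_faithful C D F \<and> essentially_surjective C D F"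
  by (metis equivalence_fully_faithful equivalence_essentially_surjective fully_faithful_equivalence
      is_equivalence_def)

lemma categoryI:
  assumes "\<And>f x y. f \<in> hom C x y \<Longrightarrow> x \<in> Ob C \<and> y \<in> Ob C"
    and "\<And>x. x \<in> Ob C \<Longrightarrow> Ident C x \<in> hom C x x"
    and "\<And>f g x y z. f \<in> hom C x y \<Longrightarrow> g \<in> hom C y z \<Longrightarrow> g \<cdot>\<^bsub>C\<^esub> f \<in> hom C x z"
    and "\<And>f x y. f \<in> hom C x y \<Longrightarrow> f \<cdot>\<^bsub>C\<^esub> Ident C x = f"
    and "\<And>f x y. f \<in> hom C x y \<Longrightarrow> Ident C y \<cdot>\<^bsub>C\<^esub> f = f"
    and "\<And>f g h x y z w. f \<in> hom C x y \<Longrightarrow> g \<in> hom C y z \<Longrightarrow> h \<in> hom C z w \<Longrightarrow>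
      h \<cdot>\<^bsub>C\<^esub> (g \<cdot>\<^bsub>C\<^esub> f) = (h \<cdot>\<^bsub>C\<^esub> g) \<cdot>\<^bsub>C\<^esub> f"
  shows "category C"
proof -
  have hom: "f \<in> hom C (Src C f) (Tgt C f)" if "f \<in> Ar C" for f using that by (simp add: in_hom)
  show ?thesis
    unfolding category_def
  proof (intro conjI ballI impI)
    fix f g h assume f: "f \<in> Ar C" and g: "g \<in> Ar C"
    show "Src C f \<in> Ob C" "Tgt C f \<in> Ob C" "f \<cdot>\<^bsub>C\<^esub> Ident C (Src C f) = f"
      "Ident C (Tgt C f) \<cdot>\<^bsub>C\<^esub> f = f"
      using assms(1,4,5)[OF hom[OF f]] by auto
    show "g \<cdot>\<^bsub>C\<^esub> f \<in> hom C (Src C f) (Tgt C g)" if "Tgt C f = Src C g"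
      using assms(3)[OF hom[OF f]] hom[OF g] that by simp
    show "h \<cdot>\<^bsub>C\<^esub> (g \<cdot>\<^bsub>C\<^esub> f) = (h \<cdot>\<^bsub>C\<^esub> g) \<cdot>\<^bsub>C\<^esub> f" if h: "h \<in> Ar C" and "Tgt C f = Src C g \<and> Tgt C g = Src C h"
      using assms(6)[OF hom[OF f]] hom[OF g] hom[OF h] that(2) by auto
  qed (rule assms(2))
qed

section \<open>Homotopy pullbacks\<close>

text \<open>Full faithfulness of the comparison functor into the iso-comma category, unfolded to
  arrows of \<open>P\<close>, \<open>A\<close> and \<open>B\<close> so that later arguments meet no
  tuples.\<close>

definition comma_full :: "('op, 'ap) cat \<Rightarrow> ('oa, 'aa) cat \<Rightarrow> ('ob, 'ab) cat \<Rightarrow>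
    ('oc, 'ac) cat \<Rightarrow> ('op, 'ap, 'oa, 'aa) func \<Rightarrow> ('op, 'ap, 'ob, 'ab) func \<Rightarrow>
    ('oa, 'aa, 'oc, 'ac) func \<Rightarrow> ('ob, 'ab, 'oc, 'ac) func \<Rightarrow> ('op \<Rightarrow> 'ac) \<Rightarrow> bool" where
  "comma_full P A B C K H F G \<alpha> \<longleftrightarrow>
     (\<forall>x \<in> Ob P. \<forall>x' \<in> Ob P. \<forall>u \<in> hom A (FOb K x) (FOb K x'). \<forall>v \<in> hom B (FOb H x) (FOb H x').
        \<alpha> x' \<cdot>\<^bsub>C\<^esub> FAr F u = FAr G v \<cdot>\<^bsub>C\<^esub> \<alpha> x \<longrightarrow> (\<exists>!w. w \<in> hom P x x' \<and> FAr K w = u \<and> FAr H w = v))"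

text \<open>Essential surjectivity of the same functor, likewise unfolded: an isomorphism of triples
  amounts to a pair of isomorphisms \<open>u\<close>, \<open>v\<close>, by
  \<open>iso_comma_is_iso\<close>.\<close>

definition comma_surj :: "('op, 'ap) cat \<Rightarrow> ('oa, 'aa) cat \<Rightarrow> ('ob, 'ab) cat \<Rightarrow>
    ('oc, 'ac) cat \<Rightarrow> ('op, 'ap, 'oa, 'aa) func \<Rightarrow> ('op, 'ap, 'ob, 'ab) func \<Rightarrow>
    ('oa, 'aa, 'oc, 'ac) func \<Rightarrow> ('ob, 'ab, 'oc, 'ac) func \<Rightarrow> ('op \<Rightarrow> 'ac) \<Rightarrow> bool" where
  "comma_surj P A B C K H F G \<alpha> \<longleftrightarrow>
     (\<forall>a \<in> Ob A. \<forall>b \<in> Ob B. \<forall>c \<in> hom C (FOb F a) (FOb G b). is_iso C c \<longrightarrow>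
        (\<exists>x \<in> Ob P. \<exists>u \<in> hom A (FOb K x) a. \<exists>v \<in> hom B (FOb H x) b. is_iso A u \<and> is_iso B v \<and>
           c \<cdot>\<^bsub>C\<^esub> FAr F u = FAr G v \<cdot>\<^bsub>C\<^esub> \<alpha> x))"

lemma comma_fullD:
  assumes "comma_full P A B C K H F G \<alpha>" "x \<in> Ob P" "x' \<in> Ob P" "u \<in> hom A (FOb K x) (FOb K x')"
    "v \<in> hom B (FOb H x) (FOb H x')" "\<alpha> x' \<cdot>\<^bsub>C\<^esub> FAr F u = FAr G v \<cdot>\<^bsub>C\<^esub> \<alpha> x"
  shows "\<exists>!w. w \<in> hom P x x' \<and> FAr K w = u \<and> FAr H w = v"
  using assms unfolding comma_full_def by blast

lemma comma_surjD:
  assumes "comma_surj P A B C K H F G \<alpha>" "a \<in> Ob A" "b \<in> Ob B" "c \<in> hom C (FOb F a) (FOb G b)" "is_iso C c"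
  obtains x u v where "x \<in> Ob P" "u \<in> hom A (FOb K x) a" "v \<in> hom B (FOb H x) b" "is_iso A u" "is_iso B v"
    "c \<cdot>\<^bsub>C\<^esub> FAr F u = FAr G v \<cdot>\<^bsub>C\<^esub> \<alpha> x"
  using assms unfolding comma_surj_def by blast

context
  fixes A :: "('oa, 'aa) cat" and B :: "('ob, 'ab) cat" and C :: "('oc, 'ac) cat"
    and F :: "('oa, 'aa, 'oc, 'ac) func" and G :: "('ob, 'ab, 'oc, 'ac) func"
  assumes F: "is_functor A C F" and G: "is_functor B C G"
begin

abbreviation (input) "ic \<equiv> iso_comma A B C F G"

lemma iso_comma_Ob: "(a, b, c) \<in> Ob ic \<longleftrightarrow> a \<in> Ob A \<and> b \<in> Ob B \<and> c \<in> hom C (FOb F a) (FOb G b) \<and> is_iso C c"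
  by (simp add: iso_comma_def iso_comma_obs_def)

lemma iso_comma_hom: "w \<in> hom ic (a, b, c) (a', b', c') \<longleftrightarrow> (\<exists>u v. w = ((a, b, c), (a', b', c'), u, v) \<and>
    (a, b, c) \<in> Ob ic \<and> (a', b', c') \<in> Ob ic \<and> u \<in> hom A a a' \<and> v \<in> hom B b b' \<and>
    c' \<cdot>\<^bsub>C\<^esub> FAr F u = FAr G v \<cdot>\<^bsub>C\<^esub> c)"
  unfolding hom_def[of ic] by (cases w) (auto simp: iso_comma_def)

lemma iso_comma_Ident: "Ident ic (a, b, c) = ((a, b, c), (a, b, c), Ident A a, Ident B b)"
  and iso_comma_Cmp: "((s', t', u', v') \<cdot>\<^bsub>ic\<^esub> (s, t, u, v)) = (s, t', u' \<cdot>\<^bsub>A\<^esub> u, v' \<cdot>\<^bsub>B\<^esub> v)"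
  by (simp_all add: iso_comma_def)

lemma iso_comma_category: "category ic"
proof -
  have cats: "category A" "category B" "category C"
    using functor_cats[OF F] functor_cats[OF G] by auto
  note [simp] = cats cat_simps functor_simps[OF F] functor_simps[OF G] is_iso_Ar
  \<comment> \<open>Closure under composition: the two compatibility squares are pasted along
    \<open>c\<close>.\<close>
  have 1: "c' \<cdot>\<^bsub>C\<^esub> FAr F (u' \<cdot>\<^bsub>A\<^esub> u) = FAr G (v' \<cdot>\<^bsub>B\<^esub> v) \<cdot>\<^bsub>C\<^esub> c0"
    if u: "u \<in> hom A a0 a1" "u' \<in> hom A a1 a2" "v \<in> hom B b0 b1" "v' \<in> hom B b1 b2"
      and c: "c0 \<in> hom C (FOb F a0) (FOb G b0)" "c \<in> hom C (FOb F a1) (FOb G b1)" "c' \<in> hom C (FOb F a2) (FOb G b2)"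
      and e: "c \<cdot>\<^bsub>C\<^esub> FAr F u = FAr G v \<cdot>\<^bsub>C\<^esub> c0" "c' \<cdot>\<^bsub>C\<^esub> FAr F u' = FAr G v' \<cdot>\<^bsub>C\<^esub> c"
    for a0 a1 a2 b0 b1 b2 c0 c c' u u' v v'
  proof -
    have "c' \<cdot>\<^bsub>C\<^esub> FAr F (u' \<cdot>\<^bsub>A\<^esub> u) = (c' \<cdot>\<^bsub>C\<^esub> FAr F u') \<cdot>\<^bsub>C\<^esub> FAr F u"
      using u c by (simp add: in_hom)
    also have "\<dots> = FAr G v' \<cdot>\<^bsub>C\<^esub> (c \<cdot>\<^bsub>C\<^esub> FAr F u)" using u c by (simp add: e(2), simp add: in_hom)
    also have "\<dots> = FAr G (v' \<cdot>\<^bsub>B\<^esub> v) \<cdot>\<^bsub>C\<^esub> c0" using u c by (simp add: e(1), simp add: in_hom)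
    finally show ?thesis .
  qed
  show ?thesis
  proof (rule categoryI; (clarify)?)
    fix f g a b c a' b' c' a'' b'' c''
    assume f: "f \<in> hom ic (a, b, c) (a', b', c')"
    show "(a, b, c) \<in> Ob ic \<and> (a', b', c') \<in> Ob ic" "f \<cdot>\<^bsub>ic\<^esub> Ident ic (a, b, c) = f"
      "Ident ic (a', b', c') \<cdot>\<^bsub>ic\<^esub> f = f"
      using f by (auto simp: iso_comma_hom iso_comma_Cmp iso_comma_Ident hom_Ident Ident_hom_cmp)
    assume g: "g \<in> hom ic (a', b', c') (a'', b'', c'')"
    show "g \<cdot>\<^bsub>ic\<^esub> f \<in> hom ic (a, b, c) (a'', b'', c'')"
      using f g
      by (auto simp: iso_comma_hom iso_comma_Cmp iso_comma_Ob intro!: cmp_hom[of A] cmp_hom[of B] 1)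
    show "h \<cdot>\<^bsub>ic\<^esub> (g \<cdot>\<^bsub>ic\<^esub> f) = (h \<cdot>\<^bsub>ic\<^esub> g) \<cdot>\<^bsub>ic\<^esub> f" if "h \<in> hom ic (a'', b'', c'') (x, y, z)" for h x y z
      using f g that by (auto simp: iso_comma_hom iso_comma_Cmp hom_assoc)
  next
    fix a b c
    show "Ident ic (a, b, c) \<in> hom ic (a, b, c) (a, b, c)" if "(a, b, c) \<in> Ob ic"
      using that by (auto simp: iso_comma_Ob iso_comma_Ident iso_comma_hom in_hom[of _ A] in_hom[of _ B] in_hom[of _ C])
  qed
qed

text \<open>The converse direction has content: the inverses of \<open>u\<close> and
  \<open>v\<close> must again form an arrow of triples, and their compatibility square is the given
  one composed with inverses on both sides.\<close>

lemma iso_comma_is_iso: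
  assumes w: "w \<in> hom ic (a, b, c) (a', b', c')"
  shows "is_iso ic w \<longleftrightarrow> is_iso A (fst (snd (snd w))) \<and> is_iso B (snd (snd (snd w)))"
proof -
  have cats: "category A" "category B" "category C"
    using functor_cats[OF F] functor_cats[OF G] by auto
  obtain u v where [simp]: "w = ((a, b, c), (a', b', c'), u, v)"
    and s: "a \<in> Ob A" "b \<in> Ob B" "c \<in> hom C (FOb F a) (FOb G b)" "is_iso C c"
    and t: "a' \<in> Ob A" "b' \<in> Ob B" "c' \<in> hom C (FOb F a') (FOb G b')" "is_iso C c'"
    and u: "u \<in> hom A a a'" and v: "v \<in> hom B b b'"
    and e: "c' \<cdot>\<^bsub>C\<^esub> FAr F u = FAr G v \<cdot>\<^bsub>C\<^esub> c"
    using w by (auto simp: iso_comma_hom iso_comma_Ob)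
  show ?thesis
  proof
    assume "is_iso ic w"
    then obtain z where z: "z \<in> hom ic (a', b', c') (a, b, c)" "z \<cdot>\<^bsub>ic\<^esub> w = Ident ic (a, b, c)"
        "w \<cdot>\<^bsub>ic\<^esub> z = Ident ic (a', b', c')"
      using w by (auto simp: is_iso_def inverse_ars_def in_hom)
    then obtain u' v' where "z = ((a', b', c'), (a, b, c), u', v')" "u' \<in> hom A a' a" "v' \<in> hom B b' b"
      by (auto simp: iso_comma_hom)
    then show "is_iso A (fst (snd (snd w))) \<and> is_iso B (snd (snd (snd w)))"
      using z u v by (auto simp: iso_comma_Cmp iso_comma_Ident intro: is_isoI[OF cats(1)] is_isoI[OF cats(2)])
  next
    assume "is_iso A (fst (snd (snd w))) \<and> is_iso B (snd (snd (snd w)))"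
    then have i: "is_iso A u" "is_iso B v" by auto
    note Fu = functor_iso[OF F i(1)] and Gv = functor_iso[OF G i(2)]
    note [simp] = cats cat_simps functor_simps[OF F] functor_simps[OF G] is_iso_Ar inv_ar_simps i Fu Gv
      functor_inv_ar[OF F i(1)] functor_inv_ar[OF G i(2)]
    have [simp]: "u \<in> Ar A" "v \<in> Ar B" "Src A u = a" "Tgt A u = a'" "Src B v = b" "Tgt B v = b'"
      "c \<in> Ar C" "c' \<in> Ar C" "Src C c = FOb F a" "Tgt C c = FOb G b" "Src C c' = FOb F a'" "Tgt C c' = FOb G b'"
      using u v s t by (auto simp: in_hom)
    have "c \<cdot>\<^bsub>C\<^esub> inv_ar C (FAr F u) = inv_ar C (FAr G v) \<cdot>\<^bsub>C\<^esub> (FAr G v \<cdot>\<^bsub>C\<^esub> c) \<cdot>\<^bsub>C\<^esub> inv_ar C (FAr F u)"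
      by (simp add: inv_ar_cmp_cancel s t)
    also have "\<dots> = inv_ar C (FAr G v) \<cdot>\<^bsub>C\<^esub> (c' \<cdot>\<^bsub>C\<^esub> FAr F u) \<cdot>\<^bsub>C\<^esub> inv_ar C (FAr F u)" by (simp only: e)
    also have "\<dots> = inv_ar C (FAr G v) \<cdot>\<^bsub>C\<^esub> c'" by (simp add: s t)
    finally have "((a', b', c'), (a, b, c), inv_ar A u, inv_ar B v) \<in> hom ic (a', b', c') (a, b, c)"
      using s t by (auto simp: iso_comma_hom iso_comma_Ob in_hom[of _ A] in_hom[of _ B] in_hom[of _ C])
    then show "is_iso ic w"
      by (rule is_isoI[OF iso_comma_category w]) (simp_all add: iso_comma_Cmp iso_comma_Ident)
  qed
qed

lemma comparison_functor:
  assumes K: "is_functor P A K" and H: "is_functor P B H"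
    and \<alpha>: "nat_iso P C (fcomp P F K) (fcomp P G H) \<alpha>"
  shows "is_functor P ic (comparison P K H \<alpha>)"
proof -
  have P: "category P" using functor_cats[OF K] by auto
  note [simp] = P cat_simps functor_simps[OF K] functor_simps[OF H]
  have ob: "(FOb K x, FOb H x, \<alpha> x) \<in> Ob ic" if "x \<in> Ob P" for x
    using that nat_isoD(3,4)[OF \<alpha> that] by (auto simp: iso_comma_Ob fcomp_simps)
  have ar: "((FOb K x, FOb H x, \<alpha> x), (FOb K y, FOb H y, \<alpha> y), FAr K w, FAr H w) \<in>
      hom ic (FOb K x, FOb H x, \<alpha> x) (FOb K y, FOb H y, \<alpha> y)" if w: "w \<in> hom P x y" for w x y
    using ob[OF hom_Ob(1)[OF P w]] ob[OF hom_Ob(2)[OF P w]] nat_isoD(8)[OF \<alpha> w]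
      functor_hom[OF K w] functor_hom[OF H w] w
    by (auto simp: iso_comma_hom fcomp_simps in_hom[of w])
  show ?thesis
  proof (rule is_functorI)
    show "FAr (comparison P K H \<alpha>) f \<in> hom ic (FOb (comparison P K H \<alpha>) x) (FOb (comparison P K H \<alpha>) y)"
      if "f \<in> hom P x y" for f x y
      using ar[OF that] that by (auto simp: comparison_def in_hom[of f] Let_def)
  qed (use ob in \<open>auto simp: P iso_comma_category comparison_def Let_def iso_comma_Ident iso_comma_Cmp in_hom[of _ P]\<close>)
qed

text \<open>The two halves of being an equivalence translate separately: \<open>1\<close> turns full
  faithfulness of the comparison functor into \<open>comma_full\<close>, \<open>3\<close> turns
  essential surjectivity into \<open>comma_surj\<close>.\<close>

lemma homotopy_pullback_iff:
  "homotopy_pullback P A B C K H F G \<alpha> \<longleftrightarrow>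
     is_functor P A K \<and> is_functor P B H \<and> nat_iso P C (fcomp P F K) (fcomp P G H) \<alpha> \<and>
     comma_full P A B C K H F G \<alpha> \<and> comma_surj P A B C K H F G \<alpha>"
proof (cases "is_functor P A K \<and> is_functor P B H \<and> nat_iso P C (fcomp P F K) (fcomp P G H) \<alpha>")
  case True
  then have K: "is_functor P A K" and H: "is_functor P B H"
    and \<alpha>: "nat_iso P C (fcomp P F K) (fcomp P G H) \<alpha>" by auto
  have P: "category P" using functor_cats[OF K] by auto
  note [simp] = P cat_simps functor_simps[OF K] functor_simps[OF H]
  let ?Q = "comparison P K H \<alpha>"
  have Q: "is_functor P ic ?Q" using comparison_functor[OF K H \<alpha>] .
  have ob: "(FOb K x, FOb H x, \<alpha> x) \<in> Ob ic" if "x \<in> Ob P" for x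
    using that nat_isoD(3,4)[OF \<alpha> that] by (auto simp: iso_comma_Ob fcomp_simps)
  have QOb: "FOb ?Q x = (FOb K x, FOb H x, \<alpha> x)" if "x \<in> Ob P" for x
    using that by (simp add: comparison_def Let_def)
  have QAr: "FAr ?Q w = ((FOb K x, FOb H x, \<alpha> x), (FOb K y, FOb H y, \<alpha> y), FAr K w, FAr H w)"
    if "w \<in> hom P x y" for w x y
    using that by (simp add: comparison_def Let_def in_hom)
  have QAr_iff: "FAr ?Q w = ((FOb K x, FOb H x, \<alpha> x), (FOb K y, FOb H y, \<alpha> y), u, v) \<longleftrightarrow> FAr K w = u \<and> FAr H w = v"
    if "w \<in> hom P x y" for w x y u v
    using QAr[OF that] by auto
  have 1: "fully_faithful P ic ?Q \<longleftrightarrow> comma_full P A B C K H F G \<alpha>"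
  proof
    assume ff: "fully_faithful P ic ?Q"
    show "comma_full P A B C K H F G \<alpha>"
      unfolding comma_full_def
    proof (intro ballI impI)
      fix x x' u v assume x: "x \<in> Ob P" "x' \<in> Ob P" and u: "u \<in> hom A (FOb K x) (FOb K x')"
        and v: "v \<in> hom B (FOb H x) (FOb H x')" and e: "\<alpha> x' \<cdot>\<^bsub>C\<^esub> FAr F u = FAr G v \<cdot>\<^bsub>C\<^esub> \<alpha> x"
      have "((FOb K x, FOb H x, \<alpha> x), (FOb K x', FOb H x', \<alpha> x'), u, v) \<in> hom ic (FOb ?Q x) (FOb ?Q x')"
        using ob x u v e by (auto simp: QOb iso_comma_hom)
      then have "\<exists>!w. w \<in> hom P x x' \<and> FAr ?Q w = ((FOb K x, FOb H x, \<alpha> x), (FOb K x', FOb H x', \<alpha> x'), u, v)"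
        using ff x unfolding fully_faithful_def by blast
      then show "\<exists>!w. w \<in> hom P x x' \<and> FAr K w = u \<and> FAr H w = v"
        by (simp add: QAr_iff cong: conj_cong)
    qed
  next
    assume cf: "comma_full P A B C K H F G \<alpha>"
    show "fully_faithful P ic ?Q"
      unfolding fully_faithful_def
    proof (intro ballI)
      fix x y q assume x: "x \<in> Ob P" "y \<in> Ob P" and q: "q \<in> hom ic (FOb ?Q x) (FOb ?Q y)"
      then obtain u v where q': "q = ((FOb K x, FOb H x, \<alpha> x), (FOb K y, FOb H y, \<alpha> y), u, v)"
        "u \<in> hom A (FOb K x) (FOb K y)" "v \<in> hom B (FOb H x) (FOb H y)"
        "\<alpha> y \<cdot>\<^bsub>C\<^esub> FAr F u = FAr G v \<cdot>\<^bsub>C\<^esub> \<alpha> x"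
        by (auto simp: QOb iso_comma_hom)
      have "\<exists>!w. w \<in> hom P x y \<and> FAr K w = u \<and> FAr H w = v" using comma_fullD[OF cf x q'(2-)] .
      then show "\<exists>!w. w \<in> hom P x y \<and> FAr ?Q w = q"
        by (simp add: q'(1) QAr_iff cong: conj_cong)
    qed
  qed
  have 2: "(\<exists>e\<in>hom ic (FOb ?Q x) (a, b, c). is_iso ic e) \<longleftrightarrow>
      (\<exists>u \<in> hom A (FOb K x) a. \<exists>v \<in> hom B (FOb H x) b. is_iso A u \<and> is_iso B v \<and>
           c \<cdot>\<^bsub>C\<^esub> FAr F u = FAr G v \<cdot>\<^bsub>C\<^esub> \<alpha> x)" (is "?l \<longleftrightarrow> ?r") if x: "x \<in> Ob P" and abc: "(a, b, c) \<in> Ob ic" for x a b c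
  proof
    assume ?l
    then obtain e where e: "e \<in> hom ic (FOb K x, FOb H x, \<alpha> x) (a, b, c)" "is_iso ic e"
      using QOb[OF x] by auto
    then obtain u v where uv: "e = ((FOb K x, FOb H x, \<alpha> x), (a, b, c), u, v)" "u \<in> hom A (FOb K x) a"
        "v \<in> hom B (FOb H x) b" "c \<cdot>\<^bsub>C\<^esub> FAr F u = FAr G v \<cdot>\<^bsub>C\<^esub> \<alpha> x"
      by (auto simp: iso_comma_hom)
    moreover have "is_iso A u" "is_iso B v" using iso_comma_is_iso[OF e(1)] e(2) uv(1) by auto
    ultimately show ?r by blast
  next
    assume ?r
    then obtain u v where r: "u \<in> hom A (FOb K x) a" "v \<in> hom B (FOb H x) b" "is_iso A u" "is_iso B v"
           "c \<cdot>\<^bsub>C\<^esub> FAr F u = FAr G v \<cdot>\<^bsub>C\<^esub> \<alpha> x" by auto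
    then have "((FOb K x, FOb H x, \<alpha> x), (a, b, c), u, v) \<in> hom ic (FOb K x, FOb H x, \<alpha> x) (a, b, c)"
      using ob x abc by (auto simp: iso_comma_hom)
    with iso_comma_is_iso[OF this] r show ?l by (auto simp: QOb[OF x])
  qed
  have 3: "essentially_surjective P ic ?Q \<longleftrightarrow> comma_surj P A B C K H F G \<alpha>"
  proof -
    have "essentially_surjective P ic ?Q \<longleftrightarrow> (\<forall>a b c. (a, b, c) \<in> Ob ic \<longrightarrow>
        (\<exists>x \<in> Ob P. \<exists>e\<in>hom ic (FOb ?Q x) (a, b, c). is_iso ic e))"
      unfolding essentially_surjective_def by auto
    also have "\<dots> \<longleftrightarrow> comma_surj P A B C K H F G \<alpha>"
      unfolding comma_surj_def using 2 by (simp add: iso_comma_Ob) blast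
    finally show ?thesis .
  qed
  show ?thesis
    using K H \<alpha> F G Q 1 3 by (simp add: homotopy_pullback_def is_equivalence_iff)
qed (auto simp: homotopy_pullback_def)

end

lemma homotopy_pullbackD:
  assumes "homotopy_pullback P A B C K H F G \<alpha>"
  shows "is_functor P A K" "is_functor P B H" "is_functor A C F" "is_functor B C G"
    "nat_iso P C (fcomp P F K) (fcomp P G H) \<alpha>"
    "comma_full P A B C K H F G \<alpha>" "comma_surj P A B C K H F G \<alpha>"
proof -
  show F: "is_functor A C F" "is_functor B C G" using assms by (auto simp: homotopy_pullback_def)
  then show "is_functor P A K" "is_functor P B H"
    "nat_iso P C (fcomp P F K) (fcomp P G H) \<alpha>"
    "comma_full P A B C K H F G \<alpha>" "comma_surj P A B C K H F G \<alpha>"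
    using assms homotopy_pullback_iff[OF F] by auto
qed

text \<open>The means of exchanging 2-cells: a square is proved for a cell coming from the
  fibration, \<open>bc_map\<close> or \<open>push_cell\<close>, and read off for the cell of the
  simplicial structure.\<close>

lemma homotopy_pullback_cong:
  assumes "homotopy_pullback P A B C K H F G \<alpha>" "\<And>x. x \<in> Ob P \<Longrightarrow> \<alpha> x = \<beta> x"
  shows "homotopy_pullback P A B C K H F G \<beta>"
proof -
  note h = homotopy_pullbackD[OF assms(1)]
  have "comma_full P A B C K H F G \<beta>" "comma_surj P A B C K H F G \<beta>"
    using h(6,7) assms(2) unfolding comma_full_def comma_surj_def by auto
  then show ?thesis using h nat_iso_cong[OF h(5) assms(2)] by (simp add: homotopy_pullback_iff)
qed

text \<open>Serves the identities of both categories. \<open>F\<close> and \<open>F'\<close> may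
  differ, because a fibration compared with itself may carry two different cleavages, whose
  pushforwards are only isomorphic.\<close>

lemma homotopy_pullback_id:
  assumes \<alpha>: "nat_iso P C F' F \<alpha>"
  shows "homotopy_pullback P P C C (idf P) F F' (idf C) \<alpha>"
proof -
  note F = nat_isoD(2)[OF \<alpha>] and F' = nat_isoD(1)[OF \<alpha>]
  have P: "category P" and C: "category C" using functor_cats[OF F] by auto
  note [simp] = P C cat_simps functor_simps[OF F] functor_simps[OF F'] idf_simps inv_ar_simps nat_isoD(4-7)[OF \<alpha>]
  have "fcomp P F' (idf P) = F'" "fcomp P (idf C) F = F"
    by (rule func_eqI[of _ "Ob P" _ "Ar P"]; simp add: fcomp_simps functor_ext[OF F] functor_ext[OF F'])+
  moreover have "comma_full P P C C (idf P) F F' (idf C) \<alpha>"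
    unfolding comma_full_def
  proof (intro ballI impI)
    fix x x' u v assume x: "x \<in> Ob P" "x' \<in> Ob P" and u: "u \<in> hom P (FOb (idf P) x) (FOb (idf P) x')"
      and v: "v \<in> hom C (FOb F x) (FOb F x')" and e: "\<alpha> x' \<cdot>\<^bsub>C\<^esub> FAr F' u = FAr (idf C) v \<cdot>\<^bsub>C\<^esub> \<alpha> x"
    have u': "u \<in> hom P x x'" using u x by simp
    have "FAr F u \<cdot>\<^bsub>C\<^esub> \<alpha> x = v \<cdot>\<^bsub>C\<^esub> \<alpha> x" using nat_isoD(8)[OF \<alpha> u'] e v by (simp add: in_hom)
    then have Fu: "FAr F u = v"
      using u' v x by (intro iso_right_cancel[of C "\<alpha> x" "FAr F u" v]) (auto simp: in_hom)
    show "\<exists>!w. w \<in> hom P x x' \<and> FAr (idf P) w = u \<and> FAr F w = v"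
    proof (rule ex1I[of _ u])
      have "u \<in> Ar P" using u' by (simp add: in_hom)
      then show "u \<in> hom P x x' \<and> FAr (idf P) u = u \<and> FAr F u = v" using u' Fu by simp
    next
      fix w assume "w \<in> hom P x x' \<and> FAr (idf P) w = u \<and> FAr F w = v"
      moreover from this have "w \<in> Ar P" by (simp add: in_hom)
      ultimately show "w = u" by simp
    qed
  qed
  moreover have "comma_surj P P C C (idf P) F F' (idf C) \<alpha>"
    unfolding comma_surj_def
  proof (intro ballI impI)
    fix a b c assume a: "a \<in> Ob P" "b \<in> Ob C" and c: "c \<in> hom C (FOb F' a) (FOb (idf C) b)" "is_iso C c"
    \<comment> \<open>With \<open>x = a\<close> and an identity as \<open>u\<close>, the equation
      forces \<open>v\<close> to be \<open>c\<close> after the inverse of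
      \<open>\<alpha> a\<close>.\<close>
    show "\<exists>x\<in>Ob P. \<exists>u\<in>hom P (FOb (idf P) x) a. \<exists>v\<in>hom C (FOb F x) b. is_iso P u \<and> is_iso C v \<and>
        c \<cdot>\<^bsub>C\<^esub> FAr F' u = FAr (idf C) v \<cdot>\<^bsub>C\<^esub> \<alpha> x"
      using a c
      by (intro bexI[of _ a] bexI[of _ "Ident P a"] bexI[of _ "c \<cdot>\<^bsub>C\<^esub> inv_ar C (\<alpha> a)"])
        (auto simp: in_hom is_iso_Ident intro!: is_iso_cmp is_iso_inv_ar)
  qed
  ultimately show ?thesis
    using F F' \<alpha> by (simp add: homotopy_pullback_iff idf_functor)
qed

text \<open>The pasted cell has the shape of a composite cell in \<open>DecompCulf\<close>, so this
  also gives the naturality of composites of simplicial maps.\<close>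

lemma nat_iso_paste:
  assumes K: "is_functor P A K" and H: "is_functor P B H" and F: "is_functor A C F" and G: "is_functor B C G"
    and \<alpha>: "nat_iso P C (fcomp P F K) (fcomp P G H) \<alpha>"
    and K': "is_functor A A' K'" and F': "is_functor A' C' F'" and G': "is_functor C C' G'"
    and \<alpha>': "nat_iso A C' (fcomp A F' K') (fcomp A G' F) \<alpha>'"
  shows "nat_iso P C' (fcomp P F' (fcomp P K' K)) (fcomp P (fcomp B G' G) H)
    (\<lambda>x. FAr G' (\<alpha> x) \<cdot>\<^bsub>C'\<^esub> \<alpha>' (FOb K x))" (is "nat_iso _ _ _ _ ?\<beta>")
proof -
  note cats[simp] = functor_cats[OF K] functor_cats[OF G] functor_cats[OF F']
  note [simp] = cat_simps functor_simps[OF F] functor_simps[OF F'] functor_simps[OF G] functor_simps[OF G']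
    functor_simps[OF H] functor_simps[OF K] functor_simps[OF K'] fcomp_simps nat_isoD(4-7)[OF \<alpha>] nat_isoD(4-7)[OF \<alpha>']
    inv_ar_simps
  have G'_nat: "?\<beta> y \<cdot>\<^bsub>C'\<^esub> FAr F' (FAr K' (FAr K w)) = FAr G' (FAr G (FAr H w)) \<cdot>\<^bsub>C'\<^esub> ?\<beta> x"
    if w: "w \<in> hom P x y" for w x y
  proof -
    have [simp]: "w \<in> Ar P" "Src P w = x" "Tgt P w = y" "x \<in> Ob P" "y \<in> Ob P"
      using w hom_Ob[OF cats(1) w] by (auto simp: in_hom)
    have "?\<beta> y \<cdot>\<^bsub>C'\<^esub> FAr F' (FAr K' (FAr K w)) =
        FAr G' (\<alpha> y) \<cdot>\<^bsub>C'\<^esub> (\<alpha>' (FOb K y) \<cdot>\<^bsub>C'\<^esub> FAr F' (FAr K' (FAr K w)))" by simp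
    also have "\<dots> = FAr G' (\<alpha> y) \<cdot>\<^bsub>C'\<^esub> (FAr G' (FAr F (FAr K w)) \<cdot>\<^bsub>C'\<^esub> \<alpha>' (FOb K x))"
      using nat_isoD(8)[OF \<alpha>' functor_hom[OF K w]] by simp
    also have "\<dots> = FAr G' (\<alpha> y \<cdot>\<^bsub>C\<^esub> FAr F (FAr K w)) \<cdot>\<^bsub>C'\<^esub> \<alpha>' (FOb K x)" by simp
    also have "\<alpha> y \<cdot>\<^bsub>C\<^esub> FAr F (FAr K w) = FAr G (FAr H w) \<cdot>\<^bsub>C\<^esub> \<alpha> x"
      using nat_isoD(8)[OF \<alpha> w] by simp
    finally show ?thesis by simp
  qed
  show ?thesis
  proof (rule nat_isoI)
    show "?\<beta> y \<cdot>\<^bsub>C'\<^esub> FAr (fcomp P F' (fcomp P K' K)) f = FAr (fcomp P (fcomp B G' G) H) f \<cdot>\<^bsub>C'\<^esub> ?\<beta> x"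
      if "f \<in> hom P x y" for f x y
      using G'_nat[OF that] that by (auto simp: in_hom)
  qed (auto simp: in_hom intro!: fcomp_functor[OF _ F'] fcomp_functor[OF K K'] fcomp_functor[OF H] fcomp_functor[OF G G']
      is_iso_cmp functor_iso[OF G'])
qed

text \<open>Arrows and objects are lifted in two stages, first through the square over
  \<open>A'\<close> and then through the one over \<open>A\<close>. The invertible cell \<alpha>
  determines the intermediate arrow in \<open>C\<close>.\<close>

lemma homotopy_pullback_paste:
  assumes 1: "homotopy_pullback P A B C K H F G \<alpha>" and 2: "homotopy_pullback A A' C C' K' F F' G' \<alpha>'"
  shows "homotopy_pullback P A' B C' (fcomp P K' K) H F' (fcomp B G' G)
    (\<lambda>x. FAr G' (\<alpha> x) \<cdot>\<^bsub>C'\<^esub> \<alpha>' (FOb K x))"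
proof -
  note K = homotopy_pullbackD(1)[OF 1] and H = homotopy_pullbackD(2)[OF 1]
    and F = homotopy_pullbackD(3)[OF 1] and G = homotopy_pullbackD(4)[OF 1] and \<alpha> = homotopy_pullbackD(5)[OF 1]
    and full = homotopy_pullbackD(6)[OF 1] and surj = homotopy_pullbackD(7)[OF 1]
  note K' = homotopy_pullbackD(1)[OF 2] and F' = homotopy_pullbackD(3)[OF 2] and G' = homotopy_pullbackD(4)[OF 2]
    and \<alpha>' = homotopy_pullbackD(5)[OF 2]
    and full' = homotopy_pullbackD(6)[OF 2] and surj' = homotopy_pullbackD(7)[OF 2]
  let ?\<beta> = "\<lambda>x. FAr G' (\<alpha> x) \<cdot>\<^bsub>C'\<^esub> \<alpha>' (FOb K x)"
  note cats[simp] = functor_cats[OF K] functor_cats[OF G] functor_cats[OF F']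
  note [simp] = cat_simps functor_simps[OF F] functor_simps[OF F'] functor_simps[OF G] functor_simps[OF G']
    functor_simps[OF H] functor_simps[OF K] functor_simps[OF K'] fcomp_simps nat_isoD(4-7)[OF \<alpha>] nat_isoD(4-7)[OF \<alpha>']
    inv_ar_simps
  have "nat_iso P C' (fcomp P F' (fcomp P K' K)) (fcomp P (fcomp B G' G) H) ?\<beta>"
    by (rule nat_iso_paste[OF K H F G \<alpha> K' F' G' \<alpha>'])
  moreover have "comma_full P A' B C' (fcomp P K' K) H F' (fcomp B G' G) ?\<beta>"
    unfolding comma_full_def
  proof (intro ballI impI)
    fix x x' u v assume [simp]: "x \<in> Ob P" "x' \<in> Ob P" and u: "u \<in> hom A' (FOb (fcomp P K' K) x) (FOb (fcomp P K' K) x')"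
      and v: "v \<in> hom B (FOb H x) (FOb H x')" and e: "?\<beta> x' \<cdot>\<^bsub>C'\<^esub> FAr F' u = FAr (fcomp B G' G) v \<cdot>\<^bsub>C'\<^esub> ?\<beta> x"
    have [simp]: "u \<in> Ar A'" "Src A' u = FOb K' (FOb K x)" "Tgt A' u = FOb K' (FOb K x')"
      "v \<in> Ar B" "Src B v = FOb H x" "Tgt B v = FOb H x'" using u v by (auto simp: in_hom)
    \<comment> \<open>The only arrow of \<open>C\<close> that can be the image of a lift of
      \<open>v\<close>, as naturality of \<alpha> shows.\<close>
    define v' where "v' = inv_ar C (\<alpha> x') \<cdot>\<^bsub>C\<^esub> FAr G v \<cdot>\<^bsub>C\<^esub> \<alpha> x"
    have v': "v' \<in> hom C (FOb F (FOb K x)) (FOb F (FOb K x'))" by (simp add: v'_def in_hom)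
    then have [simp]: "v' \<in> Ar C" "Src C v' = FOb F (FOb K x)" "Tgt C v' = FOb F (FOb K x')" by (auto simp: in_hom)
    have v'': "\<alpha> x' \<cdot>\<^bsub>C\<^esub> v' = FAr G v \<cdot>\<^bsub>C\<^esub> \<alpha> x" by (simp add: v'_def cmp_inv_ar_cancel)
    have "FAr G' (\<alpha> x') \<cdot>\<^bsub>C'\<^esub> (\<alpha>' (FOb K x') \<cdot>\<^bsub>C'\<^esub> FAr F' u) = FAr G' (FAr G v \<cdot>\<^bsub>C\<^esub> \<alpha> x) \<cdot>\<^bsub>C'\<^esub> \<alpha>' (FOb K x)"
      using e by simp
    also have "\<dots> = FAr G' (\<alpha> x') \<cdot>\<^bsub>C'\<^esub> (FAr G' v' \<cdot>\<^bsub>C'\<^esub> \<alpha>' (FOb K x))"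
      unfolding v''[symmetric] by simp
    finally have "\<alpha>' (FOb K x') \<cdot>\<^bsub>C'\<^esub> FAr F' u = FAr G' v' \<cdot>\<^bsub>C'\<^esub> \<alpha>' (FOb K x)"
      by (rule iso_left_cancel[rotated 2]) (auto intro: functor_iso[OF G'])
    then have "\<exists>!w'. w' \<in> hom A (FOb K x) (FOb K x') \<and> FAr K' w' = u \<and> FAr F w' = v'"
      by (intro comma_fullD[OF full']) (auto simp: v' in_hom)
    then obtain w' where w': "w' \<in> hom A (FOb K x) (FOb K x')" "FAr K' w' = u" "FAr F w' = v'"
      and uniq: "\<And>z. z \<in> hom A (FOb K x) (FOb K x') \<Longrightarrow> FAr K' z = u \<Longrightarrow> FAr F z = v' \<Longrightarrow> z = w'" by metis
    have ex1: "\<exists>!w. w \<in> hom P x x' \<and> FAr K w = w' \<and> FAr H w = v"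
      using w' v v'' by (intro comma_fullD[OF full]) auto
    \<comment> \<open>A competing lift \<open>z\<close> also has \<open>v'\<close> as its image in
      \<open>C\<close>, so uniqueness in the outer square identifies its image in \<open>A\<close>
      with \<open>w'\<close>; uniqueness in the inner square then applies to \<open>z\<close>
      itself.\<close>
    have "FAr K z = w'" if z: "z \<in> hom P x x'" "FAr K' (FAr K z) = u" "FAr H z = v" for z
    proof (rule uniq)
      have "\<alpha> x' \<cdot>\<^bsub>C\<^esub> FAr F (FAr K z) = \<alpha> x' \<cdot>\<^bsub>C\<^esub> v'"
        using nat_isoD(8)[OF \<alpha> z(1)] z v'' by (simp add: in_hom)
      then show "FAr F (FAr K z) = v'" using z(1)
        by (intro iso_left_cancel[of C "\<alpha> x'" "FAr F (FAr K z)" v']) (auto simp: in_hom)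
    qed (use z functor_hom[OF K] in auto)
    then show "\<exists>!w. w \<in> hom P x x' \<and> FAr (fcomp P K' K) w = u \<and> FAr H w = v"
      using ex1 w' by (auto simp: in_hom[of _ P])
  qed
  moreover have "comma_surj P A' B C' (fcomp P K' K) H F' (fcomp B G' G) ?\<beta>"
    unfolding comma_surj_def
  proof (intro ballI impI)
    fix a b c assume [simp]: "a \<in> Ob A'" "b \<in> Ob B" and c: "c \<in> hom C' (FOb F' a) (FOb (fcomp B G' G) b)" "is_iso C' c"
    then have c': "c \<in> hom C' (FOb F' a) (FOb G' (FOb G b))" by simp
    \<comment> \<open>First \<open>(a, G b)\<close> is approximated by an object of
      \<open>A\<close>; the resulting \<open>v1\<close> is the isomorphism needed to approximate
      \<open>(x1, b)\<close> by an object of \<open>P\<close>.\<close>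
    obtain x1 u1 v1 where 1: "x1 \<in> Ob A" "u1 \<in> hom A' (FOb K' x1) a" "v1 \<in> hom C (FOb F x1) (FOb G b)"
        "is_iso A' u1" "is_iso C v1" "c \<cdot>\<^bsub>C'\<^esub> FAr F' u1 = FAr G' v1 \<cdot>\<^bsub>C'\<^esub> \<alpha>' x1"
      by (rule comma_surjD[OF surj' _ _ c' c(2)]) auto
    obtain x u2 v2 where 2: "x \<in> Ob P" "u2 \<in> hom A (FOb K x) x1" "v2 \<in> hom B (FOb H x) b"
        "is_iso A u2" "is_iso B v2" "v1 \<cdot>\<^bsub>C\<^esub> FAr F u2 = FAr G v2 \<cdot>\<^bsub>C\<^esub> \<alpha> x"
      by (rule comma_surjD[OF surj 1(1) \<open>b \<in> Ob B\<close> 1(3,5)]) auto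
    have [simp]: "u1 \<in> Ar A'" "Src A' u1 = FOb K' x1" "Tgt A' u1 = a" "v1 \<in> Ar C" "Src C v1 = FOb F x1"
      "Tgt C v1 = FOb G b" "u2 \<in> Ar A" "Src A u2 = FOb K x" "Tgt A u2 = x1" "v2 \<in> Ar B" "Src B v2 = FOb H x"
      "Tgt B v2 = b" "x \<in> Ob P" "x1 \<in> Ob A" "c \<in> Ar C'" "Src C' c = FOb F' a" "Tgt C' c = FOb G' (FOb G b)"
      using 1 2 c' by (auto simp: in_hom)
    have "c \<cdot>\<^bsub>C'\<^esub> FAr F' (u1 \<cdot>\<^bsub>A'\<^esub> FAr K' u2) = (c \<cdot>\<^bsub>C'\<^esub> FAr F' u1) \<cdot>\<^bsub>C'\<^esub> FAr F' (FAr K' u2)" by simp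
    also have "\<dots> = FAr G' v1 \<cdot>\<^bsub>C'\<^esub> (\<alpha>' x1 \<cdot>\<^bsub>C'\<^esub> FAr F' (FAr K' u2))" unfolding 1(6) by simp
    also have "\<alpha>' x1 \<cdot>\<^bsub>C'\<^esub> FAr F' (FAr K' u2) = FAr G' (FAr F u2) \<cdot>\<^bsub>C'\<^esub> \<alpha>' (FOb K x)"
      using nat_isoD(8)[OF \<alpha>' 2(2)] by simp
    also have "FAr G' v1 \<cdot>\<^bsub>C'\<^esub> FAr G' (FAr F u2) \<cdot>\<^bsub>C'\<^esub> \<alpha>' (FOb K x) =
        FAr G' (v1 \<cdot>\<^bsub>C\<^esub> FAr F u2) \<cdot>\<^bsub>C'\<^esub> \<alpha>' (FOb K x)" by simp
    also have "\<dots> = FAr G' (FAr G v2) \<cdot>\<^bsub>C'\<^esub> ?\<beta> x" unfolding 2(6) by simp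
    finally show "\<exists>x\<in>Ob P. \<exists>u\<in>hom A' (FOb (fcomp P K' K) x) a. \<exists>v\<in>hom B (FOb H x) b. is_iso A' u \<and> is_iso B v \<and>
        c \<cdot>\<^bsub>C'\<^esub> FAr F' u = FAr (fcomp B G' G) v \<cdot>\<^bsub>C'\<^esub> ?\<beta> x"
      using 1 2
      by (intro bexI[of _ x] bexI[of _ "u1 \<cdot>\<^bsub>A'\<^esub> FAr K' u2"] bexI[of _ v2])
        (auto simp: in_hom intro!: is_iso_cmp functor_iso[OF K'])
  qed
  ultimately show ?thesis
    using F' H fcomp_functor[OF K K'] fcomp_functor[OF G G'] by (simp add: homotopy_pullback_iff)
qed

section \<open>Maximal subgroupoids\<close>

lemma core_simps:
  "Ob (core C) = Ob C" "f \<in> Ar (core C) \<longleftrightarrow> f \<in> Ar C \<and> is_iso C f" "Src (core C) = Src C" "Tgt (core C) = Tgt C"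
  "Ident (core C) = Ident C" "Cmp (core C) = Cmp C"
  by (auto simp: core_def)

lemma core_hom: "f \<in> hom (core C) x y \<longleftrightarrow> f \<in> hom C x y \<and> is_iso C f"
  by (auto simp: in_hom core_simps)

lemma core_category:
  assumes "category C"
  shows "category (core C)"
  using assms unfolding category_def[of "core C"]
  by (auto simp: core_hom core_simps Ident_hom is_iso_Ident is_iso_cmp cat_simps in_hom)

text \<open>The inverse of an isomorphism is an isomorphism, so it already lies in the maximal
  subgroupoid.\<close>

lemma core_inverse_ars:
  assumes "category C"
  shows "inverse_ars (core C) f g \<longleftrightarrow> inverse_ars C f g"
proof -
  have "is_iso C f \<and> is_iso C g" if "inverse_ars C f g"
    using that is_iso_inv_ar[OF assms, of f] inv_ar_eq[OF assms that] by (auto simp: is_iso_def)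
  then show ?thesis by (auto simp: inverse_ars_def core_hom core_simps)
qed

lemma core_is_iso: "category C \<Longrightarrow> is_iso (core C) f \<longleftrightarrow> is_iso C f"
  by (simp add: is_iso_def core_inverse_ars)

lemma core_groupoid: "category C \<Longrightarrow> groupoid (core C)"
  by (auto simp: groupoid_def core_category core_is_iso core_simps)

lemma core_func_simps:
  "x \<in> Ob C \<Longrightarrow> FOb (core_func C F) x = FOb F x"
  "f \<in> Ar C \<Longrightarrow> is_iso C f \<Longrightarrow> FAr (core_func C F) f = FAr F f"
  "FOb (core_func C F) \<in> extensional (Ob C)" "FAr (core_func C F) \<in> extensional (Ar (core C))"
  by (auto simp: core_func_def core_simps)

lemma core_functor:
  assumes F: "is_functor C D F"
  shows "is_functor (core C) (core D) (core_func C F)"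
  by (rule is_functorI)
    (auto simp: core_category functor_cats[OF F] core_func_simps core_simps core_hom functor_iso[OF F] functor_simps[OF F]
     in_hom is_iso_Ident is_iso_cmp cat_simps)

lemma core_fcomp:
  assumes F: "is_functor C D F"
  shows "core_func C (fcomp C G F) = fcomp (core C) (core_func D G) (core_func C F)"
  by (rule func_eqI[of _ "Ob C" _ "Ar (core C)"])
    (auto simp: core_func_simps fcomp_simps fcomp_simps(3,4)[of "core C", unfolded core_simps(1)]
      core_simps functor_simps[OF F] functor_iso[OF F])

lemma core_idf: "category C \<Longrightarrow> core_func C (idf C) = idf (core C)"
  by (rule func_eqI[of _ "Ob C" _ "Ar (core C)"])
    (simp_all add: core_func_simps idf_simps idf_simps(3)[of "core C", unfolded core_simps(1)] core_simps(1,2))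

lemma core_nat_iso:
  assumes \<alpha>: "nat_iso C D F G \<alpha>"
  shows "nat_iso (core C) (core D) (core_func C F) (core_func C G) \<alpha>"
proof (rule nat_isoI)
  note F = nat_isoD(1)[OF \<alpha>] and G = nat_isoD(2)[OF \<alpha>]
  note [simp] = functor_cats[OF F]
  show "is_functor (core C) (core D) (core_func C F)" "is_functor (core C) (core D) (core_func C G)"
    using core_functor F G by auto
  show "\<alpha> x \<in> hom (core D) (FOb (core_func C F) x) (FOb (core_func C G) x)" "is_iso (core D) (\<alpha> x)"
    if "x \<in> Ob (core C)" for x
    using that nat_isoD(3,4)[OF \<alpha>] by (auto simp: core_hom core_func_simps core_is_iso core_simps)
  show "(\<alpha> y \<cdot>\<^bsub>core D\<^esub> FAr (core_func C F) f) = FAr (core_func C G) f \<cdot>\<^bsub>core D\<^esub> \<alpha> x"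
    if "f \<in> hom (core C) x y" for f x y
    using that nat_isoD(8)[OF \<alpha>] by (auto simp: core_hom core_func_simps core_simps in_hom)
qed

text \<open>The point is that the lift of a pair of isomorphisms is an isomorphism. Essential
  surjectivity speaks of isomorphisms from the start and carries over directly.\<close>

lemma core_homotopy_pullback:
  assumes h: "homotopy_pullback P A B C K H F G \<alpha>"
  shows "homotopy_pullback (core P) (core A) (core B) (core C) (core_func P K) (core_func P H)
    (core_func A F) (core_func B G) \<alpha>"
proof -
  note K = homotopy_pullbackD(1)[OF h] and H = homotopy_pullbackD(2)[OF h]
    and F = homotopy_pullbackD(3)[OF h] and G = homotopy_pullbackD(4)[OF h] and \<alpha> = homotopy_pullbackD(5)[OF h]
    and full = homotopy_pullbackD(6)[OF h] and surj = homotopy_pullbackD(7)[OF h]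
  note cats[simp] = functor_cats[OF K] functor_cats[OF H] functor_cats[OF G]
  note [simp] = functor_simps[OF K] functor_simps[OF H] functor_simps[OF F] functor_simps[OF G] cat_simps
    nat_isoD(4-7)[OF \<alpha>] fcomp_simps
  \<comment> \<open>The two legs are jointly faithful: every arrow of \<open>P\<close> is the unique
    lift of its pair of images.\<close>
  have inj: "w = w'" if "w \<in> hom P x y" "w' \<in> hom P x y" "FAr K w = FAr K w'" "FAr H w = FAr H w'" for w w' x y
  proof -
    have "x \<in> Ob P" "y \<in> Ob P" using that(1) by (auto simp: in_hom)
    moreover have "\<alpha> y \<cdot>\<^bsub>C\<^esub> FAr F (FAr K w) = FAr G (FAr H w) \<cdot>\<^bsub>C\<^esub> \<alpha> x"
      using nat_isoD(8)[OF \<alpha> that(1)] that(1) by (simp add: in_hom)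
    ultimately have "\<exists>!z. z \<in> hom P x y \<and> FAr K z = FAr K w \<and> FAr H z = FAr H w"
      using comma_fullD[OF full _ _ functor_hom[OF K that(1)] functor_hom[OF H that(1)]] by auto
    then show ?thesis using that by auto
  qed
  have "comma_full (core P) (core A) (core B) (core C) (core_func P K) (core_func P H)
    (core_func A F) (core_func B G) \<alpha>"
    unfolding comma_full_def
  proof (intro ballI impI)
    fix x x' u v assume "x \<in> Ob (core P)" "x' \<in> Ob (core P)"
      and "u \<in> hom (core A) (FOb (core_func P K) x) (FOb (core_func P K) x')"
      and "v \<in> hom (core B) (FOb (core_func P H) x) (FOb (core_func P H) x')"
      and "\<alpha> x' \<cdot>\<^bsub>core C\<^esub> FAr (core_func A F) u = FAr (core_func B G) v \<cdot>\<^bsub>core C\<^esub> \<alpha> x"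
    then have [simp]: "x \<in> Ob P" "x' \<in> Ob P" and iso[simp]: "is_iso A u" "is_iso B v"
      and u: "u \<in> hom A (FOb K x) (FOb K x')" and v: "v \<in> hom B (FOb H x) (FOb H x')"
      and e: "\<alpha> x' \<cdot>\<^bsub>C\<^esub> FAr F u = FAr G v \<cdot>\<^bsub>C\<^esub> \<alpha> x"
      by (auto simp: core_simps core_hom core_func_simps in_hom)
    have [simp]: "u \<in> Ar A" "Src A u = FOb K x" "Tgt A u = FOb K x'" "v \<in> Ar B" "Src B v = FOb H x" "Tgt B v = FOb H x'"
      using u v by (auto simp: in_hom)
    obtain w where w: "w \<in> hom P x x'" "FAr K w = u" "FAr H w = v"
      using comma_fullD[OF full _ _ u v e] by auto
    have Fu: "is_iso C (FAr F u)" and Gv: "is_iso C (FAr G v)" using functor_iso[OF F] functor_iso[OF G] by auto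
    have u': "inv_ar A u \<in> hom A (FOb K x') (FOb K x)" "inv_ar B v \<in> hom B (FOb H x') (FOb H x)"
      by (auto simp: in_hom inv_ar_simps)
    \<comment> \<open>The pair of inverses is compatible with \<alpha> too, hence lifts to some
      \<open>z\<close>; by joint faithfulness \<open>z\<close> is inverse to
      \<open>w\<close>.\<close>
    have "\<alpha> x \<cdot>\<^bsub>C\<^esub> inv_ar C (FAr F u) = inv_ar C (FAr G v) \<cdot>\<^bsub>C\<^esub> (FAr G v \<cdot>\<^bsub>C\<^esub> \<alpha> x) \<cdot>\<^bsub>C\<^esub> inv_ar C (FAr F u)"
      using Fu Gv by (simp add: inv_ar_simps inv_ar_cmp_cancel)
    also have "\<dots> = inv_ar C (FAr G v) \<cdot>\<^bsub>C\<^esub> (\<alpha> x' \<cdot>\<^bsub>C\<^esub> FAr F u) \<cdot>\<^bsub>C\<^esub> inv_ar C (FAr F u)" by (simp only: e)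
    also have "\<dots> = inv_ar C (FAr G v) \<cdot>\<^bsub>C\<^esub> \<alpha> x'" using Fu Gv by (simp add: inv_ar_simps)
    finally obtain z where z: "z \<in> hom P x' x" "FAr K z = inv_ar A u" "FAr H z = inv_ar B v"
      using comma_fullD[OF full _ _ u'] by (auto simp: functor_inv_ar[OF F] functor_inv_ar[OF G])
    have "is_iso P w"
    proof (rule is_isoI[OF cats(1) w(1) z(1)])
      show "z \<cdot>\<^bsub>P\<^esub> w = Ident P x"
        using w z by (intro inj[of _ x x]) (auto simp: in_hom inv_ar_simps)
      show "w \<cdot>\<^bsub>P\<^esub> z = Ident P x'"
        using w z by (intro inj[of _ x' x']) (auto simp: in_hom inv_ar_simps)
    qed
    then show "\<exists>!w. w \<in> hom (core P) x x' \<and> FAr (core_func P K) w = u \<and> FAr (core_func P H) w = v"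
      using w inj[of _ x x'] by (intro ex1I[of _ w]) (auto simp: core_hom core_func_simps in_hom[of _ P])
  qed
  moreover have "comma_surj (core P) (core A) (core B) (core C) (core_func P K) (core_func P H)
    (core_func A F) (core_func B G) \<alpha>"
    unfolding comma_surj_def
  proof (intro ballI impI)
    fix a b c assume "a \<in> Ob (core A)" "b \<in> Ob (core B)"
      "c \<in> hom (core C) (FOb (core_func A F) a) (FOb (core_func B G) b)"
    then have a: "a \<in> Ob A" "b \<in> Ob B" "c \<in> hom C (FOb F a) (FOb G b)" "is_iso C c"
      by (auto simp: core_simps core_hom core_func_simps)
    obtain x u v where "x \<in> Ob P" "u \<in> hom A (FOb K x) a" "v \<in> hom B (FOb H x) b" "is_iso A u" "is_iso B v"
      "c \<cdot>\<^bsub>C\<^esub> FAr F u = FAr G v \<cdot>\<^bsub>C\<^esub> \<alpha> x"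
      by (rule comma_surjD[OF surj a])
    then show "\<exists>x\<in>Ob (core P). \<exists>u\<in>hom (core A) (FOb (core_func P K) x) a.
        \<exists>v\<in>hom (core B) (FOb (core_func P H) x) b. is_iso (core A) u \<and> is_iso (core B) v \<and>
        c \<cdot>\<^bsub>core C\<^esub> FAr (core_func A F) u = FAr (core_func B G) v \<cdot>\<^bsub>core C\<^esub> \<alpha> x"
      by (intro bexI[of _ x] bexI[of _ u] bexI[of _ v])
        (auto simp: core_simps core_hom core_func_simps core_is_iso in_hom[of _ A] in_hom[of _ B] in_hom[of _ C])
  qed
  moreover have "nat_iso (core P) (core C) (fcomp (core P) (core_func A F) (core_func P K))
      (fcomp (core P) (core_func B G) (core_func P H)) \<alpha>"
    using core_nat_iso[OF \<alpha>] by (simp add: core_fcomp[OF K] core_fcomp[OF H])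
  ultimately show ?thesis
    unfolding homotopy_pullback_iff[OF core_functor[OF F] core_functor[OF G]]
    using core_functor[OF K] core_functor[OF H] by blast
qed

section \<open>Ordinals\<close>

lemma ordinals_simps [simp]:
  "Ob (ordinals l) = UNIV" "Src (ordinals l) = osrc" "Tgt (ordinals l) = otgt"
  "osrc (Ident (ordinals l) n) = n" "otgt (Ident (ordinals l) n) = n"
  "osrc (g \<cdot>\<^bsub>ordinals l\<^esub> f) = osrc f" "otgt (g \<cdot>\<^bsub>ordinals l\<^esub> f) = otgt g"
  by (simp_all add: ordinals_def)

lemma ordinals_ofun:
  "l \<le> i \<Longrightarrow> i \<le> n \<Longrightarrow> ofun (Ident (ordinals l) n) i = i"
  "l \<le> i \<Longrightarrow> i \<le> osrc f \<Longrightarrow> ofun (g \<cdot>\<^bsub>ordinals l\<^esub> f) i = ofun g (ofun f i)"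
  by (simp_all add: ordinals_def compose_def)

lemma ordinals_Ar: "f \<in> Ar (ordinals l) \<longleftrightarrow> ofun f \<in> extensional {l..osrc f} \<and>
    (\<forall>i. l \<le> i \<and> i \<le> osrc f \<longrightarrow> l \<le> ofun f i \<and> ofun f i \<le> otgt f) \<and>
    (\<forall>i j. l \<le> i \<and> i \<le> j \<and> j \<le> osrc f \<longrightarrow> ofun f i \<le> ofun f j)"
  by (auto simp: ordinals_def PiE_iff mono_on_def)

lemma omap_eqI:
  fixes f g :: omap
  assumes "f \<in> Ar (ordinals l)" "g \<in> Ar (ordinals l)" "osrc f = osrc g" "otgt f = otgt g"
    "\<And>i. l \<le> i \<Longrightarrow> i \<le> osrc g \<Longrightarrow> ofun f i = ofun g i"
  shows "f = g"
proof -
  have "ofun f = ofun g"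
    using assms by (intro extensionalityI[of _ "{l..osrc g}"]) (auto simp: ordinals_Ar)
  then show ?thesis using assms by simp
qed

lemma ordinals_closed:
  "Ident (ordinals l) n \<in> Ar (ordinals l)"
  "f \<in> Ar (ordinals l) \<Longrightarrow> g \<in> Ar (ordinals l) \<Longrightarrow> otgt f = osrc g \<Longrightarrow> g \<cdot>\<^bsub>ordinals l\<^esub> f \<in> Ar (ordinals l)"
proof -
  show "Ident (ordinals l) n \<in> Ar (ordinals l)" unfolding ordinals_Ar by (auto simp: ordinals_def)
  assume fg: "f \<in> Ar (ordinals l)" "g \<in> Ar (ordinals l)" "otgt f = osrc g"
  have "ofun (g \<cdot>\<^bsub>ordinals l\<^esub> f) \<in> extensional {l..osrc f}" by (simp add: ordinals_def)
  with fg show "g \<cdot>\<^bsub>ordinals l\<^esub> f \<in> Ar (ordinals l)"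
    unfolding ordinals_Ar[of "g \<cdot>\<^bsub>ordinals l\<^esub> f"] by (auto simp: ordinals_ofun) (auto simp: ordinals_Ar)
qed

lemma ordinals_category: "category (ordinals l)"
proof (rule categoryI)
  fix f g h :: omap and x y z w
  assume f: "f \<in> hom (ordinals l) x y"
  have b: "l \<le> ofun f i" "ofun f i \<le> y" if "l \<le> i" "i \<le> x" for i using f that by (auto simp: in_hom ordinals_Ar)
  show "f \<cdot>\<^bsub>ordinals l\<^esub> Ident (ordinals l) x = f"
    using f by (intro omap_eqI[of _ l]) (auto simp: in_hom ordinals_closed ordinals_ofun)
  show "Ident (ordinals l) y \<cdot>\<^bsub>ordinals l\<^esub> f = f"
    using f b by (intro omap_eqI[of _ l]) (auto simp: in_hom ordinals_closed ordinals_ofun)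
  assume g: "g \<in> hom (ordinals l) y z"
  show "g \<cdot>\<^bsub>ordinals l\<^esub> f \<in> hom (ordinals l) x z"
    using f g by (simp add: in_hom ordinals_closed)
  assume h: "h \<in> hom (ordinals l) z w"
  show "h \<cdot>\<^bsub>ordinals l\<^esub> (g \<cdot>\<^bsub>ordinals l\<^esub> f) = (h \<cdot>\<^bsub>ordinals l\<^esub> g) \<cdot>\<^bsub>ordinals l\<^esub> f"
    using f g h b by (intro omap_eqI[of _ l]) (auto simp: in_hom ordinals_closed ordinals_ofun)
qed (auto simp: in_hom ordinals_closed)

lemmas Delta_simps [simp] = ordinals_simps[where l = 0, folded Delta_def]
  and uDelta_simps [simp] = ordinals_simps[where l = 1, folded uDelta_def]
lemmas Delta_ofun = ordinals_ofun[where l = 0, folded Delta_def, simplified]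
  and uDelta_ofun = ordinals_ofun[where l = 1, folded uDelta_def]
lemmas Delta_Ar = ordinals_Ar[of _ 0, folded Delta_def, simplified]
  and uDelta_Ar = ordinals_Ar[of _ 1, folded uDelta_def]
lemmas Delta_closed = ordinals_closed[where l = 0, folded Delta_def]
  and uDelta_closed = ordinals_closed[where l = 1, folded uDelta_def]
lemmas Delta_category = ordinals_category[of 0, folded Delta_def]
  and uDelta_category = ordinals_category[of 1, folded uDelta_def]
lemmas Delta_eqI = omap_eqI[where l = 0, folded Delta_def, simplified]
  and uDelta_eqI = omap_eqI[where l = 1, folded uDelta_def]

lemma Delta_bound: "h \<in> Ar Delta \<Longrightarrow> i \<le> osrc h \<Longrightarrow> ofun h i \<le> otgt h"
  and Delta_mono: "h \<in> Ar Delta \<Longrightarrow> i \<le> j \<Longrightarrow> j \<le> osrc h \<Longrightarrow> ofun h i \<le> ofun h j"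
  by (auto simp: Delta_Ar)

lemma convex_strict:
  assumes "convex f" "1 \<le> i" "i < j" "j \<le> osrc f"
  shows "ofun f i < ofun f j"
  using assms(3,4)
proof (induction j)
  case (Suc j)
  have "ofun f (j + 1) = ofun f j + 1" using assms(1,2) Suc.prems by (auto simp: convex_def)
  then show ?case using Suc by (cases "i = j") auto
qed simp

lemma convex_monic:
  assumes f: "convex f" and a: "a \<in> hom uDelta z (osrc f)" and b: "b \<in> hom uDelta z (osrc f)"
    and e: "f \<cdot>\<^bsub>uDelta\<^esub> a = f \<cdot>\<^bsub>uDelta\<^esub> b"
  shows "a = b"
proof (rule uDelta_eqI)
  fix i assume i: "1 \<le> i" "i \<le> osrc b"
  have "ofun f (ofun a i) = ofun f (ofun b i)"
    using arg_cong[OF e, of "\<lambda>h. ofun h i"] i a b by (simp add: uDelta_ofun in_hom)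
  moreover have "1 \<le> ofun a i" "ofun a i \<le> osrc f" "1 \<le> ofun b i" "ofun b i \<le> osrc f"
    using a b i by (auto simp: in_hom uDelta_Ar)
  ultimately show "ofun a i = ofun b i"
    using convex_strict[OF f] by (metis nat_neq_iff)
qed (use a b in \<open>auto simp: in_hom\<close>)

text \<open>The base map of the cocartesian leg of the span by which \<open>h\<close> acts, for
  arbitrary \<open>h\<close>. Its source is the length of the interval spanned by the image of
  \<open>h\<close>.\<close>

definition push_map :: "omap \<Rightarrow> omap" where
  "push_map h = under_gen (gen_part h)"

text \<open>The base map of the cartesian leg: the inclusion of the interval spanned by the image of
  \<open>h\<close>. It has the same source as \<open>push_map h\<close>, so the two form a
  span.\<close>

definition pull_map :: "omap \<Rightarrow> omap" where
  "pull_map h = under_free (free_part h)"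

lemma push_map_simps [simp]:
  "osrc (push_map h) = ofun h (osrc h) - ofun h 0" "otgt (push_map h) = osrc h"
  by (simp_all add: push_map_def under_gen_def gen_part_def)

lemma pull_map_simps [simp]:
  "osrc (pull_map h) = ofun h (osrc h) - ofun h 0" "otgt (pull_map h) = otgt h"
  by (simp_all add: pull_map_def under_free_def free_part_def)

lemma pull_map_ofun: "1 \<le> i \<Longrightarrow> i \<le> ofun h (osrc h) - ofun h 0 \<Longrightarrow> ofun (pull_map h) i = i + ofun h 0"
  by (simp add: pull_map_def under_free_def free_part_def)

lemma pull_map_convex: "h \<in> Ar Delta \<Longrightarrow> convex (pull_map h)"
  using Delta_bound[of h "osrc h"]
  by (auto simp: convex_def uDelta_Ar pull_map_ofun) (auto simp: pull_map_def under_free_def free_part_def)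

text \<open>The correspondence between generic maps and their duals is a Galois connection.\<close>

lemma push_map_galois:
  assumes h: "h \<in> Ar Delta" and j: "1 \<le> j" "j \<le> ofun h (osrc h) - ofun h 0"
  shows "1 \<le> ofun (push_map h) j" "ofun (push_map h) j \<le> osrc h"
    "i \<le> osrc h \<Longrightarrow> ofun (push_map h) j \<le> i \<longleftrightarrow> j + ofun h 0 \<le> ofun h i"
proof -
  \<comment> \<open>The least index whose value reaches \<open>j + ofun h 0\<close>; the top index
    \<open>osrc h\<close> is one of them. Being least is exactly the adjunction
    \<open>gal\<close>.\<close>
  define k where "k = (LEAST k. j + ofun h 0 \<le> ofun h k)"
  have ex: "j + ofun h 0 \<le> ofun h (osrc h)" using j by simp
  have k: "j + ofun h 0 \<le> ofun h k" unfolding k_def by (rule LeastI[of "\<lambda>k. j + ofun h 0 \<le> ofun h k", OF ex])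
  have less: "ofun h i < j + ofun h 0" if "i < k" for i
    using not_less_Least[of i "\<lambda>k. j + ofun h 0 \<le> ofun h k"] that unfolding k_def by simp
  have k1: "1 \<le> k" using k j by (cases k) auto
  have kn: "k \<le> osrc h" unfolding k_def by (rule Least_le[of "\<lambda>k. j + ofun h 0 \<le> ofun h k", OF ex])
  have gal: "k \<le> i \<longleftrightarrow> j + ofun h 0 \<le> ofun h i" if "i \<le> osrc h" for i
    using k less[of i] Delta_mono[OF h, of k i] that by (metis le_trans not_le)
  \<comment> \<open>The jump condition in \<open>under_gen\<close> holds at the least such index and
    nowhere else. Adding \<open>ofun h 0\<close> to \<open>j\<close>, rather than subtracting it
    from \<open>ofun h i\<close>, keeps truncated subtraction out of the adjunction.\<close>
  have P: "i \<in> {1..osrc h} \<and> ofun h (i - 1) - ofun h 0 < j \<and> j \<le> ofun h i - ofun h 0 \<longleftrightarrow> i = k" for i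
  proof
    assume a: "i \<in> {1..osrc h} \<and> ofun h (i - 1) - ofun h 0 < j \<and> j \<le> ofun h i - ofun h 0"
    then have i: "i \<le> osrc h" "i - 1 \<le> osrc h" by auto
    have "k \<le> i" "\<not> k \<le> i - 1" using gal[OF i(1)] gal[OF i(2)] a j by auto
    then show "i = k" by simp
  next
    assume "i = k"
    then show "i \<in> {1..osrc h} \<and> ofun h (i - 1) - ofun h 0 < j \<and> j \<le> ofun h i - ofun h 0"
      using k1 kn k less[of "k - 1"] j by auto
  qed
  have "ofun (push_map h) j =
      (THE i. i \<in> {1..osrc h} \<and> ofun h (i - 1) - ofun h 0 < j \<and> j \<le> ofun h i - ofun h 0)"
    using j unfolding push_map_def under_gen_def gen_part_def
    by (auto intro!: arg_cong[where f = The])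
  also have "\<dots> = k" unfolding P by simp
  finally have e: "ofun (push_map h) j = k" .
  show "1 \<le> ofun (push_map h) j" "ofun (push_map h) j \<le> osrc h" using e k1 kn by auto
  show "ofun (push_map h) j \<le> i \<longleftrightarrow> j + ofun h 0 \<le> ofun h i" if "i \<le> osrc h"
    using e gal[OF that] by simp
qed

text \<open>Uniqueness of left adjoints. Values of \<open>push_map\<close> are computed by this rule
  alone, without returning to the description in \<open>under_gen\<close>.\<close>

lemma push_map_eqI:
  assumes h: "h \<in> Ar Delta" and j: "1 \<le> j" "j \<le> ofun h (osrc h) - ofun h 0"
    and e: "e \<le> osrc h" "\<And>i. i \<le> osrc h \<Longrightarrow> e \<le> i \<longleftrightarrow> j + ofun h 0 \<le> ofun h i"
  shows "ofun (push_map h) j = e"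
  using push_map_galois[OF h j] e by (metis order.antisym order_refl)

text \<open>Monotone because it is a left adjoint.\<close>

lemma push_map_Ar: "h \<in> Ar Delta \<Longrightarrow> push_map h \<in> Ar uDelta"
proof -
  assume h: "h \<in> Ar Delta"
  have "ofun (push_map h) i \<le> ofun (push_map h) j"
    if "1 \<le> i" "i \<le> j" "j \<le> ofun h (osrc h) - ofun h 0" for i j
  proof -
    have "j + ofun h 0 \<le> ofun h (ofun (push_map h) j)"
      using push_map_galois[OF h, of j] that by auto
    then show ?thesis using push_map_galois[OF h, of j] push_map_galois[OF h, of i] that by auto
  qed
  moreover have "ofun (push_map h) \<in> extensional {1..ofun h (osrc h) - ofun h 0}"
    by (simp add: push_map_def under_gen_def gen_part_def)
  ultimately show ?thesis
    using push_map_galois[OF h] by (auto simp: uDelta_Ar)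
qed

lemma pull_map_Ar: "h \<in> Ar Delta \<Longrightarrow> pull_map h \<in> Ar uDelta"
  using pull_map_convex by (auto simp: convex_def)

lemma push_pull_Ident: "push_map (Ident Delta n) = Ident uDelta n" "pull_map (Ident Delta n) = Ident uDelta n"
proof -
  have "ofun (push_map (Ident Delta n)) i = i" if "1 \<le> i" "i \<le> n" for i
    by (rule push_map_eqI) (use that in \<open>auto simp: Delta_closed Delta_ofun\<close>)
  then show "push_map (Ident Delta n) = Ident uDelta n"
    by (intro uDelta_eqI) (auto simp: push_map_Ar Delta_closed uDelta_closed uDelta_ofun Delta_ofun)
  show "pull_map (Ident Delta n) = Ident uDelta n"
    by (intro uDelta_eqI) (auto simp: pull_map_Ar Delta_closed uDelta_closed uDelta_ofun Delta_ofun pull_map_ofun)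
qed

lemma generic_Ar: "generic g \<Longrightarrow> g \<in> Ar Delta" and free_Ar: "free f \<Longrightarrow> f \<in> Ar Delta"
  by (auto simp: generic_def free_def)

lemma generic_gen_part:
  assumes "generic g"
  shows "gen_part g = g" "free_part g = Ident Delta (otgt g)"
proof -
  have g: "g \<in> Ar Delta" "ofun g 0 = 0" "ofun g (osrc g) = otgt g" using assms by (auto simp: generic_def)
  have "restrict (ofun g) {0..osrc g} = ofun g"
    using g(1) by (intro extensional_restrict) (simp add: Delta_Ar)
  then show "gen_part g = g" using g by (simp add: gen_part_def)
  show "free_part g = Ident Delta (otgt g)" using g by (simp add: free_part_def Delta_def ordinals_def)
qed

lemma free_ofun: "free f \<Longrightarrow> i \<le> osrc f \<Longrightarrow> ofun f i = i + ofun f 0"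
  by (induction i) (auto simp: free_def)

lemma free_gen_part:
  assumes "free f"
  shows "gen_part f = Ident Delta (osrc f)" "free_part f = f"
proof -
  note o = free_ofun[OF assms]
  have n: "ofun f (osrc f) - ofun f 0 = osrc f" using o[of "osrc f"] by simp
  have "restrict (\<lambda>i. i + ofun f 0) {0..osrc f} = restrict (ofun f) {0..osrc f}"
  proof (rule restrict_ext)
    show "i + ofun f 0 = ofun f i" if "i \<in> {0..osrc f}" for i using o[of i] that by simp
  qed
  also have "\<dots> = ofun f" using free_Ar[OF assms] by (intro extensional_restrict) (simp add: Delta_Ar)
  finally show "free_part f = f" using n by (simp add: free_part_def)
  have "restrict (\<lambda>i. ofun f i - ofun f 0) {0..osrc f} = restrict (\<lambda>i. i) {0..osrc f}"
  proof (rule restrict_ext)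
    show "ofun f i - ofun f 0 = i" if "i \<in> {0..osrc f}" for i using o[of i] that by simp
  qed
  then show "gen_part f = Ident Delta (osrc f)"
    using n by (simp add: gen_part_def Delta_def ordinals_def)
qed

text \<open>The span of a generic map has an identity as its left base map; by
  \<open>free_push_pull\<close>, that of a free map has one as its right base map. A normal cleavage
  turns the corresponding legs into identities.\<close>

lemma generic_push_pull:
  assumes "generic g"
  shows "push_map g = under_gen g" "pull_map g = Ident uDelta (otgt g)"
  using generic_gen_part[OF assms] push_pull_Ident(2)[of "otgt g"]
    generic_gen_part(2)[of "Ident Delta (otgt g)"]
  by (simp_all add: push_map_def pull_map_def generic_def Delta_closed Delta_ofun)

lemma free_push_pull:
  assumes "free f"
  shows "push_map f = Ident uDelta (osrc f)" "pull_map f = under_free f"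
  using free_gen_part[OF assms] push_pull_Ident(1)[of "osrc f"]
    free_gen_part(1)[of "Ident Delta (osrc f)"]
  by (simp_all add: push_map_def pull_map_def free_def Delta_closed Delta_ofun)

text \<open>
  The span of a composite is obtained from the two spans by a pullback with convex legs, so
  that Beck--Chevalley applies to it.
\<close>

lemma span_pullback:
  assumes h: "h \<in> Ar Delta" and h': "h' \<in> Ar Delta" and m: "otgt h = osrc h'"
  obtains \<sigma> \<tau> where "pullback_square uDelta (pull_map h) (push_map h') \<sigma> \<tau>" "convex \<tau>"
    "pull_map h' \<cdot>\<^bsub>uDelta\<^esub> \<tau> = pull_map (h' \<cdot>\<^bsub>Delta\<^esub> h)"
    "push_map h \<cdot>\<^bsub>uDelta\<^esub> \<sigma> = push_map (h' \<cdot>\<^bsub>Delta\<^esub> h)"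
proof -
  let ?k = "h' \<cdot>\<^bsub>Delta\<^esub> h"
  define n where "n = osrc h"
  \<comment> \<open>The interval spanned by the composite has length \<open>q\<close> and sits
    inside that spanned by \<open>h'\<close> with offset \<open>c\<close>.\<close>
  define c where "c = ofun h' (ofun h 0) - ofun h' 0"
  define q where "q = ofun h' (ofun h n) - ofun h' (ofun h 0)"
  have k: "?k \<in> Ar Delta" using Delta_closed(2)[OF h h' m] .
  have k0: "ofun ?k 0 = ofun h' (ofun h 0)" "ofun ?k n = ofun h' (ofun h n)" by (simp_all add: Delta_ofun n_def)
  have hb: "ofun h i \<le> osrc h'" if "i \<le> n" for i using Delta_bound[OF h, of i] m that n_def by simp
  have h0n: "ofun h 0 \<le> ofun h n" using Delta_mono[OF h, of 0 n] by (simp add: n_def)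
  have c': "c + ofun h' 0 = ofun h' (ofun h 0)"
    unfolding c_def using Delta_mono[OF h', of 0 "ofun h 0"] hb[of 0] by simp
  have qn: "ofun h' (ofun h 0) \<le> ofun h' (ofun h n)" using Delta_mono[OF h' h0n] hb[of n] by simp
  have nm: "ofun h' (ofun h n) \<le> ofun h' (osrc h')" using Delta_mono[OF h', of "ofun h n" "osrc h'"] hb[of n] by simp
  let ?p = "ofun h n - ofun h 0" and ?p' = "ofun h' (osrc h') - ofun h' 0"
  have cq: "j + c \<le> ?p'" if "j \<le> q" for j using that nm c' qn unfolding q_def by linarith
  define s where "s = ofun (push_map h')"
  \<comment> \<open>The adjunction for \<open>h'\<close> at a point of the inner interval: by
    \<open>c'\<close>, shifting \<open>j\<close> by \<open>c\<close> replaces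
    \<open>ofun h' 0\<close> by \<open>ofun h' (ofun h 0)\<close>.\<close>
  have s: "s (j + c) \<le> i \<longleftrightarrow> j + ofun h' (ofun h 0) \<le> ofun h' i" if "1 \<le> j" "j \<le> q" "i \<le> osrc h'" for i j
    unfolding s_def using push_map_galois(3)[OF h', of "j + c" i] that cq[of j] c' by (simp add: add.assoc)
  \<comment> \<open>The lower bound is strict because \<open>j\<close> starts at 1; this is why
    \<sigma> takes values from 1 on.\<close>
  have s0: "ofun h 0 < s (j + c)" "s (j + c) \<le> ofun h n" if "1 \<le> j" "j \<le> q" for j
    using s[OF that, of "ofun h 0"] s[OF that, of "ofun h n"] that hb[of 0] hb[of n] qn by (auto simp: q_def)
  have s_mono: "s i \<le> s j" if "1 \<le> i" "i \<le> j" "j \<le> ?p'" for i j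
    using push_map_Ar[OF h'] that by (auto simp: uDelta_Ar s_def)
  \<comment> \<open>\<tau> includes the inner interval into the one spanned by \<open>h'\<close>,
    and \<sigma> is \<open>push_map h'\<close> restricted to it, with values counted from
    \<open>ofun h 0\<close>.\<close>
  define \<sigma> where "\<sigma> = \<lparr>osrc = q, otgt = ?p, ofun = restrict (\<lambda>j. s (j + c) - ofun h 0) {1..q}\<rparr>"
  define \<tau> where "\<tau> = \<lparr>osrc = q, otgt = ?p', ofun = restrict (\<lambda>j. j + c) {1..q}\<rparr>"
  have \<sigma>s[simp]: "osrc \<sigma> = q" "otgt \<sigma> = ?p" and \<tau>s[simp]: "osrc \<tau> = q" "otgt \<tau> = ?p'"
    by (simp_all add: \<sigma>_def \<tau>_def)
  have \<sigma>o: "ofun \<sigma> j = s (j + c) - ofun h 0" and \<tau>o: "ofun \<tau> j = j + c" if "1 \<le> j" "j \<le> q" for j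
    using that by (simp_all add: \<sigma>_def \<tau>_def)
  have \<sigma>b: "1 \<le> ofun \<sigma> j" "ofun \<sigma> j \<le> ?p" if "1 \<le> j" "j \<le> q" for j
    using s0[OF that] \<sigma>o[OF that] by auto
  have \<sigma>: "\<sigma> \<in> Ar uDelta"
    unfolding uDelta_Ar
  proof (intro conjI allI impI)
    fix i j assume "1 \<le> i \<and> i \<le> j \<and> j \<le> osrc \<sigma>"
    then show "ofun \<sigma> i \<le> ofun \<sigma> j" using s_mono[of "i + c" "j + c"] cq[of j] by (auto simp: \<sigma>o)
  qed (use \<sigma>b in \<open>auto simp: \<sigma>_def\<close>)
  have \<tau>: "\<tau> \<in> Ar uDelta"
    unfolding uDelta_Ar using cq by (auto simp: \<tau>o) (auto simp: \<tau>_def)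
  have eq1: "pull_map h' \<cdot>\<^bsub>uDelta\<^esub> \<tau> = pull_map ?k"
    using c' cq by (intro uDelta_eqI uDelta_closed)
      (auto simp: pull_map_Ar h' k \<tau> \<tau>o uDelta_ofun pull_map_ofun q_def n_def k0[unfolded n_def])
  have eq2: "push_map h \<cdot>\<^bsub>uDelta\<^esub> \<sigma> = push_map ?k"
  proof (intro uDelta_eqI uDelta_closed)
    fix j assume "1 \<le> j" "j \<le> osrc (push_map ?k)"
    then have j: "1 \<le> j" "j \<le> q" using k0 by (auto simp: q_def n_def)
    \<comment> \<open>Left adjoints compose: the adjunctions for \<open>h\<close> and for
      \<open>h'\<close> combine to the one that characterises \<open>push_map\<close> of the
      composite.\<close>
    have "ofun (push_map ?k) j = ofun (push_map h) (ofun \<sigma> j)"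
    proof (rule push_map_eqI[OF k])
      have p: "ofun \<sigma> j \<le> ofun h (osrc h) - ofun h 0" using \<sigma>b[OF j] by (simp add: n_def)
      note gal = push_map_galois[OF h \<sigma>b(1)[OF j] p]
      show "ofun (push_map h) (ofun \<sigma> j) \<le> osrc ?k" using gal by simp
      show "ofun (push_map h) (ofun \<sigma> j) \<le> i \<longleftrightarrow> j + ofun ?k 0 \<le> ofun ?k i" if "i \<le> osrc ?k" for i
      proof -
        have i: "i \<le> osrc h" using that by simp
        have "ofun (push_map h) (ofun \<sigma> j) \<le> i \<longleftrightarrow> s (j + c) - ofun h 0 + ofun h 0 \<le> ofun h i"
          using gal(3)[OF i] \<sigma>o[OF j] by simp
        also have "\<dots> \<longleftrightarrow> s (j + c) \<le> ofun h i" using s0[OF j] by simp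
        also have "\<dots> \<longleftrightarrow> j + ofun ?k 0 \<le> ofun ?k i" using s[OF j, of "ofun h i"] hb[of i] i k0
          by (simp add: Delta_ofun n_def)
        finally show ?thesis .
      qed
    qed (use j k0 in \<open>auto simp: q_def n_def\<close>)
    then show "ofun (push_map h \<cdot>\<^bsub>uDelta\<^esub> \<sigma>) j = ofun (push_map ?k) j" using j by (simp add: uDelta_ofun)
  qed (auto simp: push_map_Ar h k \<sigma> n_def q_def k0[unfolded n_def])
  have comm: "pull_map h \<cdot>\<^bsub>uDelta\<^esub> \<sigma> = push_map h' \<cdot>\<^bsub>uDelta\<^esub> \<tau>"
  proof (intro uDelta_eqI uDelta_closed)
    fix j assume "1 \<le> j" "j \<le> osrc (push_map h' \<cdot>\<^bsub>uDelta\<^esub> \<tau>)"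
    then have j: "1 \<le> j" "j \<le> q" by auto
    have "ofun (pull_map h \<cdot>\<^bsub>uDelta\<^esub> \<sigma>) j = ofun \<sigma> j + ofun h 0"
      using j \<sigma>b[OF j] by (simp add: uDelta_ofun pull_map_ofun n_def)
    also have "\<dots> = s (j + c)" using s0[OF j] \<sigma>o[OF j] by simp
    also have "\<dots> = ofun (push_map h' \<cdot>\<^bsub>uDelta\<^esub> \<tau>) j" using j by (simp add: uDelta_ofun \<tau>o s_def)
    finally show "ofun (pull_map h \<cdot>\<^bsub>uDelta\<^esub> \<sigma>) j = ofun (push_map h' \<cdot>\<^bsub>uDelta\<^esub> \<tau>) j" .
  qed (auto simp: push_map_Ar pull_map_Ar h h' \<sigma> \<tau> m n_def)
  have \<tau>c: "convex \<tau>" using \<tau> by (auto simp: convex_def \<tau>o)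
  have "pullback_square uDelta (pull_map h) (push_map h') \<sigma> \<tau>"
    unfolding pullback_square_def
  proof (intro conjI ballI impI ex_ex1I)
    fix z u v
    assume u: "u \<in> hom uDelta z (Src uDelta (pull_map h))" and v: "v \<in> hom uDelta z (Src uDelta (push_map h'))"
      and e: "pull_map h \<cdot>\<^bsub>uDelta\<^esub> u = push_map h' \<cdot>\<^bsub>uDelta\<^esub> v"
    have ub: "1 \<le> ofun u i" "ofun u i \<le> ?p" and vb: "1 \<le> ofun v i" "ofun v i \<le> ?p'" if "1 \<le> i" "i \<le> z" for i
      using u v that by (auto simp: in_hom uDelta_Ar n_def)
    have uv: "ofun u i + ofun h 0 = s (ofun v i)" if "1 \<le> i" "i \<le> z" for i
      using arg_cong[OF e, of "\<lambda>f. ofun f i"] u v that ub[OF that]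
      by (simp add: in_hom uDelta_ofun pull_map_ofun s_def n_def)
    \<comment> \<open>Commutativity places \<open>s\<close> at the values of \<open>v\<close>
      strictly above \<open>ofun h 0\<close> and at most at \<open>ofun h n\<close>. The adjunction
      converts this into bounds for \<open>v\<close> itself, so that \<open>v\<close> factors
      through the interval included by \<tau>.\<close>
    have vi: "c < ofun v i" "ofun v i \<le> q + c" if i: "1 \<le> i" "i \<le> z" for i
    proof -
      note gal = push_map_galois(3)[OF h' vb[OF i], folded s_def]
      have "\<not> s (ofun v i) \<le> ofun h 0" "s (ofun v i) \<le> ofun h n" using uv[OF i] ub[OF i] h0n by auto
      then have "\<not> ofun v i + ofun h' 0 \<le> ofun h' (ofun h 0)" "ofun v i + ofun h' 0 \<le> ofun h' (ofun h n)"
        using gal hb[of 0] hb[of n] by auto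
      then show "c < ofun v i" "ofun v i \<le> q + c" using c' qn by (auto simp: q_def)
    qed
    define w where "w = \<lparr>osrc = z, otgt = q, ofun = restrict (\<lambda>i. ofun v i - c) {1..z}\<rparr>"
    have ws: "osrc w = z" "otgt w = q" and wo: "\<And>i. 1 \<le> i \<Longrightarrow> i \<le> z \<Longrightarrow> ofun w i = ofun v i - c"
      by (simp_all add: w_def)
    have wb: "1 \<le> ofun w i" "ofun w i \<le> q" if "1 \<le> i" "i \<le> z" for i
      using vi[OF that] wo[OF that] by auto
    have w: "w \<in> Ar uDelta"
      unfolding uDelta_Ar
    proof (intro conjI allI impI)
      fix i j assume ij: "1 \<le> i \<and> i \<le> j \<and> j \<le> osrc w"
      then have "ofun v i \<le> ofun v j" using v by (auto simp: in_hom uDelta_Ar ws)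
      then show "ofun w i \<le> ofun w j" using ij by (auto simp: wo ws)
    qed (use wb ws in \<open>auto simp: w_def\<close>)
    have \<tau>w: "\<tau> \<cdot>\<^bsub>uDelta\<^esub> w = v"
      using v vi wb by (intro uDelta_eqI uDelta_closed) (auto simp: w ws \<tau> in_hom uDelta_ofun \<tau>o wo less_imp_le)
    have \<sigma>w: "\<sigma> \<cdot>\<^bsub>uDelta\<^esub> w = u"
    proof (intro uDelta_eqI uDelta_closed)
      fix i assume "1 \<le> i" "i \<le> osrc u"
      then have i: "1 \<le> i" "i \<le> z" using u by (auto simp: in_hom)
      have "ofun (\<sigma> \<cdot>\<^bsub>uDelta\<^esub> w) i = s (ofun w i + c) - ofun h 0"
        using i wb[OF i] by (simp add: uDelta_ofun ws \<sigma>o)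
      then show "ofun (\<sigma> \<cdot>\<^bsub>uDelta\<^esub> w) i = ofun u i" using uv[OF i, symmetric] vi[OF i] wo[OF i] by simp
    qed (use u in \<open>auto simp: in_hom w ws \<sigma> n_def\<close>)
    show "\<exists>w. w \<in> hom uDelta z (Src uDelta \<sigma>) \<and> \<sigma> \<cdot>\<^bsub>uDelta\<^esub> w = u \<and> \<tau> \<cdot>\<^bsub>uDelta\<^esub> w = v"
      using w ws \<sigma>w \<tau>w by (intro exI[of _ w]) (auto simp: in_hom)
    \<comment> \<open>\<tau> is convex, hence monic.\<close>
    show "w = w'" if "w \<in> hom uDelta z (Src uDelta \<sigma>) \<and> \<sigma> \<cdot>\<^bsub>uDelta\<^esub> w = u \<and> \<tau> \<cdot>\<^bsub>uDelta\<^esub> w = v"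
      "w' \<in> hom uDelta z (Src uDelta \<sigma>) \<and> \<sigma> \<cdot>\<^bsub>uDelta\<^esub> w' = u \<and> \<tau> \<cdot>\<^bsub>uDelta\<^esub> w' = v" for w w'
      using convex_monic[OF \<tau>c, of w z w'] that by simp
  qed (use comm m in \<open>auto simp: push_map_Ar pull_map_Ar h h' \<sigma> \<tau> n_def\<close>)
  then show ?thesis using that \<tau>c eq1 eq2 by blast
qed

section \<open>Pushouts of generic maps along free maps\<close>

lemma ordinal_automorphism:
  fixes w :: "nat \<Rightarrow> nat"
  assumes mono: "\<And>i j. i \<le> j \<Longrightarrow> j \<le> z \<Longrightarrow> w i \<le> w j" and inj: "inj_on w {0..z}"
    and surj: "w ` {0..z} = {0..l}"
  shows "z = l" "i \<le> z \<Longrightarrow> w i = i"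
proof -
  show zl: "z = l" using card_image[OF inj] surj by simp
  have less: "w i < w j" if "i < j" "j \<le> z" for i j
    using mono[of i j] inj_onD[OF inj, of i j] that by (cases "w i = w j") auto
  \<comment> \<open>A strictly increasing map never falls below the diagonal.\<close>
  have ge: "i \<le> w i" if "i \<le> z" for i
    using that
  proof (induction i)
    case (Suc i)
    then show ?case using less[of i "Suc i"] by simp
  qed simp
  \<comment> \<open>Nor does it rise above the diagonal, counting down from the top, whose value is
    bounded by \<open>l\<close>, that is, by \<open>z\<close>.\<close>
  have "w (z - d) \<le> z - d" if "d \<le> z" for d
    using that
  proof (induction d)
    case 0
    then show ?case using surj zl by auto
  next
    case (Suc d)
    then have "z - Suc d < z - d" by simp
    from less[OF this] show ?case using Suc by simp
  qed
  from this[of "z - i"] show "w i = i" if "i \<le> z" using ge[OF that] that by simp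
qed

lemma pushout_squareD:
  assumes "pushout_square Delta g f f' g'"
  shows "f' \<in> Ar Delta" "g' \<in> Ar Delta" "osrc g = osrc f" "otgt f' = otgt g'" "osrc f' = otgt g"
    "osrc g' = otgt f" "f' \<cdot>\<^bsub>Delta\<^esub> g = g' \<cdot>\<^bsub>Delta\<^esub> f"
  using assms unfolding pushout_square_def Delta_simps by blast+

text \<open>Gluing replaces the interval of \<open>otgt f\<close> hit by \<open>f\<close>, of length
  \<open>osrc g\<close>, by one of length \<open>otgt g\<close>; the points below it and the
  \<open>b\<close> points above it persist. The universal property compares this explicit cocone
  with the given one.\<close>

lemma pushout_explicit:
  assumes po: "pushout_square Delta g f f' g'" and g: "generic g" and f: "free f"
  obtains b where "otgt f = ofun f 0 + osrc g + b" "otgt f' = ofun f 0 + otgt g + b"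
    "\<And>i. i \<le> otgt g \<Longrightarrow> ofun f' i = ofun f 0 + i"
    "\<And>i. i \<le> otgt f \<Longrightarrow> ofun g' i = (if i \<le> ofun f 0 then i else if i \<le> ofun f 0 + osrc g
        then ofun f 0 + ofun g (i - ofun f 0) else i - osrc g + otgt g)"
proof -
  define a where "a = ofun f 0"
  define n where "n = osrc g"
  define m where "m = otgt g"
  define k where "k = otgt f"
  define z where "z = otgt f'"
  have gA: "g \<in> Ar Delta" and fA: "f \<in> Ar Delta" using g f generic_Ar free_Ar by auto
  have f'A: "f' \<in> Ar Delta" "g' \<in> Ar Delta"
    and sq: "osrc f = n" "otgt g' = z" "osrc f' = m" "osrc g' = k"
    and comm: "f' \<cdot>\<^bsub>Delta\<^esub> g = g' \<cdot>\<^bsub>Delta\<^esub> f"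
    using pushout_squareD[OF po] by (simp_all add: n_def m_def k_def z_def)
  have fo: "ofun f i = i + a" if "i \<le> n" for i using free_ofun[OF f, of i] that sq a_def by simp
  have g0: "ofun g 0 = 0" "ofun g n = m" using g by (auto simp: generic_def n_def m_def)
  have ank: "a + n \<le> k" using Delta_bound[OF fA, of n] fo[of n] sq k_def by simp
  define b where "b = k - (a + n)"
  have kb: "k = a + n + b" using ank b_def by simp
  define l where "l = a + m + b"
  have gb: "ofun g i \<le> m" if "i \<le> n" for i using Delta_bound[OF gA, of i] that n_def m_def by simp
  have gia: "ofun g (i - a) \<le> m" if "i \<le> a + n" for i using gb[of "i - a"] that by simp
  have gm: "ofun g i \<le> ofun g j" if "i \<le> j" "j \<le> n" for i j using Delta_mono[OF gA] that n_def by simp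
  have f'm: "ofun f' i \<le> ofun f' j" if "i \<le> j" "j \<le> m" for i j using Delta_mono[OF f'A(1)] that sq by simp
  have g'm: "ofun g' i \<le> ofun g' j" if "i \<le> j" "j \<le> k" for i j using Delta_mono[OF f'A(2)] that sq by simp
  have f'b: "ofun f' i \<le> z" if "i \<le> m" for i using Delta_bound[OF f'A(1), of i] that sq z_def by simp
  have g'b: "ofun g' i \<le> z" if "i \<le> k" for i using Delta_bound[OF f'A(2), of i] that sq z_def by simp
  have cm: "ofun f' (ofun g i) = ofun g' (i + a)" if "i \<le> n" for i
    using arg_cong[OF comm, of "\<lambda>h. ofun h i"] that sq by (simp add: Delta_ofun n_def[symmetric] fo)
  \<comment> \<open>Agreement at the two seams, where the pieces of \<open>W\<close> below will
    meet.\<close>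
  have glue: "ofun f' 0 = ofun g' a" "ofun f' m = ofun g' (a + n)"
    using cm[of 0] cm[of n] g0 by (auto simp: add.commute)
  \<comment> \<open>\<open>F\<close> and \<open>G\<close> form the explicit cocone on
    \<open>[l]\<close>; \<open>W\<close> goes back from \<open>[l]\<close> to the given pushout and
    is glued from \<open>g'\<close>, \<open>f'\<close> and again \<open>g'\<close>.\<close>
  define F where "F = \<lparr>osrc = m, otgt = l, ofun = restrict (\<lambda>i. a + i) {0..m}\<rparr>"
  define G where "G = \<lparr>osrc = k, otgt = l, ofun = restrict (\<lambda>i. if i \<le> a then i
      else if i \<le> a + n then a + ofun g (i - a) else i - n + m) {0..k}\<rparr>"
  define W where "W = \<lparr>osrc = l, otgt = z, ofun = restrict (\<lambda>i. if i \<le> a then ofun g' i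
      else if i \<le> a + m then ofun f' (i - a) else ofun g' (i - m + n)) {0..l}\<rparr>"
  have Fs[simp]: "osrc F = m" "otgt F = l" and Gs[simp]: "osrc G = k" "otgt G = l" and Ws[simp]: "osrc W = l" "otgt W = z"
    by (simp_all add: F_def G_def W_def)
  have Fo: "ofun F i = a + i" if "i \<le> m" for i using that by (simp add: F_def)
  have Go: "ofun G i = (if i \<le> a then i else if i \<le> a + n then a + ofun g (i - a) else i - n + m)" if "i \<le> k" for i
    using that by (simp add: G_def)
  have Wo: "ofun W i = (if i \<le> a then ofun g' i else if i \<le> a + m then ofun f' (i - a) else ofun g' (i - m + n))"
    if "i \<le> l" for i using that by (simp add: W_def)
  have FA: "F \<in> Ar Delta" unfolding Delta_Ar by (auto simp: Fo l_def) (auto simp: F_def)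
  have GA: "G \<in> Ar Delta"
    unfolding Delta_Ar
  proof (intro conjI allI impI)
    show "ofun G i \<le> otgt G" if "i \<le> osrc G" for i
      using that gia[of i] kb by (auto simp: Go l_def)
    show "ofun G i \<le> ofun G j" if "i \<le> j \<and> j \<le> osrc G" for i j
      using that gia[of i] gm[of "i - a" "j - a"] kb by (auto simp: Go)
  qed (auto simp: G_def)
  have WA: "W \<in> Ar Delta"
    unfolding Delta_Ar
  proof (intro conjI allI impI)
    show "ofun W i \<le> otgt W" if "i \<le> osrc W" for i
      using that f'b[of "i - a"] g'b[of i] g'b[of "i - m + n"] kb by (auto simp: Wo l_def)
    show "ofun W i \<le> ofun W j" if ij: "i \<le> j \<and> j \<le> osrc W" for i j
    proof -
      have l: "i \<le> l" "j \<le> l" using ij by auto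
      consider "j \<le> a" | "i \<le> a" "a < j" "j \<le> a + m" | "i \<le> a" "a + m < j" | "a < i" "j \<le> a + m"
        | "a < i" "i \<le> a + m" "a + m < j" | "a + m < i"
        by linarith
      then show ?thesis
      proof cases
        case 1 then show ?thesis using ij ank by (auto simp: Wo l g'm)
      next
        case 2
        have "ofun g' i \<le> ofun f' 0" using 2 ank by (simp add: glue g'm)
        also have "\<dots> \<le> ofun f' (j - a)" using 2 by (intro f'm) auto
        finally show ?thesis using 2 by (simp add: Wo l)
      next
        case 3
        then have "ofun g' i \<le> ofun g' (j - m + n)" using kb l by (intro g'm) (auto simp: l_def)
        then show ?thesis using 3 by (simp add: Wo l)
      next
        case 4 then show ?thesis using ij by (auto simp: Wo l intro!: f'm)
      next
        case 5
        have "ofun f' (i - a) \<le> ofun f' m" using 5 by (intro f'm) auto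
        also have "\<dots> \<le> ofun g' (j - m + n)" unfolding glue using 5 kb l by (intro g'm) (auto simp: l_def)
        finally show ?thesis using 5 by (simp add: Wo l)
      next
        case 6 then show ?thesis using ij kb l by (auto simp: Wo l_def intro!: g'm)
      qed
    qed
  qed (auto simp: W_def)
  have Fg: "F \<cdot>\<^bsub>Delta\<^esub> g = G \<cdot>\<^bsub>Delta\<^esub> f"
  proof (intro Delta_eqI Delta_closed)
    fix i assume "i \<le> osrc (G \<cdot>\<^bsub>Delta\<^esub> f)"
    then have i: "i \<le> n" using sq by simp
    then show "ofun (F \<cdot>\<^bsub>Delta\<^esub> g) i = ofun (G \<cdot>\<^bsub>Delta\<^esub> f) i"
      using gb[of i] sq kb g0 by (cases "i = 0") (auto simp: Delta_ofun Fo Go fo n_def[symmetric])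
  qed (use sq in \<open>auto simp: FA GA gA fA n_def m_def k_def\<close>)
  \<comment> \<open>The universal property of the given square, applied to the explicit
    cocone.\<close>
  obtain w where w: "w \<in> hom Delta z l" "w \<cdot>\<^bsub>Delta\<^esub> f' = F" "w \<cdot>\<^bsub>Delta\<^esub> g' = G"
  proof -
    have "\<forall>z \<in> Ob Delta. \<forall>u \<in> hom Delta (otgt g) z. \<forall>v \<in> hom Delta (otgt f) z. u \<cdot>\<^bsub>Delta\<^esub> g = v \<cdot>\<^bsub>Delta\<^esub> f \<longrightarrow>
        (\<exists>!w. w \<in> hom Delta (otgt f') z \<and> w \<cdot>\<^bsub>Delta\<^esub> f' = u \<and> w \<cdot>\<^bsub>Delta\<^esub> g' = v)"
      using po unfolding pushout_square_def Delta_simps by (elim conjE)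
    moreover have "F \<in> hom Delta (otgt g) l" "G \<in> hom Delta (otgt f) l"
      by (auto simp: in_hom FA GA m_def k_def)
    ultimately show ?thesis using that Fg unfolding z_def by simp blast
  qed
  have Wf': "W \<cdot>\<^bsub>Delta\<^esub> F = f'"
  proof (intro Delta_eqI Delta_closed)
    fix i assume "i \<le> osrc f'"
    then show "ofun (W \<cdot>\<^bsub>Delta\<^esub> F) i = ofun f' i"
      using sq glue by (cases "i = 0") (auto simp: Delta_ofun Fo Wo l_def)
  qed (use sq in \<open>auto simp: WA FA f'A z_def\<close>)
  have Wg': "W \<cdot>\<^bsub>Delta\<^esub> G = g'"
  proof (intro Delta_eqI Delta_closed)
    fix i assume "i \<le> osrc g'"
    then have i: "i \<le> k" using sq by simp
    have Gi: "ofun G i \<le> l" using GA i by (auto simp: Delta_Ar)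
    show "ofun (W \<cdot>\<^bsub>Delta\<^esub> G) i = ofun g' i"
    proof (cases "a < i \<and> i \<le> a + n")
      case True
      then have "i - a \<le> n" "i - a + a = i" by auto
      then have "ofun f' (ofun g (i - a)) = ofun g' i" using cm[of "i - a"] by simp
      then show ?thesis using True i Gi gia[of i] glue by (auto simp: Delta_ofun Go Wo)
    next
      case False
      then show ?thesis using i Gi by (auto simp: Delta_ofun Go Wo)
    qed
  qed (use sq in \<open>auto simp: WA GA f'A z_def\<close>)
  \<comment> \<open>\<open>W\<close> after \<open>w\<close> is an endomorphism of the given cocone,
    hence the identity, and \<open>w\<close> is injective. It will be surjective because the images
    of \<open>F\<close> and \<open>G\<close> cover \<open>[l]\<close>.\<close>
  have wW: "W \<cdot>\<^bsub>Delta\<^esub> w = Ident Delta z"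
  proof -
    have W: "W \<in> hom Delta l z" by (simp add: in_hom WA)
    have "\<forall>z' \<in> Ob Delta. \<forall>u \<in> hom Delta (otgt g) z'. \<forall>v \<in> hom Delta (otgt f) z'. u \<cdot>\<^bsub>Delta\<^esub> g = v \<cdot>\<^bsub>Delta\<^esub> f \<longrightarrow>
        (\<exists>!w. w \<in> hom Delta z z' \<and> w \<cdot>\<^bsub>Delta\<^esub> f' = u \<and> w \<cdot>\<^bsub>Delta\<^esub> g' = v)"
      using po unfolding pushout_square_def Delta_simps z_def by (elim conjE)
    moreover have f'g': "f' \<in> hom Delta (otgt g) z" "g' \<in> hom Delta (otgt f) z"
      using sq f'A by (auto simp: in_hom m_def k_def z_def)
    ultimately have ex: "\<exists>!w. w \<in> hom Delta z z \<and> w \<cdot>\<^bsub>Delta\<^esub> f' = f' \<and> w \<cdot>\<^bsub>Delta\<^esub> g' = g'"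
      using comm by simp
    have "W \<cdot>\<^bsub>Delta\<^esub> w \<in> hom Delta z z" using cmp_hom[OF Delta_category w(1) W] .
    moreover have "(W \<cdot>\<^bsub>Delta\<^esub> w) \<cdot>\<^bsub>Delta\<^esub> f' = f'" "(W \<cdot>\<^bsub>Delta\<^esub> w) \<cdot>\<^bsub>Delta\<^esub> g' = g'"
      using hom_assoc[OF Delta_category f'g'(1) w(1) W] hom_assoc[OF Delta_category f'g'(2) w(1) W] w(2,3) Wf' Wg' by auto
    moreover have "Ident Delta z \<in> hom Delta z z" "Ident Delta z \<cdot>\<^bsub>Delta\<^esub> f' = f'" "Ident Delta z \<cdot>\<^bsub>Delta\<^esub> g' = g'"
      using Ident_hom_cmp[OF Delta_category] f'g' Ident_hom[OF Delta_category] by auto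
    ultimately show ?thesis using ex by blast
  qed
  have wF: "ofun w (ofun f' i) = a + i" if "i \<le> m" for i
    using arg_cong[OF w(2), of "\<lambda>h. ofun h i"] that sq by (simp add: Delta_ofun Fo)
  have wG: "ofun w (ofun g' i) = ofun G i" if "i \<le> k" for i
    using arg_cong[OF w(3), of "\<lambda>h. ofun h i"] that sq by (simp add: Delta_ofun)
  have inj: "inj_on (ofun w) {0..z}"
  proof (rule inj_onI)
    have "ofun W (ofun w i) = i" if "i \<le> z" for i
      using arg_cong[OF wW, of "\<lambda>h. ofun h i"] that w(1) by (simp add: Delta_ofun in_hom)
    then show "x = y" if "x \<in> {0..z}" "y \<in> {0..z}" "ofun w x = ofun w y" for x y using that by (metis atLeastAtMost_iff)
  qed
  have surj: "ofun w ` {0..z} = {0..l}"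
  proof (intro equalityI subsetI)
    fix i assume "i \<in> {0..l}"
    then have i: "i \<le> l" by simp
    consider "i \<le> a" | "a < i" "i \<le> a + m" | "a + m < i" by linarith
    then show "i \<in> ofun w ` {0..z}"
    proof cases
      case 1 then show ?thesis using wG[of i] g'b[of i] ank by (intro image_eqI[of _ _ "ofun g' i"]) (auto simp: Go)
    next
      case 2 then show ?thesis using wF[of "i - a"] f'b[of "i - a"] by (intro image_eqI[of _ _ "ofun f' (i - a)"]) auto
    next
      case 3
      then show ?thesis using wG[of "i - m + n"] g'b[of "i - m + n"] kb i
        by (intro image_eqI[of _ _ "ofun g' (i - m + n)"]) (auto simp: Go l_def)
    qed
  qed (use w(1) in \<open>auto simp: in_hom Delta_Ar\<close>)
  have wm: "ofun w i \<le> ofun w j" if "i \<le> j" "j \<le> z" for i j using w(1) that by (auto simp: in_hom Delta_Ar)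
  \<comment> \<open>A pushout is unique only up to isomorphism, but the isomorphism \<open>w\<close>
    is a monotone bijection of ordinals and therefore the identity. Thus \<open>z\<close> is
    \<open>l\<close>, and \<open>f'\<close>, \<open>g'\<close> have the values of \<open>F\<close>,
    \<open>G\<close>.\<close>
  note aut = ordinal_automorphism[OF wm inj surj]
  have zl: "z = l" by (rule aut(1))
  have wid: "ofun w i = i" if "i \<le> z" for i by (rule aut(2)[OF _ _ that])
  show thesis
  proof (rule that[of b])
    show "otgt f = ofun f 0 + osrc g + b" using kb by (simp add: k_def a_def n_def)
    show "otgt f' = ofun f 0 + otgt g + b" using zl by (simp add: z_def l_def a_def m_def)
    show "ofun f' i = ofun f 0 + i" if "i \<le> otgt g" for i
      using wF[of i] wid[OF f'b[of i]] that by (simp add: a_def m_def)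
    show "ofun g' i = (if i \<le> ofun f 0 then i else if i \<le> ofun f 0 + osrc g
        then ofun f 0 + ofun g (i - ofun f 0) else i - osrc g + otgt g)" if "i \<le> otgt f" for i
      using wG[of i] wid[OF g'b[of i]] that Go[of i] by (simp add: a_def m_def n_def k_def)
  qed
qed

text \<open>Under the duality the pushout becomes the identity-extension square of
  \<open>under_gen g\<close>, where \<open>a\<close> and \<open>b\<close> count the points of
  \<open>otgt f\<close> below and above the image of \<open>f\<close>. The last two conclusions say
  that \<open>g\<close> followed by \<open>f'\<close> is the generic--free factorization of the
  diagonal; they will make the compositor of \<open>f'\<close> and \<open>g\<close> trivial.\<close>

lemma pushout_id_ext:
  assumes po: "pushout_square Delta g f f' g'" and g: "generic g" and f: "free f"
  obtains a b where "otgt f = a + osrc g + b" "otgt f' = a + otgt g + b" "free f'" "generic g'"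
    "under_free f = incl a (osrc g) b" "under_free f' = incl a (otgt g) b"
    "under_gen g' = id_ext a (under_gen g) b" "push_map (f' \<cdot>\<^bsub>Delta\<^esub> g) = under_gen g"
    "pull_map (f' \<cdot>\<^bsub>Delta\<^esub> g) = under_free f'"
proof -
  obtain b where b: "otgt f = ofun f 0 + osrc g + b" "otgt f' = ofun f 0 + otgt g + b"
    "\<And>i. i \<le> otgt g \<Longrightarrow> ofun f' i = ofun f 0 + i"
    "\<And>i. i \<le> otgt f \<Longrightarrow> ofun g' i = (if i \<le> ofun f 0 then i else if i \<le> ofun f 0 + osrc g
        then ofun f 0 + ofun g (i - ofun f 0) else i - osrc g + otgt g)"
    using pushout_explicit[OF po g f] by blast
  define a where "a = ofun f 0"
  note b = b[folded a_def]
  have gA: "g \<in> Ar Delta" using g generic_Ar by auto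
  have g0: "ofun g 0 = 0" "ofun g (osrc g) = otgt g" using g by (auto simp: generic_def)
  have A: "f' \<in> Ar Delta" "g' \<in> Ar Delta"
    and sq: "osrc f = osrc g" "otgt g' = otgt f'" "osrc f' = otgt g" "osrc g' = otgt f"
    using pushout_squareD[OF po] by simp_all
  have f': "free f'" using b(3) A sq by (auto simp: free_def)
  have g': "generic g'"
    unfolding generic_def
  proof (intro conjI)
    \<comment> \<open>If \<open>osrc g\<close> is 0 and \<open>b\<close> is 0, the top element falls
      into the first branch of the formula for \<open>g'\<close>. Its value is still the top, since
      a generic map out of \<open>[0]\<close> has target \<open>[0]\<close>.\<close>
    have "otgt g = 0" if "osrc g = 0" using g0 that by simp
    then show "ofun g' (osrc g') = otgt g'" using b sq g0 by (cases "osrc g = 0") auto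
  qed (use A b in auto)
  have "under_gen g' = id_ext a (under_gen g) b"
  proof -
    have u: "under_gen g = push_map g" and u': "under_gen g' = push_map g'"
      using generic_push_pull(1) g g' by auto
    let ?e = "id_ext a (push_map g) b"
    have eo: "ofun ?e j = (if j \<le> a then j else if j \<le> a + otgt g then a + ofun (push_map g) (j - a)
        else a + osrc g + (j - (a + otgt g)))" if "1 \<le> j" "j \<le> a + otgt g + b" for j
      using that g0 by (simp add: id_ext_def)
    have "push_map g' = ?e"
    proof -
      \<comment> \<open>The adjunction is checked on three blocks: on the outer two it is
        arithmetic, on the middle one it is the adjunction for \<open>g\<close> shifted by
        \<open>a\<close>.\<close>
      have o: "ofun (push_map g') j = ofun ?e j" if j: "1 \<le> j" "j \<le> a + otgt g + b" for j
      proof (rule push_map_eqI[OF A(2)])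
        have gal: "1 \<le> ofun (push_map g) (j - a)" "ofun (push_map g) (j - a) \<le> osrc g"
            "\<And>i. i \<le> osrc g \<Longrightarrow> ofun (push_map g) (j - a) \<le> i \<longleftrightarrow> j - a \<le> ofun g i"
          if "a < j" "j \<le> a + otgt g"
          using push_map_galois[OF gA, of "j - a"] that g0 by auto
        show "ofun ?e j \<le> osrc g'" using j gal(2) b sq by (auto simp: eo)
        show "ofun ?e j \<le> i \<longleftrightarrow> j + ofun g' 0 \<le> ofun g' i" if i: "i \<le> osrc g'" for i
        proof -
          have i': "i \<le> otgt f" "i \<le> a + osrc g + b" using i b(1) sq by auto
          have G: "ofun g' i = (if i \<le> a then i else if i \<le> a + osrc g
              then a + ofun g (i - a) else i - osrc g + otgt g)" "ofun g' 0 = 0" using b(4)[OF i'(1)] b(4)[of 0] by auto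
          have gi: "ofun g (i - a) \<le> otgt g" if "i \<le> a + osrc g" using Delta_bound[OF gA, of "i - a"] that by simp
          consider "j \<le> a" | "a < j" "j \<le> a + otgt g" | "a + otgt g < j" by linarith
          then show ?thesis
          proof cases
            case 1 then show ?thesis using j G by (auto simp: eo)
          next
            case 2
            show ?thesis
            proof (cases "a < i \<and> i \<le> a + osrc g")
              case True
              then have "ofun (push_map g) (j - a) \<le> i - a \<longleftrightarrow> j - a \<le> ofun g (i - a)" by (intro gal(3)[OF 2]) auto
              then have "a + ofun (push_map g) (j - a) \<le> i \<longleftrightarrow> j \<le> a + ofun g (i - a)" using True by linarith
              then show ?thesis using j 2 True G by (simp add: eo)
            next
              case False
              then show ?thesis using j G 2 gal(1,2)[OF 2] by (auto simp: eo)
            qed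
          next
            case 3 then show ?thesis using j G gi by (auto simp: eo)
          qed
        qed
      qed (use j g' b sq in \<open>auto simp: generic_def\<close>)
      show ?thesis
      proof (rule omap.equality)
        have "ofun (push_map g') \<in> extensional {1..a + otgt g + b}"
          using push_map_Ar[OF A(2)] g' b sq by (auto simp: uDelta_Ar generic_def)
        moreover have "ofun ?e \<in> extensional {1..a + otgt g + b}" using g0 by (simp add: id_ext_def)
        ultimately show "ofun (push_map g') = ofun ?e"
          by (rule extensionalityI) (use o in auto)
      qed (use g' b sq g0 in \<open>auto simp: id_ext_def generic_def\<close>)
    qed
    then show ?thesis using u u' by simp
  qed
  moreover have "under_free f = incl a (osrc g) b" "under_free f' = incl a (otgt g) b"
    using b sq by (auto simp: under_free_def incl_def add.commute a_def)
  moreover have "push_map (f' \<cdot>\<^bsub>Delta\<^esub> g) = under_gen g" "pull_map (f' \<cdot>\<^bsub>Delta\<^esub> g) = under_free f'"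
  proof -
    have fg: "f' \<cdot>\<^bsub>Delta\<^esub> g \<in> Ar Delta" using Delta_closed(2) gA A sq by auto
    have o: "ofun (f' \<cdot>\<^bsub>Delta\<^esub> g) i = a + ofun g i" if "i \<le> osrc g" for i
      using that b(3)[of "ofun g i"] Delta_bound[OF gA, of i] by (simp add: Delta_ofun)
    have f'0: "ofun f' 0 = a" using b(3)[of 0] by simp
    \<comment> \<open>The shift by \<open>a\<close> contributes equally to both sides of the
      adjunction condition, so the left adjoint is unchanged.\<close>
    have "push_map (f' \<cdot>\<^bsub>Delta\<^esub> g) = push_map g"
    proof (rule uDelta_eqI)
      fix j assume "1 \<le> j" "j \<le> osrc (push_map g)"
      then show "ofun (push_map (f' \<cdot>\<^bsub>Delta\<^esub> g)) j = ofun (push_map g) j"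
        using push_map_galois[OF gA, of j] g0 o by (intro push_map_eqI[OF fg]) auto
    qed (use fg gA g0 o push_map_Ar in auto)
    then show "push_map (f' \<cdot>\<^bsub>Delta\<^esub> g) = under_gen g" using generic_push_pull(1)[OF g] by simp
    have "pull_map (f' \<cdot>\<^bsub>Delta\<^esub> g) = pull_map f'"
      using o f'0 b(3)[of "otgt g"] sq g0
      by (intro uDelta_eqI pull_map_Ar fg A) (auto simp: pull_map_ofun)
    then show "pull_map (f' \<cdot>\<^bsub>Delta\<^esub> g) = under_free f'" using free_push_pull(2)[OF f'] by simp
  qed
  ultimately show thesis using that[of a b] f' g' b by simp
qed

section \<open>Cartesian and cocartesian arrows\<close>

text \<open>Two commuting squares sharing the leg \<open>c\<close>. Composites of maps of spans are
  verified by this rule; its typing premises are explicit, so that it applies by resolution and no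
  composite has to be normalised.\<close>

lemma square_paste:
  assumes "category C" "b \<in> hom C P Q" "a \<in> hom C Q R" "d \<in> hom C P S" "c \<in> hom C S R" "e \<in> hom C R T"
    "g \<in> hom C S U" "f \<in> hom C U T" "a \<cdot>\<^bsub>C\<^esub> b = c \<cdot>\<^bsub>C\<^esub> d" "e \<cdot>\<^bsub>C\<^esub> c = f \<cdot>\<^bsub>C\<^esub> g"
  shows "(e \<cdot>\<^bsub>C\<^esub> a) \<cdot>\<^bsub>C\<^esub> b = f \<cdot>\<^bsub>C\<^esub> (g \<cdot>\<^bsub>C\<^esub> d)"
  using hom_assoc[OF assms(1,2,3,6)] hom_assoc[OF assms(1,4,5,6), symmetric] hom_assoc[OF assms(1,4,7,8)] assms(9,10)
  by simp

locale fibration =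
  fixes X :: "('o, 'a) fib"
  assumes over: "over_uDelta X"
begin

abbreviation E :: "('o, 'a) cat" where "E \<equiv> total X"
abbreviation pr :: "'a \<Rightarrow> omap" where "pr \<equiv> FAr (proj X)"

lemma proj_functor: "is_functor E uDelta (proj X)"
  using over by (simp add: over_uDelta_def)

lemmas E_cat [simp] = functor_cats(1)[OF proj_functor]

lemma pr_simps:
  "f \<in> Ar E \<Longrightarrow> pr f \<in> Ar uDelta"
  "f \<in> Ar E \<Longrightarrow> FOb (proj X) (Src E f) = osrc (pr f)"
  "f \<in> Ar E \<Longrightarrow> FOb (proj X) (Tgt E f) = otgt (pr f)"
  "x \<in> Ob E \<Longrightarrow> pr (Ident E x) = Ident uDelta (FOb (proj X) x)"
  "f \<in> Ar E \<Longrightarrow> g \<in> Ar E \<Longrightarrow> Tgt E f = Src E g \<Longrightarrow> pr (g \<cdot>\<^bsub>E\<^esub> f) = pr g \<cdot>\<^bsub>uDelta\<^esub> pr f"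
  using functor_simps[OF proj_functor] by auto

lemma osrc_pr_otgt: "f \<in> Ar E \<Longrightarrow> g \<in> Ar E \<Longrightarrow> Tgt E f = Src E g \<Longrightarrow> osrc (pr g) = otgt (pr f)"
  and osrc_pr_eq: "f \<in> Ar E \<Longrightarrow> g \<in> Ar E \<Longrightarrow> Src E f = Src E g \<Longrightarrow> osrc (pr f) = osrc (pr g)"
  by (metis pr_simps(2,3))+

lemma fibre_simps [simp]:
  "Src (fibre X n) = Src E" "Tgt (fibre X n) = Tgt E" "Ident (fibre X n) = Ident E" "Cmp (fibre X n) = Cmp E"
  by (simp_all add: fibre_def)

lemma fibre_Ob: "x \<in> Ob (fibre X n) \<longleftrightarrow> x \<in> Ob E \<and> FOb (proj X) x = n"
  and fibre_Ar [simp]: "v \<in> Ar (fibre X n) \<longleftrightarrow> v \<in> Ar E \<and> pr v = Ident uDelta n"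
  by (simp_all add: fibre_def)

lemma Src_fibre: "v \<in> Ar E \<Longrightarrow> Src E v \<in> Ob (fibre X (osrc (pr v)))"
  and Tgt_fibre: "v \<in> Ar E \<Longrightarrow> Tgt E v \<in> Ob (fibre X (otgt (pr v)))"
  by (simp_all add: fibre_Ob pr_simps cat_simps)

lemma fibre_hom: "v \<in> hom (fibre X n) x y \<longleftrightarrow> v \<in> hom E x y \<and> pr v = Ident uDelta n"
  by (auto simp: in_hom fibre_Ar)

lemma pr_cmp_vertical:
  assumes "f \<in> Ar E" "g \<in> Ar E" "Tgt E f = Src E g"
  shows "pr f = Ident uDelta n \<Longrightarrow> pr (g \<cdot>\<^bsub>E\<^esub> f) = pr g" "pr g = Ident uDelta n \<Longrightarrow> pr (g \<cdot>\<^bsub>E\<^esub> f) = pr f"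
proof -
  have "osrc (pr g) = otgt (pr f)" by (rule osrc_pr_otgt[OF assms])
  then show "pr f = Ident uDelta n \<Longrightarrow> pr (g \<cdot>\<^bsub>E\<^esub> f) = pr g" "pr g = Ident uDelta n \<Longrightarrow> pr (g \<cdot>\<^bsub>E\<^esub> f) = pr f"
    using assms by (auto simp: pr_simps cmp_Ident Ident_cmp uDelta_category)
qed

lemma fibre_category: "category (fibre X n)"
proof (rule categoryI)
  fix f g x y z assume f: "f \<in> hom (fibre X n) x y"
  then have "osrc (pr f) = n" "otgt (pr f) = n" by (auto simp: fibre_hom)
  then show "x \<in> Ob (fibre X n) \<and> y \<in> Ob (fibre X n)"
    using f Src_fibre[of f] Tgt_fibre[of f] by (auto simp: fibre_hom in_hom)
  show "g \<cdot>\<^bsub>fibre X n\<^esub> f \<in> hom (fibre X n) x z" if "g \<in> hom (fibre X n) y z"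
    using f that pr_cmp_vertical(1)[of f g n] by (auto simp: fibre_hom in_hom cat_simps)
qed (auto simp: fibre_hom in_hom cat_simps fibre_Ob pr_simps)

section \<open>Factorizations through cartesian and cocartesian arrows\<close>

lemma cartesianD:
  assumes "cartesian X \<phi>" "\<xi> \<in> hom E z (Tgt E \<phi>)" "h \<in> hom uDelta (osrc (pr \<xi>)) (osrc (pr \<phi>))"
    "pr \<xi> = pr \<phi> \<cdot>\<^bsub>uDelta\<^esub> h"
  shows "\<exists>!\<chi>. \<chi> \<in> hom E z (Src E \<phi>) \<and> pr \<chi> = h \<and> \<phi> \<cdot>\<^bsub>E\<^esub> \<chi> = \<xi>"
proof -
  have "\<phi> \<in> Ar E" using assms(1) by (simp add: cartesian_def)
  then have "FOb (proj X) (Src E \<phi>) = osrc (pr \<phi>)" by (rule pr_simps(2))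
  moreover have "z \<in> Ob E" using hom_Ob(1)[OF E_cat assms(2)] .
  moreover have "FOb (proj X) z = osrc (pr \<xi>)" using assms(2) pr_simps(2)[of \<xi>] by (simp add: in_hom)
  ultimately show ?thesis using assms unfolding cartesian_def by metis
qed

lemma cocartesianD:
  assumes "cocartesian X \<psi>" "\<xi> \<in> hom E (Src E \<psi>) z" "h \<in> hom uDelta (otgt (pr \<psi>)) (otgt (pr \<xi>))"
    "pr \<xi> = h \<cdot>\<^bsub>uDelta\<^esub> pr \<psi>"
  shows "\<exists>!\<chi>. \<chi> \<in> hom E (Tgt E \<psi>) z \<and> pr \<chi> = h \<and> \<chi> \<cdot>\<^bsub>E\<^esub> \<psi> = \<xi>"
proof -
  have "\<psi> \<in> Ar E" using assms(1) by (simp add: cocartesian_def)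
  then have "FOb (proj X) (Tgt E \<psi>) = otgt (pr \<psi>)" by (rule pr_simps(3))
  moreover have "z \<in> Ob E" using hom_Ob(2)[OF E_cat assms(2)] .
  moreover have "FOb (proj X) z = otgt (pr \<xi>)" using assms(2) pr_simps(3)[of \<xi>] by (simp add: in_hom)
  ultimately show ?thesis using assms unfolding cocartesian_def by metis
qed

lemma cart_fill:
  assumes "cartesian X \<phi>" "\<xi> \<in> hom E z (Tgt E \<phi>)" "h \<in> Ar uDelta" "osrc h = osrc (pr \<xi>)" "otgt h = osrc (pr \<phi>)"
    "pr \<xi> = pr \<phi> \<cdot>\<^bsub>uDelta\<^esub> h"
  obtains \<chi> where "\<chi> \<in> hom E z (Src E \<phi>)" "pr \<chi> = h" "\<phi> \<cdot>\<^bsub>E\<^esub> \<chi> = \<xi>"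
proof -
  have "h \<in> hom uDelta (osrc (pr \<xi>)) (osrc (pr \<phi>))" using assms(3-5) by (simp add: in_hom)
  from cartesianD[OF assms(1,2) this assms(6)] show ?thesis using that by blast
qed

lemma cart_unique:
  assumes "cartesian X \<phi>" "\<chi> \<in> hom E z (Src E \<phi>)" "\<chi>' \<in> hom E z (Src E \<phi>)" "pr \<chi> = pr \<chi>'"
    "\<phi> \<cdot>\<^bsub>E\<^esub> \<chi> = \<phi> \<cdot>\<^bsub>E\<^esub> \<chi>'"
  shows "\<chi> = \<chi>'"
proof -
  have \<phi>: "\<phi> \<in> Ar E" using assms(1) by (simp add: cartesian_def)
  have \<chi>: "\<chi> \<in> Ar E" "Tgt E \<chi> = Src E \<phi>" "Src E \<chi> = z" using assms(2) by (auto simp: in_hom)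
  have o: "otgt (pr \<chi>) = osrc (pr \<phi>)" using osrc_pr_otgt[OF \<chi>(1) \<phi> \<chi>(2)] by (rule sym)
  have c: "\<phi> \<cdot>\<^bsub>E\<^esub> \<chi> \<in> hom E z (Tgt E \<phi>)" "pr (\<phi> \<cdot>\<^bsub>E\<^esub> \<chi>) = pr \<phi> \<cdot>\<^bsub>uDelta\<^esub> pr \<chi>"
    using \<phi> \<chi> by (simp_all add: in_hom cat_simps pr_simps)
  have "\<exists>!w. w \<in> hom E z (Src E \<phi>) \<and> pr w = pr \<chi> \<and> \<phi> \<cdot>\<^bsub>E\<^esub> w = \<phi> \<cdot>\<^bsub>E\<^esub> \<chi>"
    by (rule cartesianD[OF assms(1) c(1) _ c(2)]) (simp add: in_hom o c(2) pr_simps \<chi>(1))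
  then show ?thesis using assms(2-) by metis
qed

text \<open>Convex maps being monomorphisms, so are the cartesian arrows above them.\<close>

lemma cart_monic:
  assumes "cartesian X \<phi>" "convex (pr \<phi>)" "\<chi> \<in> hom E z (Src E \<phi>)" "\<chi>' \<in> hom E z (Src E \<phi>)"
    "\<phi> \<cdot>\<^bsub>E\<^esub> \<chi> = \<phi> \<cdot>\<^bsub>E\<^esub> \<chi>'"
  shows "\<chi> = \<chi>'"
proof (rule cart_unique[OF assms(1,3,4) _ assms(5)])
  have \<phi>: "\<phi> \<in> Ar E" using assms(1) by (simp add: cartesian_def)
  have \<chi>: "\<chi> \<in> Ar E" "\<chi>' \<in> Ar E" and s: "Src E \<chi> = Src E \<chi>'" "Tgt E \<chi> = Src E \<phi>" "Tgt E \<chi>' = Src E \<phi>"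
    using assms(3,4) by (auto simp: in_hom)
  have o: "osrc (pr \<chi>) = osrc (pr \<chi>')" "otgt (pr \<chi>) = osrc (pr \<phi>)" "otgt (pr \<chi>') = osrc (pr \<phi>)"
    using osrc_pr_eq[OF \<chi>(1) \<chi>(2) s(1)] osrc_pr_otgt[OF \<chi>(1) \<phi> s(2)] osrc_pr_otgt[OF \<chi>(2) \<phi> s(3)]
    by (simp_all only:)
  have "pr (\<phi> \<cdot>\<^bsub>E\<^esub> \<chi>) = pr (\<phi> \<cdot>\<^bsub>E\<^esub> \<chi>')" using assms(5) by simp
  then have "pr \<phi> \<cdot>\<^bsub>uDelta\<^esub> pr \<chi> = pr \<phi> \<cdot>\<^bsub>uDelta\<^esub> pr \<chi>'"
    using \<phi> \<chi> s by (simp add: pr_simps)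
  then show "pr \<chi> = pr \<chi>'"
    using o \<chi> by - (rule convex_monic[OF assms(2), of _ "osrc (pr \<chi>)"], auto simp: in_hom pr_simps)
qed

lemma cocart_fill:
  assumes "cocartesian X \<psi>" "\<xi> \<in> hom E (Src E \<psi>) z" "h \<in> Ar uDelta" "osrc h = otgt (pr \<psi>)" "otgt h = otgt (pr \<xi>)"
    "pr \<xi> = h \<cdot>\<^bsub>uDelta\<^esub> pr \<psi>"
  obtains \<chi> where "\<chi> \<in> hom E (Tgt E \<psi>) z" "pr \<chi> = h" "\<chi> \<cdot>\<^bsub>E\<^esub> \<psi> = \<xi>"
proof -
  have "h \<in> hom uDelta (otgt (pr \<psi>)) (otgt (pr \<xi>))" using assms(3-5) by (simp add: in_hom)
  from cocartesianD[OF assms(1,2) this assms(6)] show ?thesis using that by blast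
qed

lemma cocart_unique:
  assumes "cocartesian X \<psi>" "\<chi> \<in> hom E (Tgt E \<psi>) z" "\<chi>' \<in> hom E (Tgt E \<psi>) z" "pr \<chi> = pr \<chi>'"
    "\<chi> \<cdot>\<^bsub>E\<^esub> \<psi> = \<chi>' \<cdot>\<^bsub>E\<^esub> \<psi>"
  shows "\<chi> = \<chi>'"
proof -
  have \<psi>: "\<psi> \<in> Ar E" using assms(1) by (simp add: cocartesian_def)
  have \<chi>: "\<chi> \<in> Ar E" "Src E \<chi> = Tgt E \<psi>" "Tgt E \<chi> = z" using assms(2) by (auto simp: in_hom)
  have o: "osrc (pr \<chi>) = otgt (pr \<psi>)" using osrc_pr_otgt[OF \<psi> \<chi>(1) \<chi>(2)[symmetric]] .
  have c: "\<chi> \<cdot>\<^bsub>E\<^esub> \<psi> \<in> hom E (Src E \<psi>) z" "pr (\<chi> \<cdot>\<^bsub>E\<^esub> \<psi>) = pr \<chi> \<cdot>\<^bsub>uDelta\<^esub> pr \<psi>"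
    using \<psi> \<chi> by (simp_all add: in_hom cat_simps pr_simps)
  have "\<exists>!w. w \<in> hom E (Tgt E \<psi>) z \<and> pr w = pr \<chi> \<and> w \<cdot>\<^bsub>E\<^esub> \<psi> = \<chi> \<cdot>\<^bsub>E\<^esub> \<psi>"
    by (rule cocartesianD[OF assms(1) c(1) _ c(2)]) (simp add: in_hom o c(2) pr_simps \<chi>(1))
  then show ?thesis using assms(2-) by metis
qed

section \<open>Comparison, composition and cancellation of lifts\<close>

lemma cart_fill_vertical:
  assumes "cartesian X \<phi>" "\<xi> \<in> hom E z (Tgt E \<phi>)" "pr \<xi> = pr \<phi>" "n = osrc (pr \<phi>)"
  obtains t where "t \<in> hom (fibre X n) z (Src E \<phi>)" "\<phi> \<cdot>\<^bsub>E\<^esub> t = \<xi>"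
proof -
  have \<phi>: "\<phi> \<in> Ar E" using assms(1) by (simp add: cartesian_def)
  show ?thesis
    by (rule cart_fill[OF assms(1,2), of "Ident uDelta n"])
      (use assms \<phi> that in \<open>auto simp: uDelta_closed cmp_Ident uDelta_category pr_simps fibre_hom\<close>)
qed

lemma cocart_fill_vertical:
  assumes "cocartesian X \<psi>" "\<xi> \<in> hom E (Src E \<psi>) z" "pr \<xi> = pr \<psi>" "n = otgt (pr \<psi>)"
  obtains t where "t \<in> hom (fibre X n) (Tgt E \<psi>) z" "t \<cdot>\<^bsub>E\<^esub> \<psi> = \<xi>"
proof -
  have \<psi>: "\<psi> \<in> Ar E" using assms(1) by (simp add: cocartesian_def)
  show ?thesis
    by (rule cocart_fill[OF assms(1,2), of "Ident uDelta n"])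
      (use assms \<psi> that in \<open>auto simp: uDelta_closed Ident_cmp uDelta_category pr_simps fibre_hom\<close>)
qed

lemma cocart_unique_vertical:
  assumes "cocartesian X \<psi>" "t \<in> hom (fibre X n) (Tgt E \<psi>) z" "t' \<in> hom (fibre X n) (Tgt E \<psi>) z"
    "t \<cdot>\<^bsub>E\<^esub> \<psi> = t' \<cdot>\<^bsub>E\<^esub> \<psi>"
  shows "t = t'"
  using cocart_unique[OF assms(1), of t z t'] assms(2-) by (simp add: fibre_hom)

text \<open>As \<open>t\<close> is vertical, the two arrows lie over the same base map. The
  factorization in the other direction exists for the same reason and is inverse to \<open>t\<close>
  by uniqueness.\<close>

lemma cocart_iso:
  assumes \<psi>: "cocartesian X \<psi>" "cocartesian X \<psi>'" and s: "Src E \<psi> = Src E \<psi>'"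
    and t: "t \<in> hom (fibre X n) (Tgt E \<psi>) (Tgt E \<psi>')" "t \<cdot>\<^bsub>E\<^esub> \<psi> = \<psi>'"
  shows "is_iso (fibre X n) t"
proof -
  have A: "\<psi> \<in> Ar E" "\<psi>' \<in> Ar E" using \<psi> by (auto simp: cocartesian_def)
  have tE: "t \<in> Ar E" "Src E t = Tgt E \<psi>" "Tgt E t = Tgt E \<psi>'" "pr t = Ident uDelta n"
    using t by (auto simp: fibre_hom in_hom)
  have p: "pr \<psi> = pr \<psi>'" using pr_cmp_vertical(2)[of \<psi> t n] tE A t(2) by simp
  have n: "n = otgt (pr \<psi>)" using osrc_pr_otgt[OF A(1) tE(1)] tE by simp
  obtain t' where t': "t' \<in> hom (fibre X n) (Tgt E \<psi>') (Tgt E \<psi>)" "t' \<cdot>\<^bsub>E\<^esub> \<psi>' = \<psi>"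
    by (rule cocart_fill_vertical[OF \<psi>(2), of \<psi> "Tgt E \<psi>"]) (use A s p n in \<open>auto simp: in_hom\<close>)
  have t'E: "t' \<in> Ar E" "Src E t' = Tgt E \<psi>'" "Tgt E t' = Tgt E \<psi>"
    using t' by (auto simp: fibre_hom in_hom)
  note hom = cmp_hom[OF fibre_category t(1) t'(1)] cmp_hom[OF fibre_category t'(1) t(1)]
  have obs: "Tgt E \<psi> \<in> Ob (fibre X n)" "Tgt E \<psi>' \<in> Ob (fibre X n)" using hom_Ob[OF fibre_category t(1)] by auto
  note i = Ident_hom[OF fibre_category obs(1)] Ident_hom[OF fibre_category obs(2)]
  have "(t' \<cdot>\<^bsub>E\<^esub> t) \<cdot>\<^bsub>E\<^esub> \<psi> = Ident E (Tgt E \<psi>) \<cdot>\<^bsub>E\<^esub> \<psi>"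
    using cmp_assoc[OF E_cat A(1) tE(1) t'E(1)] tE t'E t(2) t'(2) A by (simp add: Ident_cmp)
  then have 1: "t' \<cdot>\<^bsub>E\<^esub> t = Ident E (Tgt E \<psi>)"
    by (rule cocart_unique_vertical[OF \<psi>(1), of _ n, rotated 2]) (use hom(1) i(1) in simp_all)
  have "(t \<cdot>\<^bsub>E\<^esub> t') \<cdot>\<^bsub>E\<^esub> \<psi>' = Ident E (Tgt E \<psi>') \<cdot>\<^bsub>E\<^esub> \<psi>'"
    using cmp_assoc[OF E_cat A(2) t'E(1) tE(1)] tE t'E t(2) t'(2) A by (simp add: Ident_cmp)
  then have 2: "t \<cdot>\<^bsub>E\<^esub> t' = Ident E (Tgt E \<psi>')"
    by (rule cocart_unique_vertical[OF \<psi>(2), of _ n, rotated 2]) (use hom(2) i(2) in simp_all)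
  show ?thesis
    by (rule is_isoI[OF fibre_category t(1) t'(1)]) (use 1 2 in simp_all)
qed

lemma cart_iso:
  assumes \<phi>: "cartesian X \<phi>" "cartesian X \<phi>'" and s: "Tgt E \<phi> = Tgt E \<phi>'"
    and t: "t \<in> hom (fibre X n) (Src E \<phi>') (Src E \<phi>)" "\<phi> \<cdot>\<^bsub>E\<^esub> t = \<phi>'"
  shows "is_iso (fibre X n) t"
proof -
  have A: "\<phi> \<in> Ar E" "\<phi>' \<in> Ar E" using \<phi> by (auto simp: cartesian_def)
  have tE: "t \<in> Ar E" "Src E t = Src E \<phi>'" "Tgt E t = Src E \<phi>" "pr t = Ident uDelta n"
    using t by (auto simp: fibre_hom in_hom)
  have p: "pr \<phi> = pr \<phi>'" using pr_cmp_vertical(1)[of t \<phi> n] tE A t(2) by simp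
  have n: "n = osrc (pr \<phi>)" using osrc_pr_otgt[OF tE(1) A(1)] tE by simp
  obtain t' where t': "t' \<in> hom (fibre X n) (Src E \<phi>) (Src E \<phi>')" "\<phi>' \<cdot>\<^bsub>E\<^esub> t' = \<phi>"
    by (rule cart_fill_vertical[OF \<phi>(2), of \<phi> "Src E \<phi>"]) (use A s p n in \<open>auto simp: in_hom\<close>)
  have t'E: "t' \<in> Ar E" "Src E t' = Src E \<phi>" "Tgt E t' = Src E \<phi>'" "pr t' = Ident uDelta n"
    using t' by (auto simp: fibre_hom in_hom)
  note hom = cmp_hom[OF fibre_category t(1) t'(1)] cmp_hom[OF fibre_category t'(1) t(1)]
  have obs: "Src E \<phi> \<in> Ob (fibre X n)" "Src E \<phi>' \<in> Ob (fibre X n)" using hom_Ob[OF fibre_category t(1)] by auto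
  note i = Ident_hom[OF fibre_category obs(1)] Ident_hom[OF fibre_category obs(2)]
  have "\<phi>' \<cdot>\<^bsub>E\<^esub> (t' \<cdot>\<^bsub>E\<^esub> t) = \<phi>' \<cdot>\<^bsub>E\<^esub> Ident E (Src E \<phi>')"
    using cmp_assoc[OF E_cat tE(1) t'E(1) A(2)] tE t'E t(2) t'(2) A by (simp add: cmp_Ident)
  then have 1: "t' \<cdot>\<^bsub>E\<^esub> t = Ident E (Src E \<phi>')"
    by (rule cart_unique[OF \<phi>(2), of _ "Src E \<phi>'", rotated -1]) (use hom(1) i(2) in \<open>simp_all add: fibre_hom\<close>)
  have "\<phi> \<cdot>\<^bsub>E\<^esub> (t \<cdot>\<^bsub>E\<^esub> t') = \<phi> \<cdot>\<^bsub>E\<^esub> Ident E (Src E \<phi>)"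
    using cmp_assoc[OF E_cat t'E(1) tE(1) A(1)] tE t'E t(2) t'(2) A by (simp add: cmp_Ident)
  then have 2: "t \<cdot>\<^bsub>E\<^esub> t' = Ident E (Src E \<phi>)"
    by (rule cart_unique[OF \<phi>(1), of _ "Src E \<phi>", rotated -1]) (use hom(2) i(1) in \<open>simp_all add: fibre_hom\<close>)
  show ?thesis
    by (rule is_isoI[OF fibre_category t(1) t'(1)]) (use 1 2 in simp_all)
qed

text \<open>A test arrow is factored first through \<psi>, over \<open>h\<close> after the base map
  of \<psi>', and the result is factored through \<psi>' over \<open>h\<close>.\<close>

lemma cocart_cmp:
  assumes \<psi>: "cocartesian X \<psi>" and \<psi>': "cocartesian X \<psi>'" and s: "Tgt E \<psi> = Src E \<psi>'"
  shows "cocartesian X (\<psi>' \<cdot>\<^bsub>E\<^esub> \<psi>)"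
proof -
  have A: "\<psi> \<in> Ar E" "\<psi>' \<in> Ar E" using \<psi> \<psi>' by (auto simp: cocartesian_def)
  have o: "osrc (pr \<psi>') = otgt (pr \<psi>)" using osrc_pr_otgt[OF A s] .
  note [simp] = A s cat_simps pr_simps
  show ?thesis
    unfolding cocartesian_def
  proof (intro conjI ballI impI ex_ex1I)
    fix z \<xi> h assume z: "z \<in> Ob E" and \<xi>: "\<xi> \<in> hom E (Src E (\<psi>' \<cdot>\<^bsub>E\<^esub> \<psi>)) z"
      and h: "h \<in> hom uDelta (FOb (proj X) (Tgt E (\<psi>' \<cdot>\<^bsub>E\<^esub> \<psi>))) (FOb (proj X) z)"
      and e: "pr \<xi> = h \<cdot>\<^bsub>uDelta\<^esub> pr (\<psi>' \<cdot>\<^bsub>E\<^esub> \<psi>)"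
    have [simp]: "\<xi> \<in> Ar E" "Src E \<xi> = Src E \<psi>" "Tgt E \<xi> = z" using \<xi> by (auto simp: in_hom)
    have [simp]: "FOb (proj X) z = otgt (pr \<xi>)" using pr_simps(3)[of \<xi>] by simp
    have [simp]: "h \<in> Ar uDelta" "osrc h = otgt (pr \<psi>')" "otgt h = otgt (pr \<xi>)" using h by (auto simp: in_hom)
    have e': "pr \<xi> = (h \<cdot>\<^bsub>uDelta\<^esub> pr \<psi>') \<cdot>\<^bsub>uDelta\<^esub> pr \<psi>"
      using e o by (simp add: cmp_assoc[OF uDelta_category])
    have \<xi>': "\<xi> \<in> hom E (Src E \<psi>) z" by (simp add: in_hom)
    have h': "h \<cdot>\<^bsub>uDelta\<^esub> pr \<psi>' \<in> Ar uDelta" by (rule uDelta_closed) simp_all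
    obtain \<chi>1 where 1: "\<chi>1 \<in> hom E (Tgt E \<psi>) z" "pr \<chi>1 = h \<cdot>\<^bsub>uDelta\<^esub> pr \<psi>'" "\<chi>1 \<cdot>\<^bsub>E\<^esub> \<psi> = \<xi>"
      by (rule cocart_fill[OF \<psi> \<xi>' h' _ _ e']) (simp_all add: o)
    obtain \<chi>2 where 2: "\<chi>2 \<in> hom E (Tgt E \<psi>') z" "pr \<chi>2 = h" "\<chi>2 \<cdot>\<^bsub>E\<^esub> \<psi>' = \<chi>1"
      by (rule cocart_fill[OF \<psi>' 1(1)[unfolded s] _ _ _ 1(2)]) (simp_all add: 1(2))
    show "\<exists>\<chi>. \<chi> \<in> hom E (Tgt E (\<psi>' \<cdot>\<^bsub>E\<^esub> \<psi>)) z \<and> pr \<chi> = h \<and> \<chi> \<cdot>\<^bsub>E\<^esub> (\<psi>' \<cdot>\<^bsub>E\<^esub> \<psi>) = \<xi>"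
    proof (intro exI[of _ \<chi>2] conjI)
      have "\<chi>2 \<cdot>\<^bsub>E\<^esub> (\<psi>' \<cdot>\<^bsub>E\<^esub> \<psi>) = (\<chi>2 \<cdot>\<^bsub>E\<^esub> \<psi>') \<cdot>\<^bsub>E\<^esub> \<psi>"
        by (rule cmp_assoc[OF E_cat, symmetric]) (use 2(1) in \<open>auto simp: in_hom\<close>)
      then show "\<chi>2 \<cdot>\<^bsub>E\<^esub> (\<psi>' \<cdot>\<^bsub>E\<^esub> \<psi>) = \<xi>" by (simp only: 1(3) 2(3))
    qed (use 2(1,2) in simp_all)
    show "\<chi> = \<chi>'" if "\<chi> \<in> hom E (Tgt E (\<psi>' \<cdot>\<^bsub>E\<^esub> \<psi>)) z \<and> pr \<chi> = h \<and> \<chi> \<cdot>\<^bsub>E\<^esub> (\<psi>' \<cdot>\<^bsub>E\<^esub> \<psi>) = \<xi>"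
      "\<chi>' \<in> hom E (Tgt E (\<psi>' \<cdot>\<^bsub>E\<^esub> \<psi>)) z \<and> pr \<chi>' = h \<and> \<chi>' \<cdot>\<^bsub>E\<^esub> (\<psi>' \<cdot>\<^bsub>E\<^esub> \<psi>) = \<xi>" for \<chi> \<chi>'
    proof (rule cocart_unique[OF \<psi>', of _ z])
      have \<chi>: "\<chi> \<in> Ar E" "Src E \<chi> = Tgt E \<psi>'" "Tgt E \<chi> = z" "\<chi>' \<in> Ar E" "Src E \<chi>' = Tgt E \<psi>'" "Tgt E \<chi>' = z"
        "pr \<chi> = pr \<chi>'" using that by (auto simp: in_hom)
      then show "\<chi> \<in> hom E (Tgt E \<psi>') z" "\<chi>' \<in> hom E (Tgt E \<psi>') z" "pr \<chi> = pr \<chi>'" by (auto simp: in_hom)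
      have "(\<chi> \<cdot>\<^bsub>E\<^esub> \<psi>') \<cdot>\<^bsub>E\<^esub> \<psi> = (\<chi>' \<cdot>\<^bsub>E\<^esub> \<psi>') \<cdot>\<^bsub>E\<^esub> \<psi>" using that \<chi> by simp
      then show "\<chi> \<cdot>\<^bsub>E\<^esub> \<psi>' = \<chi>' \<cdot>\<^bsub>E\<^esub> \<psi>'"
        by (rule cocart_unique[OF \<psi>, of _ z, rotated -1]) (use \<chi> in \<open>auto simp: in_hom\<close>)
    qed
  qed simp
qed

lemma cart_cmp:
  assumes \<phi>: "cartesian X \<phi>" and \<phi>': "cartesian X \<phi>'" and s: "Tgt E \<phi> = Src E \<phi>'"
  shows "cartesian X (\<phi>' \<cdot>\<^bsub>E\<^esub> \<phi>)"
proof -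
  have A: "\<phi> \<in> Ar E" "\<phi>' \<in> Ar E" using \<phi> \<phi>' by (auto simp: cartesian_def)
  have o: "osrc (pr \<phi>') = otgt (pr \<phi>)" using osrc_pr_otgt[OF A s] .
  note [simp] = A s cat_simps pr_simps
  show ?thesis
    unfolding cartesian_def
  proof (intro conjI ballI impI ex_ex1I)
    fix z \<xi> h assume z: "z \<in> Ob E" and \<xi>: "\<xi> \<in> hom E z (Tgt E (\<phi>' \<cdot>\<^bsub>E\<^esub> \<phi>))"
      and h: "h \<in> hom uDelta (FOb (proj X) z) (FOb (proj X) (Src E (\<phi>' \<cdot>\<^bsub>E\<^esub> \<phi>)))"
      and e: "pr \<xi> = pr (\<phi>' \<cdot>\<^bsub>E\<^esub> \<phi>) \<cdot>\<^bsub>uDelta\<^esub> h"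
    have [simp]: "\<xi> \<in> Ar E" "Src E \<xi> = z" "Tgt E \<xi> = Tgt E \<phi>'" using \<xi> by (auto simp: in_hom)
    have [simp]: "FOb (proj X) z = osrc (pr \<xi>)" using pr_simps(2)[of \<xi>] by simp
    have [simp]: "h \<in> Ar uDelta" "otgt h = osrc (pr \<phi>)" "osrc h = osrc (pr \<xi>)" using h by (auto simp: in_hom)
    have e': "pr \<xi> = pr \<phi>' \<cdot>\<^bsub>uDelta\<^esub> (pr \<phi> \<cdot>\<^bsub>uDelta\<^esub> h)"
      using e o by (simp add: cmp_assoc[OF uDelta_category])
    have \<xi>': "\<xi> \<in> hom E z (Tgt E \<phi>')" by (simp add: in_hom)
    have h': "pr \<phi> \<cdot>\<^bsub>uDelta\<^esub> h \<in> Ar uDelta" by (rule uDelta_closed) simp_all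
    obtain \<chi>1 where 1: "\<chi>1 \<in> hom E z (Src E \<phi>')" "pr \<chi>1 = pr \<phi> \<cdot>\<^bsub>uDelta\<^esub> h" "\<phi>' \<cdot>\<^bsub>E\<^esub> \<chi>1 = \<xi>"
      by (rule cart_fill[OF \<phi>' \<xi>' h' _ _ e']) (simp_all add: o)
    obtain \<chi>2 where 2: "\<chi>2 \<in> hom E z (Src E \<phi>)" "pr \<chi>2 = h" "\<phi> \<cdot>\<^bsub>E\<^esub> \<chi>2 = \<chi>1"
      by (rule cart_fill[OF \<phi> 1(1)[folded s] _ _ _ 1(2)]) (simp_all add: 1(2))
    show "\<exists>\<chi>. \<chi> \<in> hom E z (Src E (\<phi>' \<cdot>\<^bsub>E\<^esub> \<phi>)) \<and> pr \<chi> = h \<and> (\<phi>' \<cdot>\<^bsub>E\<^esub> \<phi>) \<cdot>\<^bsub>E\<^esub> \<chi> = \<xi>"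
      using 1 2 by (intro exI[of _ \<chi>2]) (auto simp: in_hom)
    show "\<chi> = \<chi>'" if "\<chi> \<in> hom E z (Src E (\<phi>' \<cdot>\<^bsub>E\<^esub> \<phi>)) \<and> pr \<chi> = h \<and> (\<phi>' \<cdot>\<^bsub>E\<^esub> \<phi>) \<cdot>\<^bsub>E\<^esub> \<chi> = \<xi>"
      "\<chi>' \<in> hom E z (Src E (\<phi>' \<cdot>\<^bsub>E\<^esub> \<phi>)) \<and> pr \<chi>' = h \<and> (\<phi>' \<cdot>\<^bsub>E\<^esub> \<phi>) \<cdot>\<^bsub>E\<^esub> \<chi>' = \<xi>" for \<chi> \<chi>'
    proof (rule cart_unique[OF \<phi>, of _ z])
      have \<chi>: "\<chi> \<in> Ar E" "Src E \<chi> = z" "Tgt E \<chi> = Src E \<phi>" "\<chi>' \<in> Ar E" "Src E \<chi>' = z" "Tgt E \<chi>' = Src E \<phi>"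
        "pr \<chi> = pr \<chi>'" using that by (auto simp: in_hom)
      then show "\<chi> \<in> hom E z (Src E \<phi>)" "\<chi>' \<in> hom E z (Src E \<phi>)" "pr \<chi> = pr \<chi>'" by (auto simp: in_hom)
      have "\<phi>' \<cdot>\<^bsub>E\<^esub> (\<phi> \<cdot>\<^bsub>E\<^esub> \<chi>) = \<phi>' \<cdot>\<^bsub>E\<^esub> (\<phi> \<cdot>\<^bsub>E\<^esub> \<chi>')" using that \<chi> by simp
      then show "\<phi> \<cdot>\<^bsub>E\<^esub> \<chi> = \<phi> \<cdot>\<^bsub>E\<^esub> \<chi>'"
        by (rule cart_unique[OF \<phi>', of _ z, rotated -1]) (use \<chi> in \<open>auto simp: in_hom\<close>)
    qed
  qed simp
qed

text \<open>Used for the arrow that connects the left leg of a composite span with the left leg of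
  its first constituent: Beck--Chevalley applies to it only once it is known to be
  cartesian.\<close>

lemma cart_cancel:
  assumes \<phi>: "cartesian X \<phi>" and c: "cartesian X (\<phi> \<cdot>\<^bsub>E\<^esub> u)" and u: "u \<in> Ar E" "Tgt E u = Src E \<phi>"
  shows "cartesian X u"
proof -
  have A: "\<phi> \<in> Ar E" using \<phi> by (auto simp: cartesian_def)
  have o: "osrc (pr \<phi>) = otgt (pr u)" using osrc_pr_otgt[OF u(1) A u(2)] .
  note [simp] = A u cat_simps pr_simps
  show ?thesis
    unfolding cartesian_def
  proof (intro conjI ballI impI ex_ex1I)
    fix z \<xi> h assume z: "z \<in> Ob E" and \<xi>: "\<xi> \<in> hom E z (Tgt E u)"
      and h: "h \<in> hom uDelta (FOb (proj X) z) (FOb (proj X) (Src E u))" and e: "pr \<xi> = pr u \<cdot>\<^bsub>uDelta\<^esub> h"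
    have [simp]: "\<xi> \<in> Ar E" "Src E \<xi> = z" "Tgt E \<xi> = Src E \<phi>" using \<xi> by (auto simp: in_hom)
    have [simp]: "FOb (proj X) z = osrc (pr \<xi>)" using pr_simps(2)[of \<xi>] by simp
    have [simp]: "h \<in> Ar uDelta" "otgt h = osrc (pr u)" "osrc h = osrc (pr \<xi>)" using h by (auto simp: in_hom)
    have e': "pr (\<phi> \<cdot>\<^bsub>E\<^esub> \<xi>) = pr (\<phi> \<cdot>\<^bsub>E\<^esub> u) \<cdot>\<^bsub>uDelta\<^esub> h"
      using e o by (simp add: cmp_assoc[OF uDelta_category])
    have "\<phi> \<cdot>\<^bsub>E\<^esub> \<xi> \<in> hom E z (Tgt E (\<phi> \<cdot>\<^bsub>E\<^esub> u))" "h \<in> Ar uDelta" "osrc h = osrc (pr (\<phi> \<cdot>\<^bsub>E\<^esub> \<xi>))"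
      "otgt h = osrc (pr (\<phi> \<cdot>\<^bsub>E\<^esub> u))"
      by (simp_all add: in_hom)
    from cart_fill[OF c this e'] obtain w where "w \<in> hom E z (Src E (\<phi> \<cdot>\<^bsub>E\<^esub> u))"
      and w: "pr w = h" "(\<phi> \<cdot>\<^bsub>E\<^esub> u) \<cdot>\<^bsub>E\<^esub> w = \<phi> \<cdot>\<^bsub>E\<^esub> \<xi>" by blast
    then have w1: "w \<in> hom E z (Src E u)" by simp
    have [simp]: "w \<in> Ar E" "Src E w = z" "Tgt E w = Src E u" using w1 by (auto simp: in_hom)
    \<comment> \<open>The factorization was obtained after composing with \<phi>; as \<phi> is
      cartesian and the projections agree, it holds before composing.\<close>
    have "u \<cdot>\<^bsub>E\<^esub> w = \<xi>"
    proof (rule cart_unique[OF \<phi>, of _ z])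
      show "pr (u \<cdot>\<^bsub>E\<^esub> w) = pr \<xi>" by (simp add: w(1) e)
      show "\<phi> \<cdot>\<^bsub>E\<^esub> (u \<cdot>\<^bsub>E\<^esub> w) = \<phi> \<cdot>\<^bsub>E\<^esub> \<xi>" using w(2) by simp
    qed (simp_all add: in_hom)
    then show "\<exists>\<chi>. \<chi> \<in> hom E z (Src E u) \<and> pr \<chi> = h \<and> u \<cdot>\<^bsub>E\<^esub> \<chi> = \<xi>" using w w1 by blast
    show "\<chi> = \<chi>'" if "\<chi> \<in> hom E z (Src E u) \<and> pr \<chi> = h \<and> u \<cdot>\<^bsub>E\<^esub> \<chi> = \<xi>"
      "\<chi>' \<in> hom E z (Src E u) \<and> pr \<chi>' = h \<and> u \<cdot>\<^bsub>E\<^esub> \<chi>' = \<xi>" for \<chi> \<chi>'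
    proof (rule cart_unique[OF c, of _ z])
      have \<chi>: "\<chi> \<in> Ar E" "Src E \<chi> = z" "Tgt E \<chi> = Src E u" "\<chi>' \<in> Ar E" "Src E \<chi>' = z" "Tgt E \<chi>' = Src E u"
        using that by (auto simp: in_hom)
      show "(\<phi> \<cdot>\<^bsub>E\<^esub> u) \<cdot>\<^bsub>E\<^esub> \<chi> = (\<phi> \<cdot>\<^bsub>E\<^esub> u) \<cdot>\<^bsub>E\<^esub> \<chi>'" using that by (simp add: \<chi>)
    qed (use that in simp_all)
  qed simp
qed

text \<open>With closure under composition, this allows lifts to be altered by vertical isomorphisms
  at either end, and hence chosen lifts to be exchanged for arbitrary ones.\<close>

lemma vertical_iso_bicartesian:
  assumes t: "is_iso (fibre X n) t"
  shows "cocartesian X t" "cartesian X t"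
proof -
  have A: "t \<in> Ar (fibre X n)" using is_iso_Ar[OF fibre_category t] .
  obtain t' where t': "t' \<in> hom (fibre X n) (Tgt E t) (Src E t)" "t' \<cdot>\<^bsub>E\<^esub> t = Ident E (Src E t)" "t \<cdot>\<^bsub>E\<^esub> t' = Ident E (Tgt E t)"
    using t by (auto simp: is_iso_def inverse_ars_def)
  note [simp] = cat_simps pr_simps
  have [simp]: "t \<in> Ar E" "t' \<in> Ar E" "Src E t' = Tgt E t" "Tgt E t' = Src E t" "pr t = Ident uDelta n" "pr t' = Ident uDelta n"
    using A t' by (auto simp: fibre_Ar fibre_hom in_hom)
  have *: "(\<xi> \<cdot>\<^bsub>E\<^esub> t') \<cdot>\<^bsub>E\<^esub> t = \<xi>" if "\<xi> \<in> Ar E" "Src E \<xi> = Src E t" for \<xi> using that t' by simp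
  have **: "(\<xi> \<cdot>\<^bsub>E\<^esub> t) \<cdot>\<^bsub>E\<^esub> t' = \<xi>" if "\<xi> \<in> Ar E" "Src E \<xi> = Tgt E t" for \<xi> using that t' by simp
  have ***: "t \<cdot>\<^bsub>E\<^esub> (t' \<cdot>\<^bsub>E\<^esub> \<xi>) = \<xi>" if "\<xi> \<in> Ar E" "Tgt E \<xi> = Tgt E t" for \<xi>
    using that t' cmp_assoc[OF E_cat, of \<xi> t' t] by simp
  have ****: "t' \<cdot>\<^bsub>E\<^esub> (t \<cdot>\<^bsub>E\<^esub> \<xi>) = \<xi>" if "\<xi> \<in> Ar E" "Tgt E \<xi> = Src E t" for \<xi>
    using that t' cmp_assoc[OF E_cat, of \<xi> t t'] by simp
  show "cocartesian X t"
    unfolding cocartesian_def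
  proof (intro conjI ballI impI ex_ex1I)
    fix z \<xi> h assume \<xi>: "\<xi> \<in> hom E (Src E t) z" and h: "h \<in> hom uDelta (FOb (proj X) (Tgt E t)) (FOb (proj X) z)"
      and e: "pr \<xi> = h \<cdot>\<^bsub>uDelta\<^esub> pr t"
    have "pr \<xi> = h" using h e by (simp add: in_hom cmp_Ident uDelta_category)
    moreover have "osrc (pr \<xi>) = n" using \<xi> pr_simps(2)[of \<xi>] by (simp add: in_hom)
    ultimately show "\<exists>\<chi>. \<chi> \<in> hom E (Tgt E t) z \<and> pr \<chi> = h \<and> \<chi> \<cdot>\<^bsub>E\<^esub> t = \<xi>"
      using \<xi> t' by (intro exI[of _ "\<xi> \<cdot>\<^bsub>E\<^esub> t'"]) (auto simp: in_hom cmp_Ident uDelta_category)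
    show "\<chi> = \<chi>'" if "\<chi> \<in> hom E (Tgt E t) z \<and> pr \<chi> = h \<and> \<chi> \<cdot>\<^bsub>E\<^esub> t = \<xi>"
      "\<chi>' \<in> hom E (Tgt E t) z \<and> pr \<chi>' = h \<and> \<chi>' \<cdot>\<^bsub>E\<^esub> t = \<xi>" for \<chi> \<chi>'
      using that **[of \<chi>] **[of \<chi>'] by (simp add: in_hom)
  qed simp
  show "cartesian X t"
    unfolding cartesian_def
  proof (intro conjI ballI impI ex_ex1I)
    fix z \<xi> h assume \<xi>: "\<xi> \<in> hom E z (Tgt E t)" and h: "h \<in> hom uDelta (FOb (proj X) z) (FOb (proj X) (Src E t))"
      and e: "pr \<xi> = pr t \<cdot>\<^bsub>uDelta\<^esub> h"
    have "pr \<xi> = h" using h e by (simp add: in_hom Ident_cmp uDelta_category)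
    moreover have "otgt (pr \<xi>) = n" using \<xi> pr_simps(3)[of \<xi>] by (simp add: in_hom)
    ultimately show "\<exists>\<chi>. \<chi> \<in> hom E z (Src E t) \<and> pr \<chi> = h \<and> t \<cdot>\<^bsub>E\<^esub> \<chi> = \<xi>"
      using \<xi> ***[of \<xi>] t' by (intro exI[of _ "t' \<cdot>\<^bsub>E\<^esub> \<xi>"]) (auto simp: in_hom Ident_cmp uDelta_category)
    show "\<chi> = \<chi>'" if "\<chi> \<in> hom E z (Src E t) \<and> pr \<chi> = h \<and> t \<cdot>\<^bsub>E\<^esub> \<chi> = \<xi>"
      "\<chi>' \<in> hom E z (Src E t) \<and> pr \<chi>' = h \<and> t \<cdot>\<^bsub>E\<^esub> \<chi>' = \<xi>" for \<chi> \<chi>'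
      using that ****[of \<chi>] ****[of \<chi>'] by (auto simp: in_hom)
  qed simp
qed

end

section \<open>The action of a cleavage\<close>

locale cleaved_fibration = fibration X for X :: "('o, 'a) fib" +
  fixes \<kappa> :: "('o, 'a) cleavage"
  assumes cleavage: "is_cleavage X \<kappa>"
begin

lemma cocart_props:
  assumes "f \<in> Ar uDelta" "x \<in> Ob (fibre X (osrc f))"
  shows "cocartesian X (cocart \<kappa> f x)" "cocart \<kappa> f x \<in> Ar E" "Src E (cocart \<kappa> f x) = x"
    "pr (cocart \<kappa> f x) = f" "Tgt E (cocart \<kappa> f x) \<in> Ob (fibre X (otgt f))"
proof -
  show c: "cocartesian X (cocart \<kappa> f x)" and "Src E (cocart \<kappa> f x) = x" and p: "pr (cocart \<kappa> f x) = f"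
    using cleavage assms by (auto simp: is_cleavage_def cocart_lift_def)
  show A: "cocart \<kappa> f x \<in> Ar E" using c by (simp add: cocartesian_def)
  show "Tgt E (cocart \<kappa> f x) \<in> Ob (fibre X (otgt f))" using Tgt_fibre[OF A] p by simp
qed

lemma cart_props:
  assumes "convex f" "x \<in> Ob (fibre X (otgt f))"
  shows "cartesian X (cart \<kappa> f x)" "cart \<kappa> f x \<in> Ar E" "Tgt E (cart \<kappa> f x) = x"
    "pr (cart \<kappa> f x) = f" "Src E (cart \<kappa> f x) \<in> Ob (fibre X (osrc f))"
proof -
  show c: "cartesian X (cart \<kappa> f x)" and "Tgt E (cart \<kappa> f x) = x" and p: "pr (cart \<kappa> f x) = f"
    using cleavage assms by (auto simp: is_cleavage_def cart_lift_def)
  show A: "cart \<kappa> f x \<in> Ar E" using c by (simp add: cartesian_def)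
  show "Src E (cart \<kappa> f x) \<in> Ob (fibre X (osrc f))" using Src_fibre[OF A] p by simp
qed

section \<open>The functors given by a cleavage\<close>

lemma push_Ob: "x \<in> Ob (fibre X (osrc f)) \<Longrightarrow> FOb (push X \<kappa> f) x = Tgt E (cocart \<kappa> f x)"
  by (simp add: push_def Let_def)

lemma pull_Ob: "x \<in> Ob (fibre X (otgt f)) \<Longrightarrow> FOb (pull X \<kappa> f) x = Src E (cart \<kappa> f x)"
  by (simp add: pull_def Let_def)

text \<open>Cocartesian uniqueness evaluates the definite description in \<open>push\<close>. Each
  functor law then becomes the verification of one commuting square.\<close>

lemma push_eqI:
  assumes f: "f \<in> Ar uDelta" and v: "v \<in> hom (fibre X (osrc f)) x x'"
    and t: "t \<in> hom (fibre X (otgt f)) (Tgt E (cocart \<kappa> f x)) (Tgt E (cocart \<kappa> f x'))"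
    and e: "t \<cdot>\<^bsub>E\<^esub> cocart \<kappa> f x = cocart \<kappa> f x' \<cdot>\<^bsub>E\<^esub> v"
  shows "FAr (push X \<kappa> f) v = t"
proof -
  have x: "x \<in> Ob (fibre X (osrc f))" using hom_Ob[OF fibre_category v] by simp
  have "v \<in> Ar (fibre X (osrc f))" "Src E v = x" "Tgt E v = x'" using v by (auto simp: in_hom)
  then have "FAr (push X \<kappa> f) v = (THE t. t \<in> hom (fibre X (otgt f)) (Tgt E (cocart \<kappa> f x)) (Tgt E (cocart \<kappa> f x')) \<and>
      t \<cdot>\<^bsub>E\<^esub> cocart \<kappa> f x = cocart \<kappa> f x' \<cdot>\<^bsub>E\<^esub> v)"
    by (simp add: push_def Let_def del: fibre_Ar)
  also have "\<dots> = t"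
  proof (rule the_equality)
    fix s assume "s \<in> hom (fibre X (otgt f)) (Tgt E (cocart \<kappa> f x)) (Tgt E (cocart \<kappa> f x')) \<and>
      s \<cdot>\<^bsub>E\<^esub> cocart \<kappa> f x = cocart \<kappa> f x' \<cdot>\<^bsub>E\<^esub> v"
    then show "s = t" using e by (intro cocart_unique_vertical[OF cocart_props(1)[OF f x] _ t]) auto
  qed (use t e in blast)
  finally show ?thesis .
qed

lemma push_Ar:
  assumes f: "f \<in> Ar uDelta" and v: "v \<in> hom (fibre X (osrc f)) x x'"
  shows "FAr (push X \<kappa> f) v \<in> hom (fibre X (otgt f)) (Tgt E (cocart \<kappa> f x)) (Tgt E (cocart \<kappa> f x'))"
    "FAr (push X \<kappa> f) v \<cdot>\<^bsub>E\<^esub> cocart \<kappa> f x = cocart \<kappa> f x' \<cdot>\<^bsub>E\<^esub> v"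
proof -
  have x: "x \<in> Ob (fibre X (osrc f))" "x' \<in> Ob (fibre X (osrc f))" using hom_Ob[OF fibre_category v] by auto
  have vE: "v \<in> Ar E" "Src E v = x" "Tgt E v = x'" "pr v = Ident uDelta (osrc f)" using v by (auto simp: in_hom)
  note c = cocart_props[OF f x(1)] and c' = cocart_props[OF f x(2)]
  have "cocart \<kappa> f x' \<cdot>\<^bsub>E\<^esub> v \<in> hom E (Src E (cocart \<kappa> f x)) (Tgt E (cocart \<kappa> f x'))"
    using vE c c' by (simp add: in_hom cat_simps)
  moreover have "pr (cocart \<kappa> f x' \<cdot>\<^bsub>E\<^esub> v) = pr (cocart \<kappa> f x)"
    using pr_cmp_vertical(1)[OF vE(1) c'(2) _ vE(4)] vE(3) c(4) c'(3,4) by simp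
  moreover have "otgt f = otgt (pr (cocart \<kappa> f x))" using c by simp
  ultimately obtain t where t: "t \<in> hom (fibre X (otgt f)) (Tgt E (cocart \<kappa> f x)) (Tgt E (cocart \<kappa> f x'))"
    "t \<cdot>\<^bsub>E\<^esub> cocart \<kappa> f x = cocart \<kappa> f x' \<cdot>\<^bsub>E\<^esub> v"
    by (rule cocart_fill_vertical[OF c(1)])
  then show "FAr (push X \<kappa> f) v \<in> hom (fibre X (otgt f)) (Tgt E (cocart \<kappa> f x)) (Tgt E (cocart \<kappa> f x'))"
    "FAr (push X \<kappa> f) v \<cdot>\<^bsub>E\<^esub> cocart \<kappa> f x = cocart \<kappa> f x' \<cdot>\<^bsub>E\<^esub> v"
    using push_eqI[OF f v t] by auto
qed

lemma push_functor:
  assumes f: "f \<in> Ar uDelta"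
  shows "is_functor (fibre X (osrc f)) (fibre X (otgt f)) (push X \<kappa> f)"
proof (rule is_functorI)
  note p = cocart_props[OF f]
  show "FAr (push X \<kappa> f) v \<in> hom (fibre X (otgt f)) (FOb (push X \<kappa> f) x) (FOb (push X \<kappa> f) y)"
    if "v \<in> hom (fibre X (osrc f)) x y" for v x y
    using push_Ar(1)[OF f that] hom_Ob[OF fibre_category that] by (simp add: push_Ob)
  show "FAr (push X \<kappa> f) (Ident (fibre X (osrc f)) x) = Ident (fibre X (otgt f)) (FOb (push X \<kappa> f) x)"
    if x: "x \<in> Ob (fibre X (osrc f))" for x
    using Ident_hom[OF fibre_category x] Ident_hom[OF fibre_category p(5)[OF x]]
      Ident_cmp[OF E_cat p(2)[OF x] refl] cmp_Ident[OF E_cat p(2,3)[OF x]]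
    by (intro push_eqI[OF f, of _ x x]) (simp_all add: push_Ob[OF x])
  fix v w x y z assume v: "v \<in> hom (fibre X (osrc f)) x y" and w: "w \<in> hom (fibre X (osrc f)) y z"
  have ob: "x \<in> Ob (fibre X (osrc f))" "y \<in> Ob (fibre X (osrc f))" "z \<in> Ob (fibre X (osrc f))"
    using hom_Ob[OF fibre_category v] hom_Ob[OF fibre_category w] by auto
  note pv = push_Ar[OF f v] and pw = push_Ar[OF f w]
  have "FAr (push X \<kappa> f) (w \<cdot>\<^bsub>E\<^esub> v) = FAr (push X \<kappa> f) w \<cdot>\<^bsub>E\<^esub> FAr (push X \<kappa> f) v"
  proof (rule push_eqI[OF f])
    show "w \<cdot>\<^bsub>E\<^esub> v \<in> hom (fibre X (osrc f)) x z" using cmp_hom[OF fibre_category v w] by simp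
    show "FAr (push X \<kappa> f) w \<cdot>\<^bsub>E\<^esub> FAr (push X \<kappa> f) v \<in>
        hom (fibre X (otgt f)) (Tgt E (cocart \<kappa> f x)) (Tgt E (cocart \<kappa> f z))"
      using cmp_hom[OF fibre_category pv(1) pw(1)] by simp
    show "(FAr (push X \<kappa> f) w \<cdot>\<^bsub>E\<^esub> FAr (push X \<kappa> f) v) \<cdot>\<^bsub>E\<^esub> cocart \<kappa> f x = cocart \<kappa> f z \<cdot>\<^bsub>E\<^esub> (w \<cdot>\<^bsub>E\<^esub> v)"
      by (rule square_paste[OF E_cat _ _ _ _ _ _ _ pv(2) pw(2)])
        (use v w pv(1) pw(1) p[OF ob(1)] p[OF ob(2)] p[OF ob(3)] in \<open>auto simp: fibre_hom intro: homI\<close>)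
  qed
  then show "FAr (push X \<kappa> f) (w \<cdot>\<^bsub>fibre X (osrc f)\<^esub> v) = FAr (push X \<kappa> f) w \<cdot>\<^bsub>fibre X (otgt f)\<^esub> FAr (push X \<kappa> f) v"
    by simp
qed (use cocart_props[OF f] in \<open>auto simp: fibre_category push_Ob simp del: fibre_Ar, auto simp: push_def Let_def\<close>)

lemma pull_eqI:
  assumes f: "convex f" and v: "v \<in> hom (fibre X (otgt f)) x x'"
    and t: "t \<in> hom (fibre X (osrc f)) (Src E (cart \<kappa> f x)) (Src E (cart \<kappa> f x'))"
    and e: "v \<cdot>\<^bsub>E\<^esub> cart \<kappa> f x = cart \<kappa> f x' \<cdot>\<^bsub>E\<^esub> t"
  shows "FAr (pull X \<kappa> f) v = t"
proof -
  have x: "x' \<in> Ob (fibre X (otgt f))" using hom_Ob[OF fibre_category v] by simp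
  have "v \<in> Ar (fibre X (otgt f))" "Src E v = x" "Tgt E v = x'" using v by (auto simp: in_hom)
  then have "FAr (pull X \<kappa> f) v = (THE t. t \<in> hom (fibre X (osrc f)) (Src E (cart \<kappa> f x)) (Src E (cart \<kappa> f x')) \<and>
      cart \<kappa> f x' \<cdot>\<^bsub>E\<^esub> t = v \<cdot>\<^bsub>E\<^esub> cart \<kappa> f x)"
    by (simp add: pull_def Let_def del: fibre_Ar)
  also have "\<dots> = t"
  proof (rule the_equality)
    fix s assume "s \<in> hom (fibre X (osrc f)) (Src E (cart \<kappa> f x)) (Src E (cart \<kappa> f x')) \<and>
      cart \<kappa> f x' \<cdot>\<^bsub>E\<^esub> s = v \<cdot>\<^bsub>E\<^esub> cart \<kappa> f x"
    then show "s = t" using t e f cart_props[OF f x]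
      by (intro cart_monic[OF cart_props(1)[OF f x], of s "Src E (cart \<kappa> f x)" t]) (auto simp: fibre_hom)
  qed (use t e in auto)
  finally show ?thesis .
qed

lemma pull_Ar:
  assumes f: "convex f" and v: "v \<in> hom (fibre X (otgt f)) x x'"
  shows "FAr (pull X \<kappa> f) v \<in> hom (fibre X (osrc f)) (Src E (cart \<kappa> f x)) (Src E (cart \<kappa> f x'))"
    "v \<cdot>\<^bsub>E\<^esub> cart \<kappa> f x = cart \<kappa> f x' \<cdot>\<^bsub>E\<^esub> FAr (pull X \<kappa> f) v"
proof -
  have x: "x \<in> Ob (fibre X (otgt f))" "x' \<in> Ob (fibre X (otgt f))" using hom_Ob[OF fibre_category v] by auto
  have vE: "v \<in> Ar E" "Src E v = x" "Tgt E v = x'" "pr v = Ident uDelta (otgt f)" using v by (auto simp: in_hom)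
  note c = cart_props[OF f x(1)] and c' = cart_props[OF f x(2)]
  have "v \<cdot>\<^bsub>E\<^esub> cart \<kappa> f x \<in> hom E (Src E (cart \<kappa> f x)) (Tgt E (cart \<kappa> f x'))"
    using vE c c' by (simp add: in_hom cat_simps)
  moreover have "pr (v \<cdot>\<^bsub>E\<^esub> cart \<kappa> f x) = pr (cart \<kappa> f x')"
    using pr_cmp_vertical(2)[OF c(2) vE(1) _ vE(4)] vE(2) c(3,4) c'(4) by simp
  moreover have "osrc f = osrc (pr (cart \<kappa> f x'))" using c' by simp
  ultimately obtain t where t: "t \<in> hom (fibre X (osrc f)) (Src E (cart \<kappa> f x)) (Src E (cart \<kappa> f x'))"
    "cart \<kappa> f x' \<cdot>\<^bsub>E\<^esub> t = v \<cdot>\<^bsub>E\<^esub> cart \<kappa> f x"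
    by (rule cart_fill_vertical[OF c'(1)])
  then show "FAr (pull X \<kappa> f) v \<in> hom (fibre X (osrc f)) (Src E (cart \<kappa> f x)) (Src E (cart \<kappa> f x'))"
    "v \<cdot>\<^bsub>E\<^esub> cart \<kappa> f x = cart \<kappa> f x' \<cdot>\<^bsub>E\<^esub> FAr (pull X \<kappa> f) v"
    using pull_eqI[OF f v t(1) t(2)[symmetric]] by auto
qed

lemma pull_functor:
  assumes f: "convex f"
  shows "is_functor (fibre X (otgt f)) (fibre X (osrc f)) (pull X \<kappa> f)"
proof (rule is_functorI)
  note p = cart_props[OF f]
  show "FAr (pull X \<kappa> f) v \<in> hom (fibre X (osrc f)) (FOb (pull X \<kappa> f) x) (FOb (pull X \<kappa> f) y)"
    if "v \<in> hom (fibre X (otgt f)) x y" for v x y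
    using pull_Ar(1)[OF f that] hom_Ob[OF fibre_category that] by (simp add: pull_Ob)
  show "FAr (pull X \<kappa> f) (Ident (fibre X (otgt f)) x) = Ident (fibre X (osrc f)) (FOb (pull X \<kappa> f) x)"
    if x: "x \<in> Ob (fibre X (otgt f))" for x
    using Ident_hom[OF fibre_category x] Ident_hom[OF fibre_category p(5)[OF x]]
      cmp_Ident[OF E_cat p(2)[OF x] refl] Ident_cmp[OF E_cat p(2,3)[OF x]]
    by (intro pull_eqI[OF f, of _ x x]) (simp_all add: pull_Ob[OF x])
  fix v w x y z assume v: "v \<in> hom (fibre X (otgt f)) x y" and w: "w \<in> hom (fibre X (otgt f)) y z"
  have ob: "x \<in> Ob (fibre X (otgt f))" "y \<in> Ob (fibre X (otgt f))" "z \<in> Ob (fibre X (otgt f))"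
    using hom_Ob[OF fibre_category v] hom_Ob[OF fibre_category w] by auto
  note pv = pull_Ar[OF f v] and pw = pull_Ar[OF f w]
  have "FAr (pull X \<kappa> f) (w \<cdot>\<^bsub>E\<^esub> v) = FAr (pull X \<kappa> f) w \<cdot>\<^bsub>E\<^esub> FAr (pull X \<kappa> f) v"
  proof (rule pull_eqI[OF f])
    show "w \<cdot>\<^bsub>E\<^esub> v \<in> hom (fibre X (otgt f)) x z" using cmp_hom[OF fibre_category v w] by simp
    show "FAr (pull X \<kappa> f) w \<cdot>\<^bsub>E\<^esub> FAr (pull X \<kappa> f) v \<in>
        hom (fibre X (osrc f)) (Src E (cart \<kappa> f x)) (Src E (cart \<kappa> f z))"
      using cmp_hom[OF fibre_category pv(1) pw(1)] by simp
    show "(w \<cdot>\<^bsub>E\<^esub> v) \<cdot>\<^bsub>E\<^esub> cart \<kappa> f x = cart \<kappa> f z \<cdot>\<^bsub>E\<^esub> (FAr (pull X \<kappa> f) w \<cdot>\<^bsub>E\<^esub> FAr (pull X \<kappa> f) v)"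
      by (rule square_paste[OF E_cat _ _ _ _ _ _ _ pv(2) pw(2)])
        (use v w pv(1) pw(1) p[OF ob(1)] p[OF ob(2)] p[OF ob(3)] in \<open>auto simp: fibre_hom intro: homI\<close>)
  qed
  then show "FAr (pull X \<kappa> f) (w \<cdot>\<^bsub>fibre X (otgt f)\<^esub> v) = FAr (pull X \<kappa> f) w \<cdot>\<^bsub>fibre X (osrc f)\<^esub> FAr (pull X \<kappa> f) v"
    by simp
qed (use cart_props[OF f] in \<open>auto simp: fibre_category pull_Ob simp del: fibre_Ar, auto simp: pull_def Let_def\<close>)

section \<open>The action of a map of \<Delta> through spans\<close>

abbreviation lft :: "omap \<Rightarrow> 'o \<Rightarrow> 'a" where "lft h x \<equiv> span_left \<kappa> h x"
abbreviation rgt :: "omap \<Rightarrow> 'o \<Rightarrow> 'a" where "rgt h x \<equiv> span_right X \<kappa> h x"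

context
  fixes h :: omap
  assumes h: "h \<in> Ar Delta"
begin

lemma left_props:
  assumes "x \<in> Ob (fibre X (otgt h))"
  shows "cartesian X (lft h x)" "lft h x \<in> Ar E" "Tgt E (lft h x) = x" "pr (lft h x) = pull_map h"
    "Src E (lft h x) \<in> Ob (fibre X (osrc (pull_map h)))"
  using cart_props[OF pull_map_convex[OF h], of x] assms by (simp_all add: span_left_def flip: pull_map_def)

lemma right_props:
  assumes "x \<in> Ob (fibre X (otgt h))"
  shows "cocartesian X (rgt h x)" "rgt h x \<in> Ar E" "Src E (rgt h x) = Src E (lft h x)" "pr (rgt h x) = push_map h"
    "Tgt E (rgt h x) \<in> Ob (fibre X (osrc h))"
  using cocart_props[OF push_map_Ar[OF h], of "Src E (lft h x)"] left_props(5)[OF assms]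
  by (simp_all add: span_right_def flip: push_map_def)

lemma left_monic:
  assumes "x \<in> Ob (fibre X (otgt h))" "u \<in> hom E z (Src E (lft h x))" "v \<in> hom E z (Src E (lft h x))"
    "lft h x \<cdot>\<^bsub>E\<^esub> u = lft h x \<cdot>\<^bsub>E\<^esub> v"
  shows "u = v"
  using cart_monic[OF left_props(1)[OF assms(1)] _ assms(2-4)] left_props(4)[OF assms(1)] pull_map_convex[OF h] by simp

lemma right_epi:
  assumes "x \<in> Ob (fibre X (otgt h))" "t \<in> hom (fibre X (osrc h)) (Tgt E (rgt h x)) z"
    "t' \<in> hom (fibre X (osrc h)) (Tgt E (rgt h x)) z" "t \<cdot>\<^bsub>E\<^esub> rgt h x = t' \<cdot>\<^bsub>E\<^esub> rgt h x"
  shows "t = t'"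
  using cocart_unique_vertical[OF right_props(1)[OF assms(1)] assms(2-4)] .

lemma act_functor: "is_functor (fibre X (otgt h)) (fibre X (osrc h)) (act X \<kappa> h)"
proof -
  have "is_functor (fibre X (otgt h)) (fibre X (osrc (pull_map h))) (pull X \<kappa> (pull_map h))"
    using pull_functor[OF pull_map_convex[OF h]] by simp
  moreover have "is_functor (fibre X (osrc (pull_map h))) (fibre X (osrc h)) (push X \<kappa> (push_map h))"
    using push_functor[OF push_map_Ar[OF h]] by simp
  ultimately show ?thesis unfolding act_def push_map_def[symmetric] pull_map_def[symmetric] by (rule fcomp_functor)
qed

lemma act_Ob: "x \<in> Ob (fibre X (otgt h)) \<Longrightarrow> FOb (act X \<kappa> h) x = Tgt E (rgt h x)"
  using left_props(5)[of x]
  by (simp add: act_def fcomp_simps push_Ob pull_Ob span_right_def span_left_def flip: push_map_def pull_map_def)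

text \<open>On arrows the action enters later arguments in this form: \<open>w\<close> extends to a
  map of spans whose component between the apexes is \<open>u\<close>. Naturality and coherence are
  then questions about composites of such maps.\<close>

lemma act_Ar:
  assumes w: "w \<in> hom (fibre X (otgt h)) x x'"
  obtains u where "u \<in> hom E (Src E (lft h x)) (Src E (lft h x'))" "w \<cdot>\<^bsub>E\<^esub> lft h x = lft h x' \<cdot>\<^bsub>E\<^esub> u"
    "FAr (act X \<kappa> h) w \<cdot>\<^bsub>E\<^esub> rgt h x = rgt h x' \<cdot>\<^bsub>E\<^esub> u"
proof -
  have w1: "w \<in> hom (fibre X (otgt (pull_map h))) x x'" using w by simp
  note u = pull_Ar[OF pull_map_convex[OF h] w1]
  then have u': "FAr (pull X \<kappa> (pull_map h)) w \<in> hom (fibre X (osrc (push_map h))) (Src E (lft h x)) (Src E (lft h x'))"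
    by (simp add: span_left_def flip: pull_map_def)
  note t = push_Ar(2)[OF push_map_Ar[OF h] u']
  have "w \<in> Ar (fibre X (otgt h))" using w by (simp add: in_hom)
  then have "FAr (act X \<kappa> h) w = FAr (push X \<kappa> (push_map h)) (FAr (pull X \<kappa> (pull_map h)) w)"
    unfolding act_def push_map_def[symmetric] pull_map_def[symmetric] by (rule fcomp_simps(2))
  then show thesis
    using that[of "FAr (pull X \<kappa> (pull_map h)) w"] u u' t
    by (simp add: span_left_def span_right_def fibre_hom flip: pull_map_def push_map_def)
qed

lemma act_hom:
  assumes w: "w \<in> hom (fibre X (otgt h)) x x'"
  shows "FAr (act X \<kappa> h) w \<in> hom (fibre X (osrc h)) (Tgt E (rgt h x)) (Tgt E (rgt h x'))"
  using functor_hom[OF act_functor w] hom_Ob[OF fibre_category w] by (simp add: act_Ob)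

end

end

locale cleaved_sesquicartesian = cleaved_fibration X \<kappa> for X :: "('o, 'a) fib" and \<kappa> +
  assumes sesq: "sesquicartesian X"
begin

text \<open>Beck--Chevalley, freed from the cleavage.\<close>

lemma beck_chevalley_cocartesian:
  assumes pb: "pullback_square uDelta (pr \<phi>) (pr \<psi>) (pr v) (pr \<phi>')"
    and conv: "convex (pr \<phi>)" "convex (pr \<phi>')"
    and c: "cartesian X \<phi>" "cartesian X \<phi>'" "cocartesian X \<psi>"
    and v: "v \<in> hom E (Src E \<phi>') (Src E \<phi>)" and s: "Tgt E \<phi>' = Src E \<psi>" "Tgt E \<psi> = Tgt E \<phi>"
    and e: "\<phi> \<cdot>\<^bsub>E\<^esub> v = \<psi> \<cdot>\<^bsub>E\<^esub> \<phi>'"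
  shows "cocartesian X v"
proof -
  define \<tau> \<sigma> \<sigma>' \<tau>' where defs: "\<tau> = pr \<phi>" "\<sigma> = pr \<psi>" "\<sigma>' = pr v" "\<tau>' = pr \<phi>'"
  define x where "x = Src E \<psi>"
  have A: "\<phi> \<in> Ar E" "\<phi>' \<in> Ar E" "\<psi> \<in> Ar E" using c by (auto simp: cartesian_def cocartesian_def)
  have vE: "v \<in> Ar E" "Src E v = Src E \<phi>'" "Tgt E v = Src E \<phi>" using v by (auto simp: in_hom)
  have D: "\<tau> \<in> Ar uDelta" "\<sigma> \<in> Ar uDelta" "\<sigma>' \<in> Ar uDelta" "\<tau>' \<in> Ar uDelta"
    using A vE by (auto simp: defs pr_simps)
  have eq: "\<tau> \<cdot>\<^bsub>uDelta\<^esub> \<sigma>' = \<sigma> \<cdot>\<^bsub>uDelta\<^esub> \<tau>'" and bd: "otgt \<tau> = otgt \<sigma>" "osrc \<sigma>' = osrc \<tau>'" "otgt \<sigma>' = osrc \<tau>" "otgt \<tau>' = osrc \<sigma>"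
    using pb unfolding pullback_square_def defs uDelta_simps by blast+
  have x: "x \<in> Ob (fibre X (osrc \<sigma>))" "x \<in> Ob (fibre X (otgt \<tau>'))"
    using Src_fibre[OF A(3)] bd by (auto simp: x_def defs)
  have conv': "convex \<tau>" "convex \<tau>'" using conv by (auto simp: defs)
  let ?\<psi> = "cocart \<kappa> \<sigma> x"
  let ?\<phi>' = "cart \<kappa> \<tau>' x"
  note p\<psi> = cocart_props[OF D(2) x(1)] and p\<phi>' = cart_props[OF conv'(2) x(2)]
  define y where "y = Tgt E ?\<psi>"
  have y: "y \<in> Ob (fibre X (otgt \<tau>))" using p\<psi>(5) bd by (simp add: y_def)
  let ?\<phi> = "cart \<kappa> \<tau> y"
  note p\<phi> = cart_props[OF conv'(1) y]
  define x' where "x' = Src E ?\<phi>'"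
  have x': "x' \<in> Ob (fibre X (osrc \<sigma>'))" using p\<phi>'(5) bd by (simp add: x'_def)
  let ?\<psi>' = "cocart \<kappa> \<sigma>' x'"
  note p\<psi>' = cocart_props[OF D(3) x']
  note hom = homI[OF p\<psi>(2,3) y_def[symmetric]] homI[OF p\<phi>'(2) x'_def[symmetric] p\<phi>'(3)]
    homI[OF p\<phi>(2) refl p\<phi>(3)] homI[OF p\<psi>'(2,3) refl] homI[OF A(1) refl refl] homI[OF A(2) refl s(1)]
    homI[OF A(3) refl s(2)]
  \<comment> \<open>The given lifts are compared with the chosen ones by vertical isomorphisms:
    \<open>d\<close> at the target of \<psi>, \<open>a\<close> at the source of \<phi>', and
    \<open>r\<close> at the source of \<phi>.\<close>
  obtain d where d: "d \<in> hom (fibre X (otgt \<sigma>)) (Tgt E \<psi>) y" "d \<cdot>\<^bsub>E\<^esub> \<psi> = ?\<psi>"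
    by (rule cocart_fill_vertical[OF c(3), of ?\<psi> y "otgt \<sigma>"]) (use hom p\<psi> in \<open>auto simp: defs x_def\<close>)
  have d_iso: "is_iso (fibre X (otgt \<sigma>)) d"
    by (rule cocart_iso[OF c(3) p\<psi>(1) _ _ d(2)]) (use d(1) p\<psi>(3) in \<open>auto simp: x_def y_def\<close>)
  have dE: "d \<in> Ar E" "Src E d = Tgt E \<phi>" "Tgt E d = y" "pr d = Ident uDelta (otgt \<sigma>)"
    using d s(2) by (auto simp: in_hom)
  obtain a where a: "a \<in> hom (fibre X (osrc \<sigma>')) (Src E \<phi>') x'" "?\<phi>' \<cdot>\<^bsub>E\<^esub> a = \<phi>'"
    unfolding x'_def
    by (rule cart_fill_vertical[OF p\<phi>'(1), of \<phi>' "Src E \<phi>'" "osrc \<sigma>'"]) (use hom p\<phi>' bd s in \<open>auto simp: defs x_def\<close>)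
  have a_iso: "is_iso (fibre X (osrc \<sigma>')) a"
    by (rule cart_iso[OF p\<phi>'(1) c(2) _ _ a(2)]) (use a(1) p\<phi>'(3) s(1) in \<open>auto simp: x_def x'_def\<close>)
  have aE: "a \<in> hom E (Src E \<phi>') x'" using a(1) by (simp add: fibre_hom)
  \<comment> \<open>\<phi> ends at the target of \<psi>, the chosen \<open>?\<phi>\<close> at
    \<open>y\<close>. Prolonging \<phi> by \<open>d\<close> gives two cartesian lifts with the same
    end.\<close>
  have d\<phi>: "cartesian X (d \<cdot>\<^bsub>E\<^esub> \<phi>)"
    by (rule cart_cmp[OF c(1) vertical_iso_bicartesian(2)[OF d_iso]]) (use dE in simp)
  have prd\<phi>: "pr (d \<cdot>\<^bsub>E\<^esub> \<phi>) = \<tau>" using pr_cmp_vertical(2)[OF A(1) dE(1) _ dE(4)] dE(2) by (simp add: defs)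
  have d\<phi>_hom: "d \<cdot>\<^bsub>E\<^esub> \<phi> \<in> hom E (Src E \<phi>) y"
    using cmp_hom[OF E_cat hom(5)] dE by (simp add: in_hom)
  obtain r where r: "r \<in> hom (fibre X (osrc \<tau>)) (Src E \<phi>) (Src E ?\<phi>)" "?\<phi> \<cdot>\<^bsub>E\<^esub> r = d \<cdot>\<^bsub>E\<^esub> \<phi>"
    by (rule cart_fill_vertical[OF p\<phi>(1), of "d \<cdot>\<^bsub>E\<^esub> \<phi>" "Src E \<phi>" "osrc \<tau>"]) (use d\<phi>_hom prd\<phi> p\<phi> in auto)
  have r_iso: "is_iso (fibre X (osrc \<tau>)) r"
    by (rule cart_iso[OF p\<phi>(1) d\<phi> _ _ r(2)]) (use r(1) d\<phi>_hom p\<phi>(3) in \<open>auto simp: in_hom\<close>)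
  have rE: "r \<in> hom E (Src E \<phi>) (Src E ?\<phi>)" using r(1) by (simp add: fibre_hom)
  define b where "b = bc_map X \<kappa> \<tau> \<sigma> \<sigma>' \<tau>' x"
  \<comment> \<open>The one direct appeal to the Beck--Chevalley condition. The equation
    characterising \<open>b\<close> comes afterwards, by showing that its description is satisfied
    by exactly one arrow.\<close>
  have b_iso: "is_iso (fibre X (osrc \<tau>)) b"
    using sesq pb conv'(1) cleavage x(1) unfolding sesquicartesian_def beck_chevalley_def b_def defs by blast
  have bobs: "FOb (push X \<kappa> \<sigma>) x = y" "FOb (pull X \<kappa> \<tau>') x = x'" "FOb (push X \<kappa> \<sigma>') x' = Tgt E ?\<psi>'"
      "FOb (pull X \<kappa> \<tau>) y = Src E ?\<phi>"
    using x x' y by (simp_all add: push_Ob pull_Ob y_def x'_def)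
  have bdef: "b = (THE t. t \<in> hom (fibre X (osrc \<tau>)) (Tgt E ?\<psi>') (Src E ?\<phi>) \<and> ?\<phi> \<cdot>\<^bsub>E\<^esub> t \<cdot>\<^bsub>E\<^esub> ?\<psi>' = ?\<psi> \<cdot>\<^bsub>E\<^esub> ?\<phi>')"
    unfolding b_def bc_map_def Let_def bobs ..
  \<comment> \<open>Existence: the composite of the chosen lifts factors through
    \<open>?\<phi>\<close> over \<sigma>', and the result factors vertically through
    \<open>?\<psi>'\<close>. Uniqueness: the monic \<open>?\<phi>\<close> cancels on the left and
    the cocartesian \<open>?\<psi>'\<close> on the right.\<close>
  have b: "b \<in> hom (fibre X (osrc \<tau>)) (Tgt E ?\<psi>') (Src E ?\<phi>) \<and> ?\<phi> \<cdot>\<^bsub>E\<^esub> b \<cdot>\<^bsub>E\<^esub> ?\<psi>' = ?\<psi> \<cdot>\<^bsub>E\<^esub> ?\<phi>'"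
    unfolding bdef
  proof (rule theI', rule ex_ex1I)
    have "?\<psi> \<cdot>\<^bsub>E\<^esub> ?\<phi>' \<in> hom E x' (Tgt E ?\<phi>)" using cmp_hom[OF E_cat hom(2,1)] p\<phi>(3) by simp
    moreover have "pr (?\<psi> \<cdot>\<^bsub>E\<^esub> ?\<phi>') = pr ?\<phi> \<cdot>\<^bsub>uDelta\<^esub> \<sigma>'"
      using p\<psi> p\<phi>' p\<phi> eq by (simp add: pr_simps)
    moreover have "osrc \<sigma>' = osrc (pr (?\<psi> \<cdot>\<^bsub>E\<^esub> ?\<phi>'))" "otgt \<sigma>' = osrc (pr ?\<phi>)"
      using p\<psi> p\<phi>' p\<phi> bd by (simp_all add: pr_simps)
    ultimately obtain q where q: "q \<in> hom E x' (Src E ?\<phi>)" "pr q = \<sigma>'" "?\<phi> \<cdot>\<^bsub>E\<^esub> q = ?\<psi> \<cdot>\<^bsub>E\<^esub> ?\<phi>'"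
      using cart_fill[OF p\<phi>(1) _ D(3)] by metis
    obtain t where t: "t \<in> hom (fibre X (osrc \<tau>)) (Tgt E ?\<psi>') (Src E ?\<phi>)" "t \<cdot>\<^bsub>E\<^esub> ?\<psi>' = q"
      by (rule cocart_fill_vertical[OF p\<psi>'(1), of q "Src E ?\<phi>" "osrc \<tau>"]) (use q p\<psi>' bd in auto)
    then show "\<exists>t. t \<in> hom (fibre X (osrc \<tau>)) (Tgt E ?\<psi>') (Src E ?\<phi>) \<and> ?\<phi> \<cdot>\<^bsub>E\<^esub> t \<cdot>\<^bsub>E\<^esub> ?\<psi>' = ?\<psi> \<cdot>\<^bsub>E\<^esub> ?\<phi>'"
      using q(3) by blast
    fix t t' assume t: "t \<in> hom (fibre X (osrc \<tau>)) (Tgt E ?\<psi>') (Src E ?\<phi>) \<and> ?\<phi> \<cdot>\<^bsub>E\<^esub> t \<cdot>\<^bsub>E\<^esub> ?\<psi>' = ?\<psi> \<cdot>\<^bsub>E\<^esub> ?\<phi>'"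
      and t': "t' \<in> hom (fibre X (osrc \<tau>)) (Tgt E ?\<psi>') (Src E ?\<phi>) \<and> ?\<phi> \<cdot>\<^bsub>E\<^esub> t' \<cdot>\<^bsub>E\<^esub> ?\<psi>' = ?\<psi> \<cdot>\<^bsub>E\<^esub> ?\<phi>'"
    have tE: "t \<in> hom E (Tgt E ?\<psi>') (Src E ?\<phi>)" "t' \<in> hom E (Tgt E ?\<psi>') (Src E ?\<phi>)" using t t' by (auto simp: fibre_hom)
    have "t \<cdot>\<^bsub>E\<^esub> ?\<psi>' = t' \<cdot>\<^bsub>E\<^esub> ?\<psi>'"
      by (rule cart_monic[OF p\<phi>(1) _ cmp_hom[OF E_cat hom(4) tE(1)] cmp_hom[OF E_cat hom(4) tE(2)]])
        (use t t' p\<phi>(4) conv' in auto)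
    then show "t = t'" by (rule cocart_unique_vertical[OF p\<psi>'(1), rotated -1]) (use t t' in auto)
  qed
  then have bE: "b \<in> hom E (Tgt E ?\<psi>') (Src E ?\<phi>)" by (simp add: fibre_hom)
  \<comment> \<open>It suffices to compare after the monic \<open>?\<phi>\<close>. There both sides
    become \<open>?\<psi>\<close> after \<phi>', once through the given square and once through the
    chosen one.\<close>
  have r\<psi>: "r \<cdot>\<^bsub>E\<^esub> v = b \<cdot>\<^bsub>E\<^esub> (?\<psi>' \<cdot>\<^bsub>E\<^esub> a)"
  proof (rule cart_monic[OF p\<phi>(1)])
    note h1 = cmp_hom[OF E_cat v rE] and h2 = cmp_hom[OF E_cat aE hom(4)]
    show "r \<cdot>\<^bsub>E\<^esub> v \<in> hom E (Src E \<phi>') (Src E ?\<phi>)" by (rule h1)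
    show "b \<cdot>\<^bsub>E\<^esub> (?\<psi>' \<cdot>\<^bsub>E\<^esub> a) \<in> hom E (Src E \<phi>') (Src E ?\<phi>)" by (rule cmp_hom[OF E_cat h2 bE])
    have dh: "d \<in> hom E (Tgt E \<phi>) y" using dE by (simp add: in_hom)
    have "?\<phi> \<cdot>\<^bsub>E\<^esub> (r \<cdot>\<^bsub>E\<^esub> v) = (d \<cdot>\<^bsub>E\<^esub> \<phi>) \<cdot>\<^bsub>E\<^esub> v" using hom_assoc[OF E_cat v rE hom(3)] r(2) by simp
    also have "\<dots> = d \<cdot>\<^bsub>E\<^esub> (\<psi> \<cdot>\<^bsub>E\<^esub> \<phi>')" using hom_assoc[OF E_cat v hom(5) dh] e by simp
    also have "\<dots> = ?\<psi> \<cdot>\<^bsub>E\<^esub> \<phi>'" using hom_assoc[OF E_cat hom(6) hom(7) dh] d(2) by simp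
    also have "\<dots> = (?\<psi> \<cdot>\<^bsub>E\<^esub> ?\<phi>') \<cdot>\<^bsub>E\<^esub> a" using hom_assoc[OF E_cat aE hom(2) hom(1)] a(2) by simp
    also have "\<dots> = ?\<phi> \<cdot>\<^bsub>E\<^esub> (b \<cdot>\<^bsub>E\<^esub> ?\<psi>') \<cdot>\<^bsub>E\<^esub> a"
      using b hom_assoc[OF E_cat aE cmp_hom[OF E_cat hom(4) bE] hom(3)] by simp
    also have "(b \<cdot>\<^bsub>E\<^esub> ?\<psi>') \<cdot>\<^bsub>E\<^esub> a = b \<cdot>\<^bsub>E\<^esub> (?\<psi>' \<cdot>\<^bsub>E\<^esub> a)" by (rule hom_assoc[OF E_cat aE hom(4) bE])
    finally show "?\<phi> \<cdot>\<^bsub>E\<^esub> (r \<cdot>\<^bsub>E\<^esub> v) = ?\<phi> \<cdot>\<^bsub>E\<^esub> (b \<cdot>\<^bsub>E\<^esub> (?\<psi>' \<cdot>\<^bsub>E\<^esub> a))" .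
  qed (use p\<phi>(4) conv' in simp)
  define r' where "r' = inv_ar (fibre X (osrc \<tau>)) r"
  have r'_iso: "is_iso (fibre X (osrc \<tau>)) r'" unfolding r'_def by (rule is_iso_inv_ar[OF fibre_category r_iso])
  have r': "r' \<in> hom E (Src E ?\<phi>) (Src E \<phi>)" "r' \<cdot>\<^bsub>E\<^esub> r = Ident E (Src E \<phi>)"
    using inv_ar_hom[OF fibre_category r_iso r(1)] inv_ar_simps(4)[OF fibre_category r_iso] rE
    by (auto simp: r'_def fibre_hom in_hom)
  have "v = r' \<cdot>\<^bsub>E\<^esub> (r \<cdot>\<^bsub>E\<^esub> v)"
    using hom_assoc[OF E_cat v rE r'(1)] r'(2) Ident_hom_cmp[OF E_cat v] by simp
  also have "\<dots> = r' \<cdot>\<^bsub>E\<^esub> (b \<cdot>\<^bsub>E\<^esub> (?\<psi>' \<cdot>\<^bsub>E\<^esub> a))" by (simp only: r\<psi>)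
  \<comment> \<open>Up to vertical isomorphisms on both sides, \<open>v\<close> is the chosen
    cocartesian lift \<open>?\<psi>'\<close>.\<close>
  finally have v_eq: "v = r' \<cdot>\<^bsub>E\<^esub> (b \<cdot>\<^bsub>E\<^esub> (?\<psi>' \<cdot>\<^bsub>E\<^esub> a))" .
  note k1 = cmp_hom[OF E_cat aE hom(4)]
  have 1: "cocartesian X (?\<psi>' \<cdot>\<^bsub>E\<^esub> a)"
    by (rule cocart_cmp[OF vertical_iso_bicartesian(1)[OF a_iso] p\<psi>'(1)]) (use aE p\<psi>' in \<open>simp add: in_hom\<close>)
  have 2: "cocartesian X (b \<cdot>\<^bsub>E\<^esub> (?\<psi>' \<cdot>\<^bsub>E\<^esub> a))"
    by (rule cocart_cmp[OF 1 vertical_iso_bicartesian(1)[OF b_iso]]) (use bE k1 in \<open>simp add: in_hom\<close>)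
  show ?thesis
    unfolding v_eq
    by (rule cocart_cmp[OF 2 vertical_iso_bicartesian(1)[OF r'_iso]])
      (use r'(1) cmp_hom[OF E_cat k1 bE] in \<open>simp add: in_hom\<close>)
qed

section \<open>Compositors: existence, invertibility and naturality\<close>

context
  fixes h h' :: omap
  assumes h: "h \<in> Ar Delta" and h': "h' \<in> Ar Delta" and hh': "otgt h = osrc h'"
begin

abbreviation (input) "hh \<equiv> h' \<cdot>\<^bsub>Delta\<^esub> h"

lemma hh: "hh \<in> Ar Delta" by (rule Delta_closed(2)[OF h h' hh'])

lemma hh_Ob: "x \<in> Ob (fibre X (otgt h')) \<Longrightarrow> x \<in> Ob (fibre X (otgt hh))" by simp

text \<open>
  The compositor at \<open>x\<close> is the transport along the identity of \<open>x\<close>. Allowing a general \<open>w : x \<rightarrow> x'\<close>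
  makes naturality and coherence both instances of the uniqueness of transports.
\<close>

definition transport :: "'o \<Rightarrow> 'o \<Rightarrow> 'a \<Rightarrow> 'a \<Rightarrow> bool" where
  "transport x x' w t \<longleftrightarrow>
     t \<in> hom (fibre X (osrc h)) (Tgt E (rgt hh x)) (Tgt E (rgt h (Tgt E (rgt h' x')))) \<and>
     (\<exists>u v. u \<in> hom E (Src E (lft hh x)) (Src E (lft h' x')) \<and>
            v \<in> hom E (Src E (lft hh x)) (Src E (lft h (Tgt E (rgt h' x')))) \<and>
            w \<cdot>\<^bsub>E\<^esub> lft hh x = lft h' x' \<cdot>\<^bsub>E\<^esub> u \<and>
            rgt h' x' \<cdot>\<^bsub>E\<^esub> u = lft h (Tgt E (rgt h' x')) \<cdot>\<^bsub>E\<^esub> v \<and>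
            t \<cdot>\<^bsub>E\<^esub> rgt hh x = rgt h (Tgt E (rgt h' x')) \<cdot>\<^bsub>E\<^esub> v)"

lemma transportI:
  assumes "t \<in> hom (fibre X (osrc h)) (Tgt E (rgt hh x)) (Tgt E (rgt h (Tgt E (rgt h' x'))))"
    "u \<in> hom E (Src E (lft hh x)) (Src E (lft h' x'))"
    "v \<in> hom E (Src E (lft hh x)) (Src E (lft h (Tgt E (rgt h' x'))))"
    "w \<cdot>\<^bsub>E\<^esub> lft hh x = lft h' x' \<cdot>\<^bsub>E\<^esub> u"
    "rgt h' x' \<cdot>\<^bsub>E\<^esub> u = lft h (Tgt E (rgt h' x')) \<cdot>\<^bsub>E\<^esub> v"
    "t \<cdot>\<^bsub>E\<^esub> rgt hh x = rgt h (Tgt E (rgt h' x')) \<cdot>\<^bsub>E\<^esub> v"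
  shows "transport x x' w t"
  unfolding transport_def using assms by blast

lemma transport_unique:
  assumes x: "x \<in> Ob (fibre X (otgt h'))" "x' \<in> Ob (fibre X (otgt h'))"
    and t: "transport x x' w t" "transport x x' w t'"
  shows "t = t'"
proof -
  have y: "Tgt E (rgt h' x') \<in> Ob (fibre X (otgt h))" using right_props(5)[OF h' x(2)] hh' by simp
  from t(1) obtain u v where t1: "t \<in> hom (fibre X (osrc h)) (Tgt E (rgt hh x)) (Tgt E (rgt h (Tgt E (rgt h' x'))))"
    and uv: "u \<in> hom E (Src E (lft hh x)) (Src E (lft h' x'))"
      "v \<in> hom E (Src E (lft hh x)) (Src E (lft h (Tgt E (rgt h' x'))))"
      "w \<cdot>\<^bsub>E\<^esub> lft hh x = lft h' x' \<cdot>\<^bsub>E\<^esub> u" "rgt h' x' \<cdot>\<^bsub>E\<^esub> u = lft h (Tgt E (rgt h' x')) \<cdot>\<^bsub>E\<^esub> v"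
      "t \<cdot>\<^bsub>E\<^esub> rgt hh x = rgt h (Tgt E (rgt h' x')) \<cdot>\<^bsub>E\<^esub> v"
    unfolding transport_def by blast
  from t(2) obtain u' v' where t2: "t' \<in> hom (fibre X (osrc h)) (Tgt E (rgt hh x)) (Tgt E (rgt h (Tgt E (rgt h' x'))))"
    and uv': "u' \<in> hom E (Src E (lft hh x)) (Src E (lft h' x'))"
      "v' \<in> hom E (Src E (lft hh x)) (Src E (lft h (Tgt E (rgt h' x'))))"
      "w \<cdot>\<^bsub>E\<^esub> lft hh x = lft h' x' \<cdot>\<^bsub>E\<^esub> u'" "rgt h' x' \<cdot>\<^bsub>E\<^esub> u' = lft h (Tgt E (rgt h' x')) \<cdot>\<^bsub>E\<^esub> v'"
      "t' \<cdot>\<^bsub>E\<^esub> rgt hh x = rgt h (Tgt E (rgt h' x')) \<cdot>\<^bsub>E\<^esub> v'"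
    unfolding transport_def by blast
  have u: "u = u'" by (rule left_monic[OF h' x(2) uv(1) uv'(1)]) (use uv(3) uv'(3) in simp)
  have v: "v = v'" by (rule left_monic[OF h y uv(2) uv'(2)]) (use uv(4) uv'(4) u in simp)
  show ?thesis
    by (rule right_epi[OF hh hh_Ob[OF x(1)]]) (use t1 t2 uv(5) uv'(5) v in simp_all)
qed

text \<open>The pullback of base maps from \<open>span_pullback\<close> is lifted: \<open>u\<close>
  over \<tau> is cartesian by cancellation, and \<open>v\<close> over \<sigma> is cocartesian by
  Beck--Chevalley. The right leg of \<open>h\<close> after \<open>v\<close> is therefore a
  cocartesian lift of \<open>push_map\<close> of the composite, and its comparison \<open>t\<close>
  with the chosen lift is invertible.\<close>

lemma transport_exists:
  assumes x: "x \<in> Ob (fibre X (otgt h'))"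
  obtains t where "transport x x (Ident E x) t" "is_iso (fibre X (osrc h)) t"
proof -
  obtain \<sigma> \<tau> where pb: "pullback_square uDelta (pull_map h) (push_map h') \<sigma> \<tau>" and \<tau>: "convex \<tau>"
    and c1: "pull_map h' \<cdot>\<^bsub>uDelta\<^esub> \<tau> = pull_map hh" and c2: "push_map h \<cdot>\<^bsub>uDelta\<^esub> \<sigma> = push_map hh"
    by (rule span_pullback[OF h h' hh'])
  have eq: "pull_map h \<cdot>\<^bsub>uDelta\<^esub> \<sigma> = push_map h' \<cdot>\<^bsub>uDelta\<^esub> \<tau>"
    and D: "\<sigma> \<in> Ar uDelta" "\<tau> \<in> Ar uDelta"
    and bd: "osrc \<sigma> = osrc \<tau>" "otgt \<sigma> = osrc (pull_map h)" "otgt \<tau> = osrc (push_map h')"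
    using pb unfolding pullback_square_def uDelta_simps by blast+
  let ?y = "Tgt E (rgt h' x)"
  note L' = left_props[OF h' x] and R' = right_props[OF h' x]
  have y: "?y \<in> Ob (fibre X (otgt h))" using R'(5) hh' by simp
  note L = left_props[OF h y] and R = right_props[OF h y]
  note K = left_props[OF hh hh_Ob[OF x]] and M = right_props[OF hh hh_Ob[OF x]]
  have os: "osrc \<tau> = osrc (pull_map hh)" using c1 by (metis uDelta_simps(6))
  obtain u where u: "u \<in> hom E (Src E (lft hh x)) (Src E (lft h' x))" "pr u = \<tau>" "lft h' x \<cdot>\<^bsub>E\<^esub> u = lft hh x"
    by (rule cart_fill[OF L'(1), of "lft hh x" "Src E (lft hh x)" \<tau>])
      (use L' K D c1 bd os in \<open>auto simp: in_hom\<close>)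
  have u_cart: "cartesian X u"
    by (rule cart_cancel[OF L'(1)]) (use u K(1) in \<open>auto simp: in_hom\<close>)
  have uA: "u \<in> Ar E" "Src E u = Src E (lft hh x)" "Tgt E u = Src E (rgt h' x)" using u(1) R'(3) by (auto simp: in_hom)
  have Ru: "rgt h' x \<cdot>\<^bsub>E\<^esub> u \<in> hom E (Src E (lft hh x)) (Tgt E (lft h ?y))" "pr (rgt h' x \<cdot>\<^bsub>E\<^esub> u) = push_map h' \<cdot>\<^bsub>uDelta\<^esub> \<tau>"
    using uA R' L u(2) by (auto simp: in_hom cat_simps pr_simps)
  obtain v where v: "v \<in> hom E (Src E (lft hh x)) (Src E (lft h ?y))" "pr v = \<sigma>" "lft h ?y \<cdot>\<^bsub>E\<^esub> v = rgt h' x \<cdot>\<^bsub>E\<^esub> u"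
    by (rule cart_fill[OF L(1) Ru(1) D(1)]) (use L Ru(2) eq bd in auto)
  have vA: "v \<in> Ar E" "Src E v = Src E (lft hh x)" "Tgt E v = Src E (rgt h ?y)" using v(1) R(3) by (auto simp: in_hom)
  have v_cocart: "cocartesian X v"
  proof (rule beck_chevalley_cocartesian[OF _ _ _ L(1) u_cart R'(1)])
    show "pullback_square uDelta (pr (lft h ?y)) (pr (rgt h' x)) (pr v) (pr u)"
      using pb L(4) R'(4) u(2) v(2) by simp
  qed (use \<tau> u v L R' uA pull_map_convex[OF h] in \<open>auto simp: in_hom\<close>)
  have Rv: "rgt h ?y \<cdot>\<^bsub>E\<^esub> v \<in> hom E (Src E (rgt hh x)) (Tgt E (rgt h ?y))" "pr (rgt h ?y \<cdot>\<^bsub>E\<^esub> v) = pr (rgt hh x)"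
    using vA R M v(2) c2 by (auto simp: in_hom cat_simps pr_simps)
  have Rv_cocart: "cocartesian X (rgt h ?y \<cdot>\<^bsub>E\<^esub> v)" by (rule cocart_cmp[OF v_cocart R(1) vA(3)])
  have "osrc h = otgt (pr (rgt hh x))" using M(4) by simp
  with Rv obtain t where t: "t \<in> hom (fibre X (osrc h)) (Tgt E (rgt hh x)) (Tgt E (rgt h ?y))"
    "t \<cdot>\<^bsub>E\<^esub> rgt hh x = rgt h ?y \<cdot>\<^bsub>E\<^esub> v"
    by (rule cocart_fill_vertical[OF M(1)])
  have "is_iso (fibre X (osrc h)) t"
  proof (rule cocart_iso[OF M(1) Rv_cocart _ _ t(2)])
    show "Src E (rgt hh x) = Src E (rgt h ?y \<cdot>\<^bsub>E\<^esub> v)" "t \<in> hom (fibre X (osrc h)) (Tgt E (rgt hh x)) (Tgt E (rgt h ?y \<cdot>\<^bsub>E\<^esub> v))"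
      using Rv(1) t(1) by (simp_all add: in_hom)
  qed
  moreover have "transport x x (Ident E x) t"
    unfolding transport_def using t u v K by (metis Ident_cmp E_cat)
  ultimately show thesis using that by blast
qed

lemma compositor_transport:
  assumes x: "x \<in> Ob (fibre X (otgt h'))"
  shows "transport x x (Ident E x) (compositor X \<kappa> h' h x)"
    "is_iso (fibre X (osrc h)) (compositor X \<kappa> h' h x)"
proof -
  note K = left_props[OF hh hh_Ob[OF x]]
  have i: "Ident E x \<cdot>\<^bsub>E\<^esub> lft hh x = lft hh x" using K by (simp add: Ident_cmp)
  have y: "Tgt E (rgt h' x) \<in> Ob (fibre X (otgt h))" using right_props(5)[OF h' x] hh' by simp
  obtain t where t: "transport x x (Ident E x) t" "is_iso (fibre X (osrc h)) t" by (rule transport_exists[OF x])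
  \<comment> \<open>The definition of \<open>compositor\<close> has no identity in front and two of
    its equations reversed; otherwise the two descriptions agree.\<close>
  have "compositor X \<kappa> h' h x = (THE t. transport x x (Ident E x) t)"
    unfolding compositor_def Let_def transport_def act_Ob[OF h' x] act_Ob[OF h y] act_Ob[OF hh hh_Ob[OF x]] i
    by (intro arg_cong[where f = The] ext) (auto simp: eq_commute)
  also have "\<dots> = t" by (rule the_equality[of "transport x x (Ident E x)", OF t(1)]) (rule transport_unique[OF x x _ t(1)])
  finally show "transport x x (Ident E x) (compositor X \<kappa> h' h x)" "is_iso (fibre X (osrc h)) (compositor X \<kappa> h' h x)"
    using t by auto
qed

lemma compositor_hom:
  assumes "x \<in> Ob (fibre X (otgt h'))"
  shows "compositor X \<kappa> h' h x \<in> hom (fibre X (osrc h)) (Tgt E (rgt hh x)) (Tgt E (rgt h (Tgt E (rgt h' x))))"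
  using compositor_transport(1)[OF assms] by (simp add: transport_def)

lemma compositorE:
  assumes x: "x \<in> Ob (fibre X (otgt h'))"
  obtains u v where "u \<in> hom E (Src E (lft hh x)) (Src E (lft h' x))"
    "v \<in> hom E (Src E (lft hh x)) (Src E (lft h (Tgt E (rgt h' x))))"
    "lft h' x \<cdot>\<^bsub>E\<^esub> u = lft hh x" "rgt h' x \<cdot>\<^bsub>E\<^esub> u = lft h (Tgt E (rgt h' x)) \<cdot>\<^bsub>E\<^esub> v"
    "compositor X \<kappa> h' h x \<cdot>\<^bsub>E\<^esub> rgt hh x = rgt h (Tgt E (rgt h' x)) \<cdot>\<^bsub>E\<^esub> v"
proof -
  have "Ident E x \<cdot>\<^bsub>E\<^esub> lft hh x = lft hh x"
    using left_props[OF hh hh_Ob[OF x]] by (simp add: Ident_cmp)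
  then show thesis
    using compositor_transport(1)[OF x] that unfolding transport_def by metis
qed

lemma compositor_eqI:
  assumes x: "x \<in> Ob (fibre X (otgt h'))"
    and "t \<in> hom (fibre X (osrc h)) (Tgt E (rgt hh x)) (Tgt E (rgt h (Tgt E (rgt h' x))))"
    "u \<in> hom E (Src E (lft hh x)) (Src E (lft h' x))"
    "v \<in> hom E (Src E (lft hh x)) (Src E (lft h (Tgt E (rgt h' x))))"
    "lft h' x \<cdot>\<^bsub>E\<^esub> u = lft hh x" "rgt h' x \<cdot>\<^bsub>E\<^esub> u = lft h (Tgt E (rgt h' x)) \<cdot>\<^bsub>E\<^esub> v"
    "t \<cdot>\<^bsub>E\<^esub> rgt hh x = rgt h (Tgt E (rgt h' x)) \<cdot>\<^bsub>E\<^esub> v"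
  shows "compositor X \<kappa> h' h x = t"
proof -
  have "Ident E x \<cdot>\<^bsub>E\<^esub> lft hh x = lft hh x"
    using left_props[OF hh hh_Ob[OF x]] by (simp add: Ident_cmp)
  then have "transport x x (Ident E x) t" using assms(2-) by (intro transportI) simp_all
  then show ?thesis by (rule transport_unique[OF x x compositor_transport(1)[OF x]])
qed

lemma compositor_nat_iso:
  "nat_iso (fibre X (otgt h')) (fibre X (osrc h)) (act X \<kappa> hh) (fcomp (fibre X (otgt h')) (act X \<kappa> h) (act X \<kappa> h'))
     (compositor X \<kappa> h' h)"
proof (rule nat_isoI)
  show "is_functor (fibre X (otgt h')) (fibre X (osrc h)) (act X \<kappa> hh)" using act_functor[OF hh] by simp
  have F': "is_functor (fibre X (otgt h')) (fibre X (otgt h)) (act X \<kappa> h')" using act_functor[OF h'] hh' by simp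
  then show "is_functor (fibre X (otgt h')) (fibre X (osrc h)) (fcomp (fibre X (otgt h')) (act X \<kappa> h) (act X \<kappa> h'))"
    using fcomp_functor[OF _ act_functor[OF h]] by blast
  have ob: "Tgt E (rgt h' x) \<in> Ob (fibre X (otgt h))" if "x \<in> Ob (fibre X (otgt h'))" for x
    using right_props(5)[OF h' that] hh' by simp
  show "compositor X \<kappa> h' h x \<in> hom (fibre X (osrc h)) (FOb (act X \<kappa> hh) x)
      (FOb (fcomp (fibre X (otgt h')) (act X \<kappa> h) (act X \<kappa> h')) x)"
    and "is_iso (fibre X (osrc h)) (compositor X \<kappa> h' h x)" if "x \<in> Ob (fibre X (otgt h'))" for x
    using compositor_hom[OF that] compositor_transport(2)[OF that] act_Ob[OF hh hh_Ob[OF that]] act_Ob[OF h' that]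
      act_Ob[OF h ob[OF that]] that by (simp_all add: fcomp_simps)
  fix w x x' assume w: "w \<in> hom (fibre X (otgt h')) x x'"
  have x: "x \<in> Ob (fibre X (otgt h'))" "x' \<in> Ob (fibre X (otgt h'))" using hom_Ob[OF fibre_category w] by auto
  let ?y = "Tgt E (rgt h' x)" and ?y' = "Tgt E (rgt h' x')"
  note y = ob[OF x(1)] ob[OF x(2)]
  have wE: "w \<in> hom E x x'" using w by (simp add: fibre_hom)
  have wh: "w \<in> hom (fibre X (otgt hh)) x x'" using w by simp
  have w1: "FAr (act X \<kappa> h') w \<in> hom (fibre X (otgt h)) ?y ?y'" using act_hom[OF h' w] hh' by simp
  note homs = homI[OF left_props(2)[OF hh hh_Ob[OF x(1)]] refl left_props(3)[OF hh hh_Ob[OF x(1)]]]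
    homI[OF left_props(2)[OF hh hh_Ob[OF x(2)]] refl left_props(3)[OF hh hh_Ob[OF x(2)]]]
    homI[OF right_props(2,3)[OF hh hh_Ob[OF x(1)]] refl] homI[OF right_props(2,3)[OF hh hh_Ob[OF x(2)]] refl]
    homI[OF left_props(2)[OF h' x(1)] refl left_props(3)[OF h' x(1)]]
    homI[OF left_props(2)[OF h' x(2)] refl left_props(3)[OF h' x(2)]]
    homI[OF right_props(2,3)[OF h' x(1)] refl] homI[OF right_props(2,3)[OF h' x(2)] refl]
    homI[OF left_props(2)[OF h y(1)] refl left_props(3)[OF h y(1)]]
    homI[OF left_props(2)[OF h y(2)] refl left_props(3)[OF h y(2)]]
    homI[OF right_props(2,3)[OF h y(1)] refl] homI[OF right_props(2,3)[OF h y(2)] refl]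
  obtain p where p: "p \<in> hom E (Src E (lft hh x)) (Src E (lft hh x'))" "w \<cdot>\<^bsub>E\<^esub> lft hh x = lft hh x' \<cdot>\<^bsub>E\<^esub> p"
    "FAr (act X \<kappa> hh) w \<cdot>\<^bsub>E\<^esub> rgt hh x = rgt hh x' \<cdot>\<^bsub>E\<^esub> p" by (rule act_Ar[OF hh wh])
  obtain p' where p': "p' \<in> hom E (Src E (lft h' x)) (Src E (lft h' x'))" "w \<cdot>\<^bsub>E\<^esub> lft h' x = lft h' x' \<cdot>\<^bsub>E\<^esub> p'"
    "FAr (act X \<kappa> h') w \<cdot>\<^bsub>E\<^esub> rgt h' x = rgt h' x' \<cdot>\<^bsub>E\<^esub> p'" by (rule act_Ar[OF h' w])
  obtain q where q: "q \<in> hom E (Src E (lft h ?y)) (Src E (lft h ?y'))"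
    "FAr (act X \<kappa> h') w \<cdot>\<^bsub>E\<^esub> lft h ?y = lft h ?y' \<cdot>\<^bsub>E\<^esub> q"
    "FAr (act X \<kappa> h) (FAr (act X \<kappa> h') w) \<cdot>\<^bsub>E\<^esub> rgt h ?y = rgt h ?y' \<cdot>\<^bsub>E\<^esub> q" by (rule act_Ar[OF h w1])
  obtain u v where u: "u \<in> hom E (Src E (lft hh x)) (Src E (lft h' x))"
    "v \<in> hom E (Src E (lft hh x)) (Src E (lft h ?y))"
    "lft h' x \<cdot>\<^bsub>E\<^esub> u = lft hh x" "rgt h' x \<cdot>\<^bsub>E\<^esub> u = lft h ?y \<cdot>\<^bsub>E\<^esub> v"
    "compositor X \<kappa> h' h x \<cdot>\<^bsub>E\<^esub> rgt hh x = rgt h ?y \<cdot>\<^bsub>E\<^esub> v" by (rule compositorE[OF x(1)])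
  obtain u' v' where u': "u' \<in> hom E (Src E (lft hh x')) (Src E (lft h' x'))"
    "v' \<in> hom E (Src E (lft hh x')) (Src E (lft h ?y'))"
    "lft h' x' \<cdot>\<^bsub>E\<^esub> u' = lft hh x'" "rgt h' x' \<cdot>\<^bsub>E\<^esub> u' = lft h ?y' \<cdot>\<^bsub>E\<^esub> v'"
    "compositor X \<kappa> h' h x' \<cdot>\<^bsub>E\<^esub> rgt hh x' = rgt h ?y' \<cdot>\<^bsub>E\<^esub> v'" by (rule compositorE[OF x(2)])
  note cx = compositor_hom[OF x(1)] and cx' = compositor_hom[OF x(2)]
  note a = act_hom[OF hh wh] and a' = act_hom[OF h w1]
  note v = fibre_hom[THEN iffD1, THEN conjunct1]
  \<comment> \<open>For either side of the naturality square, the apex components combine those of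
    the action of \<open>w\<close> with those of a compositor, in the two possible orders.\<close>
  have "transport x x' w (compositor X \<kappa> h' h x' \<cdot>\<^bsub>E\<^esub> FAr (act X \<kappa> hh) w)"
  proof (rule transportI)
    show "compositor X \<kappa> h' h x' \<cdot>\<^bsub>E\<^esub> FAr (act X \<kappa> hh) w \<in> hom (fibre X (osrc h)) (Tgt E (rgt hh x)) (Tgt E (rgt h ?y'))"
      using cmp_hom[OF fibre_category _ cx', of "FAr (act X \<kappa> hh) w"] a by simp
    show "u' \<cdot>\<^bsub>E\<^esub> p \<in> hom E (Src E (lft hh x)) (Src E (lft h' x'))" by (rule cmp_hom[OF E_cat p(1) u'(1)])
    show "v' \<cdot>\<^bsub>E\<^esub> p \<in> hom E (Src E (lft hh x)) (Src E (lft h ?y'))" by (rule cmp_hom[OF E_cat p(1) u'(2)])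
    show "w \<cdot>\<^bsub>E\<^esub> lft hh x = lft h' x' \<cdot>\<^bsub>E\<^esub> (u' \<cdot>\<^bsub>E\<^esub> p)"
      using hom_assoc[OF E_cat p(1) u'(1) homs(6)] p(2) u'(3) by simp
    show "rgt h' x' \<cdot>\<^bsub>E\<^esub> (u' \<cdot>\<^bsub>E\<^esub> p) = lft h ?y' \<cdot>\<^bsub>E\<^esub> (v' \<cdot>\<^bsub>E\<^esub> p)"
      using hom_assoc[OF E_cat p(1) u'(1) homs(8)] hom_assoc[OF E_cat p(1) u'(2) homs(10)] u'(4) by simp
    show "(compositor X \<kappa> h' h x' \<cdot>\<^bsub>E\<^esub> FAr (act X \<kappa> hh) w) \<cdot>\<^bsub>E\<^esub> rgt hh x = rgt h ?y' \<cdot>\<^bsub>E\<^esub> (v' \<cdot>\<^bsub>E\<^esub> p)"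
      using a by (intro square_paste[OF E_cat homs(3) _ p(1) homs(4) v[OF cx'] u'(2) homs(12) p(3) u'(5)]) (simp add: fibre_hom)
  qed
  moreover have "transport x x' w (FAr (act X \<kappa> h) (FAr (act X \<kappa> h') w) \<cdot>\<^bsub>E\<^esub> compositor X \<kappa> h' h x)"
  proof (rule transportI)
    show "FAr (act X \<kappa> h) (FAr (act X \<kappa> h') w) \<cdot>\<^bsub>E\<^esub> compositor X \<kappa> h' h x \<in>
        hom (fibre X (osrc h)) (Tgt E (rgt hh x)) (Tgt E (rgt h ?y'))"
      using cmp_hom[OF fibre_category cx a'] by simp
    show "p' \<cdot>\<^bsub>E\<^esub> u \<in> hom E (Src E (lft hh x)) (Src E (lft h' x'))" by (rule cmp_hom[OF E_cat u(1) p'(1)])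
    show "q \<cdot>\<^bsub>E\<^esub> v \<in> hom E (Src E (lft hh x)) (Src E (lft h ?y'))" by (rule cmp_hom[OF E_cat u(2) q(1)])
    show "w \<cdot>\<^bsub>E\<^esub> lft hh x = lft h' x' \<cdot>\<^bsub>E\<^esub> (p' \<cdot>\<^bsub>E\<^esub> u)"
      using hom_assoc[OF E_cat u(1) p'(1) homs(6)] hom_assoc[OF E_cat u(1) homs(5) wE] p'(2) u(3) by simp
    have "rgt h' x' \<cdot>\<^bsub>E\<^esub> (p' \<cdot>\<^bsub>E\<^esub> u) = FAr (act X \<kappa> h') w \<cdot>\<^bsub>E\<^esub> (rgt h' x \<cdot>\<^bsub>E\<^esub> u)"
      using hom_assoc[OF E_cat u(1) p'(1) homs(8)] hom_assoc[OF E_cat u(1) homs(7) v[OF w1]] p'(3) by simp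
    also have "\<dots> = lft h ?y' \<cdot>\<^bsub>E\<^esub> (q \<cdot>\<^bsub>E\<^esub> v)"
      using hom_assoc[OF E_cat u(2) homs(9) v[OF w1]] hom_assoc[OF E_cat u(2) q(1) homs(10)] u(4) q(2) by simp
    finally show "rgt h' x' \<cdot>\<^bsub>E\<^esub> (p' \<cdot>\<^bsub>E\<^esub> u) = lft h ?y' \<cdot>\<^bsub>E\<^esub> (q \<cdot>\<^bsub>E\<^esub> v)" .
    show "(FAr (act X \<kappa> h) (FAr (act X \<kappa> h') w) \<cdot>\<^bsub>E\<^esub> compositor X \<kappa> h' h x) \<cdot>\<^bsub>E\<^esub> rgt hh x = rgt h ?y' \<cdot>\<^bsub>E\<^esub> (q \<cdot>\<^bsub>E\<^esub> v)"
      by (rule square_paste[OF E_cat homs(3) v[OF cx] u(2) homs(11) v[OF a'] q(1) homs(12) u(5) q(3)])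
  qed
  ultimately have "compositor X \<kappa> h' h x' \<cdot>\<^bsub>E\<^esub> FAr (act X \<kappa> hh) w = FAr (act X \<kappa> h) (FAr (act X \<kappa> h') w) \<cdot>\<^bsub>E\<^esub> compositor X \<kappa> h' h x"
    by (rule transport_unique[OF x])
  moreover have "FAr (fcomp (fibre X (otgt h')) (act X \<kappa> h) (act X \<kappa> h')) w = FAr (act X \<kappa> h) (FAr (act X \<kappa> h') w)"
    using w by (intro fcomp_simps(2)) (simp only: in_hom)
  ultimately show "compositor X \<kappa> h' h x' \<cdot>\<^bsub>fibre X (osrc h)\<^esub> FAr (act X \<kappa> hh) w =
      FAr (fcomp (fibre X (otgt h')) (act X \<kappa> h) (act X \<kappa> h')) w \<cdot>\<^bsub>fibre X (osrc h)\<^esub> compositor X \<kappa> h' h x"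
    by simp
qed

end

end

section \<open>The decomposition space of an iesq sesquicartesian fibration\<close>

lemma fcomp_idf:
  assumes F: "is_functor C D F"
  shows "fcomp C F (idf C) = F" "fcomp C (idf D) F = F"
  by (rule func_eqI[of _ "Ob C" _ "Ar C"]; simp add: fcomp_simps idf_simps functor_ext[OF F] functor_simps[OF F])+

lemma idf_nat_iso: "category C \<Longrightarrow> nat_iso C C (idf C) (idf C) (Ident C)"
  by (rule nat_isoI) (auto simp: idf_functor idf_simps Ident_hom is_iso_Ident in_hom cat_simps)

lemma core_func_cong:
  assumes "\<And>x. x \<in> Ob C \<Longrightarrow> FOb F x = FOb G x" "\<And>f. f \<in> Ar C \<Longrightarrow> FAr F f = FAr G f"
  shows "core_func C F = core_func C G"
  unfolding core_func_def using assms by (auto simp: core_simps intro!: restrict_ext)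

context cleaved_fibration
begin

lemma left_hom: "h \<in> Ar Delta \<Longrightarrow> x \<in> Ob (fibre X (otgt h)) \<Longrightarrow> lft h x \<in> hom E (Src E (lft h x)) x"
  by (rule homI) (simp_all add: left_props)

lemma right_hom: "h \<in> Ar Delta \<Longrightarrow> x \<in> Ob (fibre X (otgt h)) \<Longrightarrow> rgt h x \<in> hom E (Src E (lft h x)) (Tgt E (rgt h x))"
  by (rule homI) (simp_all add: right_props)

end

section \<open>Normal cleavages and the pseudo-functor laws\<close>

locale normal_sesquicartesian = cleaved_sesquicartesian X \<kappa> for X :: "('o, 'a) fib" and \<kappa> +
  assumes normal: "normal_cleavage X \<kappa>"
begin

lemma normal_cocart: "x \<in> Ob (fibre X n) \<Longrightarrow> cocart \<kappa> (Ident uDelta n) x = Ident E x"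
  and normal_cart: "x \<in> Ob (fibre X n) \<Longrightarrow> cart \<kappa> (Ident uDelta n) x = Ident E x"
  using normal by (auto simp: normal_cleavage_def)

lemma fibre_ObE: "x \<in> Ob (fibre X n) \<Longrightarrow> x \<in> Ob E"
  by (simp add: fibre_Ob)

lemma fibre_Ident_hom: "x \<in> Ob (fibre X n) \<Longrightarrow> Ident E x \<in> hom (fibre X n) x x"
  using Ident_hom[OF fibre_category, of x n] by simp

text \<open>An equality of functors, not just a natural isomorphism: in a normal cleavage the lifts
  of identities are identities, and \<open>push\<close> is extensional.\<close>

lemma push_Ident: "push X \<kappa> (Ident uDelta n) = idf (fibre X n)"
proof -
  have F: "is_functor (fibre X n) (fibre X n) (push X \<kappa> (Ident uDelta n))"
    using push_functor[OF uDelta_closed(1), of n] by simp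
  show ?thesis
  proof (rule func_eqI[of _ "Ob (fibre X n)" _ "Ar (fibre X n)"])
    show "FOb (push X \<kappa> (Ident uDelta n)) x = FOb (idf (fibre X n)) x" if "x \<in> Ob (fibre X n)" for x
      using that by (simp add: push_Ob idf_simps normal_cocart Tgt_Ident fibre_ObE)
    fix v assume v: "v \<in> Ar (fibre X n)"
    define x x' where "x = Src E v" "x' = Tgt E v"
    have vh: "v \<in> hom (fibre X n) x x'" using v by (simp add: in_hom x_x'_def)
    have vE: "v \<in> hom E x x'" using vh by (simp add: fibre_hom)
    have ob: "x \<in> Ob (fibre X n)" "x' \<in> Ob (fibre X n)" using hom_Ob[OF fibre_category vh] by auto
    have "FAr (push X \<kappa> (Ident uDelta n)) v = v"
      by (rule push_eqI[of _ _ x x'])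
        (use vh hom_Ident[OF E_cat vE] Ident_hom_cmp[OF E_cat vE] fibre_ObE[OF ob(1)] fibre_ObE[OF ob(2)] in
          \<open>simp_all add: uDelta_closed normal_cocart[OF ob(1)] normal_cocart[OF ob(2)] Tgt_Ident\<close>)
    then show "FAr (push X \<kappa> (Ident uDelta n)) v = FAr (idf (fibre X n)) v" using v by (simp add: idf_simps(2)[OF v])
  qed (simp_all add: functor_ext[OF F] idf_simps(3,4))
qed

lemma pull_Ident: "pull X \<kappa> (Ident uDelta n) = idf (fibre X n)"
proof -
  have F: "is_functor (fibre X n) (fibre X n) (pull X \<kappa> (Ident uDelta n))"
    using pull_functor[OF convex_Ident, of n] by simp
  show ?thesis
  proof (rule func_eqI[of _ "Ob (fibre X n)" _ "Ar (fibre X n)"])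
    show "FOb (pull X \<kappa> (Ident uDelta n)) x = FOb (idf (fibre X n)) x" if "x \<in> Ob (fibre X n)" for x
      using that by (simp add: pull_Ob idf_simps normal_cart Src_Ident fibre_ObE)
    fix v assume v: "v \<in> Ar (fibre X n)"
    define x x' where "x = Src E v" "x' = Tgt E v"
    have vh: "v \<in> hom (fibre X n) x x'" using v by (simp add: in_hom x_x'_def)
    have vE: "v \<in> hom E x x'" using vh by (simp add: fibre_hom)
    have ob: "x \<in> Ob (fibre X n)" "x' \<in> Ob (fibre X n)" using hom_Ob[OF fibre_category vh] by auto
    have "FAr (pull X \<kappa> (Ident uDelta n)) v = v"
      by (rule pull_eqI[of _ _ x x'])
        (use vh hom_Ident[OF E_cat vE] Ident_hom_cmp[OF E_cat vE] fibre_ObE[OF ob(1)] fibre_ObE[OF ob(2)] in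
          \<open>simp_all add: convex_Ident normal_cart[OF ob(1)] normal_cart[OF ob(2)] Src_Ident\<close>)
    then show "FAr (pull X \<kappa> (Ident uDelta n)) v = FAr (idf (fibre X n)) v" using v by (simp add: idf_simps(2)[OF v])
  qed (simp_all add: functor_ext[OF F] idf_simps(3,4))
qed

lemma act_generic:
  assumes g: "generic g"
  shows "act X \<kappa> g = push X \<kappa> (under_gen g)"
proof -
  have "push_map g \<in> Ar uDelta" using push_map_Ar generic_Ar g by blast
  then have "is_functor (fibre X (otgt g)) (fibre X (osrc g)) (push X \<kappa> (push_map g))"
    using push_functor[of "push_map g"] g by (simp add: generic_def)
  then have "fcomp (fibre X (otgt g)) (push X \<kappa> (push_map g)) (idf (fibre X (otgt g))) = push X \<kappa> (push_map g)"
    by (rule fcomp_idf(1))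
  then show ?thesis
    by (simp add: act_def generic_push_pull[OF g] pull_Ident flip: push_map_def pull_map_def)
qed

lemma act_free:
  assumes f: "free f"
  shows "act X \<kappa> f = pull X \<kappa> (under_free f)"
proof -
  have "osrc (pull_map f) = osrc f" using free_ofun[OF f, of "osrc f"] by simp
  then have "is_functor (fibre X (otgt f)) (fibre X (osrc f)) (pull X \<kappa> (pull_map f))"
    using pull_functor[OF pull_map_convex[OF free_Ar[OF f]]] by simp
  then have "fcomp (fibre X (otgt f)) (idf (fibre X (osrc f))) (pull X \<kappa> (pull_map f)) = pull X \<kappa> (pull_map f)"
    by (rule fcomp_idf(2))
  then show ?thesis
    by (simp add: act_def free_push_pull[OF f] push_Ident flip: push_map_def pull_map_def)
qed

lemma Ident_generic: "generic (Ident Delta n)"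
  by (simp add: generic_def Delta_closed Delta_ofun)

lemma act_Ident: "act X \<kappa> (Ident Delta n) = idf (fibre X n)"
  using act_generic[OF Ident_generic] generic_push_pull(1)[OF Ident_generic] push_pull_Ident(1) push_Ident by metis

lemma span_generic:
  assumes g: "generic g" and x: "x \<in> Ob (fibre X (otgt g))"
  shows "lft g x = Ident E x" "rgt g x = cocart \<kappa> (under_gen g) x"
  using generic_push_pull[OF g] normal_cart[OF x] fibre_ObE[OF x]
  by (simp_all add: span_left_def span_right_def Src_Ident flip: push_map_def pull_map_def)

lemma span_free:
  assumes f: "free f" and x: "x \<in> Ob (fibre X (otgt f))"
  shows "lft f x = cart \<kappa> (under_free f) x" "rgt f x = Ident E (Src E (lft f x))"
proof -
  show "lft f x = cart \<kappa> (under_free f) x"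
    using free_push_pull[OF f] by (simp add: span_left_def flip: pull_map_def)
  have "osrc (pull_map f) = osrc f" using free_ofun[OF f, of "osrc f"] by simp
  then show "rgt f x = Ident E (Src E (lft f x))"
    using left_props(5)[OF free_Ar[OF f] x] normal_cocart
    by (simp add: span_right_def free_push_pull[OF f] flip: push_map_def)
qed

lemma span_Ident:
  assumes "x \<in> Ob (fibre X n)"
  shows "lft (Ident Delta n) x = Ident E x" "rgt (Ident Delta n) x = Ident E x"
  using span_generic[OF Ident_generic, of x n] assms generic_push_pull(1)[OF Ident_generic, of n] push_pull_Ident(1)[of n]
    normal_cocart[OF assms] by simp_all

text \<open>Both sides induce maps from the span of the triple composite at \<open>x\<close> to the
  consecutive spans of \<open>h''\<close>, \<open>h'\<close> and \<open>h\<close>. These maps agree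
  on one apex after the other, by the monic left legs, and the cocartesian right leg of the triple
  composite transfers the agreement to the ends.\<close>

lemma compositor_coherence:
  assumes h: "h \<in> Ar Delta" "h' \<in> Ar Delta" "h'' \<in> Ar Delta" "otgt h = osrc h'" "otgt h' = osrc h''"
    and x: "x \<in> Ob (fibre X (otgt h''))"
  shows "FAr (act X \<kappa> h) (compositor X \<kappa> h'' h' x) \<cdot>\<^bsub>E\<^esub> compositor X \<kappa> (h'' \<cdot>\<^bsub>Delta\<^esub> h') h x
    = compositor X \<kappa> h' h (FOb (act X \<kappa> h'') x) \<cdot>\<^bsub>E\<^esub> compositor X \<kappa> h'' (h' \<cdot>\<^bsub>Delta\<^esub> h) x"
proof -
  let ?k = "h' \<cdot>\<^bsub>Delta\<^esub> h" and ?k' = "h'' \<cdot>\<^bsub>Delta\<^esub> h'"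
  define K where "K = h'' \<cdot>\<^bsub>Delta\<^esub> ?k"
  \<comment> \<open>Associativity in \<Delta> makes both sides start from the same chosen
    span.\<close>
  have K': "?k' \<cdot>\<^bsub>Delta\<^esub> h = K" unfolding K_def by (rule cmp_assoc[OF Delta_category]) (use h in auto)
  have k: "?k \<in> Ar Delta" "?k' \<in> Ar Delta" using h by (auto intro: Delta_closed)
  have KA: "K \<in> Ar Delta" unfolding K_def using h k by (auto intro: Delta_closed)
  have K_simps[simp]: "osrc K = osrc h" "otgt K = otgt h''" by (simp_all add: K_def)
  define y1 where "y1 = Tgt E (rgt h'' x)"
  define y2 where "y2 = Tgt E (rgt h' y1)"
  define y3 where "y3 = Tgt E (rgt h y2)"
  define z where "z = Tgt E (rgt ?k' x)"
  have y1: "y1 \<in> Ob (fibre X (otgt h'))" using right_props(5)[OF h(3) x] h(5) by (simp add: y1_def)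
  have y2: "y2 \<in> Ob (fibre X (otgt h))" using right_props(5)[OF h(2) y1] h(4) by (simp add: y2_def)
  have xk: "x \<in> Ob (fibre X (otgt ?k'))" "x \<in> Ob (fibre X (otgt K))" using x by auto
  have yk: "y1 \<in> Ob (fibre X (otgt ?k))" using y1 by simp
  have z: "z \<in> Ob (fibre X (otgt h))" using right_props(5)[OF k(2) xk(1)] h(4) by (simp add: z_def)
  have hk: "otgt ?k = osrc h''" "otgt h = osrc ?k'" using h by auto
  obtain u v where t1: "u \<in> hom E (Src E (lft K x)) (Src E (lft ?k' x))" "v \<in> hom E (Src E (lft K x)) (Src E (lft h z))"
    "lft ?k' x \<cdot>\<^bsub>E\<^esub> u = lft K x" "rgt ?k' x \<cdot>\<^bsub>E\<^esub> u = lft h z \<cdot>\<^bsub>E\<^esub> v"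
    "compositor X \<kappa> ?k' h x \<cdot>\<^bsub>E\<^esub> rgt K x = rgt h z \<cdot>\<^bsub>E\<^esub> v"
    using compositorE[OF h(1) k(2) hk(2) xk(1)] unfolding K' z_def by blast
  obtain u' v' where t2: "u' \<in> hom E (Src E (lft ?k' x)) (Src E (lft h'' x))" "v' \<in> hom E (Src E (lft ?k' x)) (Src E (lft h' y1))"
    "lft h'' x \<cdot>\<^bsub>E\<^esub> u' = lft ?k' x" "rgt h'' x \<cdot>\<^bsub>E\<^esub> u' = lft h' y1 \<cdot>\<^bsub>E\<^esub> v'"
    "compositor X \<kappa> h'' h' x \<cdot>\<^bsub>E\<^esub> rgt ?k' x = rgt h' y1 \<cdot>\<^bsub>E\<^esub> v'"
    using compositorE[OF h(2,3,5) x] unfolding y1_def by blast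
  obtain m n where s1: "m \<in> hom E (Src E (lft K x)) (Src E (lft h'' x))" "n \<in> hom E (Src E (lft K x)) (Src E (lft ?k y1))"
    "lft h'' x \<cdot>\<^bsub>E\<^esub> m = lft K x" "rgt h'' x \<cdot>\<^bsub>E\<^esub> m = lft ?k y1 \<cdot>\<^bsub>E\<^esub> n"
    "compositor X \<kappa> h'' ?k x \<cdot>\<^bsub>E\<^esub> rgt K x = rgt ?k y1 \<cdot>\<^bsub>E\<^esub> n"
    using compositorE[OF k(1) h(3) hk(1) x] unfolding K_def y1_def by blast
  obtain m' n' where s2: "m' \<in> hom E (Src E (lft ?k y1)) (Src E (lft h' y1))" "n' \<in> hom E (Src E (lft ?k y1)) (Src E (lft h y2))"
    "lft h' y1 \<cdot>\<^bsub>E\<^esub> m' = lft ?k y1" "rgt h' y1 \<cdot>\<^bsub>E\<^esub> m' = lft h y2 \<cdot>\<^bsub>E\<^esub> n'"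
    "compositor X \<kappa> h' h y1 \<cdot>\<^bsub>E\<^esub> rgt ?k y1 = rgt h y2 \<cdot>\<^bsub>E\<^esub> n'"
    using compositorE[OF h(1,2,4) y1] unfolding y2_def by blast
  define T1 where "T1 = compositor X \<kappa> ?k' h x"
  define T2 where "T2 = compositor X \<kappa> h'' h' x"
  define S1 where "S1 = compositor X \<kappa> h'' ?k x"
  define S2 where "S2 = compositor X \<kappa> h' h y1"
  have T1: "T1 \<in> hom (fibre X (osrc h)) (Tgt E (rgt K x)) (Tgt E (rgt h z))"
    using compositor_hom[OF h(1) k(2) hk(2) xk(1)] unfolding T1_def K' z_def .
  have T2: "T2 \<in> hom (fibre X (otgt h)) z y2"
    using compositor_hom[OF h(2,3,5) x] unfolding T2_def z_def y2_def y1_def h(4) .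
  have S1: "S1 \<in> hom (fibre X (osrc h)) (Tgt E (rgt K x)) (Tgt E (rgt ?k y1))"
    using compositor_hom[OF k(1) h(3) hk(1) x] unfolding S1_def K_def y1_def by simp
  have S2: "S2 \<in> hom (fibre X (osrc h)) (Tgt E (rgt ?k y1)) y3"
    using compositor_hom[OF h(1,2,4) y1] unfolding S2_def y3_def y2_def .
  \<comment> \<open>The action of \<open>h\<close> on the compositor \<open>T2\<close>, seen as a
    map of spans from the span of \<open>h\<close> at \<open>z\<close> to the one at
    \<open>y2\<close>.\<close>
  obtain w where w: "w \<in> hom E (Src E (lft h z)) (Src E (lft h y2))" "T2 \<cdot>\<^bsub>E\<^esub> lft h z = lft h y2 \<cdot>\<^bsub>E\<^esub> w"
    "FAr (act X \<kappa> h) T2 \<cdot>\<^bsub>E\<^esub> rgt h z = rgt h y2 \<cdot>\<^bsub>E\<^esub> w" by (rule act_Ar[OF h(1) T2])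
  have T3: "FAr (act X \<kappa> h) T2 \<in> hom (fibre X (osrc h)) (Tgt E (rgt h z)) y3"
    unfolding y3_def by (rule act_hom[OF h(1) T2])
  note E1 = t1[folded T1_def] and E2 = t2[folded T2_def] and F1 = s1[folded S1_def] and F2 = s2[folded S2_def]
  note lh'' = left_hom[OF h(3) x]
    and lh' = left_hom[OF h(2) y1] and lhz = left_hom[OF h(1) z] and lh = left_hom[OF h(1) y2]
  note rh'' = right_hom[OF h(3) x, folded y1_def] and rk' = right_hom[OF k(2) xk(1), folded z_def]
    and rK = right_hom[OF KA xk(2)] and rh' = right_hom[OF h(2) y1, folded y2_def]
    and rhz = right_hom[OF h(1) z] and rh = right_hom[OF h(1) y2, folded y3_def] and rk = right_hom[OF k(1) yk]
  note ver = fibre_hom[THEN iffD1, THEN conjunct1]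
  note A = hom_assoc[OF E_cat]
  \<comment> \<open>Agreement on the apexes of \<open>h''\<close> at \<open>x\<close>, of
    \<open>h'\<close> at \<open>y1\<close> and of \<open>h\<close> at \<open>y2\<close>, in this
    order; each equality is fed through a right leg into the next.\<close>
  have m: "m = u' \<cdot>\<^bsub>E\<^esub> u"
  proof (rule left_monic[OF h(3) x F1(1) cmp_hom[OF E_cat E1(1) E2(1)]])
    show "lft h'' x \<cdot>\<^bsub>E\<^esub> m = lft h'' x \<cdot>\<^bsub>E\<^esub> (u' \<cdot>\<^bsub>E\<^esub> u)"
      using A[OF E1(1) E2(1) lh''] E2(3) E1(3) F1(3) by simp
  qed
  have mn: "v' \<cdot>\<^bsub>E\<^esub> u = m' \<cdot>\<^bsub>E\<^esub> n"
  proof (rule left_monic[OF h(2) y1 cmp_hom[OF E_cat E1(1) E2(2)] cmp_hom[OF E_cat F1(2) F2(1)]])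
    have "lft h' y1 \<cdot>\<^bsub>E\<^esub> (v' \<cdot>\<^bsub>E\<^esub> u) = rgt h'' x \<cdot>\<^bsub>E\<^esub> m"
      using A[OF E1(1) E2(2) lh'] A[OF E1(1) E2(1) rh''] E2(4) m by simp
    also have "\<dots> = lft h' y1 \<cdot>\<^bsub>E\<^esub> (m' \<cdot>\<^bsub>E\<^esub> n)"
      using A[OF F1(2) F2(1) lh'] F2(3) F1(4) by simp
    finally show "lft h' y1 \<cdot>\<^bsub>E\<^esub> (v' \<cdot>\<^bsub>E\<^esub> u) = lft h' y1 \<cdot>\<^bsub>E\<^esub> (m' \<cdot>\<^bsub>E\<^esub> n)" .
  qed
  have wv: "w \<cdot>\<^bsub>E\<^esub> v = n' \<cdot>\<^bsub>E\<^esub> n"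
  proof (rule left_monic[OF h(1) y2 cmp_hom[OF E_cat E1(2) w(1)] cmp_hom[OF E_cat F1(2) F2(2)]])
    have "lft h y2 \<cdot>\<^bsub>E\<^esub> (w \<cdot>\<^bsub>E\<^esub> v) = T2 \<cdot>\<^bsub>E\<^esub> (rgt ?k' x \<cdot>\<^bsub>E\<^esub> u)"
      using A[OF E1(2) w(1) lh] A[OF E1(2) lhz ver[OF T2]] w(2) E1(4) by simp
    also have "\<dots> = rgt h' y1 \<cdot>\<^bsub>E\<^esub> (m' \<cdot>\<^bsub>E\<^esub> n)"
      using A[OF E1(1) rk' ver[OF T2]] A[OF E1(1) E2(2) rh'] E2(5) mn by simp
    also have "\<dots> = lft h y2 \<cdot>\<^bsub>E\<^esub> (n' \<cdot>\<^bsub>E\<^esub> n)"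
      using A[OF F1(2) F2(1) rh'] A[OF F1(2) F2(2) lh] F2(4) by simp
    finally show "lft h y2 \<cdot>\<^bsub>E\<^esub> (w \<cdot>\<^bsub>E\<^esub> v) = lft h y2 \<cdot>\<^bsub>E\<^esub> (n' \<cdot>\<^bsub>E\<^esub> n)" .
  qed
  have "FAr (act X \<kappa> h) T2 \<cdot>\<^bsub>E\<^esub> T1 = S2 \<cdot>\<^bsub>E\<^esub> S1"
  proof (rule right_epi[OF KA xk(2)])
    show "FAr (act X \<kappa> h) T2 \<cdot>\<^bsub>E\<^esub> T1 \<in> hom (fibre X (osrc K)) (Tgt E (rgt K x)) y3"
      using cmp_hom[OF fibre_category T1 T3] by simp
    show "S2 \<cdot>\<^bsub>E\<^esub> S1 \<in> hom (fibre X (osrc K)) (Tgt E (rgt K x)) y3"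
      using cmp_hom[OF fibre_category S1 S2] by simp
    have "(FAr (act X \<kappa> h) T2 \<cdot>\<^bsub>E\<^esub> T1) \<cdot>\<^bsub>E\<^esub> rgt K x = rgt h y2 \<cdot>\<^bsub>E\<^esub> (w \<cdot>\<^bsub>E\<^esub> v)"
      by (rule square_paste[OF E_cat rK ver[OF T1] E1(2) rhz ver[OF T3] w(1) rh E1(5) w(3)])
    moreover have "(S2 \<cdot>\<^bsub>E\<^esub> S1) \<cdot>\<^bsub>E\<^esub> rgt K x = rgt h y2 \<cdot>\<^bsub>E\<^esub> (n' \<cdot>\<^bsub>E\<^esub> n)"
      by (rule square_paste[OF E_cat rK ver[OF S1] F1(2) rk ver[OF S2] F2(2) rh F1(5) F2(5)])
    ultimately show "(FAr (act X \<kappa> h) T2 \<cdot>\<^bsub>E\<^esub> T1) \<cdot>\<^bsub>E\<^esub> rgt K x = (S2 \<cdot>\<^bsub>E\<^esub> S1) \<cdot>\<^bsub>E\<^esub> rgt K x"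
      using wv by simp
  qed
  then show ?thesis by (simp add: T1_def T2_def S1_def S2_def y1_def act_Ob[OF h(3) x])
qed

text \<open>Both legs of the span of an identity are identities. The apex maps are therefore an
  identity and \<open>rgt h x\<close> in the first case, \<open>lft h x\<close> and an identity in
  the second.\<close>

lemma compositor_Ident:
  assumes h: "h \<in> Ar Delta" and x: "x \<in> Ob (fibre X (otgt h))"
  shows "compositor X \<kappa> h (Ident Delta (osrc h)) x = Ident E (Tgt E (rgt h x))"
    "compositor X \<kappa> (Ident Delta (otgt h)) h x = Ident E (Tgt E (rgt h x))"
proof -
  let ?y = "Tgt E (rgt h x)"
  have y: "?y \<in> Ob (fibre X (osrc h))" by (rule right_props(5)[OF h x])
  note sy = span_Ident[OF y] and sx = span_Ident[OF x]
  have k: "h \<cdot>\<^bsub>Delta\<^esub> Ident Delta (osrc h) = h" "Ident Delta (otgt h) \<cdot>\<^bsub>Delta\<^esub> h = h"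
    using h by (simp_all add: cmp_Ident Ident_cmp Delta_category)
  have yE: "?y \<in> Ob E" and xE: "x \<in> Ob E" using x y by (auto simp: fibre_ObE)
  note L = left_props[OF h x]
  have i: "Ident E ?y \<in> hom (fibre X (osrc h)) ?y ?y" by (rule fibre_Ident_hom[OF y])
  have li: "Ident E (Src E (lft h x)) \<in> hom E (Src E (lft h x)) (Src E (lft h x))"
    using Ident_hom[OF E_cat] Src_Ob[OF E_cat L(2)] by blast
  note lh = left_hom[OF h x] and rh = right_hom[OF h x]
  note Tx = Tgt_Ident[OF E_cat xE] Src_Ident[OF E_cat xE] Tgt_Ident[OF E_cat yE] Src_Ident[OF E_cat yE]
  show "compositor X \<kappa> h (Ident Delta (osrc h)) x = Ident E ?y"
    by (rule compositor_eqI[OF Delta_closed(1) h _ x, of _ _ "Ident E (Src E (lft h x))" "rgt h x"])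
      (simp_all only: k Delta_simps sy Tx i li rh hom_Ident[OF E_cat lh] hom_Ident[OF E_cat rh] Ident_hom_cmp[OF E_cat rh])
  show "compositor X \<kappa> (Ident Delta (otgt h)) h x = Ident E ?y"
    by (rule compositor_eqI[where u = "lft h x" and v = "Ident E (Src E (lft h x))", OF h Delta_closed(1)])
      (simp_all only: k Delta_simps sx Tx i li lh x Ident_hom_cmp[OF E_cat lh] hom_Ident[OF E_cat lh] hom_Ident[OF E_cat rh] Ident_hom_cmp[OF E_cat rh])
qed

lemma decomp_of_simps [simp]:
  "sgrp (decomp_of X \<kappa>) n = core (fibre X n)" "sact (decomp_of X \<kappa>) h = core_func (fibre X (otgt h)) (act X \<kappa> h)"
  "scmp (decomp_of X \<kappa>) = compositor X \<kappa>" "suni (decomp_of X \<kappa>) n = Ident E"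
  by (simp_all add: decomp_of_def)

lemma core_act_functor:
  "h \<in> Ar Delta \<Longrightarrow> is_functor (core (fibre X (otgt h))) (core (fibre X (osrc h))) (core_func (fibre X (otgt h)) (act X \<kappa> h))"
  by (rule core_functor[OF act_functor])

lemma decomp_of_simplicial: "simplicial_groupoid (decomp_of X \<kappa>)"
  unfolding simplicial_groupoid_def decomp_of_simps
proof (intro conjI allI ballI impI)
  show "groupoid (core (fibre X n))" for n by (rule core_groupoid[OF fibre_category])
  show "is_functor (core (fibre X (otgt h))) (core (fibre X (osrc h))) (core_func (fibre X (otgt h)) (act X \<kappa> h))"
    if "h \<in> Ar Delta" for h by (rule core_act_functor[OF that])
  show "nat_iso (core (fibre X (otgt h'))) (core (fibre X (osrc h)))
      (core_func (fibre X (otgt (h' \<cdot>\<^bsub>Delta\<^esub> h))) (act X \<kappa> (h' \<cdot>\<^bsub>Delta\<^esub> h)))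
      (fcomp (core (fibre X (otgt h'))) (core_func (fibre X (otgt h)) (act X \<kappa> h)) (core_func (fibre X (otgt h')) (act X \<kappa> h')))
      (compositor X \<kappa> h' h)" if "h \<in> Ar Delta" "h' \<in> Ar Delta" "otgt h = osrc h'" for h h'
    using core_nat_iso[OF compositor_nat_iso[OF that]] core_fcomp[OF act_functor[OF that(2)], of "act X \<kappa> h"] that(3) by simp
  show "nat_iso (core (fibre X n)) (core (fibre X n)) (idf (core (fibre X n)))
      (core_func (fibre X (otgt (Ident Delta n))) (act X \<kappa> (Ident Delta n))) (Ident E)" for n
    using idf_nat_iso[OF core_category[OF fibre_category[of n]]]
    by (simp add: act_Ident core_idf[OF fibre_category] core_simps)
next
  fix h h' h'' x assume h: "h \<in> Ar Delta" "h' \<in> Ar Delta" "h'' \<in> Ar Delta" and c: "otgt h = osrc h' \<and> otgt h' = osrc h''"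
    and "x \<in> Ob (core (fibre X (otgt h'')))"
  then have x: "x \<in> Ob (fibre X (otgt h''))" by (simp add: core_simps)
  have c': "otgt h = osrc h'" "otgt h' = osrc h''" using c by auto
  have "compositor X \<kappa> h'' h' x \<in> Ar (fibre X (otgt h))" "is_iso (fibre X (otgt h)) (compositor X \<kappa> h'' h' x)"
    using compositor_hom[OF h(2,3) c'(2) x] compositor_transport(2)[OF h(2,3) c'(2) x] c'(1) by (simp_all only: in_hom)
  then have "FAr (core_func (fibre X (otgt h)) (act X \<kappa> h)) (compositor X \<kappa> h'' h' x) = FAr (act X \<kappa> h) (compositor X \<kappa> h'' h' x)"
    by (rule core_func_simps(2))
  then show "FAr (core_func (fibre X (otgt h)) (act X \<kappa> h)) (compositor X \<kappa> h'' h' x)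
      \<cdot>\<^bsub>core (fibre X (osrc h))\<^esub> compositor X \<kappa> (h'' \<cdot>\<^bsub>Delta\<^esub> h') h x
    = compositor X \<kappa> h' h (FOb (core_func (fibre X (otgt h'')) (act X \<kappa> h'')) x)
      \<cdot>\<^bsub>core (fibre X (osrc h))\<^esub> compositor X \<kappa> h'' (h' \<cdot>\<^bsub>Delta\<^esub> h) x"
    using compositor_coherence[OF h c' x] by (simp add: core_simps core_func_simps(1)[OF x])
next
  fix h x assume h: "h \<in> Ar Delta" and "x \<in> Ob (core (fibre X (otgt h)))"
  then have x: "x \<in> Ob (fibre X (otgt h))" by (simp add: core_simps)
  show "compositor X \<kappa> h (Ident Delta (osrc h)) x = Ident E (FOb (core_func (fibre X (otgt h)) (act X \<kappa> h)) x)"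
    using compositor_Ident(1)[OF h x] by (simp add: core_func_simps(1)[OF x] act_Ob[OF h x])
  have "FAr (core_func (fibre X (otgt h)) (act X \<kappa> h)) (Ident E x) = Ident E (FOb (act X \<kappa> h) x)"
    using functor_simps(5)[OF core_act_functor[OF h], of x] x by (simp add: core_simps core_func_simps(1)[OF x])
  then show "compositor X \<kappa> (Ident Delta (otgt h)) h x = FAr (core_func (fibre X (otgt h)) (act X \<kappa> h)) (Ident E x)"
    using compositor_Ident(2)[OF h x] by (simp add: act_Ob[OF h x])
qed

text \<open>By the hypotheses \<open>k\<close>, the two base maps of the composite are those of
  \<open>g\<close> and \<open>f'\<close>. Its span is then the left leg of \<open>f'\<close>
  followed by the right leg of \<open>g\<close>, the other two legs being identities, so identities
  satisfy the description of the compositor.\<close>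

lemma compositor_free_generic:
  assumes f': "free f'" and g: "generic g" and c: "osrc f' = otgt g"
    and k: "push_map (f' \<cdot>\<^bsub>Delta\<^esub> g) = under_gen g" "pull_map (f' \<cdot>\<^bsub>Delta\<^esub> g) = under_free f'"
    and x: "x \<in> Ob (fibre X (otgt f'))"
  shows "compositor X \<kappa> f' g x = Ident E (Tgt E (rgt (f' \<cdot>\<^bsub>Delta\<^esub> g) x))"
proof -
  let ?k = "f' \<cdot>\<^bsub>Delta\<^esub> g"
  have A: "g \<in> Ar Delta" "f' \<in> Ar Delta" using f' g free_Ar generic_Ar by auto
  have kA: "?k \<in> Ar Delta" using A c by (auto intro: Delta_closed)
  have xk: "x \<in> Ob (fibre X (otgt ?k))" using x by simp
  have lk: "lft ?k x = lft f' x" by (simp add: span_left_def k(2) free_push_pull(2)[OF f'] flip: pull_map_def)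
  let ?a = "Src E (lft f' x)"
  have aE: "?a \<in> Ob E" using left_props(2)[OF A(2) x] by (simp add: Src_Ob)
  have rf: "rgt f' x = Ident E ?a" by (rule span_free(2)[OF f' x])
  have a: "?a \<in> Ob (fibre X (otgt g))" using right_props(5)[OF A(2) x] c aE by (simp add: rf Tgt_Ident)
  have lg: "lft g ?a = Ident E ?a" by (rule span_generic(1)[OF g a])
  have rg: "rgt g ?a = rgt ?k x" using span_generic(2)[OF g a] lk by (simp add: span_right_def k(1) flip: push_map_def)
  note Ta = Tgt_Ident[OF E_cat aE] Src_Ident[OF E_cat aE]
  have li: "Ident E ?a \<in> hom E ?a ?a" by (rule Ident_hom[OF E_cat aE])
  note lh = left_hom[OF A(2) x] and rh = right_hom[OF kA xk, unfolded lk]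
  have i: "Ident E (Tgt E (rgt ?k x)) \<in> hom (fibre X (osrc g)) (Tgt E (rgt ?k x)) (Tgt E (rgt ?k x))"
    using right_props(5)[OF kA xk] by (intro fibre_Ident_hom) simp
  show ?thesis
    by (rule compositor_eqI[OF A(1,2) c[symmetric] x, of _ "Ident E ?a" "Ident E ?a"])
      (simp_all only: lk rf Ta lg rg i li hom_Ident[OF E_cat lh] hom_Ident[OF E_cat li] hom_Ident[OF E_cat rh] Ident_hom_cmp[OF E_cat rh])
qed

text \<open>In this order the left leg of \<open>g'\<close> and the right leg of \<open>f\<close>
  are identities. Thus \<open>u\<close> is the left leg of the composite, \<open>v\<close> is
  \<open>t\<close> after its right leg, and the remaining equation is the one that defines
  \<open>bc_map\<close>.\<close>

lemma compositor_bc_map: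
  assumes g': "generic g'" and f: "free f" and c: "otgt f = osrc g'"
    and k: "push_map (g' \<cdot>\<^bsub>Delta\<^esub> f) = \<sigma>'" "pull_map (g' \<cdot>\<^bsub>Delta\<^esub> f) = \<tau>'"
    and x: "x \<in> Ob (fibre X (otgt g'))"
  shows "bc_map X \<kappa> (under_free f) (under_gen g') \<sigma>' \<tau>' x = compositor X \<kappa> g' f x"
proof -
  let ?k = "g' \<cdot>\<^bsub>Delta\<^esub> f" and ?t = "compositor X \<kappa> g' f x"
  have A: "f \<in> Ar Delta" "g' \<in> Ar Delta" using f g' free_Ar generic_Ar by auto
  have kA: "?k \<in> Ar Delta" using A c by (auto intro: Delta_closed)
  have xk: "x \<in> Ob (fibre X (otgt ?k))" using x by simp
  have xE: "x \<in> Ob E" using x by (rule fibre_ObE)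
  have lg: "lft g' x = Ident E x" and rg: "rgt g' x = cocart \<kappa> (under_gen g') x" using span_generic[OF g' x] by auto
  define y where "y = Tgt E (rgt g' x)"
  have y: "y \<in> Ob (fibre X (otgt f))" using right_props(5)[OF A(2) x] c by (simp add: y_def)
  have lf: "lft f y = cart \<kappa> (under_free f) y" and rf: "rgt f y = Ident E (Src E (lft f y))" using span_free[OF f y] by auto
  have lk: "lft ?k x = cart \<kappa> \<tau>' x" by (simp add: span_left_def k(2) flip: pull_map_def)
  define x' where "x' = Src E (lft ?k x)"
  have rk: "rgt ?k x = cocart \<kappa> \<sigma>' x'" by (simp add: span_right_def k(1) x'_def flip: push_map_def)
  have x': "x' \<in> Ob (fibre X (osrc \<sigma>'))" using left_props(5)[OF kA xk] by (simp add: x'_def flip: k(1))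
  have ug: "osrc (under_gen g') = otgt g'" and uf: "otgt (under_free f) = otgt f" "osrc (under_free f) = osrc f"
    and t': "otgt \<tau>' = otgt g'"
    by (simp_all add: under_gen_def under_free_def flip: k(2))
  have aE: "Src E (lft f y) \<in> Ob E" using left_props(2)[OF A(1) y] by (simp add: Src_Ob)
  obtain u v where u: "u \<in> hom E (Src E (lft ?k x)) (Src E (lft g' x))" and v: "v \<in> hom E (Src E (lft ?k x)) (Src E (lft f y))"
    and uv: "lft g' x \<cdot>\<^bsub>E\<^esub> u = lft ?k x" "rgt g' x \<cdot>\<^bsub>E\<^esub> u = lft f y \<cdot>\<^bsub>E\<^esub> v" "?t \<cdot>\<^bsub>E\<^esub> rgt ?k x = rgt f y \<cdot>\<^bsub>E\<^esub> v"
    unfolding y_def by (rule compositorE[OF A c x])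
  have u_eq: "u = lft ?k x"
    using uv(1) u Ident_hom_cmp[OF E_cat, of u] Src_Ident[OF E_cat xE] unfolding lg by metis
  have v_eq: "?t \<cdot>\<^bsub>E\<^esub> rgt ?k x = v" using uv(3) Ident_hom_cmp[OF E_cat v] unfolding rf by simp
  have t: "?t \<in> hom (fibre X (osrc f)) (Tgt E (rgt ?k x)) (Src E (lft f y))"
    using compositor_hom[OF A c x, folded y_def] Tgt_Ident[OF E_cat aE] unfolding rf by simp
  have e: "lft f y \<cdot>\<^bsub>E\<^esub> ?t \<cdot>\<^bsub>E\<^esub> rgt ?k x = rgt g' x \<cdot>\<^bsub>E\<^esub> lft ?k x" using uv(2) u_eq v_eq by simp
  have bobs: "FOb (push X \<kappa> (under_gen g')) x = y" "FOb (pull X \<kappa> \<tau>') x = x'" "FOb (push X \<kappa> \<sigma>') x' = Tgt E (rgt ?k x)"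
      "FOb (pull X \<kappa> (under_free f)) y = Src E (lft f y)"
    using x x' y unfolding y_def x'_def rk rg by (simp_all add: push_Ob pull_Ob ug uf t' lk lf[unfolded y_def rg])
  have "bc_map X \<kappa> (under_free f) (under_gen g') \<sigma>' \<tau>' x =
      (THE t. t \<in> hom (fibre X (osrc f)) (Tgt E (rgt ?k x)) (Src E (lft f y)) \<and>
        lft f y \<cdot>\<^bsub>E\<^esub> t \<cdot>\<^bsub>E\<^esub> rgt ?k x = rgt g' x \<cdot>\<^bsub>E\<^esub> lft ?k x)"
    unfolding bc_map_def Let_def bobs unfolding uf lf[symmetric] rk[symmetric] rg[symmetric] lk[symmetric] ..
  also have "\<dots> = ?t"
  proof (rule the_equality)
    show "?t \<in> hom (fibre X (osrc f)) (Tgt E (rgt ?k x)) (Src E (lft f y)) \<and>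
        lft f y \<cdot>\<^bsub>E\<^esub> ?t \<cdot>\<^bsub>E\<^esub> rgt ?k x = rgt g' x \<cdot>\<^bsub>E\<^esub> lft ?k x" using t e by simp
    fix s assume s: "s \<in> hom (fibre X (osrc f)) (Tgt E (rgt ?k x)) (Src E (lft f y)) \<and>
        lft f y \<cdot>\<^bsub>E\<^esub> s \<cdot>\<^bsub>E\<^esub> rgt ?k x = rgt g' x \<cdot>\<^bsub>E\<^esub> lft ?k x"
    then have sE: "s \<in> hom E (Tgt E (rgt ?k x)) (Src E (lft f y))" and tE: "?t \<in> hom E (Tgt E (rgt ?k x)) (Src E (lft f y))"
      using t by (auto simp: fibre_hom)
    note rh = right_hom[OF kA xk]
    have "s \<cdot>\<^bsub>E\<^esub> rgt ?k x = ?t \<cdot>\<^bsub>E\<^esub> rgt ?k x"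
      by (rule left_monic[OF A(1) y cmp_hom[OF E_cat rh sE] cmp_hom[OF E_cat rh tE]]) (use s e in simp)
    then show "s = ?t" by (rule right_epi[OF kA xk, rotated -1]) (use s t in simp_all)
  qed
  finally show ?thesis .
qed

text \<open>The square is the maximal subgroupoid square of an identity-extension square. The 2-cell
  demanded here, a composite of two compositors, has to be recognised as
  \<open>bc_map\<close>.\<close>

lemma decomp_of_decomposition_space:
  assumes "iesq X"
  shows "decomposition_space (decomp_of X \<kappa>)"
  unfolding decomposition_space_def
proof (intro conjI allI impI decomp_of_simplicial)
  fix g f f' g' assume "pushout_square Delta g f f' g' \<and> generic g \<and> free f"
  then have po: "pushout_square Delta g f f' g'" and g: "generic g" and f: "free f" by auto
  obtain a b where ab: "otgt f = a + osrc g + b" "otgt f' = a + otgt g + b" and f': "free f'" and g': "generic g'"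
    and uf: "under_free f = incl a (osrc g) b" "under_free f' = incl a (otgt g) b"
    and ug: "under_gen g' = id_ext a (under_gen g) b" and k: "push_map (f' \<cdot>\<^bsub>Delta\<^esub> g) = under_gen g"
    "pull_map (f' \<cdot>\<^bsub>Delta\<^esub> g) = under_free f'"
    by (rule pushout_id_ext[OF po g f])
  note sq = pushout_squareD[OF po]
  have k': "push_map (g' \<cdot>\<^bsub>Delta\<^esub> f) = under_gen g" "pull_map (g' \<cdot>\<^bsub>Delta\<^esub> f) = under_free f'" using k sq(7) by auto
  let ?u = "under_gen g"
  have u: "?u \<in> Ar uDelta" using push_map_Ar[OF generic_Ar[OF g]] generic_push_pull(1)[OF g] by simp
  have us: "osrc ?u = otgt g" "otgt ?u = osrc g" by (simp_all add: under_gen_def)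
  have "homotopy_pullback (fibre X (a + otgt g + b)) (fibre X (otgt g)) (fibre X (a + osrc g + b)) (fibre X (osrc g))
           (pull X \<kappa> (incl a (otgt g) b)) (push X \<kappa> (id_ext a ?u b)) (push X \<kappa> ?u) (pull X \<kappa> (incl a (osrc g) b))
           (bc_map X \<kappa> (incl a (osrc g) b) (id_ext a ?u b) ?u (incl a (otgt g) b))"
    using assms u cleavage unfolding iesq_def Let_def by (metis us)
  then have "homotopy_pullback (fibre X (otgt f')) (fibre X (otgt g)) (fibre X (otgt f)) (fibre X (osrc g))
           (act X \<kappa> f') (act X \<kappa> g') (act X \<kappa> g) (act X \<kappa> f) (bc_map X \<kappa> (under_free f) (under_gen g') ?u (under_free f'))"
    by (simp only: act_free[OF f'] act_free[OF f] act_generic[OF g] act_generic[OF g'] ab uf ug)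
  then have hp: "homotopy_pullback (core (fibre X (otgt f'))) (core (fibre X (otgt g))) (core (fibre X (otgt f))) (core (fibre X (osrc g)))
      (core_func (fibre X (otgt f')) (act X \<kappa> f')) (core_func (fibre X (otgt f')) (act X \<kappa> g'))
      (core_func (fibre X (otgt g)) (act X \<kappa> g)) (core_func (fibre X (otgt f)) (act X \<kappa> f))
      (bc_map X \<kappa> (under_free f) (under_gen g') ?u (under_free f'))"
    by (rule core_homotopy_pullback)
  show "homotopy_pullback (sgrp (decomp_of X \<kappa>) (otgt f')) (sgrp (decomp_of X \<kappa>) (otgt g)) (sgrp (decomp_of X \<kappa>) (otgt f))
      (sgrp (decomp_of X \<kappa>) (osrc g)) (sact (decomp_of X \<kappa>) f') (sact (decomp_of X \<kappa>) g') (sact (decomp_of X \<kappa>) g)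
      (sact (decomp_of X \<kappa>) f)
      (\<lambda>x. scmp (decomp_of X \<kappa>) g' f x \<cdot>\<^bsub>sgrp (decomp_of X \<kappa>) (osrc g)\<^esub>
         inv_ar (sgrp (decomp_of X \<kappa>) (osrc g)) (scmp (decomp_of X \<kappa>) f' g x))"
    unfolding decomp_of_simps sq(4)[symmetric]
  proof (rule homotopy_pullback_cong[OF hp])
    fix x assume "x \<in> Ob (core (fibre X (otgt f')))"
    then have x: "x \<in> Ob (fibre X (otgt f'))" "x \<in> Ob (fibre X (otgt g'))" using sq(4) by (simp_all add: core_simps)
    let ?z = "Tgt E (rgt (f' \<cdot>\<^bsub>Delta\<^esub> g) x)"
    have z: "?z \<in> Ob (fibre X (osrc g))"
      using right_props(5)[of "f' \<cdot>\<^bsub>Delta\<^esub> g" x] Delta_closed(2)[OF generic_Ar[OF g] free_Ar[OF f']] sq(5) x(1) by simp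
    \<comment> \<open>This compositor is an identity, so composing with its inverse changes nothing,
      and the other compositor is \<open>bc_map\<close>.\<close>
    have e: "compositor X \<kappa> f' g x = Ident E ?z" by (rule compositor_free_generic[OF f' g sq(5) k x(1)])
    have "inverse_ars (core (fibre X (osrc g))) (Ident E ?z) (Ident E ?z)"
      unfolding core_inverse_ars[OF fibre_category]
      using fibre_Ident_hom[OF z] z fibre_ObE[OF z]
      by (simp add: inverse_ars_def in_hom cat_simps)
    then have inv: "inv_ar (core (fibre X (osrc g))) (Ident E ?z) = Ident E ?z"
      by (rule inv_ar_eq[OF core_category[OF fibre_category]])
    have "compositor X \<kappa> g' f x \<in> hom (fibre X (osrc f)) (Tgt E (rgt (g' \<cdot>\<^bsub>Delta\<^esub> f) x)) (Tgt E (rgt f (Tgt E (rgt g' x))))"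
      by (rule compositor_hom[OF free_Ar[OF f] generic_Ar[OF g'] sq(6)[symmetric] x(2)])
    then have "compositor X \<kappa> g' f x \<in> hom E ?z (Tgt E (rgt f (Tgt E (rgt g' x))))" by (simp add: fibre_hom sq(7))
    then have "compositor X \<kappa> g' f x \<cdot>\<^bsub>E\<^esub> Ident E ?z = compositor X \<kappa> g' f x" by (rule hom_Ident[OF E_cat])
    then show "bc_map X \<kappa> (under_free f) (under_gen g') ?u (under_free f') x =
        compositor X \<kappa> g' f x \<cdot>\<^bsub>core (fibre X (osrc g))\<^esub> inv_ar (core (fibre X (osrc g))) (compositor X \<kappa> f' g x)"
      using compositor_bc_map[OF g' f sq(6)[symmetric] k' x(2)] by (simp add: e inv core_simps)
  qed
qed

end

section \<open>The category of decomposition spaces and CULF maps\<close>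

lemma fcomp_assoc:
  assumes F: "is_functor C D F" and G: "is_functor D D' G"
  shows "fcomp C H (fcomp C G F) = fcomp C (fcomp D H G) F"
  by (rule func_eqI[of _ "Ob C" _ "Ar C"]) (simp_all add: fcomp_simps functor_simps[OF F] functor_simps[OF G])

lemma restrict_cells_simps:
  "h \<in> Ar Delta \<Longrightarrow> x \<in> Ob (sgrp S (otgt h)) \<Longrightarrow> restrict_cells S cl h x = cl h x"
  "restrict_cells S (restrict_cells S cl) = restrict_cells S cl"
  by (auto simp: restrict_cells_def fun_eq_iff restrict_def)

text \<open>Cells are kept undefined off the maps of \<Delta> and the objects in question, which
  makes the category laws of \<open>DecompCulf\<close> equalities of records. This rule reduces them
  to the values that matter.\<close>

lemma restrict_cells_cong:
  assumes "\<And>h x. h \<in> Ar Delta \<Longrightarrow> x \<in> Ob (sgrp S (otgt h)) \<Longrightarrow> cl h x = cl' h x"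
  shows "restrict_cells S cl = restrict_cells S cl'"
  using assms by (auto simp: restrict_cells_def fun_eq_iff restrict_def)

lemma simplicial_groupoidD:
  assumes "simplicial_groupoid S"
  shows "groupoid (sgrp S n)" "category (sgrp S n)"
    "h \<in> Ar Delta \<Longrightarrow> is_functor (sgrp S (otgt h)) (sgrp S (osrc h)) (sact S h)"
    "h \<in> Ar Delta \<Longrightarrow> h' \<in> Ar Delta \<Longrightarrow> otgt h = osrc h' \<Longrightarrow>
        nat_iso (sgrp S (otgt h')) (sgrp S (osrc h)) (sact S (h' \<cdot>\<^bsub>Delta\<^esub> h))
          (fcomp (sgrp S (otgt h')) (sact S h) (sact S h')) (scmp S h' h)"
    "nat_iso (sgrp S n) (sgrp S n) (idf (sgrp S n)) (sact S (Ident Delta n)) (suni S n)"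
proof -
  show "groupoid (sgrp S n)" using assms unfolding simplicial_groupoid_def by blast
  then show "category (sgrp S n)" by (simp add: groupoid_def)
  show "h \<in> Ar Delta \<Longrightarrow> is_functor (sgrp S (otgt h)) (sgrp S (osrc h)) (sact S h)"
    using assms unfolding simplicial_groupoid_def by blast
  show "h \<in> Ar Delta \<Longrightarrow> h' \<in> Ar Delta \<Longrightarrow> otgt h = osrc h' \<Longrightarrow>
        nat_iso (sgrp S (otgt h')) (sgrp S (osrc h)) (sact S (h' \<cdot>\<^bsub>Delta\<^esub> h))
          (fcomp (sgrp S (otgt h')) (sact S h) (sact S h')) (scmp S h' h)"
    using assms unfolding simplicial_groupoid_def by blast
  show "nat_iso (sgrp S n) (sgrp S n) (idf (sgrp S n)) (sact S (Ident Delta n)) (suni S n)"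
    using assms unfolding simplicial_groupoid_def by blast
qed

lemma simplicial_mapD:
  assumes "simplicial_map \<alpha>"
  shows "simplicial_groupoid (ssrc \<alpha>)" "simplicial_groupoid (stgt \<alpha>)" "restrict_cells (ssrc \<alpha>) (scell \<alpha>) = scell \<alpha>"
    "is_functor (sgrp (ssrc \<alpha>) n) (sgrp (stgt \<alpha>) n) (scomponent \<alpha> n)"
    "h \<in> Ar Delta \<Longrightarrow> nat_iso (sgrp (ssrc \<alpha>) (otgt h)) (sgrp (stgt \<alpha>) (osrc h))
         (fcomp (sgrp (ssrc \<alpha>) (otgt h)) (sact (stgt \<alpha>) h) (scomponent \<alpha> (otgt h)))
         (fcomp (sgrp (ssrc \<alpha>) (otgt h)) (scomponent \<alpha> (osrc h)) (sact (ssrc \<alpha>) h)) (scell \<alpha> h)"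
    "h \<in> Ar Delta \<Longrightarrow> h' \<in> Ar Delta \<Longrightarrow> otgt h = osrc h' \<Longrightarrow> x \<in> Ob (sgrp (ssrc \<alpha>) (otgt h')) \<Longrightarrow>
        FAr (scomponent \<alpha> (osrc h)) (scmp (ssrc \<alpha>) h' h x)
              \<cdot>\<^bsub>sgrp (stgt \<alpha>) (osrc h)\<^esub> scell \<alpha> (h' \<cdot>\<^bsub>Delta\<^esub> h) x
            = scell \<alpha> h (FOb (sact (ssrc \<alpha>) h') x)
              \<cdot>\<^bsub>sgrp (stgt \<alpha>) (osrc h)\<^esub> FAr (sact (stgt \<alpha>) h) (scell \<alpha> h' x)
              \<cdot>\<^bsub>sgrp (stgt \<alpha>) (osrc h)\<^esub> scmp (stgt \<alpha>) h' h (FOb (scomponent \<alpha> (otgt h')) x)"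
    "x \<in> Ob (sgrp (ssrc \<alpha>) n) \<Longrightarrow> FAr (scomponent \<alpha> n) (suni (ssrc \<alpha>) n x)
         = scell \<alpha> (Ident Delta n) x \<cdot>\<^bsub>sgrp (stgt \<alpha>) n\<^esub> suni (stgt \<alpha>) n (FOb (scomponent \<alpha> n) x)"
  using assms unfolding simplicial_map_def Let_def by blast+

lemma simplicial_mapI:
  assumes "simplicial_groupoid (ssrc \<alpha>)" "simplicial_groupoid (stgt \<alpha>)" "restrict_cells (ssrc \<alpha>) (scell \<alpha>) = scell \<alpha>"
    "\<And>n. is_functor (sgrp (ssrc \<alpha>) n) (sgrp (stgt \<alpha>) n) (scomponent \<alpha> n)"
    "\<And>h. h \<in> Ar Delta \<Longrightarrow> nat_iso (sgrp (ssrc \<alpha>) (otgt h)) (sgrp (stgt \<alpha>) (osrc h))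
         (fcomp (sgrp (ssrc \<alpha>) (otgt h)) (sact (stgt \<alpha>) h) (scomponent \<alpha> (otgt h)))
         (fcomp (sgrp (ssrc \<alpha>) (otgt h)) (scomponent \<alpha> (osrc h)) (sact (ssrc \<alpha>) h)) (scell \<alpha> h)"
    "\<And>h h' x. h \<in> Ar Delta \<Longrightarrow> h' \<in> Ar Delta \<Longrightarrow> otgt h = osrc h' \<Longrightarrow> x \<in> Ob (sgrp (ssrc \<alpha>) (otgt h')) \<Longrightarrow>
        FAr (scomponent \<alpha> (osrc h)) (scmp (ssrc \<alpha>) h' h x)
              \<cdot>\<^bsub>sgrp (stgt \<alpha>) (osrc h)\<^esub> scell \<alpha> (h' \<cdot>\<^bsub>Delta\<^esub> h) x
            = scell \<alpha> h (FOb (sact (ssrc \<alpha>) h') x)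
              \<cdot>\<^bsub>sgrp (stgt \<alpha>) (osrc h)\<^esub> FAr (sact (stgt \<alpha>) h) (scell \<alpha> h' x)
              \<cdot>\<^bsub>sgrp (stgt \<alpha>) (osrc h)\<^esub> scmp (stgt \<alpha>) h' h (FOb (scomponent \<alpha> (otgt h')) x)"
    "\<And>n x. x \<in> Ob (sgrp (ssrc \<alpha>) n) \<Longrightarrow> FAr (scomponent \<alpha> n) (suni (ssrc \<alpha>) n x)
         = scell \<alpha> (Ident Delta n) x \<cdot>\<^bsub>sgrp (stgt \<alpha>) n\<^esub> suni (stgt \<alpha>) n (FOb (scomponent \<alpha> n) x)"
  shows "simplicial_map \<alpha>"
  unfolding simplicial_map_def Let_def using assms by blast

lemma culfD:
  assumes "culf \<alpha>"
  shows "simplicial_map \<alpha>" "generic g \<Longrightarrow> homotopy_pullback (sgrp (ssrc \<alpha>) (otgt g)) (sgrp (stgt \<alpha>) (otgt g))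
          (sgrp (ssrc \<alpha>) (osrc g)) (sgrp (stgt \<alpha>) (osrc g))
          (scomponent \<alpha> (otgt g)) (sact (ssrc \<alpha>) g) (sact (stgt \<alpha>) g) (scomponent \<alpha> (osrc g)) (scell \<alpha> g)"
  using assms by (auto simp: culf_def)

lemma DecompCulf_simps [simp]:
  "Ob DecompCulf = {S. decomposition_space S}" "Src DecompCulf = ssrc" "Tgt DecompCulf = stgt"
  "ssrc (Ident DecompCulf S) = S" "stgt (Ident DecompCulf S) = S"
  "scomponent (Ident DecompCulf S) n = idf (sgrp S n)"
  "ssrc (\<beta> \<cdot>\<^bsub>DecompCulf\<^esub> \<alpha>) = ssrc \<alpha>" "stgt (\<beta> \<cdot>\<^bsub>DecompCulf\<^esub> \<alpha>) = stgt \<beta>"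
  "scomponent (\<beta> \<cdot>\<^bsub>DecompCulf\<^esub> \<alpha>) n = fcomp (sgrp (ssrc \<alpha>) n) (scomponent \<beta> n) (scomponent \<alpha> n)"
  by (simp_all add: DecompCulf_def)

lemma DecompCulf_Ar: "\<alpha> \<in> Ar DecompCulf \<longleftrightarrow> decomposition_space (ssrc \<alpha>) \<and> decomposition_space (stgt \<alpha>) \<and> culf \<alpha>"
  by (simp add: DecompCulf_def)

lemma DecompCulf_scell:
  "scell (Ident DecompCulf S) = restrict_cells S (\<lambda>h x. Ident (sgrp S (osrc h)) (FOb (sact S h) x))"
  "scell (\<beta> \<cdot>\<^bsub>DecompCulf\<^esub> \<alpha>) = restrict_cells (ssrc \<alpha>) (\<lambda>h x.
     FAr (scomponent \<beta> (osrc h)) (scell \<alpha> h x) \<cdot>\<^bsub>sgrp (stgt \<beta>) (osrc h)\<^esub> scell \<beta> h (FOb (scomponent \<alpha> (otgt h)) x))"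
  by (simp_all add: DecompCulf_def)

lemma smap_eqI:
  fixes \<alpha> \<beta> :: "('o, 'a) smap"
  assumes "ssrc \<alpha> = ssrc \<beta>" "stgt \<alpha> = stgt \<beta>" "\<And>n. scomponent \<alpha> n = scomponent \<beta> n" "scell \<alpha> = scell \<beta>"
  shows "\<alpha> = \<beta>"
  using assms by (intro smap.equality ext) auto

lemma scell_props:
  assumes "simplicial_map \<alpha>" "h \<in> Ar Delta" "x \<in> Ob (sgrp (ssrc \<alpha>) (otgt h))"
  shows "scell \<alpha> h x \<in> hom (sgrp (stgt \<alpha>) (osrc h)) (FOb (sact (stgt \<alpha>) h) (FOb (scomponent \<alpha> (otgt h)) x))
      (FOb (scomponent \<alpha> (osrc h)) (FOb (sact (ssrc \<alpha>) h) x))"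
  using nat_isoD(3)[OF simplicial_mapD(5)[OF assms(1,2)] assms(3)] assms(3) by (simp add: fcomp_simps)

section \<open>Identities and composites of CULF maps\<close>

lemma Ident_simplicial_map:
  assumes S: "simplicial_groupoid S"
  shows "simplicial_map (Ident DecompCulf S)"
    "h \<in> Ar Delta \<Longrightarrow> nat_iso (sgrp S (otgt h)) (sgrp S (osrc h)) (sact S h) (sact S h) (scell (Ident DecompCulf S) h)"
proof -
  note D = simplicial_groupoidD[OF S]
  let ?c = "scell (Ident DecompCulf S)"
  have c: "?c h x = Ident (sgrp S (osrc h)) (FOb (sact S h) x)" if "h \<in> Ar Delta" "x \<in> Ob (sgrp S (otgt h))" for h x
    using that by (simp add: DecompCulf_scell restrict_cells_simps)
  have nat: "nat_iso (sgrp S (otgt h)) (sgrp S (osrc h)) (sact S h) (sact S h) (?c h)" if h: "h \<in> Ar Delta" for h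
  proof (rule nat_isoI)
    note F = functor_simps[OF D(3)[OF h]]
    show "?c h x \<in> hom (sgrp S (osrc h)) (FOb (sact S h) x) (FOb (sact S h) x)" "is_iso (sgrp S (osrc h)) (?c h x)"
      if "x \<in> Ob (sgrp S (otgt h))" for x
      unfolding c[OF h that] using Ident_hom[OF D(2)] is_iso_Ident[OF D(2)] F(1)[OF that] by auto
    fix f x y assume f: "f \<in> hom (sgrp S (otgt h)) x y"
    have xy: "x \<in> Ob (sgrp S (otgt h))" "y \<in> Ob (sgrp S (otgt h))" using hom_Ob[OF D(2) f] by auto
    have "FAr (sact S h) f \<in> hom (sgrp S (osrc h)) (FOb (sact S h) x) (FOb (sact S h) y)" by (rule functor_hom[OF D(3)[OF h] f])
    then show "?c h y \<cdot>\<^bsub>sgrp S (osrc h)\<^esub> FAr (sact S h) f = FAr (sact S h) f \<cdot>\<^bsub>sgrp S (osrc h)\<^esub> ?c h x"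
      unfolding c[OF h xy(1)] c[OF h xy(2)] by (simp add: hom_Ident[OF D(2)] Ident_hom_cmp[OF D(2)])
  qed (use D(3)[OF h] in auto)
  then show "h \<in> Ar Delta \<Longrightarrow> nat_iso (sgrp S (otgt h)) (sgrp S (osrc h)) (sact S h) (sact S h) (?c h)" by blast
  show "simplicial_map (Ident DecompCulf S)"
  proof (rule simplicial_mapI; unfold DecompCulf_simps)
    show "restrict_cells S ?c = ?c" by (simp add: DecompCulf_scell restrict_cells_simps)
    show "is_functor (sgrp S n) (sgrp S n) (idf (sgrp S n))" for n by (rule idf_functor[OF D(2)])
    show "nat_iso (sgrp S (otgt h)) (sgrp S (osrc h)) (fcomp (sgrp S (otgt h)) (sact S h) (idf (sgrp S (otgt h))))
        (fcomp (sgrp S (otgt h)) (idf (sgrp S (osrc h))) (sact S h)) (?c h)" if "h \<in> Ar Delta" for h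
      using nat[OF that] by (simp add: fcomp_idf[OF D(3)[OF that]])
  next
    fix h h' x assume h: "h \<in> Ar Delta" "h' \<in> Ar Delta" "otgt h = osrc h'" and x: "x \<in> Ob (sgrp S (otgt h'))"
    have k: "h' \<cdot>\<^bsub>Delta\<^esub> h \<in> Ar Delta" using Delta_closed(2)[OF h] .
    have t: "scmp S h' h x \<in> hom (sgrp S (osrc h)) (FOb (sact S (h' \<cdot>\<^bsub>Delta\<^esub> h)) x) (FOb (sact S h) (FOb (sact S h') x))"
      using nat_isoD(3)[OF D(4)[OF h] x] x by (simp add: fcomp_simps)
    have y: "FOb (sact S h') x \<in> Ob (sgrp S (otgt h))" using functor_simps(1)[OF D(3)[OF h(2)] x] h(3) by simp
    have xk: "x \<in> Ob (sgrp S (otgt (h' \<cdot>\<^bsub>Delta\<^esub> h)))" using x by simp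
    have "FAr (idf (sgrp S (osrc h))) (scmp S h' h x) = scmp S h' h x" using t by (simp add: in_hom idf_simps)
    moreover have "scmp S h' h x \<cdot>\<^bsub>sgrp S (osrc h)\<^esub> ?c (h' \<cdot>\<^bsub>Delta\<^esub> h) x = scmp S h' h x"
      using hom_Ident[OF D(2) t] by (simp add: c[OF k xk])
    moreover have "FAr (sact S h) (?c h' x) = Ident (sgrp S (osrc h)) (FOb (sact S h) (FOb (sact S h') x))"
      using functor_simps(5)[OF D(3)[OF h(1)] y] h(3) by (simp add: c[OF h(2) x])
    moreover have "Ident (sgrp S (osrc h)) (FOb (sact S h) (FOb (sact S h') x)) \<cdot>\<^bsub>sgrp S (osrc h)\<^esub> scmp S h' h x = scmp S h' h x"
      by (rule Ident_hom_cmp[OF D(2) t])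
    ultimately show "FAr (idf (sgrp S (osrc h))) (scmp S h' h x) \<cdot>\<^bsub>sgrp S (osrc h)\<^esub> ?c (h' \<cdot>\<^bsub>Delta\<^esub> h) x =
        ?c h (FOb (sact S h') x) \<cdot>\<^bsub>sgrp S (osrc h)\<^esub> FAr (sact S h) (?c h' x) \<cdot>\<^bsub>sgrp S (osrc h)\<^esub>
          scmp S h' h (FOb (idf (sgrp S (otgt h'))) x)"
      using x by (simp add: c[OF h(1) y] idf_simps)
  next
    fix n x assume x: "x \<in> Ob (sgrp S n)"
    have u: "suni S n x \<in> hom (sgrp S n) x (FOb (sact S (Ident Delta n)) x)"
      using nat_isoD(3)[OF D(5) x] x by (simp add: idf_simps)
    have "?c (Ident Delta n) x = Ident (sgrp S n) (FOb (sact S (Ident Delta n)) x)"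
      using c[OF Delta_closed(1), of x n] x by simp
    then show "FAr (idf (sgrp S n)) (suni S n x) =
        ?c (Ident Delta n) x \<cdot>\<^bsub>sgrp S n\<^esub> suni S n (FOb (idf (sgrp S n)) x)"
      using Ident_hom_cmp[OF D(2) u] u x by (simp add: idf_simps in_hom)
  qed (use S in auto)
qed

lemma Ident_culf:
  assumes "decomposition_space S"
  shows "culf (Ident DecompCulf S)"
proof -
  have S: "simplicial_groupoid S" using assms by (simp add: decomposition_space_def)
  show ?thesis
    unfolding culf_def DecompCulf_simps
    using Ident_simplicial_map(1)[OF S] homotopy_pullback_id[OF Ident_simplicial_map(2)[OF S generic_Ar]] by blast
qed

text \<open>The square of the composite at a generic map is the pasting of the two given ones, and
  the cells were defined to match this pasting. The laborious part is the compatibility of the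
  composite cells with the compositors.\<close>

lemma cmp_culf:
  assumes \<alpha>: "culf \<alpha>" and \<beta>: "culf \<beta>" and c: "stgt \<alpha> = ssrc \<beta>"
  shows "culf (\<beta> \<cdot>\<^bsub>DecompCulf\<^esub> \<alpha>)"
proof -
  define S T U where "S = ssrc \<alpha>" and "T = stgt \<alpha>" and "U = stgt \<beta>"
  have sm: "simplicial_map \<alpha>" "simplicial_map \<beta>" using \<alpha> \<beta> culfD(1) by auto
  note a = simplicial_mapD[OF sm(1), folded S_def T_def] and b = simplicial_mapD[OF sm(2), folded c U_def, folded T_def]
  note pa = scell_props[OF sm(1), folded S_def T_def] and pb = scell_props[OF sm(2), folded c U_def, folded T_def]
  note DS = simplicial_groupoidD[OF a(1)] and DT = simplicial_groupoidD[OF a(2)] and DU = simplicial_groupoidD[OF b(2)]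
  let ?A = "scomponent \<alpha>" and ?B = "scomponent \<beta>" and ?c = "scell (\<beta> \<cdot>\<^bsub>DecompCulf\<^esub> \<alpha>)"
  have cell: "?c h x = FAr (?B (osrc h)) (scell \<alpha> h x) \<cdot>\<^bsub>sgrp U (osrc h)\<^esub> scell \<beta> h (FOb (?A (otgt h)) x)"
    if "h \<in> Ar Delta" "x \<in> Ob (sgrp S (otgt h))" for h x
    using that by (simp add: DecompCulf_scell restrict_cells_simps S_def U_def)
  have "simplicial_map (\<beta> \<cdot>\<^bsub>DecompCulf\<^esub> \<alpha>)"
  proof (rule simplicial_mapI, unfold DecompCulf_simps, fold S_def U_def)
    show "restrict_cells S ?c = ?c" by (simp add: DecompCulf_scell restrict_cells_simps S_def)
    show "is_functor (sgrp S n) (sgrp U n) (fcomp (sgrp S n) (?B n) (?A n))" for n by (rule fcomp_functor[OF a(4) b(4)])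
    show "nat_iso (sgrp S (otgt h)) (sgrp U (osrc h))
        (fcomp (sgrp S (otgt h)) (sact U h) (fcomp (sgrp S (otgt h)) (?B (otgt h)) (?A (otgt h))))
        (fcomp (sgrp S (otgt h)) (fcomp (sgrp S (osrc h)) (?B (osrc h)) (?A (osrc h))) (sact S h)) (?c h)" if h: "h \<in> Ar Delta" for h
      by (rule nat_iso_cong[OF nat_iso_paste[OF a(4) DS(3)[OF h] DT(3)[OF h] a(4) a(5)[OF h] b(4) DU(3)[OF h] b(4) b(5)[OF h]]])
        (simp add: cell h)
  next
    fix h h' x assume h: "h \<in> Ar Delta" "h' \<in> Ar Delta" "otgt h = osrc h'" and x: "x \<in> Ob (sgrp S (otgt h'))"
    let ?k = "h' \<cdot>\<^bsub>Delta\<^esub> h" and ?n = "osrc h"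
    let ?C = "sgrp U (osrc h)"
    have k: "?k \<in> Ar Delta" using Delta_closed(2)[OF h] .
    have xk: "x \<in> Ob (sgrp S (otgt ?k))" using x by simp
    have y: "FOb (sact S h') x \<in> Ob (sgrp S (otgt h))" using functor_simps(1)[OF DS(3)[OF h(2)] x] h(3) by simp
    define ax where "ax = FOb (?A (otgt h')) x"
    have ax: "ax \<in> Ob (sgrp T (otgt h'))" unfolding ax_def by (rule functor_simps(1)[OF a(4) x])
    define ay where "ay = FOb (?A (otgt h)) (FOb (sact S h') x)"
    have ay: "ay \<in> Ob (sgrp T (otgt h))" unfolding ay_def by (rule functor_simps(1)[OF a(4) y])
    have az: "FOb (sact T h') ax \<in> Ob (sgrp T (otgt h))" using functor_simps(1)[OF DT(3)[OF h(2)] ax] h(3) by simp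
    define s where "s = scmp S h' h x"
    define s' where "s' = scmp T h' h ax"
    define s'' where "s'' = scmp U h' h (FOb (?B (otgt h')) ax)"
    define p where "p = scell \<alpha> h' x"
    define q where "q = scell \<alpha> h (FOb (sact S h') x)"
    have bax: "FOb (?B (otgt h')) ax \<in> Ob (sgrp U (otgt h'))" by (rule functor_simps(1)[OF b(4) ax])
    have hs: "s \<in> hom (sgrp S ?n) (FOb (sact S ?k) x) (FOb (sact S h) (FOb (sact S h') x))"
      using nat_isoD(3)[OF DS(4)[OF h] x] x by (simp add: fcomp_simps s_def)
    have hs': "s' \<in> hom (sgrp T ?n) (FOb (sact T ?k) ax) (FOb (sact T h) (FOb (sact T h') ax))"
      using nat_isoD(3)[OF DT(4)[OF h] ax] ax by (simp add: fcomp_simps s'_def)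
    have hs'': "s'' \<in> hom ?C (FOb (sact U ?k) (FOb (?B (otgt h')) ax)) (FOb (sact U h) (FOb (sact U h') (FOb (?B (otgt h')) ax)))"
      using nat_isoD(3)[OF DU(4)[OF h] bax] bax by (simp add: fcomp_simps s''_def)
    have hp: "p \<in> hom (sgrp T (otgt h)) (FOb (sact T h') ax) ay"
      using pa[OF h(2) x] h(3) by (simp add: p_def ax_def ay_def)
    have hq: "q \<in> hom (sgrp T ?n) (FOb (sact T h) ay) (FOb (?A ?n) (FOb (sact S h) (FOb (sact S h') x)))"
      using pa[OF h(1) y] by (simp add: q_def ay_def)
    have hak: "scell \<alpha> ?k x \<in> hom (sgrp T ?n) (FOb (sact T ?k) ax) (FOb (?A ?n) (FOb (sact S ?k) x))"
      using pa[OF k xk] by (simp add: ax_def)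
    have hbk: "scell \<beta> ?k ax \<in> hom ?C (FOb (sact U ?k) (FOb (?B (otgt h')) ax)) (FOb (?B ?n) (FOb (sact T ?k) ax))"
      using pb[OF k, of ax] ax by simp
    have hbh: "scell \<beta> h ay \<in> hom ?C (FOb (sact U h) (FOb (?B (otgt h)) ay)) (FOb (?B ?n) (FOb (sact T h) ay))"
      by (rule pb[OF h(1) ay])
    have hbz: "scell \<beta> h (FOb (sact T h') ax) \<in> hom ?C (FOb (sact U h) (FOb (?B (otgt h)) (FOb (sact T h') ax)))
        (FOb (?B ?n) (FOb (sact T h) (FOb (sact T h') ax)))"
      by (rule pb[OF h(1) az])
    have hbh': "scell \<beta> h' ax \<in> hom (sgrp U (otgt h)) (FOb (sact U h') (FOb (?B (otgt h')) ax)) (FOb (?B (otgt h)) (FOb (sact T h') ax))"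
      using pb[OF h(2) ax] h(3) by simp
    note Bn = functor_hom[OF b(4), of _ ?n]
    note Th = functor_hom[OF DT(3)[OF h(1)]] and Uh = functor_hom[OF DU(3)[OF h(1)]]
    note A = hom_assoc[OF DU(2)[of ?n]] and m = cmp_hom[OF DU(2)[of ?n]]
    \<comment> \<open>Three equations suffice: the compatibility for \<alpha> at \<open>x\<close>,
      later carried along the component of \<beta>; the compatibility for \<beta> at
      \<open>ax\<close>; and the naturality of the cell of \<beta> at \<open>p\<close>.\<close>
    have e1: "FAr (?A ?n) s \<cdot>\<^bsub>sgrp T ?n\<^esub> scell \<alpha> ?k x = q \<cdot>\<^bsub>sgrp T ?n\<^esub> FAr (sact T h) p \<cdot>\<^bsub>sgrp T ?n\<^esub> s'"
      using a(6)[OF h x] by (simp add: s_def q_def p_def s'_def ax_def)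
    have e2: "FAr (?B ?n) s' \<cdot>\<^bsub>?C\<^esub> scell \<beta> ?k ax = scell \<beta> h (FOb (sact T h') ax) \<cdot>\<^bsub>?C\<^esub> FAr (sact U h) (scell \<beta> h' ax) \<cdot>\<^bsub>?C\<^esub> s''"
      using b(6)[OF h ax] by (simp add: s'_def s''_def)
    have hp': "p \<in> Ar (sgrp T (otgt h))" using hp by (simp add: in_hom)
    \<comment> \<open>The interchange that moves the cell of \<beta> past the image of the cell of
      \<alpha>, so that the cells regroup into composite cells.\<close>
    have e3: "scell \<beta> h ay \<cdot>\<^bsub>?C\<^esub> FAr (sact U h) (FAr (?B (otgt h)) p) = FAr (?B ?n) (FAr (sact T h) p) \<cdot>\<^bsub>?C\<^esub> scell \<beta> h (FOb (sact T h') ax)"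
      using nat_isoD(8)[OF b(5)[OF h(1)] hp] hp' by (simp add: fcomp_simps)
    have f1: "FAr (?B ?n) (FAr (?A ?n) s) \<cdot>\<^bsub>?C\<^esub> FAr (?B ?n) (scell \<alpha> ?k x)
        = FAr (?B ?n) q \<cdot>\<^bsub>?C\<^esub> FAr (?B ?n) (FAr (sact T h) p) \<cdot>\<^bsub>?C\<^esub> FAr (?B ?n) s'"
    proof -
      have "FAr (?B ?n) (FAr (?A ?n) s \<cdot>\<^bsub>sgrp T ?n\<^esub> scell \<alpha> ?k x) = FAr (?B ?n) (FAr (?A ?n) s) \<cdot>\<^bsub>?C\<^esub> FAr (?B ?n) (scell \<alpha> ?k x)"
        using functor_hom[OF a(4) hs] hak by (intro functor_simps(6)[OF b(4)]) (simp_all add: in_hom)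
      moreover have "FAr (?B ?n) (q \<cdot>\<^bsub>sgrp T ?n\<^esub> FAr (sact T h) p \<cdot>\<^bsub>sgrp T ?n\<^esub> s') =
          FAr (?B ?n) q \<cdot>\<^bsub>?C\<^esub> FAr (?B ?n) (FAr (sact T h) p) \<cdot>\<^bsub>?C\<^esub> FAr (?B ?n) s'"
        using hq Th[OF hp] hs' cmp_hom[OF DT(2) hs' Th[OF hp]] by (simp add: functor_simps(6)[OF b(4)] in_hom)
      ultimately show ?thesis using e1 by simp
    qed
    have "(FAr (?B ?n) (FAr (?A ?n) s)) \<cdot>\<^bsub>?C\<^esub> (FAr (?B ?n) (scell \<alpha> ?k x) \<cdot>\<^bsub>?C\<^esub> scell \<beta> ?k ax)
        = (FAr (?B ?n) q \<cdot>\<^bsub>?C\<^esub> FAr (?B ?n) (FAr (sact T h) p) \<cdot>\<^bsub>?C\<^esub> FAr (?B ?n) s') \<cdot>\<^bsub>?C\<^esub> scell \<beta> ?k ax"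
      using A[OF hbk Bn[OF hak] Bn[OF functor_hom[OF a(4) hs]]] f1 by simp
    also have "\<dots> = FAr (?B ?n) q \<cdot>\<^bsub>?C\<^esub> FAr (?B ?n) (FAr (sact T h) p) \<cdot>\<^bsub>?C\<^esub> (FAr (?B ?n) s' \<cdot>\<^bsub>?C\<^esub> scell \<beta> ?k ax)"
      using A[OF hbk m[OF Bn[OF hs'] Bn[OF Th[OF hp]]] Bn[OF hq]] A[OF hbk Bn[OF hs'] Bn[OF Th[OF hp]]] by simp
    also have "\<dots> = FAr (?B ?n) q \<cdot>\<^bsub>?C\<^esub> (FAr (?B ?n) (FAr (sact T h) p) \<cdot>\<^bsub>?C\<^esub> scell \<beta> h (FOb (sact T h') ax)) \<cdot>\<^bsub>?C\<^esub>
        (FAr (sact U h) (scell \<beta> h' ax) \<cdot>\<^bsub>?C\<^esub> s'')"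
      unfolding e2 using A[OF m[OF hs''] hbz Bn[OF Th[OF hp]], of "FAr (sact U h) (scell \<beta> h' ax)"] Uh[OF hbh'] by simp
    also have "\<dots> = FAr (?B ?n) q \<cdot>\<^bsub>?C\<^esub> scell \<beta> h ay \<cdot>\<^bsub>?C\<^esub> FAr (sact U h) (FAr (?B (otgt h)) p) \<cdot>\<^bsub>?C\<^esub>
        FAr (sact U h) (scell \<beta> h' ax) \<cdot>\<^bsub>?C\<^esub> s''"
      unfolding e3[symmetric] using A[OF m[OF hs'' Uh[OF hbh']] Uh[OF functor_hom[OF b(4) hp]] hbh] by simp
    also have "\<dots> = (FAr (?B ?n) q \<cdot>\<^bsub>?C\<^esub> scell \<beta> h ay) \<cdot>\<^bsub>?C\<^esub> (FAr (sact U h) (FAr (?B (otgt h)) p) \<cdot>\<^bsub>?C\<^esub>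
        FAr (sact U h) (scell \<beta> h' ax)) \<cdot>\<^bsub>?C\<^esub> s''"
      using A[OF m[OF hs'' m[OF Uh[OF hbh'] Uh[OF functor_hom[OF b(4) hp]]]] hbh Bn[OF hq]]
        A[OF hs'' Uh[OF hbh'] Uh[OF functor_hom[OF b(4) hp]]] by simp
    also have "FAr (sact U h) (FAr (?B (otgt h)) p) \<cdot>\<^bsub>?C\<^esub> FAr (sact U h) (scell \<beta> h' ax) =
        FAr (sact U h) (FAr (?B (otgt h)) p \<cdot>\<^bsub>sgrp U (otgt h)\<^esub> scell \<beta> h' ax)"
      using functor_hom[OF b(4) hp] hbh' by (intro functor_simps(6)[OF DU(3)[OF h(1)], symmetric]) (simp_all add: in_hom)
    finally have main: "FAr (?B ?n) (FAr (?A ?n) s) \<cdot>\<^bsub>?C\<^esub> (FAr (?B ?n) (scell \<alpha> ?k x) \<cdot>\<^bsub>?C\<^esub> scell \<beta> ?k ax)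
        = (FAr (?B ?n) q \<cdot>\<^bsub>?C\<^esub> scell \<beta> h ay) \<cdot>\<^bsub>?C\<^esub>
          FAr (sact U h) (FAr (?B (otgt h)) p \<cdot>\<^bsub>sgrp U (otgt h)\<^esub> scell \<beta> h' ax) \<cdot>\<^bsub>?C\<^esub> s''" .
    have "s \<in> Ar (sgrp S ?n)" using hs by (simp add: in_hom)
    then show "FAr (fcomp (sgrp S ?n) (?B ?n) (?A ?n)) (scmp S h' h x) \<cdot>\<^bsub>?C\<^esub> ?c ?k x =
        ?c h (FOb (sact S h') x) \<cdot>\<^bsub>?C\<^esub> FAr (sact U h) (?c h' x) \<cdot>\<^bsub>?C\<^esub>
          scmp U h' h (FOb (fcomp (sgrp S (otgt h')) (?B (otgt h')) (?A (otgt h'))) x)"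
      using main x
      by (simp add: cell[OF k xk] cell[OF h(1) y] cell[OF h(2) x] fcomp_simps h(3)[symmetric]
          flip: ax_def ay_def s_def s''_def p_def q_def)
  next
    fix n x assume x: "x \<in> Ob (sgrp S n)"
    let ?i = "Ident Delta n" and ?C = "sgrp U n"
    have xi: "x \<in> Ob (sgrp S (otgt ?i))" using x by simp
    define ax where "ax = FOb (?A n) x"
    have ax: "ax \<in> Ob (sgrp T n)" unfolding ax_def by (rule functor_simps(1)[OF a(4) x])
    have bax: "FOb (?B n) ax \<in> Ob (sgrp U n)" by (rule functor_simps(1)[OF b(4) ax])
    have u: "suni S n x \<in> hom (sgrp S n) x (FOb (sact S ?i) x)"
      using nat_isoD(3)[OF DS(5) x] x by (simp add: idf_simps)
    have u': "suni T n ax \<in> hom (sgrp T n) ax (FOb (sact T ?i) ax)"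
      using nat_isoD(3)[OF DT(5) ax] ax by (simp add: idf_simps)
    have u'': "suni U n (FOb (?B n) ax) \<in> hom ?C (FOb (?B n) ax) (FOb (sact U ?i) (FOb (?B n) ax))"
      using nat_isoD(3)[OF DU(5) bax] bax by (simp add: idf_simps)
    have ca: "scell \<alpha> ?i x \<in> hom (sgrp T n) (FOb (sact T ?i) ax) (FOb (?A n) (FOb (sact S ?i) x))"
      using pa[OF Delta_closed(1) xi] by (simp add: ax_def)
    have cb: "scell \<beta> ?i ax \<in> hom ?C (FOb (sact U ?i) (FOb (?B n) ax)) (FOb (?B n) (FOb (sact T ?i) ax))"
      using pb[OF Delta_closed(1), of ax n] ax by simp
    have e1: "FAr (?A n) (suni S n x) = scell \<alpha> ?i x \<cdot>\<^bsub>sgrp T n\<^esub> suni T n ax"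
      using a(7)[OF x] by (simp add: ax_def)
    have e2: "FAr (?B n) (suni T n ax) = scell \<beta> ?i ax \<cdot>\<^bsub>?C\<^esub> suni U n (FOb (?B n) ax)" by (rule b(7)[OF ax])
    have "FAr (?B n) (FAr (?A n) (suni S n x)) = FAr (?B n) (scell \<alpha> ?i x) \<cdot>\<^bsub>?C\<^esub> FAr (?B n) (suni T n ax)"
      unfolding e1 using ca u' by (intro functor_simps(6)[OF b(4)]) (simp_all add: in_hom)
    also have "\<dots> = (FAr (?B n) (scell \<alpha> ?i x) \<cdot>\<^bsub>?C\<^esub> scell \<beta> ?i ax) \<cdot>\<^bsub>?C\<^esub> suni U n (FOb (?B n) ax)"
      unfolding e2 using hom_assoc[OF DU(2) u'' cb functor_hom[OF b(4) ca]] by simp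
    finally show "FAr (fcomp (sgrp S n) (?B n) (?A n)) (suni S n x) =
        ?c ?i x \<cdot>\<^bsub>?C\<^esub> suni U n (FOb (fcomp (sgrp S n) (?B n) (?A n)) x)"
      using cell[OF Delta_closed(1) xi] x u by (simp add: fcomp_simps in_hom flip: ax_def)
  qed (use a(1) b(2) in auto)
  moreover have "homotopy_pullback (sgrp S (otgt g)) (sgrp U (otgt g)) (sgrp S (osrc g)) (sgrp U (osrc g))
      (fcomp (sgrp S (otgt g)) (?B (otgt g)) (?A (otgt g))) (sact S g) (sact U g)
      (fcomp (sgrp S (osrc g)) (?B (osrc g)) (?A (osrc g))) (?c g)" if g: "generic g" for g
  proof (rule homotopy_pullback_cong)
    show "homotopy_pullback (sgrp S (otgt g)) (sgrp U (otgt g)) (sgrp S (osrc g)) (sgrp U (osrc g))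
      (fcomp (sgrp S (otgt g)) (?B (otgt g)) (?A (otgt g))) (sact S g) (sact U g)
      (fcomp (sgrp S (osrc g)) (?B (osrc g)) (?A (osrc g)))
      (\<lambda>x. FAr (?B (osrc g)) (scell \<alpha> g x) \<cdot>\<^bsub>sgrp U (osrc g)\<^esub> scell \<beta> g (FOb (?A (otgt g)) x))"
      by (rule homotopy_pullback_paste[OF culfD(2)[OF \<alpha> g, folded S_def T_def] culfD(2)[OF \<beta> g, folded c U_def, folded T_def]])
  qed (simp add: cell generic_Ar[OF g])
  ultimately show ?thesis unfolding culf_def by (simp flip: S_def U_def)
qed

lemma DecompCulf_category: "category (DecompCulf :: (('o, 'a) sgpd, ('o, 'a) smap) cat)"
proof (rule categoryI)
  fix f g h :: "('o, 'a) smap" and x y z w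
  assume "f \<in> hom DecompCulf x y"
  then have f: "ssrc f = x" "stgt f = y" "decomposition_space x" "decomposition_space y" "culf f"
    by (auto simp: in_hom DecompCulf_Ar)
  note Df = simplicial_mapD[OF culfD(1)[OF f(5)], unfolded f]
  note cf = scell_props[OF culfD(1)[OF f(5)], unfolded f]
  show "x \<in> Ob DecompCulf \<and> y \<in> Ob DecompCulf" using f by simp
  show "f \<cdot>\<^bsub>DecompCulf\<^esub> Ident DecompCulf x = f"
  proof (rule smap_eqI)
    show "scomponent (f \<cdot>\<^bsub>DecompCulf\<^esub> Ident DecompCulf x) n = scomponent f n" for n
      using fcomp_idf(1)[OF Df(4)] by simp
    have "scell (f \<cdot>\<^bsub>DecompCulf\<^esub> Ident DecompCulf x) = restrict_cells x (scell f)"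
      unfolding DecompCulf_scell DecompCulf_simps
    proof (rule restrict_cells_cong)
      fix h :: omap and z assume h: "h \<in> Ar Delta" and z: "z \<in> Ob (sgrp x (otgt h))"
      have "FOb (sact x h) z \<in> Ob (sgrp x (osrc h))" by (rule functor_simps(1)[OF simplicial_groupoidD(3)[OF Df(1) h] z])
      then show "FAr (scomponent f (osrc h)) (restrict_cells x (\<lambda>h z. Ident (sgrp x (osrc h)) (FOb (sact x h) z)) h z)
          \<cdot>\<^bsub>sgrp (stgt f) (osrc h)\<^esub> scell f h (FOb (idf (sgrp x (otgt h))) z) = scell f h z"
        using Ident_hom_cmp[OF simplicial_groupoidD(2)[OF Df(2)] cf[OF h z]] h z
        by (simp add: restrict_cells_simps idf_simps f functor_simps(5)[OF Df(4)])
    qed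
    then show "scell (f \<cdot>\<^bsub>DecompCulf\<^esub> Ident DecompCulf x) = scell f" using Df(3) by simp
  qed (simp_all add: f)
  show "Ident DecompCulf y \<cdot>\<^bsub>DecompCulf\<^esub> f = f"
  proof (rule smap_eqI)
    show "scomponent (Ident DecompCulf y \<cdot>\<^bsub>DecompCulf\<^esub> f) n = scomponent f n" for n
      using fcomp_idf(2)[OF Df(4)] by (simp add: f)
    have "scell (Ident DecompCulf y \<cdot>\<^bsub>DecompCulf\<^esub> f) = restrict_cells x (scell f)"
      unfolding DecompCulf_scell DecompCulf_simps f
    proof (rule restrict_cells_cong)
      fix h :: omap and z assume h: "h \<in> Ar Delta" and z: "z \<in> Ob (sgrp x (otgt h))"
      have "FOb (scomponent f (otgt h)) z \<in> Ob (sgrp y (otgt h))" by (rule functor_simps(1)[OF Df(4) z])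
      moreover have "scell f h z \<in> Ar (sgrp y (osrc h))" using cf[OF h z] by (simp add: in_hom)
      ultimately show "FAr (idf (sgrp y (osrc h))) (scell f h z) \<cdot>\<^bsub>sgrp y (osrc h)\<^esub>
          restrict_cells y (\<lambda>h z. Ident (sgrp y (osrc h)) (FOb (sact y h) z)) h (FOb (scomponent f (otgt h)) z) = scell f h z"
        using hom_Ident[OF simplicial_groupoidD(2)[OF Df(2)] cf[OF h z]] h
        by (simp add: restrict_cells_simps idf_simps)
    qed
    then show "scell (Ident DecompCulf y \<cdot>\<^bsub>DecompCulf\<^esub> f) = scell f" using Df(3) by simp
  qed (simp_all add: f)
  assume "g \<in> hom DecompCulf y z"
  then have g: "ssrc g = y" "stgt g = z" "decomposition_space z" "culf g" by (auto simp: in_hom DecompCulf_Ar)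
  note Dg = simplicial_mapD[OF culfD(1)[OF g(4)], unfolded g]
  note cg = scell_props[OF culfD(1)[OF g(4)], unfolded g]
  show "g \<cdot>\<^bsub>DecompCulf\<^esub> f \<in> hom DecompCulf x z"
    using f g cmp_culf[OF f(5) g(4)] by (simp add: in_hom DecompCulf_Ar)
  assume "h \<in> hom DecompCulf z w"
  then have h: "ssrc h = z" "stgt h = w" "decomposition_space w" "culf h" by (auto simp: in_hom DecompCulf_Ar)
  note Dh = simplicial_mapD[OF culfD(1)[OF h(4)], unfolded h]
  note ch = scell_props[OF culfD(1)[OF h(4)], unfolded h]
  show "h \<cdot>\<^bsub>DecompCulf\<^esub> (g \<cdot>\<^bsub>DecompCulf\<^esub> f) = (h \<cdot>\<^bsub>DecompCulf\<^esub> g) \<cdot>\<^bsub>DecompCulf\<^esub> f"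
  proof (rule smap_eqI)
    show "scomponent (h \<cdot>\<^bsub>DecompCulf\<^esub> (g \<cdot>\<^bsub>DecompCulf\<^esub> f)) n = scomponent ((h \<cdot>\<^bsub>DecompCulf\<^esub> g) \<cdot>\<^bsub>DecompCulf\<^esub> f) n" for n
      using fcomp_assoc[OF Df(4) Dg(4)] by (simp add: f g h)
    show "scell (h \<cdot>\<^bsub>DecompCulf\<^esub> (g \<cdot>\<^bsub>DecompCulf\<^esub> f)) = scell ((h \<cdot>\<^bsub>DecompCulf\<^esub> g) \<cdot>\<^bsub>DecompCulf\<^esub> f)"
      unfolding DecompCulf_scell DecompCulf_simps f g h
    proof (rule restrict_cells_cong)
      fix k :: omap and v assume k: "k \<in> Ar Delta" and v: "v \<in> Ob (sgrp x (otgt k))"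
      let ?n = "osrc k"
      have fv: "FOb (scomponent f (otgt k)) v \<in> Ob (sgrp y (otgt k))" by (rule functor_simps(1)[OF Df(4) v])
      have gv: "FOb (scomponent g (otgt k)) (FOb (scomponent f (otgt k)) v) \<in> Ob (sgrp z (otgt k))"
        by (rule functor_simps(1)[OF Dg(4) fv])
      note c1 = cf[OF k v] and c2 = cg[OF k fv] and c3 = ch[OF k gv]
      \<comment> \<open>Associativity of composite cells rests on the component of \<open>h\<close>
        preserving the composite of the two inner cells.\<close>
      have "FAr (scomponent h ?n) (FAr (scomponent g ?n) (scell f k v) \<cdot>\<^bsub>sgrp z ?n\<^esub> scell g k (FOb (scomponent f (otgt k)) v))
          = FAr (scomponent h ?n) (FAr (scomponent g ?n) (scell f k v)) \<cdot>\<^bsub>sgrp w ?n\<^esub>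
            FAr (scomponent h ?n) (scell g k (FOb (scomponent f (otgt k)) v))"
        using c2 functor_hom[OF Dg(4) c1] by (intro functor_simps(6)[OF Dh(4)]) (simp_all add: in_hom)
      moreover have "scell f k v \<in> Ar (sgrp y ?n)" using c1 by (simp add: in_hom)
      ultimately show "FAr (scomponent h ?n) (restrict_cells x (\<lambda>k v. FAr (scomponent g (osrc k)) (scell f k v)
            \<cdot>\<^bsub>sgrp z (osrc k)\<^esub> scell g k (FOb (scomponent f (otgt k)) v)) k v)
          \<cdot>\<^bsub>sgrp w ?n\<^esub> scell h k (FOb (fcomp (sgrp x (otgt k)) (scomponent g (otgt k)) (scomponent f (otgt k))) v)
        = FAr (fcomp (sgrp y ?n) (scomponent h ?n) (scomponent g ?n)) (scell f k v) \<cdot>\<^bsub>sgrp w ?n\<^esub>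
          restrict_cells y (\<lambda>k v. FAr (scomponent h (osrc k)) (scell g k v) \<cdot>\<^bsub>sgrp w (osrc k)\<^esub>
            scell h k (FOb (scomponent g (otgt k)) v)) k (FOb (scomponent f (otgt k)) v)"
        using hom_assoc[OF simplicial_groupoidD(2)[OF Dh(2)] c3 functor_hom[OF Dh(4) c2]
            functor_hom[OF Dh(4) functor_hom[OF Dg(4) c1]]] k v fv
        by (simp add: restrict_cells_simps fcomp_simps)
    qed
  qed (simp_all add: f g h)
next
  fix x :: "('o, 'a) sgpd" assume "x \<in> Ob DecompCulf"
  then show "Ident DecompCulf x \<in> hom DecompCulf x x"
    using Ident_culf[of x] by (simp add: in_hom DecompCulf_Ar)
qed

section \<open>Morphisms of sesquicartesian fibrations\<close>

text \<open>The preservation conditions of \<open>sesq_functor\<close>, separated from its pullback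
  condition. They already determine the comparison cells, which must be at hand while the pullback
  condition is proved for identities and composites.\<close>

definition bicartesian_functor :: "('o, 'a) fib_map \<Rightarrow> bool" where
  "bicartesian_functor c \<longleftrightarrow>
     is_functor (total (fsrc c)) (total (ftgt c)) (fmap c) \<and>
     fcomp (total (fsrc c)) (proj (ftgt c)) (fmap c) = proj (fsrc c) \<and>
     (\<forall>\<psi>. cocartesian (fsrc c) \<psi> \<longrightarrow> cocartesian (ftgt c) (FAr (fmap c) \<psi>)) \<and>
     (\<forall>\<phi>. cartesian (fsrc c) \<phi> \<and> convex (FAr (proj (fsrc c)) \<phi>) \<longrightarrow>
           cartesian (ftgt c) (FAr (fmap c) \<phi>))"

lemma sesq_functor_bicartesian: "sesq_functor c \<Longrightarrow> bicartesian_functor c"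
  unfolding sesq_functor_def bicartesian_functor_def by blast

lemma sesq_functor_pullback:
  assumes "sesq_functor c" "f \<in> Ar uDelta" "is_cleavage (fsrc c) \<kappa>" "is_cleavage (ftgt c) \<kappa>'"
  shows "homotopy_pullback (fibre (fsrc c) (osrc f)) (fibre (ftgt c) (osrc f))
          (fibre (fsrc c) (otgt f)) (fibre (ftgt c) (otgt f))
          (fibre_func c (osrc f)) (push (fsrc c) \<kappa> f) (push (ftgt c) \<kappa>' f) (fibre_func c (otgt f))
          (push_cell c \<kappa> \<kappa>' f)"
  using assms unfolding sesq_functor_def by blast

lemma sesq_functorI:
  assumes "bicartesian_functor c"
    "\<And>f \<kappa> \<kappa>'. f \<in> Ar uDelta \<Longrightarrow> is_cleavage (fsrc c) \<kappa> \<Longrightarrow> is_cleavage (ftgt c) \<kappa>' \<Longrightarrow>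
        homotopy_pullback (fibre (fsrc c) (osrc f)) (fibre (ftgt c) (osrc f))
          (fibre (fsrc c) (otgt f)) (fibre (ftgt c) (otgt f))
          (fibre_func c (osrc f)) (push (fsrc c) \<kappa> f) (push (ftgt c) \<kappa>' f) (fibre_func c (otgt f))
          (push_cell c \<kappa> \<kappa>' f)"
  shows "sesq_functor c"
  using assms unfolding sesq_functor_def bicartesian_functor_def by blast

text \<open>Source and target are tied to \<open>X\<close> and \<open>Y\<close> by equations, so
  that two morphisms and their composite can be interpreted side by side over the same fibrations
  and cleavages.\<close>

locale bicartesian_morphism =
  S: cleaved_fibration X \<kappa> + T: cleaved_fibration Y \<kappa>'
  for X :: "('o, 'a) fib" and \<kappa> and Y :: "('o, 'a) fib" and \<kappa>' +
  fixes c :: "('o, 'a) fib_map"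
  assumes src: "fsrc c = X" and tgt: "ftgt c = Y" and bicart: "bicartesian_functor c"
begin

abbreviation cO :: "'o \<Rightarrow> 'o" where "cO \<equiv> FOb (fmap c)"
abbreviation cA :: "'a \<Rightarrow> 'a" where "cA \<equiv> FAr (fmap c)"

lemma c_functor: "is_functor S.E T.E (fmap c)"
  using bicart by (simp add: bicartesian_functor_def src tgt)

lemma c_proj: "fcomp S.E (proj Y) (fmap c) = proj X"
  using bicart by (simp add: bicartesian_functor_def src tgt)

lemma c_cocartesian: "cocartesian X \<psi> \<Longrightarrow> cocartesian Y (cA \<psi>)"
  using bicart by (simp add: bicartesian_functor_def src tgt)

lemma c_cartesian: "cartesian X \<phi> \<Longrightarrow> convex (S.pr \<phi>) \<Longrightarrow> cartesian Y (cA \<phi>)"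
  using bicart by (simp add: bicartesian_functor_def src tgt)

lemma c_pr: "v \<in> Ar S.E \<Longrightarrow> T.pr (cA v) = S.pr v"
  using fcomp_simps(2)[of v S.E "proj Y" "fmap c"] by (simp add: c_proj)

lemma c_prOb: "x \<in> Ob S.E \<Longrightarrow> FOb (proj Y) (cO x) = FOb (proj X) x"
  using fcomp_simps(1)[of x S.E "proj Y" "fmap c"] by (simp add: c_proj)

lemma c_hom: "v \<in> hom S.E x y \<Longrightarrow> cA v \<in> hom T.E (cO x) (cO y)"
  by (rule functor_hom[OF c_functor])

lemma c_cmp: "v \<in> hom S.E x y \<Longrightarrow> w \<in> hom S.E y z \<Longrightarrow> cA (w \<cdot>\<^bsub>S.E\<^esub> v) = cA w \<cdot>\<^bsub>T.E\<^esub> cA v"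
  by (rule functor_simps(6)[OF c_functor]) (simp_all add: in_hom)

lemma c_fibre_Ob: "x \<in> Ob (fibre X n) \<Longrightarrow> cO x \<in> Ob (fibre Y n)"
  by (simp add: S.fibre_Ob T.fibre_Ob c_prOb functor_simps[OF c_functor])

lemma c_fibre_hom: "v \<in> hom (fibre X n) x y \<Longrightarrow> cA v \<in> hom (fibre Y n) (cO x) (cO y)"
  using c_hom[of v x y] c_pr[of v] by (simp add: S.fibre_hom T.fibre_hom in_hom[of v])

lemma fibre_func_simps:
  "x \<in> Ob (fibre X n) \<Longrightarrow> FOb (fibre_func c n) x = cO x"
  "v \<in> Ar (fibre X n) \<Longrightarrow> FAr (fibre_func c n) v = cA v"
  "FOb (fibre_func c n) \<in> extensional (Ob (fibre X n))" "FAr (fibre_func c n) \<in> extensional (Ar (fibre X n))"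
  by (simp_all add: fibre_func_def src del: S.fibre_Ar)

lemma fibre_func_hom: "v \<in> hom (fibre X n) x y \<Longrightarrow> FAr (fibre_func c n) v = cA v"
  by (rule fibre_func_simps(2)) (simp only: in_hom)

lemma fibre_func_functor: "is_functor (fibre X n) (fibre Y n) (fibre_func c n)"
proof (rule is_functorI)
  show "FOb (fibre_func c n) x \<in> Ob (fibre Y n)" if "x \<in> Ob (fibre X n)" for x
    using that by (simp add: fibre_func_simps c_fibre_Ob)
  show "FAr (fibre_func c n) f \<in> hom (fibre Y n) (FOb (fibre_func c n) x) (FOb (fibre_func c n) y)"
    if "f \<in> hom (fibre X n) x y" for f x y
    using c_fibre_hom[OF that] hom_Ob[OF S.fibre_category that] by (simp add: fibre_func_hom[OF that] fibre_func_simps(1))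
  show "FAr (fibre_func c n) (Ident (fibre X n) x) = Ident (fibre Y n) (FOb (fibre_func c n) x)" if "x \<in> Ob (fibre X n)" for x
    using fibre_func_hom[OF Ident_hom[OF S.fibre_category that]] that functor_simps(5)[OF c_functor, of x]
    by (simp add: fibre_func_simps(1) S.fibre_Ob)
  show "FAr (fibre_func c n) (g \<cdot>\<^bsub>fibre X n\<^esub> f) = FAr (fibre_func c n) g \<cdot>\<^bsub>fibre Y n\<^esub> FAr (fibre_func c n) f"
    if f: "f \<in> hom (fibre X n) x y" and g: "g \<in> hom (fibre X n) y z" for f g x y z
    using fibre_func_hom[OF cmp_hom[OF S.fibre_category f g]] f g c_cmp[of f x y g z]
    by (simp add: fibre_func_hom[OF f] fibre_func_hom[OF g] S.fibre_hom)
qed (simp_all add: S.fibre_category T.fibre_category fibre_func_simps(3,4))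

lemma push_cell_eqI:
  assumes f: "f \<in> Ar uDelta" and x: "x \<in> Ob (fibre X (osrc f))"
    and t: "t \<in> hom (fibre Y (otgt f)) (Tgt T.E (cocart \<kappa>' f (cO x))) (cO (Tgt S.E (cocart \<kappa> f x)))"
      "t \<cdot>\<^bsub>T.E\<^esub> cocart \<kappa>' f (cO x) = cA (cocart \<kappa> f x)"
  shows "push_cell c \<kappa> \<kappa>' f x = t"
proof -
  note cx = c_fibre_Ob[OF x]
  have "push_cell c \<kappa> \<kappa>' f x = (THE t. t \<in> hom (fibre Y (otgt f)) (Tgt T.E (cocart \<kappa>' f (cO x))) (cO (Tgt S.E (cocart \<kappa> f x))) \<and>
      t \<cdot>\<^bsub>T.E\<^esub> cocart \<kappa>' f (cO x) = cA (cocart \<kappa> f x))"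
    by (simp add: push_cell_def Let_def src tgt S.push_Ob[OF x] T.push_Ob[OF cx])
  also have "\<dots> = t"
  proof (rule the_equality)
    fix s assume s: "s \<in> hom (fibre Y (otgt f)) (Tgt T.E (cocart \<kappa>' f (cO x))) (cO (Tgt S.E (cocart \<kappa> f x))) \<and>
      s \<cdot>\<^bsub>T.E\<^esub> cocart \<kappa>' f (cO x) = cA (cocart \<kappa> f x)"
    show "s = t" by (rule T.cocart_unique_vertical[OF T.cocart_props(1)[OF f cx] _ t(1)]) (use s t(2) in auto)
  qed (use t in auto)
  finally show ?thesis .
qed

text \<open>\<open>c\<close> sends the chosen lift at \<open>x\<close> to a cocartesian arrow over
  the same base map; the comparison with the chosen lift at \<open>cO x\<close> is vertical, hence
  invertible.\<close>

lemma push_cell: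
  assumes f: "f \<in> Ar uDelta" and x: "x \<in> Ob (fibre X (osrc f))"
  shows "push_cell c \<kappa> \<kappa>' f x \<in> hom (fibre Y (otgt f)) (Tgt T.E (cocart \<kappa>' f (cO x))) (cO (Tgt S.E (cocart \<kappa> f x)))"
    "push_cell c \<kappa> \<kappa>' f x \<cdot>\<^bsub>T.E\<^esub> cocart \<kappa>' f (cO x) = cA (cocart \<kappa> f x)"
    "is_iso (fibre Y (otgt f)) (push_cell c \<kappa> \<kappa>' f x)"
proof -
  note cx = c_fibre_Ob[OF x]
  note p = S.cocart_props[OF f x] and p' = T.cocart_props[OF f cx]
  have cp: "cA (cocart \<kappa> f x) \<in> hom T.E (Src T.E (cocart \<kappa>' f (cO x))) (cO (Tgt S.E (cocart \<kappa> f x)))"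
    using c_hom[OF homI[OF p(2,3) refl]] p'(3) by simp
  have "T.pr (cA (cocart \<kappa> f x)) = T.pr (cocart \<kappa>' f (cO x))" using c_pr[OF p(2)] p(4) p'(4) by simp
  moreover have "otgt f = otgt (T.pr (cocart \<kappa>' f (cO x)))" using p'(4) by simp
  ultimately obtain t where t: "t \<in> hom (fibre Y (otgt f)) (Tgt T.E (cocart \<kappa>' f (cO x))) (cO (Tgt S.E (cocart \<kappa> f x)))"
    "t \<cdot>\<^bsub>T.E\<^esub> cocart \<kappa>' f (cO x) = cA (cocart \<kappa> f x)"
    by (rule T.cocart_fill_vertical[OF p'(1) cp])
  have e: "push_cell c \<kappa> \<kappa>' f x = t" by (rule push_cell_eqI[OF f x t])
  show "push_cell c \<kappa> \<kappa>' f x \<in> hom (fibre Y (otgt f)) (Tgt T.E (cocart \<kappa>' f (cO x))) (cO (Tgt S.E (cocart \<kappa> f x)))"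
    "push_cell c \<kappa> \<kappa>' f x \<cdot>\<^bsub>T.E\<^esub> cocart \<kappa>' f (cO x) = cA (cocart \<kappa> f x)" using t e by auto
  show "is_iso (fibre Y (otgt f)) (push_cell c \<kappa> \<kappa>' f x)"
    unfolding e by (rule T.cocart_iso[OF p'(1) c_cocartesian[OF p(1)] _ _ t(2)]) (use cp t(1) in \<open>simp_all add: in_hom\<close>)
qed

section \<open>Cells comparing the actions on source and target\<close>

context
  fixes h :: omap
  assumes h: "h \<in> Ar Delta"
begin

lemma c_left:
  assumes x: "x \<in> Ob (fibre X (otgt h))"
  shows "cartesian Y (cA (S.lft h x))" "cA (S.lft h x) \<in> hom T.E (cO (Src S.E (S.lft h x))) (cO x)"
    "T.pr (cA (S.lft h x)) = pull_map h"
  using c_cartesian[OF S.left_props(1)[OF h x]] c_hom[OF S.left_hom[OF h x]] c_pr[OF S.left_props(2)[OF h x]]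
    S.left_props(4)[OF h x] pull_map_convex[OF h] by simp_all

lemma c_right:
  assumes x: "x \<in> Ob (fibre X (otgt h))"
  shows "cocartesian Y (cA (S.rgt h x))" "cA (S.rgt h x) \<in> hom T.E (cO (Src S.E (S.lft h x))) (cO (Tgt S.E (S.rgt h x)))"
    "T.pr (cA (S.rgt h x)) = push_map h"
  using c_cocartesian[OF S.right_props(1)[OF h x]] c_hom[OF S.right_hom[OF h x]] c_pr[OF S.right_props(2)[OF h x]]
    S.right_props(4)[OF h x] by simp_all

lemma c_left_monic:
  assumes x: "x \<in> Ob (fibre X (otgt h))" and "u \<in> hom T.E z (cO (Src S.E (S.lft h x)))" "v \<in> hom T.E z (cO (Src S.E (S.lft h x)))"
    "cA (S.lft h x) \<cdot>\<^bsub>T.E\<^esub> u = cA (S.lft h x) \<cdot>\<^bsub>T.E\<^esub> v"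
  shows "u = v"
proof (rule T.cart_monic[OF c_left(1)[OF x] _ _ _ assms(4)])
  have "Src T.E (cA (S.lft h x)) = cO (Src S.E (S.lft h x))" using c_left(2)[OF x] by (simp add: in_hom)
  then show "u \<in> hom T.E z (Src T.E (cA (S.lft h x)))" "v \<in> hom T.E z (Src T.E (cA (S.lft h x)))" using assms by auto
qed (simp add: c_left(3)[OF x] pull_map_convex[OF h])

text \<open>The analogue of \<open>transport\<close> for the comparison of \<open>h\<^sup>* c\<close> with \<open>c h\<^sup>*\<close>.\<close>

definition span_map :: "'o \<Rightarrow> 'o \<Rightarrow> 'a \<Rightarrow> 'a \<Rightarrow> bool" where
  "span_map x x' w t \<longleftrightarrow>
     t \<in> hom (fibre Y (osrc h)) (Tgt T.E (T.rgt h (cO x))) (cO (Tgt S.E (S.rgt h x'))) \<and>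
     (\<exists>u. u \<in> hom T.E (Src T.E (T.lft h (cO x))) (cO (Src S.E (S.lft h x'))) \<and>
          w \<cdot>\<^bsub>T.E\<^esub> T.lft h (cO x) = cA (S.lft h x') \<cdot>\<^bsub>T.E\<^esub> u \<and>
          t \<cdot>\<^bsub>T.E\<^esub> T.rgt h (cO x) = cA (S.rgt h x') \<cdot>\<^bsub>T.E\<^esub> u)"

lemma span_mapI:
  assumes "t \<in> hom (fibre Y (osrc h)) (Tgt T.E (T.rgt h (cO x))) (cO (Tgt S.E (S.rgt h x')))"
    "u \<in> hom T.E (Src T.E (T.lft h (cO x))) (cO (Src S.E (S.lft h x')))"
    "w \<cdot>\<^bsub>T.E\<^esub> T.lft h (cO x) = cA (S.lft h x') \<cdot>\<^bsub>T.E\<^esub> u"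
    "t \<cdot>\<^bsub>T.E\<^esub> T.rgt h (cO x) = cA (S.rgt h x') \<cdot>\<^bsub>T.E\<^esub> u"
  shows "span_map x x' w t"
  unfolding span_map_def using assms by blast

lemma span_map_unique:
  assumes x: "x \<in> Ob (fibre X (otgt h))" "x' \<in> Ob (fibre X (otgt h))"
    and t: "span_map x x' w t" "span_map x x' w t'"
  shows "t = t'"
proof -
  obtain u u' where u: "u \<in> hom T.E (Src T.E (T.lft h (cO x))) (cO (Src S.E (S.lft h x')))"
      "w \<cdot>\<^bsub>T.E\<^esub> T.lft h (cO x) = cA (S.lft h x') \<cdot>\<^bsub>T.E\<^esub> u" "t \<cdot>\<^bsub>T.E\<^esub> T.rgt h (cO x) = cA (S.rgt h x') \<cdot>\<^bsub>T.E\<^esub> u"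
    and u': "u' \<in> hom T.E (Src T.E (T.lft h (cO x))) (cO (Src S.E (S.lft h x')))"
      "w \<cdot>\<^bsub>T.E\<^esub> T.lft h (cO x) = cA (S.lft h x') \<cdot>\<^bsub>T.E\<^esub> u'" "t' \<cdot>\<^bsub>T.E\<^esub> T.rgt h (cO x) = cA (S.rgt h x') \<cdot>\<^bsub>T.E\<^esub> u'"
    and tt: "t \<in> hom (fibre Y (osrc h)) (Tgt T.E (T.rgt h (cO x))) (cO (Tgt S.E (S.rgt h x')))"
      "t' \<in> hom (fibre Y (osrc h)) (Tgt T.E (T.rgt h (cO x))) (cO (Tgt S.E (S.rgt h x')))"
    using t unfolding span_map_def by blast
  have "u = u'" by (rule c_left_monic[OF x(2) u(1) u'(1)]) (use u(2) u'(2) in simp)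
  then show ?thesis
    by (intro T.right_epi[OF h c_fibre_Ob[OF x(1)] tt]) (use u(3) u'(3) in simp)
qed

text \<open>\<open>c\<close> carries the chosen span at \<open>x\<close> to a cartesian and a
  cocartesian arrow over the same two base maps as the chosen span at \<open>cO x\<close>. Hence the
  comparison \<open>u\<close> of left legs is a vertical isomorphism, and so is the comparison
  \<open>t\<close> of right legs that it induces.\<close>

lemma act_cell_span_map:
  assumes x: "x \<in> Ob (fibre X (otgt h))"
  shows "span_map x x (Ident T.E (cO x)) (act_cell c \<kappa> \<kappa>' h x)" "is_iso (fibre Y (osrc h)) (act_cell c \<kappa> \<kappa>' h x)"
proof -
  note cx = c_fibre_Ob[OF x]
  note L = T.left_props[OF h cx] and R = T.right_props[OF h cx] and lh = T.left_hom[OF h cx] and rh = T.right_hom[OF h cx]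
  note cl = c_left[OF x] and cr = c_right[OF x]
  have i: "Ident T.E (cO x) \<cdot>\<^bsub>T.E\<^esub> T.lft h (cO x) = T.lft h (cO x)" by (rule Ident_hom_cmp[OF T.E_cat lh])
  have sl: "Src T.E (cA (S.lft h x)) = cO (Src S.E (S.lft h x))" "Tgt T.E (cA (S.lft h x)) = cO x" "cA (S.lft h x) \<in> Ar T.E"
    using cl(2) by (simp_all add: in_hom)
  have lh': "T.lft h (cO x) \<in> hom T.E (Src T.E (T.lft h (cO x))) (Tgt T.E (cA (S.lft h x)))" using lh sl by simp
  have "T.pr (T.lft h (cO x)) = T.pr (cA (S.lft h x))" using cl(3) L(4) by simp
  from T.cart_fill_vertical[OF cl(1) lh' this refl]
  obtain u where u: "u \<in> hom (fibre Y (osrc (pull_map h))) (Src T.E (T.lft h (cO x))) (Src T.E (cA (S.lft h x)))"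
    "cA (S.lft h x) \<cdot>\<^bsub>T.E\<^esub> u = T.lft h (cO x)" unfolding cl(3) by blast
  have u_iso: "is_iso (fibre Y (osrc (pull_map h))) u"
    by (rule T.cart_iso[OF cl(1) L(1) _ u]) (use L(3) sl in simp)
  have uE: "u \<in> hom T.E (Src T.E (T.lft h (cO x))) (cO (Src S.E (S.lft h x)))" using u(1) sl by (simp add: T.fibre_hom)
  have ru: "cA (S.rgt h x) \<cdot>\<^bsub>T.E\<^esub> u \<in> hom T.E (Src T.E (T.rgt h (cO x))) (cO (Tgt S.E (S.rgt h x)))"
    using cmp_hom[OF T.E_cat uE cr(2)] R(3) by simp
  have ru_c: "cocartesian Y (cA (S.rgt h x) \<cdot>\<^bsub>T.E\<^esub> u)"
    by (rule T.cocart_cmp[OF T.vertical_iso_bicartesian(1)[OF u_iso] cr(1)]) (use uE cr(2) in \<open>simp add: in_hom\<close>)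
  have "T.pr (cA (S.rgt h x) \<cdot>\<^bsub>T.E\<^esub> u) = T.pr (T.rgt h (cO x))"
  proof -
    have "T.pr (cA (S.rgt h x) \<cdot>\<^bsub>T.E\<^esub> u) = T.pr (cA (S.rgt h x))"
      by (rule T.pr_cmp_vertical(1)) (use u(1) uE cr(2) in \<open>simp_all add: in_hom\<close>)
    then show ?thesis using cr(3) R(4) by simp
  qed
  from T.cocart_fill_vertical[OF R(1) ru this refl]
  obtain t where t: "t \<in> hom (fibre Y (osrc h)) (Tgt T.E (T.rgt h (cO x))) (cO (Tgt S.E (S.rgt h x)))"
    "t \<cdot>\<^bsub>T.E\<^esub> T.rgt h (cO x) = cA (S.rgt h x) \<cdot>\<^bsub>T.E\<^esub> u" unfolding R(4) push_map_simps by blast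
  have t_iso: "is_iso (fibre Y (osrc h)) t"
    by (rule T.cocart_iso[OF R(1) ru_c _ _ t(2)]) (use ru t(1) in \<open>simp_all add: in_hom\<close>)
  have st: "span_map x x (Ident T.E (cO x)) t"
    by (rule span_mapI[OF t(1) uE _ t(2)]) (simp only: i u(2))
  have "act_cell c \<kappa> \<kappa>' h x = (THE t. span_map x x (Ident T.E (cO x)) t)"
    unfolding act_cell_def Let_def src tgt span_map_def T.act_Ob[OF h cx] S.act_Ob[OF h x] i sl(1)
    by (intro arg_cong[where f = The] ext) (auto simp: eq_commute)
  also have "\<dots> = t"
    by (rule the_equality[of "span_map x x (Ident T.E (cO x))", OF st]) (rule span_map_unique[OF x x _ st])
  finally show "span_map x x (Ident T.E (cO x)) (act_cell c \<kappa> \<kappa>' h x)" "is_iso (fibre Y (osrc h)) (act_cell c \<kappa> \<kappa>' h x)"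
    using st t_iso by auto
qed

lemma act_cell_hom:
  assumes "x \<in> Ob (fibre X (otgt h))"
  shows "act_cell c \<kappa> \<kappa>' h x \<in> hom (fibre Y (osrc h)) (Tgt T.E (T.rgt h (cO x))) (cO (Tgt S.E (S.rgt h x)))"
  using act_cell_span_map(1)[OF assms] by (simp add: span_map_def)

lemma act_cellE:
  assumes x: "x \<in> Ob (fibre X (otgt h))"
  obtains u where "u \<in> hom T.E (Src T.E (T.lft h (cO x))) (cO (Src S.E (S.lft h x)))"
    "cA (S.lft h x) \<cdot>\<^bsub>T.E\<^esub> u = T.lft h (cO x)"
    "act_cell c \<kappa> \<kappa>' h x \<cdot>\<^bsub>T.E\<^esub> T.rgt h (cO x) = cA (S.rgt h x) \<cdot>\<^bsub>T.E\<^esub> u"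
  using act_cell_span_map(1)[OF x] Ident_hom_cmp[OF T.E_cat T.left_hom[OF h c_fibre_Ob[OF x]]] that
  unfolding span_map_def by metis

lemma act_cell_eqI:
  assumes x: "x \<in> Ob (fibre X (otgt h))"
    and t: "t \<in> hom (fibre Y (osrc h)) (Tgt T.E (T.rgt h (cO x))) (cO (Tgt S.E (S.rgt h x)))"
    and u: "u \<in> hom T.E (Src T.E (T.lft h (cO x))) (cO (Src S.E (S.lft h x)))"
      "cA (S.lft h x) \<cdot>\<^bsub>T.E\<^esub> u = T.lft h (cO x)" "t \<cdot>\<^bsub>T.E\<^esub> T.rgt h (cO x) = cA (S.rgt h x) \<cdot>\<^bsub>T.E\<^esub> u"
  shows "act_cell c \<kappa> \<kappa>' h x = t"
proof (rule span_map_unique[OF x x act_cell_span_map(1)[OF x]])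
  show "span_map x x (Ident T.E (cO x)) t"
    by (rule span_mapI[OF t u(1) _ u(3)])
      (simp only: Ident_hom_cmp[OF T.E_cat T.left_hom[OF h c_fibre_Ob[OF x]]] u(2))
qed

lemma act_cell_nat_iso:
  "nat_iso (fibre X (otgt h)) (fibre Y (osrc h)) (fcomp (fibre X (otgt h)) (act Y \<kappa>' h) (fibre_func c (otgt h)))
     (fcomp (fibre X (otgt h)) (fibre_func c (osrc h)) (act X \<kappa> h)) (act_cell c \<kappa> \<kappa>' h)"
proof (rule nat_isoI)
  show "is_functor (fibre X (otgt h)) (fibre Y (osrc h)) (fcomp (fibre X (otgt h)) (act Y \<kappa>' h) (fibre_func c (otgt h)))"
    by (rule fcomp_functor[OF fibre_func_functor T.act_functor[OF h]])
  show "is_functor (fibre X (otgt h)) (fibre Y (osrc h)) (fcomp (fibre X (otgt h)) (fibre_func c (osrc h)) (act X \<kappa> h))"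
    by (rule fcomp_functor[OF S.act_functor[OF h] fibre_func_functor])
  show "act_cell c \<kappa> \<kappa>' h x \<in> hom (fibre Y (osrc h)) (FOb (fcomp (fibre X (otgt h)) (act Y \<kappa>' h) (fibre_func c (otgt h))) x)
     (FOb (fcomp (fibre X (otgt h)) (fibre_func c (osrc h)) (act X \<kappa> h)) x)"
    and "is_iso (fibre Y (osrc h)) (act_cell c \<kappa> \<kappa>' h x)" if x: "x \<in> Ob (fibre X (otgt h))" for x
    using act_cell_hom[OF x] act_cell_span_map(2)[OF x] x S.right_props(5)[OF h x]
    by (simp_all add: fcomp_simps fibre_func_simps(1) S.act_Ob[OF h x] T.act_Ob[OF h c_fibre_Ob[OF x]])
  fix w x x' assume w: "w \<in> hom (fibre X (otgt h)) x x'"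
  have x: "x \<in> Ob (fibre X (otgt h))" "x' \<in> Ob (fibre X (otgt h))" using hom_Ob[OF S.fibre_category w] by auto
  note cx = c_fibre_Ob[OF x(1)] c_fibre_Ob[OF x(2)]
  have wE: "w \<in> hom S.E x x'" using w by (simp add: S.fibre_hom)
  note cw = c_fibre_hom[OF w] and cwE = c_hom[OF wE]
  obtain p where p: "p \<in> hom T.E (Src T.E (T.lft h (cO x))) (Src T.E (T.lft h (cO x')))"
    "cA w \<cdot>\<^bsub>T.E\<^esub> T.lft h (cO x) = T.lft h (cO x') \<cdot>\<^bsub>T.E\<^esub> p"
    "FAr (act Y \<kappa>' h) (cA w) \<cdot>\<^bsub>T.E\<^esub> T.rgt h (cO x) = T.rgt h (cO x') \<cdot>\<^bsub>T.E\<^esub> p" by (rule T.act_Ar[OF h cw])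
  obtain q where q: "q \<in> hom S.E (Src S.E (S.lft h x)) (Src S.E (S.lft h x'))"
    "w \<cdot>\<^bsub>S.E\<^esub> S.lft h x = S.lft h x' \<cdot>\<^bsub>S.E\<^esub> q" "FAr (act X \<kappa> h) w \<cdot>\<^bsub>S.E\<^esub> S.rgt h x = S.rgt h x' \<cdot>\<^bsub>S.E\<^esub> q"
    by (rule S.act_Ar[OF h w])
  obtain u where u: "u \<in> hom T.E (Src T.E (T.lft h (cO x))) (cO (Src S.E (S.lft h x)))"
    "cA (S.lft h x) \<cdot>\<^bsub>T.E\<^esub> u = T.lft h (cO x)" "act_cell c \<kappa> \<kappa>' h x \<cdot>\<^bsub>T.E\<^esub> T.rgt h (cO x) = cA (S.rgt h x) \<cdot>\<^bsub>T.E\<^esub> u"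
    by (rule act_cellE[OF x(1)])
  obtain u' where u': "u' \<in> hom T.E (Src T.E (T.lft h (cO x'))) (cO (Src S.E (S.lft h x')))"
    "cA (S.lft h x') \<cdot>\<^bsub>T.E\<^esub> u' = T.lft h (cO x')" "act_cell c \<kappa> \<kappa>' h x' \<cdot>\<^bsub>T.E\<^esub> T.rgt h (cO x') = cA (S.rgt h x') \<cdot>\<^bsub>T.E\<^esub> u'"
    by (rule act_cellE[OF x(2)])
  note ver = T.fibre_hom[THEN iffD1, THEN conjunct1] and verS = S.fibre_hom[THEN iffD1, THEN conjunct1]
  note A = hom_assoc[OF T.E_cat]
  note aw = S.act_hom[OF h w] and aw' = T.act_hom[OF h cw]
  note cq = c_hom[OF q(1)]
  \<comment> \<open>Both sides of the naturality square are span maps along \<open>cA w\<close>: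
    this one acts in \<open>Y\<close> and then compares, the other compares and then applies
    \<open>c\<close> to the action in \<open>X\<close>.\<close>
  have "span_map x x' (cA w) (act_cell c \<kappa> \<kappa>' h x' \<cdot>\<^bsub>T.E\<^esub> FAr (act Y \<kappa>' h) (cA w))"
  proof (rule span_mapI)
    show "act_cell c \<kappa> \<kappa>' h x' \<cdot>\<^bsub>T.E\<^esub> FAr (act Y \<kappa>' h) (cA w) \<in>
        hom (fibre Y (osrc h)) (Tgt T.E (T.rgt h (cO x))) (cO (Tgt S.E (S.rgt h x')))"
      using cmp_hom[OF T.fibre_category aw' act_cell_hom[OF x(2)]] by simp
    show "u' \<cdot>\<^bsub>T.E\<^esub> p \<in> hom T.E (Src T.E (T.lft h (cO x))) (cO (Src S.E (S.lft h x')))"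
      by (rule cmp_hom[OF T.E_cat p(1) u'(1)])
    show "cA w \<cdot>\<^bsub>T.E\<^esub> T.lft h (cO x) = cA (S.lft h x') \<cdot>\<^bsub>T.E\<^esub> (u' \<cdot>\<^bsub>T.E\<^esub> p)"
      using A[OF p(1) u'(1) c_left(2)[OF x(2)]] p(2) u'(2) by simp
    show "(act_cell c \<kappa> \<kappa>' h x' \<cdot>\<^bsub>T.E\<^esub> FAr (act Y \<kappa>' h) (cA w)) \<cdot>\<^bsub>T.E\<^esub> T.rgt h (cO x) =
        cA (S.rgt h x') \<cdot>\<^bsub>T.E\<^esub> (u' \<cdot>\<^bsub>T.E\<^esub> p)"
      by (rule square_paste[OF T.E_cat T.right_hom[OF h cx(1)] ver[OF aw'] p(1) T.right_hom[OF h cx(2)]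
            ver[OF act_cell_hom[OF x(2)]] u'(1) c_right(2)[OF x(2)] p(3) u'(3)])
  qed
  moreover have "span_map x x' (cA w) (cA (FAr (act X \<kappa> h) w) \<cdot>\<^bsub>T.E\<^esub> act_cell c \<kappa> \<kappa>' h x)"
  proof (rule span_mapI)
    show "cA (FAr (act X \<kappa> h) w) \<cdot>\<^bsub>T.E\<^esub> act_cell c \<kappa> \<kappa>' h x \<in>
        hom (fibre Y (osrc h)) (Tgt T.E (T.rgt h (cO x))) (cO (Tgt S.E (S.rgt h x')))"
      using cmp_hom[OF T.fibre_category act_cell_hom[OF x(1)] c_fibre_hom[OF aw]] by simp
    show "cA q \<cdot>\<^bsub>T.E\<^esub> u \<in> hom T.E (Src T.E (T.lft h (cO x))) (cO (Src S.E (S.lft h x')))"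
      by (rule cmp_hom[OF T.E_cat u(1) cq])
    have "cA w \<cdot>\<^bsub>T.E\<^esub> cA (S.lft h x) = cA (S.lft h x') \<cdot>\<^bsub>T.E\<^esub> cA q"
      using c_cmp[OF S.left_hom[OF h x(1)] wE] c_cmp[OF q(1) S.left_hom[OF h x(2)]] q(2) by simp
    then show "cA w \<cdot>\<^bsub>T.E\<^esub> T.lft h (cO x) = cA (S.lft h x') \<cdot>\<^bsub>T.E\<^esub> (cA q \<cdot>\<^bsub>T.E\<^esub> u)"
      using A[OF u(1) c_left(2)[OF x(1)] cwE] A[OF u(1) cq c_left(2)[OF x(2)]] u(2) by simp
    have e: "cA (FAr (act X \<kappa> h) w) \<cdot>\<^bsub>T.E\<^esub> cA (S.rgt h x) = cA (S.rgt h x') \<cdot>\<^bsub>T.E\<^esub> cA q"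
      using c_cmp[OF S.right_hom[OF h x(1)] verS[OF aw]] c_cmp[OF q(1) S.right_hom[OF h x(2)]] q(3) by simp
    show "(cA (FAr (act X \<kappa> h) w) \<cdot>\<^bsub>T.E\<^esub> act_cell c \<kappa> \<kappa>' h x) \<cdot>\<^bsub>T.E\<^esub> T.rgt h (cO x) =
        cA (S.rgt h x') \<cdot>\<^bsub>T.E\<^esub> (cA q \<cdot>\<^bsub>T.E\<^esub> u)"
      by (rule square_paste[OF T.E_cat T.right_hom[OF h cx(1)] ver[OF act_cell_hom[OF x(1)]] u(1) c_right(2)[OF x(1)]
            c_hom[OF verS[OF aw]] cq c_right(2)[OF x(2)] u(3) e])
  qed
  ultimately have "act_cell c \<kappa> \<kappa>' h x' \<cdot>\<^bsub>T.E\<^esub> FAr (act Y \<kappa>' h) (cA w) = cA (FAr (act X \<kappa> h) w) \<cdot>\<^bsub>T.E\<^esub> act_cell c \<kappa> \<kappa>' h x"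
    by (rule span_map_unique[OF x])
  moreover have "w \<in> Ar (fibre X (otgt h))" using w by (simp only: in_hom)
  ultimately show "act_cell c \<kappa> \<kappa>' h x' \<cdot>\<^bsub>fibre Y (osrc h)\<^esub>
      FAr (fcomp (fibre X (otgt h)) (act Y \<kappa>' h) (fibre_func c (otgt h))) w =
      FAr (fcomp (fibre X (otgt h)) (fibre_func c (osrc h)) (act X \<kappa> h)) w \<cdot>\<^bsub>fibre Y (osrc h)\<^esub> act_cell c \<kappa> \<kappa>' h x"
    using fibre_func_hom[OF w] fibre_func_hom[OF aw] by (simp add: fcomp_simps(2) del: S.fibre_Ar)
qed

end

end

section \<open>The category of iesq sesquicartesian fibrations\<close>

lemma IesqSesq_simps [simp]:
  "Ob IesqSesq = {X. sesquicartesian X \<and> iesq X}" "Src IesqSesq = fsrc" "Tgt IesqSesq = ftgt"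
  "fsrc (Ident IesqSesq X) = X" "ftgt (Ident IesqSesq X) = X" "fmap (Ident IesqSesq X) = idf (total X)"
  "fsrc (d \<cdot>\<^bsub>IesqSesq\<^esub> c) = fsrc c" "ftgt (d \<cdot>\<^bsub>IesqSesq\<^esub> c) = ftgt d"
  "fmap (d \<cdot>\<^bsub>IesqSesq\<^esub> c) = fcomp (total (fsrc c)) (fmap d) (fmap c)"
  by (simp_all add: IesqSesq_def)

lemma IesqSesq_Ar: "c \<in> Ar IesqSesq \<longleftrightarrow> sesquicartesian (fsrc c) \<and> iesq (fsrc c) \<and>
    sesquicartesian (ftgt c) \<and> iesq (ftgt c) \<and> sesq_functor c"
  by (simp add: IesqSesq_def)

lemma Ident_bicartesian:
  assumes "over_uDelta X"
  shows "bicartesian_functor (Ident IesqSesq X)"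
proof -
  interpret fibration X by (rule fibration.intro[OF assms])
  show ?thesis
    unfolding bicartesian_functor_def IesqSesq_simps
    using idf_functor[OF E_cat] fcomp_idf(1)[OF proj_functor] by (auto simp: idf_simps cocartesian_def cartesian_def)
qed

lemma cmp_bicartesian:
  assumes c: "bicartesian_functor c" and d: "bicartesian_functor d" and e: "ftgt c = fsrc d"
  shows "bicartesian_functor (d \<cdot>\<^bsub>IesqSesq\<^esub> c)"
proof -
  have F: "is_functor (total (fsrc c)) (total (fsrc d)) (fmap c)" "is_functor (total (fsrc d)) (total (ftgt d)) (fmap d)"
    and p: "fcomp (total (fsrc c)) (proj (fsrc d)) (fmap c) = proj (fsrc c)"
      "fcomp (total (fsrc d)) (proj (ftgt d)) (fmap d) = proj (fsrc d)"
    using c d e by (auto simp: bicartesian_functor_def)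
  have pr: "FAr (proj (fsrc d)) (FAr (fmap c) \<phi>) = FAr (proj (fsrc c)) \<phi>" if "\<phi> \<in> Ar (total (fsrc c))" for \<phi>
    using fcomp_simps(2)[OF that, of "proj (fsrc d)" "fmap c"] p(1) by simp
  show ?thesis
    unfolding bicartesian_functor_def IesqSesq_simps
  proof (intro conjI allI impI)
    show "is_functor (total (fsrc c)) (total (ftgt d)) (fcomp (total (fsrc c)) (fmap d) (fmap c))"
      by (rule fcomp_functor[OF F])
    show "fcomp (total (fsrc c)) (proj (ftgt d)) (fcomp (total (fsrc c)) (fmap d) (fmap c)) = proj (fsrc c)"
      unfolding fcomp_assoc[OF F] p ..
    show "cocartesian (ftgt d) (FAr (fcomp (total (fsrc c)) (fmap d) (fmap c)) \<psi>)" if "cocartesian (fsrc c) \<psi>" for \<psi>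
    proof -
      have "\<psi> \<in> Ar (total (fsrc c))" using that by (simp add: cocartesian_def)
      then show ?thesis using that c d e by (simp add: fcomp_simps bicartesian_functor_def)
    qed
    show "cartesian (ftgt d) (FAr (fcomp (total (fsrc c)) (fmap d) (fmap c)) \<phi>)"
      if "cartesian (fsrc c) \<phi> \<and> convex (FAr (proj (fsrc c)) \<phi>)" for \<phi>
    proof -
      have A: "\<phi> \<in> Ar (total (fsrc c))" using that by (simp add: cartesian_def)
      have "cartesian (fsrc d) (FAr (fmap c) \<phi>)" using that c e by (simp add: bicartesian_functor_def)
      \<comment> \<open>Cartesian arrows are preserved by \<open>d\<close> only over convex maps;
        the image under \<open>c\<close> still lies over the convex base map of \<phi>.\<close>
      then have "cartesian (ftgt d) (FAr (fmap d) (FAr (fmap c) \<phi>))"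
        using d pr[OF A] that by (simp add: bicartesian_functor_def)
      then show ?thesis using A by (simp add: fcomp_simps)
    qed
  qed
qed

lemma bicartesian_morphismI:
  assumes "over_uDelta (fsrc c)" "is_cleavage (fsrc c) \<kappa>" "over_uDelta (ftgt c)" "is_cleavage (ftgt c) \<kappa>'" "bicartesian_functor c"
  shows "bicartesian_morphism (fsrc c) \<kappa> (ftgt c) \<kappa>' c"
  using assms by (simp add: bicartesian_morphism_def bicartesian_morphism_axioms_def cleaved_fibration_def
      cleaved_fibration_axioms_def fibration_def)

lemma sesquicartesian_over: "sesquicartesian X \<Longrightarrow> over_uDelta X"
  by (simp add: sesquicartesian_def cocartesian_fibration_def)

text \<open>The pullback condition quantifies over two cleavages even when both fibrations are
  \<open>X\<close>. Its 2-cell is then the comparison between two pushforwards, and the square is of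
  the kind treated in \<open>homotopy_pullback_id\<close>.\<close>

lemma Ident_sesq_functor:
  assumes X: "over_uDelta X"
  shows "sesq_functor (Ident IesqSesq X)"
proof (rule sesq_functorI[OF Ident_bicartesian[OF X]], unfold IesqSesq_simps)
  fix f \<kappa> \<kappa>' assume f: "f \<in> Ar uDelta" and k: "is_cleavage X \<kappa>" "is_cleavage X \<kappa>'"
  let ?c = "Ident IesqSesq X"
  interpret bicartesian_morphism X \<kappa> X \<kappa>' ?c
    using bicartesian_morphismI[of ?c \<kappa> \<kappa>'] X k Ident_bicartesian[OF X] by simp
  have ff: "fibre_func ?c n = idf (fibre X n)" for n
  proof (rule func_eqI[of _ "Ob (fibre X n)" _ "Ar (fibre X n)"])
    show "FAr (fibre_func ?c n) v = FAr (idf (fibre X n)) v" if "v \<in> Ar (fibre X n)" for v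
      using that fibre_func_simps(2)[OF that] idf_simps(2)[OF that] by (simp add: idf_simps)
  qed (simp_all add: fibre_func_simps idf_simps S.fibre_Ob del: S.fibre_Ar)
  have "nat_iso (fibre X (osrc f)) (fibre X (otgt f)) (push X \<kappa>' f) (push X \<kappa> f) (push_cell ?c \<kappa> \<kappa>' f)"
  proof (rule nat_isoI)
    show "is_functor (fibre X (osrc f)) (fibre X (otgt f)) (push X \<kappa>' f)" by (rule T.push_functor[OF f])
    show "is_functor (fibre X (osrc f)) (fibre X (otgt f)) (push X \<kappa> f)" by (rule S.push_functor[OF f])
    have i: "cO x = x" if "x \<in> Ob (fibre X n)" for x n using that by (simp add: idf_simps S.fibre_Ob)
    have pc: "push_cell ?c \<kappa> \<kappa>' f x \<in> hom (fibre X (otgt f)) (Tgt S.E (cocart \<kappa>' f x)) (Tgt S.E (cocart \<kappa> f x))"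
      "push_cell ?c \<kappa> \<kappa>' f x \<cdot>\<^bsub>S.E\<^esub> cocart \<kappa>' f x = cocart \<kappa> f x" if x: "x \<in> Ob (fibre X (osrc f))" for x
      using push_cell(1,2)[OF f x] i[OF x] i[OF S.cocart_props(5)[OF f x]] S.cocart_props(2)[OF f x] by (simp_all add: idf_simps)
    show "push_cell ?c \<kappa> \<kappa>' f x \<in> hom (fibre X (otgt f)) (FOb (push X \<kappa>' f) x) (FOb (push X \<kappa> f) x)"
      "is_iso (fibre X (otgt f)) (push_cell ?c \<kappa> \<kappa>' f x)" if x: "x \<in> Ob (fibre X (osrc f))" for x
      using pc(1)[OF x] push_cell(3)[OF f x] by (simp_all add: S.push_Ob[OF x] T.push_Ob[OF x])
    fix w x y assume w: "w \<in> hom (fibre X (osrc f)) x y"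
    have x: "x \<in> Ob (fibre X (osrc f))" "y \<in> Ob (fibre X (osrc f))" using hom_Ob[OF S.fibre_category w] by auto
    note p1 = T.push_Ar[OF f w] and p2 = S.push_Ar[OF f w]
    note ver = S.fibre_hom[THEN iffD1, THEN conjunct1] and A = hom_assoc[OF S.E_cat]
    note k1 = homI[OF T.cocart_props(2,3)[OF f x(1)] refl] homI[OF T.cocart_props(2,3)[OF f x(2)] refl]
      homI[OF S.cocart_props(2,3)[OF f x(1)] refl]
    have "push_cell ?c \<kappa> \<kappa>' f y \<cdot>\<^bsub>S.E\<^esub> FAr (push X \<kappa>' f) w = FAr (push X \<kappa> f) w \<cdot>\<^bsub>S.E\<^esub> push_cell ?c \<kappa> \<kappa>' f x"
    proof (rule S.cocart_unique_vertical[OF T.cocart_props(1)[OF f x(1)]])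
      show "push_cell ?c \<kappa> \<kappa>' f y \<cdot>\<^bsub>S.E\<^esub> FAr (push X \<kappa>' f) w \<in> hom (fibre X (otgt f)) (Tgt S.E (cocart \<kappa>' f x)) (Tgt S.E (cocart \<kappa> f y))"
        using cmp_hom[OF S.fibre_category p1(1) pc(1)[OF x(2)]] by simp
      show "FAr (push X \<kappa> f) w \<cdot>\<^bsub>S.E\<^esub> push_cell ?c \<kappa> \<kappa>' f x \<in> hom (fibre X (otgt f)) (Tgt S.E (cocart \<kappa>' f x)) (Tgt S.E (cocart \<kappa> f y))"
        using cmp_hom[OF S.fibre_category pc(1)[OF x(1)] p2(1)] by simp
      have "(push_cell ?c \<kappa> \<kappa>' f y \<cdot>\<^bsub>S.E\<^esub> FAr (push X \<kappa>' f) w) \<cdot>\<^bsub>S.E\<^esub> cocart \<kappa>' f x = cocart \<kappa> f y \<cdot>\<^bsub>S.E\<^esub> w"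
        using A[OF k1(1) ver[OF p1(1)] ver[OF pc(1)[OF x(2)]]] A[OF ver[OF w] k1(2) ver[OF pc(1)[OF x(2)]]] p1(2) pc(2)[OF x(2)] by simp
      also have "\<dots> = (FAr (push X \<kappa> f) w \<cdot>\<^bsub>S.E\<^esub> push_cell ?c \<kappa> \<kappa>' f x) \<cdot>\<^bsub>S.E\<^esub> cocart \<kappa>' f x"
        using A[OF k1(1) ver[OF pc(1)[OF x(1)]] ver[OF p2(1)]] p2(2) pc(2)[OF x(1)] by simp
      finally show "(push_cell ?c \<kappa> \<kappa>' f y \<cdot>\<^bsub>S.E\<^esub> FAr (push X \<kappa>' f) w) \<cdot>\<^bsub>S.E\<^esub> cocart \<kappa>' f x =
        (FAr (push X \<kappa> f) w \<cdot>\<^bsub>S.E\<^esub> push_cell ?c \<kappa> \<kappa>' f x) \<cdot>\<^bsub>S.E\<^esub> cocart \<kappa>' f x" .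
    qed
    then show "push_cell ?c \<kappa> \<kappa>' f y \<cdot>\<^bsub>fibre X (otgt f)\<^esub> FAr (push X \<kappa>' f) w =
        FAr (push X \<kappa> f) w \<cdot>\<^bsub>fibre X (otgt f)\<^esub> push_cell ?c \<kappa> \<kappa>' f x" by simp
  qed
  from homotopy_pullback_id[OF this]
  show "homotopy_pullback (fibre X (osrc f)) (fibre X (osrc f)) (fibre X (otgt f)) (fibre X (otgt f))
      (fibre_func ?c (osrc f)) (push X \<kappa> f) (push X \<kappa>' f) (fibre_func ?c (otgt f)) (push_cell ?c \<kappa> \<kappa>' f)"
    by (simp only: ff)
qed

lemma fibre_total:
  "x \<in> Ob (fibre X n) \<Longrightarrow> x \<in> Ob (total X)" "v \<in> Ar (fibre X n) \<Longrightarrow> v \<in> Ar (total X)"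
  by (simp_all add: fibre_def)

text \<open>Restricting a composite to fibres is composing restrictions as long as \<open>c\<close>
  sends fibres into fibres, and this is what the hypothesis provides.\<close>

lemma fibre_func_cmp:
  assumes "is_functor (fibre (fsrc c) n) (fibre (fsrc d) n) (fibre_func c n)"
  shows "fibre_func (d \<cdot>\<^bsub>IesqSesq\<^esub> c) n = fcomp (fibre (fsrc c) n) (fibre_func d n) (fibre_func c n)"
proof (rule func_eqI[of _ "Ob (fibre (fsrc c) n)" _ "Ar (fibre (fsrc c) n)"])
  note F = functor_simps[OF assms]
  show "FOb (fibre_func (d \<cdot>\<^bsub>IesqSesq\<^esub> c) n) x = FOb (fcomp (fibre (fsrc c) n) (fibre_func d n) (fibre_func c n)) x"
    if x: "x \<in> Ob (fibre (fsrc c) n)" for x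
  proof -
    have "FOb (fmap c) x \<in> Ob (fibre (fsrc d) n)" using F(1)[OF x] x by (simp add: fibre_func_def)
    then show ?thesis using x fibre_total(1)[OF x] by (simp add: fibre_func_def fcomp_simps)
  qed
  show "FAr (fibre_func (d \<cdot>\<^bsub>IesqSesq\<^esub> c) n) v = FAr (fcomp (fibre (fsrc c) n) (fibre_func d n) (fibre_func c n)) v"
    if v: "v \<in> Ar (fibre (fsrc c) n)" for v
  proof -
    have "FAr (fmap c) v \<in> Ar (fibre (fsrc d) n)" using F(2)[OF v] v by (simp add: fibre_func_def)
    then show ?thesis using v fibre_total(2)[OF v] by (simp add: fibre_func_def fcomp_simps)
  qed
qed (simp_all add: fibre_func_def fcomp_simps)

text \<open>A cleavage of the middle fibration cuts the square of a composite into two.\<close>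

lemma cmp_sesq_functor:
  assumes c: "sesq_functor c" and d: "sesq_functor d" and e: "ftgt c = fsrc d"
    and s: "over_uDelta (fsrc c)" "sesquicartesian (fsrc d)" "over_uDelta (ftgt d)"
  shows "sesq_functor (d \<cdot>\<^bsub>IesqSesq\<^esub> c)"
proof (rule sesq_functorI, unfold IesqSesq_simps)
  note bc = sesq_functor_bicartesian[OF c] and bd = sesq_functor_bicartesian[OF d]
  note Y = sesquicartesian_over[OF s(2)]
  show bdc: "bicartesian_functor (d \<cdot>\<^bsub>IesqSesq\<^esub> c)" by (rule cmp_bicartesian[OF bc bd e])
  fix f \<kappa> \<kappa>'' assume f: "f \<in> Ar uDelta" and k: "is_cleavage (fsrc c) \<kappa>" "is_cleavage (ftgt d) \<kappa>''"
  obtain \<kappa>' where k': "is_cleavage (fsrc d) \<kappa>'" using normal_cleavage_exists[OF s(2)] by (auto simp: normal_cleavage_def)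
  interpret C: bicartesian_morphism "fsrc c" \<kappa> "fsrc d" \<kappa>' c
    using bicartesian_morphismI[OF s(1) k(1) Y[folded e] k'[folded e] bc] e by simp
  interpret D: bicartesian_morphism "fsrc d" \<kappa>' "ftgt d" \<kappa>'' d
    by (rule bicartesian_morphismI[OF Y k' s(3) k(2) bd])
  interpret DC: bicartesian_morphism "fsrc c" \<kappa> "ftgt d" \<kappa>'' "d \<cdot>\<^bsub>IesqSesq\<^esub> c"
    using bicartesian_morphismI[of "d \<cdot>\<^bsub>IesqSesq\<^esub> c" \<kappa> \<kappa>''] s k bdc by simp
  have ff: "fibre_func (d \<cdot>\<^bsub>IesqSesq\<^esub> c) n = fcomp (fibre (fsrc c) n) (fibre_func d n) (fibre_func c n)" for n
    by (rule fibre_func_cmp[OF C.fibre_func_functor])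
  have hp: "homotopy_pullback (fibre (fsrc c) (osrc f)) (fibre (ftgt d) (osrc f)) (fibre (fsrc c) (otgt f)) (fibre (ftgt d) (otgt f))
      (fibre_func (d \<cdot>\<^bsub>IesqSesq\<^esub> c) (osrc f)) (push (fsrc c) \<kappa> f) (push (ftgt d) \<kappa>'' f) (fibre_func (d \<cdot>\<^bsub>IesqSesq\<^esub> c) (otgt f))
      (\<lambda>x. FAr (fibre_func d (otgt f)) (push_cell c \<kappa> \<kappa>' f x) \<cdot>\<^bsub>fibre (ftgt d) (otgt f)\<^esub>
         push_cell d \<kappa>' \<kappa>'' f (FOb (fibre_func c (osrc f)) x))"
    unfolding ff
    by (rule homotopy_pullback_paste[OF sesq_functor_pullback[OF c f k(1) k'[folded e], unfolded e] sesq_functor_pullback[OF d f k' k(2)]])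
  show "homotopy_pullback (fibre (fsrc c) (osrc f)) (fibre (ftgt d) (osrc f)) (fibre (fsrc c) (otgt f)) (fibre (ftgt d) (otgt f))
      (fibre_func (d \<cdot>\<^bsub>IesqSesq\<^esub> c) (osrc f)) (push (fsrc c) \<kappa> f) (push (ftgt d) \<kappa>'' f) (fibre_func (d \<cdot>\<^bsub>IesqSesq\<^esub> c) (otgt f))
      (push_cell (d \<cdot>\<^bsub>IesqSesq\<^esub> c) \<kappa> \<kappa>'' f)"
  proof (rule homotopy_pullback_cong[OF hp])
    fix x assume x: "x \<in> Ob (fibre (fsrc c) (osrc f))"
    note cx = C.c_fibre_Ob[OF x]
    note pc = C.push_cell[OF f x] and pd = D.push_cell[OF f cx]
    note kx = C.S.cocart_props[OF f x] and ky = C.T.cocart_props[OF f cx]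
    have kyh: "cocart \<kappa>' f (C.cO x) \<in> hom (total (fsrc d)) (C.cO x) (Tgt (total (fsrc d)) (cocart \<kappa>' f (C.cO x)))" by (rule homI[OF ky(2,3) refl])
    have kzh: "cocart \<kappa>'' f (D.cO (C.cO x)) \<in> hom (total (ftgt d)) (D.cO (C.cO x)) (Tgt (total (ftgt d)) (cocart \<kappa>'' f (D.cO (C.cO x))))"
      by (rule homI[OF D.T.cocart_props(2,3)[OF f D.c_fibre_Ob[OF cx]] refl])
    have xE: "x \<in> Ob (total (fsrc c))" "Tgt (total (fsrc c)) (cocart \<kappa> f x) \<in> Ob (total (fsrc c))"
      using x kx(5) by (simp_all add: C.S.fibre_Ob)
    have o: "DC.cO x = D.cO (C.cO x)" "DC.cO (Tgt (total (fsrc c)) (cocart \<kappa> f x)) = D.cO (C.cO (Tgt (total (fsrc c)) (cocart \<kappa> f x)))"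
      "DC.cA (cocart \<kappa> f x) = D.cA (C.cA (cocart \<kappa> f x))"
      using xE kx(2) by (simp_all add: fcomp_simps)
    \<comment> \<open>The pasted cell satisfies the equation that characterises the cell of the
      composite, so the auxiliary cleavage \<open>\<kappa>'\<close> disappears from the
      result.\<close>
    have "push_cell (d \<cdot>\<^bsub>IesqSesq\<^esub> c) \<kappa> \<kappa>'' f x = D.cA (push_cell c \<kappa> \<kappa>' f x) \<cdot>\<^bsub>total (ftgt d)\<^esub> push_cell d \<kappa>' \<kappa>'' f (C.cO x)"
    proof (rule DC.push_cell_eqI[OF f x], unfold o)
      show "D.cA (push_cell c \<kappa> \<kappa>' f x) \<cdot>\<^bsub>total (ftgt d)\<^esub> push_cell d \<kappa>' \<kappa>'' f (C.cO x) \<in>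
          hom (fibre (ftgt d) (otgt f)) (Tgt (total (ftgt d)) (cocart \<kappa>'' f (D.cO (C.cO x)))) (D.cO (C.cO (Tgt (total (fsrc c)) (cocart \<kappa> f x))))"
        using cmp_hom[OF D.T.fibre_category pd(1) D.c_fibre_hom[OF pc(1)]] by simp
      have pcE: "push_cell c \<kappa> \<kappa>' f x \<in> hom (total (fsrc d)) (Tgt (total (fsrc d)) (cocart \<kappa>' f (C.cO x))) (C.cO (Tgt (total (fsrc c)) (cocart \<kappa> f x)))"
        and pdE: "push_cell d \<kappa>' \<kappa>'' f (C.cO x) \<in> hom (total (ftgt d)) (Tgt (total (ftgt d)) (cocart \<kappa>'' f (D.cO (C.cO x))))
          (D.cO (Tgt (total (fsrc d)) (cocart \<kappa>' f (C.cO x))))"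
        using pc(1) pd(1) by (simp_all add: C.T.fibre_hom D.T.fibre_hom)
      show "(D.cA (push_cell c \<kappa> \<kappa>' f x) \<cdot>\<^bsub>total (ftgt d)\<^esub> push_cell d \<kappa>' \<kappa>'' f (C.cO x)) \<cdot>\<^bsub>total (ftgt d)\<^esub> cocart \<kappa>'' f (D.cO (C.cO x)) =
          D.cA (C.cA (cocart \<kappa> f x))"
        using hom_assoc[OF D.T.E_cat kzh pdE D.c_hom[OF pcE]] pd(2) D.c_cmp[OF kyh pcE] pc(2) by simp
    qed
    then show "FAr (fibre_func d (otgt f)) (push_cell c \<kappa> \<kappa>' f x) \<cdot>\<^bsub>fibre (ftgt d) (otgt f)\<^esub>
         push_cell d \<kappa>' \<kappa>'' f (FOb (fibre_func c (osrc f)) x) = push_cell (d \<cdot>\<^bsub>IesqSesq\<^esub> c) \<kappa> \<kappa>'' f x"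
      using C.fibre_func_simps(1)[OF x] D.fibre_func_hom[OF pc(1)] by simp
  qed
qed

lemma fib_map_eqI:
  fixes c d :: "('o, 'a) fib_map"
  shows "fsrc c = fsrc d \<Longrightarrow> ftgt c = ftgt d \<Longrightarrow> fmap c = fmap d \<Longrightarrow> c = d"
  by simp

lemma IesqSesq_category: "category (IesqSesq :: (('o, 'a) fib, ('o, 'a) fib_map) cat)"
proof (rule categoryI)
  fix f g h :: "('o, 'a) fib_map" and x y z w
  assume "f \<in> hom IesqSesq x y"
  then have f: "fsrc f = x" "ftgt f = y" "sesquicartesian x" "sesquicartesian y" "iesq x" "iesq y" "sesq_functor f"
    by (auto simp: in_hom IesqSesq_Ar)
  have F: "is_functor (total x) (total y) (fmap f)"
    using sesq_functor_bicartesian[OF f(7)] f by (simp add: bicartesian_functor_def)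
  show "x \<in> Ob IesqSesq \<and> y \<in> Ob IesqSesq" using f by simp
  show "f \<cdot>\<^bsub>IesqSesq\<^esub> Ident IesqSesq x = f" "Ident IesqSesq y \<cdot>\<^bsub>IesqSesq\<^esub> f = f"
    by (rule fib_map_eqI; simp add: f fcomp_idf[OF F])+
  assume "g \<in> hom IesqSesq y z"
  then have g: "fsrc g = y" "ftgt g = z" "sesquicartesian z" "iesq z" "sesq_functor g"
    by (auto simp: in_hom IesqSesq_Ar)
  have G: "is_functor (total y) (total z) (fmap g)"
    using sesq_functor_bicartesian[OF g(5)] g by (simp add: bicartesian_functor_def)
  show "g \<cdot>\<^bsub>IesqSesq\<^esub> f \<in> hom IesqSesq x z"
    using cmp_sesq_functor[OF f(7) g(5)] f g sesquicartesian_over[OF f(3)] sesquicartesian_over[OF g(3)]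
    by (simp add: in_hom IesqSesq_Ar)
  show "h \<cdot>\<^bsub>IesqSesq\<^esub> (g \<cdot>\<^bsub>IesqSesq\<^esub> f) = (h \<cdot>\<^bsub>IesqSesq\<^esub> g) \<cdot>\<^bsub>IesqSesq\<^esub> f" if "h \<in> hom IesqSesq z w"
    by (rule fib_map_eqI) (simp_all add: f g fcomp_assoc[OF F G])
next
  fix x :: "('o, 'a) fib" assume "x \<in> Ob IesqSesq"
  then show "Ident IesqSesq x \<in> hom IesqSesq x x"
    using Ident_sesq_functor[OF sesquicartesian_over[of x]] by (simp add: in_hom IesqSesq_Ar)
qed

section \<open>The functor\<close>

locale sesquicartesian_morphism =
  S: normal_sesquicartesian X \<kappa> + T: normal_sesquicartesian Y \<kappa>' + bicartesian_morphism X \<kappa> Y \<kappa>' c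
  for X :: "('o, 'a) fib" and \<kappa> and Y :: "('o, 'a) fib" and \<kappa>' and c +
  assumes sesq_functor: "sesq_functor c"
begin

text \<open>Maps out of the apex of the composite span at \<open>cO x\<close> are compared towards
  the images under \<open>c\<close> of the spans of \<open>h'\<close> and of \<open>h\<close>. The
  monic left legs of these images yield \<open>e1\<close> and \<open>e2\<close>, and the cocartesian
  leg of the composite span concludes.\<close>

lemma act_cell_coherence:
  assumes h: "h \<in> Ar Delta" "h' \<in> Ar Delta" "otgt h = osrc h'" and x: "x \<in> Ob (fibre X (otgt h'))"
  shows "cA (compositor X \<kappa> h' h x) \<cdot>\<^bsub>T.E\<^esub> act_cell c \<kappa> \<kappa>' (h' \<cdot>\<^bsub>Delta\<^esub> h) x
    = act_cell c \<kappa> \<kappa>' h (Tgt S.E (S.rgt h' x)) \<cdot>\<^bsub>T.E\<^esub> FAr (act Y \<kappa>' h) (act_cell c \<kappa> \<kappa>' h' x)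
        \<cdot>\<^bsub>T.E\<^esub> compositor Y \<kappa>' h' h (cO x)"
proof -
  define K where "K = h' \<cdot>\<^bsub>Delta\<^esub> h"
  have KA: "K \<in> Ar Delta" unfolding K_def by (rule Delta_closed(2)[OF h])
  have Ks[simp]: "osrc K = osrc h" "otgt K = otgt h'" by (simp_all add: K_def)
  have xK: "x \<in> Ob (fibre X (otgt K))" using x by simp
  define y1 where "y1 = Tgt S.E (S.rgt h' x)"
  define y' where "y' = Tgt T.E (T.rgt h' (cO x))"
  note cx = c_fibre_Ob[OF x] and cxK = c_fibre_Ob[OF xK]
  have y1: "y1 \<in> Ob (fibre X (otgt h))" using S.right_props(5)[OF h(2) x] h(3) by (simp add: y1_def)
  note cy1 = c_fibre_Ob[OF y1]
  have y': "y' \<in> Ob (fibre Y (otgt h))" using T.right_props(5)[OF h(2) cx] h(3) by (simp add: y'_def)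
  define CX where "CX = compositor X \<kappa> h' h x"
  define CY where "CY = compositor Y \<kappa>' h' h (cO x)"
  define TK where "TK = act_cell c \<kappa> \<kappa>' K x"
  define T0 where "T0 = act_cell c \<kappa> \<kappa>' h' x"
  define T1 where "T1 = act_cell c \<kappa> \<kappa>' h y1"
  have CX: "CX \<in> hom (fibre X (osrc h)) (Tgt S.E (S.rgt K x)) (Tgt S.E (S.rgt h y1))"
    using S.compositor_hom[OF h x] unfolding CX_def K_def y1_def .
  have CY: "CY \<in> hom (fibre Y (osrc h)) (Tgt T.E (T.rgt K (cO x))) (Tgt T.E (T.rgt h y'))"
    using T.compositor_hom[OF h cx] unfolding CY_def K_def y'_def .
  have TK: "TK \<in> hom (fibre Y (osrc h)) (Tgt T.E (T.rgt K (cO x))) (cO (Tgt S.E (S.rgt K x)))"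
    using act_cell_hom[OF KA xK] unfolding TK_def by simp
  have T0: "T0 \<in> hom (fibre Y (otgt h)) y' (cO y1)"
    using act_cell_hom[OF h(2) x] unfolding T0_def y'_def y1_def h(3) .
  have T1: "T1 \<in> hom (fibre Y (osrc h)) (Tgt T.E (T.rgt h (cO y1))) (cO (Tgt S.E (S.rgt h y1)))"
    unfolding T1_def by (rule act_cell_hom[OF h(1) y1])
  obtain u where u: "u \<in> hom T.E (Src T.E (T.lft K (cO x))) (cO (Src S.E (S.lft K x)))"
    "cA (S.lft K x) \<cdot>\<^bsub>T.E\<^esub> u = T.lft K (cO x)" "TK \<cdot>\<^bsub>T.E\<^esub> T.rgt K (cO x) = cA (S.rgt K x) \<cdot>\<^bsub>T.E\<^esub> u"
    unfolding TK_def by (rule act_cellE[OF KA xK])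
  obtain m n where m: "m \<in> hom S.E (Src S.E (S.lft K x)) (Src S.E (S.lft h' x))" "n \<in> hom S.E (Src S.E (S.lft K x)) (Src S.E (S.lft h y1))"
    "S.lft h' x \<cdot>\<^bsub>S.E\<^esub> m = S.lft K x" "S.rgt h' x \<cdot>\<^bsub>S.E\<^esub> m = S.lft h y1 \<cdot>\<^bsub>S.E\<^esub> n" "CX \<cdot>\<^bsub>S.E\<^esub> S.rgt K x = S.rgt h y1 \<cdot>\<^bsub>S.E\<^esub> n"
    unfolding CX_def K_def y1_def by (rule S.compositorE[OF h x])
  obtain m' n' where m': "m' \<in> hom T.E (Src T.E (T.lft K (cO x))) (Src T.E (T.lft h' (cO x)))"
    "n' \<in> hom T.E (Src T.E (T.lft K (cO x))) (Src T.E (T.lft h y'))"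
    "T.lft h' (cO x) \<cdot>\<^bsub>T.E\<^esub> m' = T.lft K (cO x)" "T.rgt h' (cO x) \<cdot>\<^bsub>T.E\<^esub> m' = T.lft h y' \<cdot>\<^bsub>T.E\<^esub> n'"
    "CY \<cdot>\<^bsub>T.E\<^esub> T.rgt K (cO x) = T.rgt h y' \<cdot>\<^bsub>T.E\<^esub> n'"
    unfolding CY_def K_def y'_def by (rule T.compositorE[OF h cx])
  obtain v where v: "v \<in> hom T.E (Src T.E (T.lft h' (cO x))) (cO (Src S.E (S.lft h' x)))"
    "cA (S.lft h' x) \<cdot>\<^bsub>T.E\<^esub> v = T.lft h' (cO x)" "T0 \<cdot>\<^bsub>T.E\<^esub> T.rgt h' (cO x) = cA (S.rgt h' x) \<cdot>\<^bsub>T.E\<^esub> v"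
    unfolding T0_def by (rule act_cellE[OF h(2) x])
  obtain w where w: "w \<in> hom T.E (Src T.E (T.lft h y')) (Src T.E (T.lft h (cO y1)))"
    "T0 \<cdot>\<^bsub>T.E\<^esub> T.lft h y' = T.lft h (cO y1) \<cdot>\<^bsub>T.E\<^esub> w"
    "FAr (act Y \<kappa>' h) T0 \<cdot>\<^bsub>T.E\<^esub> T.rgt h y' = T.rgt h (cO y1) \<cdot>\<^bsub>T.E\<^esub> w" by (rule T.act_Ar[OF h(1) T0])
  obtain z where z: "z \<in> hom T.E (Src T.E (T.lft h (cO y1))) (cO (Src S.E (S.lft h y1)))"
    "cA (S.lft h y1) \<cdot>\<^bsub>T.E\<^esub> z = T.lft h (cO y1)" "T1 \<cdot>\<^bsub>T.E\<^esub> T.rgt h (cO y1) = cA (S.rgt h y1) \<cdot>\<^bsub>T.E\<^esub> z"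
    unfolding T1_def by (rule act_cellE[OF h(1) y1])
  note aT0 = T.act_hom[OF h(1) T0]
  note ver = T.fibre_hom[THEN iffD1, THEN conjunct1] and verS = S.fibre_hom[THEN iffD1, THEN conjunct1]
  note A = hom_assoc[OF T.E_cat]
  note cm = c_hom[OF m(1)] and cn = c_hom[OF m(2)]
  note cL1 = c_left(2)[OF h(2) x] and cR1 = c_right(2)[OF h(2) x, folded y1_def] and cL2 = c_left(2)[OF h(1) y1]
    and cR2 = c_right(2)[OF h(1) y1]
  note rh' = T.right_hom[OF h(2) cx, folded y'_def] and ly' = T.left_hom[OF h(1) y']
    and ry' = T.right_hom[OF h(1) y'] and lcy = T.left_hom[OF h(1) cy1] and rcy = T.right_hom[OF h(1) cy1]
    and rK = T.right_hom[OF KA cxK]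
  have e1: "cA m \<cdot>\<^bsub>T.E\<^esub> u = v \<cdot>\<^bsub>T.E\<^esub> m'"
  proof (rule c_left_monic[OF h(2) x cmp_hom[OF T.E_cat u(1) cm] cmp_hom[OF T.E_cat m'(1) v(1)]])
    have "cA (S.lft h' x) \<cdot>\<^bsub>T.E\<^esub> cA m = cA (S.lft K x)" using c_cmp[OF m(1) S.left_hom[OF h(2) x]] m(3) by simp
    then show "cA (S.lft h' x) \<cdot>\<^bsub>T.E\<^esub> (cA m \<cdot>\<^bsub>T.E\<^esub> u) = cA (S.lft h' x) \<cdot>\<^bsub>T.E\<^esub> (v \<cdot>\<^bsub>T.E\<^esub> m')"
      using A[OF u(1) cm cL1] A[OF m'(1) v(1) cL1] u(2) v(2) m'(3) by simp
  qed
  \<comment> \<open>The comparison is pushed through the right leg of \<open>h'\<close>, where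
    \<open>e1\<close> applies, and through the action of \<open>h\<close> on the cell
    \<open>T0\<close>, whose apex component is \<open>w\<close>.\<close>
  have e2: "cA n \<cdot>\<^bsub>T.E\<^esub> u = z \<cdot>\<^bsub>T.E\<^esub> (w \<cdot>\<^bsub>T.E\<^esub> n')"
  proof (rule c_left_monic[OF h(1) y1 cmp_hom[OF T.E_cat u(1) cn] cmp_hom[OF T.E_cat cmp_hom[OF T.E_cat m'(2) w(1)] z(1)]])
    have q: "cA (S.lft h y1) \<cdot>\<^bsub>T.E\<^esub> cA n = cA (S.rgt h' x) \<cdot>\<^bsub>T.E\<^esub> cA m"
      using c_cmp[OF m(2) S.left_hom[OF h(1) y1]] c_cmp[OF m(1) S.right_hom[OF h(2) x]] m(4) by simp
    have "cA (S.lft h y1) \<cdot>\<^bsub>T.E\<^esub> (cA n \<cdot>\<^bsub>T.E\<^esub> u) = cA (S.rgt h' x) \<cdot>\<^bsub>T.E\<^esub> (v \<cdot>\<^bsub>T.E\<^esub> m')"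
      using A[OF u(1) cn cL2] A[OF u(1) cm cR1] q e1 by simp
    also have "\<dots> = T0 \<cdot>\<^bsub>T.E\<^esub> (T.lft h y' \<cdot>\<^bsub>T.E\<^esub> n')"
      using A[OF m'(1) v(1) cR1] A[OF m'(1) rh' ver[OF T0]] v(3) m'(4) by simp
    also have "\<dots> = T.lft h (cO y1) \<cdot>\<^bsub>T.E\<^esub> (w \<cdot>\<^bsub>T.E\<^esub> n')"
      using A[OF m'(2) ly' ver[OF T0]] A[OF m'(2) w(1) lcy] w(2) by simp
    also have "\<dots> = cA (S.lft h y1) \<cdot>\<^bsub>T.E\<^esub> (z \<cdot>\<^bsub>T.E\<^esub> (w \<cdot>\<^bsub>T.E\<^esub> n'))"
      using A[OF cmp_hom[OF T.E_cat m'(2) w(1)] z(1) cL2] z(2) by simp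
    finally show "cA (S.lft h y1) \<cdot>\<^bsub>T.E\<^esub> (cA n \<cdot>\<^bsub>T.E\<^esub> u) = cA (S.lft h y1) \<cdot>\<^bsub>T.E\<^esub> (z \<cdot>\<^bsub>T.E\<^esub> (w \<cdot>\<^bsub>T.E\<^esub> n'))" .
  qed
  have "cA CX \<cdot>\<^bsub>T.E\<^esub> TK = T1 \<cdot>\<^bsub>T.E\<^esub> (FAr (act Y \<kappa>' h) T0 \<cdot>\<^bsub>T.E\<^esub> CY)"
  proof (rule T.right_epi[OF KA cxK])
    show "cA CX \<cdot>\<^bsub>T.E\<^esub> TK \<in> hom (fibre Y (osrc K)) (Tgt T.E (T.rgt K (cO x))) (cO (Tgt S.E (S.rgt h y1)))"
      using cmp_hom[OF T.fibre_category TK c_fibre_hom[OF CX]] by simp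
    show "T1 \<cdot>\<^bsub>T.E\<^esub> (FAr (act Y \<kappa>' h) T0 \<cdot>\<^bsub>T.E\<^esub> CY) \<in> hom (fibre Y (osrc K)) (Tgt T.E (T.rgt K (cO x))) (cO (Tgt S.E (S.rgt h y1)))"
      using cmp_hom[OF T.fibre_category cmp_hom[OF T.fibre_category CY aT0] T1] by simp
    have q: "cA CX \<cdot>\<^bsub>T.E\<^esub> cA (S.rgt K x) = cA (S.rgt h y1) \<cdot>\<^bsub>T.E\<^esub> cA n"
      using c_cmp[OF S.right_hom[OF KA xK] verS[OF CX]] c_cmp[OF m(2) S.right_hom[OF h(1) y1]] m(5) by simp
    have "(cA CX \<cdot>\<^bsub>T.E\<^esub> TK) \<cdot>\<^bsub>T.E\<^esub> T.rgt K (cO x) = cA (S.rgt h y1) \<cdot>\<^bsub>T.E\<^esub> (cA n \<cdot>\<^bsub>T.E\<^esub> u)"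
      by (rule square_paste[OF T.E_cat rK ver[OF TK] u(1) c_right(2)[OF KA xK] c_hom[OF verS[OF CX]] cn cR2 u(3) q])
    moreover have r: "(FAr (act Y \<kappa>' h) T0 \<cdot>\<^bsub>T.E\<^esub> CY) \<cdot>\<^bsub>T.E\<^esub> T.rgt K (cO x) = T.rgt h (cO y1) \<cdot>\<^bsub>T.E\<^esub> (w \<cdot>\<^bsub>T.E\<^esub> n')"
      by (rule square_paste[OF T.E_cat rK ver[OF CY] m'(2) ry' ver[OF aT0] w(1) rcy m'(5) w(3)])
    moreover have "(T1 \<cdot>\<^bsub>T.E\<^esub> (FAr (act Y \<kappa>' h) T0 \<cdot>\<^bsub>T.E\<^esub> CY)) \<cdot>\<^bsub>T.E\<^esub> T.rgt K (cO x) = cA (S.rgt h y1) \<cdot>\<^bsub>T.E\<^esub> (z \<cdot>\<^bsub>T.E\<^esub> (w \<cdot>\<^bsub>T.E\<^esub> n'))"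
      by (rule square_paste[OF T.E_cat rK cmp_hom[OF T.E_cat ver[OF CY] ver[OF aT0]] cmp_hom[OF T.E_cat m'(2) w(1)] rcy ver[OF T1] z(1) cR2 r z(3)])
    ultimately show "(cA CX \<cdot>\<^bsub>T.E\<^esub> TK) \<cdot>\<^bsub>T.E\<^esub> T.rgt K (cO x) =
        (T1 \<cdot>\<^bsub>T.E\<^esub> (FAr (act Y \<kappa>' h) T0 \<cdot>\<^bsub>T.E\<^esub> CY)) \<cdot>\<^bsub>T.E\<^esub> T.rgt K (cO x)"
      using e2 by simp
  qed
  then show ?thesis by (simp add: CX_def CY_def TK_def T0_def T1_def y1_def K_def)
qed

text \<open>The left legs are identities, so \<open>u\<close> is one too, and the description of
  \<open>act_cell\<close> becomes that of \<open>push_cell\<close>. This is how the pullback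
  condition on \<open>c\<close> becomes the CULF condition.\<close>

lemma act_cell_generic:
  assumes g: "generic g" and x: "x \<in> Ob (fibre X (otgt g))"
  shows "act_cell c \<kappa> \<kappa>' g x = push_cell c \<kappa> \<kappa>' (under_gen g) x"
proof -
  note gA = generic_Ar[OF g] and cx = c_fibre_Ob[OF x]
  have u: "under_gen g \<in> Ar uDelta" using push_map_Ar[OF gA] generic_push_pull(1)[OF g] by simp
  have us: "osrc (under_gen g) = otgt g" "otgt (under_gen g) = osrc g" by (simp_all add: under_gen_def)
  have xu: "x \<in> Ob (fibre X (osrc (under_gen g)))" using x us by simp
  note pc = push_cell[OF u xu]
  have xE: "x \<in> Ob S.E" "cO x \<in> Ob T.E" using x cx by (simp_all add: S.fibre_Ob T.fibre_Ob)
  have ci: "cA (Ident S.E x) = Ident T.E (cO x)" by (rule functor_simps(5)[OF c_functor xE(1)])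
  have i: "Ident T.E (cO x) \<in> hom T.E (cO x) (cO x)" by (rule Ident_hom[OF T.E_cat xE(2)])
  have "cA (cocart \<kappa> (under_gen g) x) \<in> hom T.E (cO x) (cO (Tgt S.E (cocart \<kappa> (under_gen g) x)))"
    by (rule c_hom[OF homI[OF S.cocart_props(2,3)[OF u xu] refl]])
  then show ?thesis
    by (intro act_cell_eqI[OF gA x, of _ "Ident T.E (cO x)"])
      (use pc(1,2) in \<open>simp_all add: S.span_generic[OF g x] T.span_generic[OF g cx] us ci i hom_Ident[OF T.E_cat] hom_Ident[OF T.E_cat i]
         Src_Ident[OF S.E_cat xE(1)] Src_Ident[OF T.E_cat xE(2)]\<close>)
qed

lemma act_cell_Ident_Delta:
  assumes x: "x \<in> Ob (fibre X n)"
  shows "act_cell c \<kappa> \<kappa>' (Ident Delta n) x = Ident T.E (cO x)"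
proof -
  have x': "x \<in> Ob (fibre X (otgt (Ident Delta n)))" using x by simp
  note cx = c_fibre_Ob[OF x]
  have xE: "x \<in> Ob S.E" "cO x \<in> Ob T.E" using x cx by (simp_all add: S.fibre_Ob T.fibre_Ob)
  have ci: "cA (Ident S.E x) = Ident T.E (cO x)" by (rule functor_simps(5)[OF c_functor xE(1)])
  have i: "Ident T.E (cO x) \<in> hom T.E (cO x) (cO x)" by (rule Ident_hom[OF T.E_cat xE(2)])
  show ?thesis
    by (rule act_cell_eqI[OF Delta_closed(1) x', of _ "Ident T.E (cO x)"])
      (simp_all only: S.span_Ident[OF x] T.span_Ident[OF cx] ci i hom_Ident[OF T.E_cat i] T.fibre_Ident_hom[OF cx] Delta_simps
         Src_Ident[OF S.E_cat xE(1)] Src_Ident[OF T.E_cat xE(2)] Tgt_Ident[OF S.E_cat xE(1)] Tgt_Ident[OF T.E_cat xE(2)])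
qed

lemma decomp_map_simps [simp]:
  "ssrc (decomp_map c \<kappa> \<kappa>') = decomp_of X \<kappa>" "stgt (decomp_map c \<kappa> \<kappa>') = decomp_of Y \<kappa>'"
  "scomponent (decomp_map c \<kappa> \<kappa>') n = core_func (fibre X n) (fibre_func c n)"
  by (simp_all add: decomp_map_def src tgt)

lemma decomp_map_scell: "scell (decomp_map c \<kappa> \<kappa>') = restrict_cells (decomp_of X \<kappa>) (act_cell c \<kappa> \<kappa>')"
  by (simp add: decomp_map_def src)

lemma decomp_map_scell_app:
  "h \<in> Ar Delta \<Longrightarrow> x \<in> Ob (fibre X (otgt h)) \<Longrightarrow> scell (decomp_map c \<kappa> \<kappa>') h x = act_cell c \<kappa> \<kappa>' h x"
  by (simp add: decomp_map_scell restrict_cells_simps core_simps)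

lemma decomp_map_culf: "culf (decomp_map c \<kappa> \<kappa>')"
proof -
  let ?\<alpha> = "decomp_map c \<kappa> \<kappa>'"
  have comp: "is_functor (core (fibre X n)) (core (fibre Y n)) (core_func (fibre X n) (fibre_func c n))" for n
    by (rule core_functor[OF fibre_func_functor])
  have "simplicial_map ?\<alpha>"
  proof (rule simplicial_mapI, unfold decomp_map_simps S.decomp_of_simps T.decomp_of_simps)
    show "simplicial_groupoid (decomp_of X \<kappa>)" by (rule S.decomp_of_simplicial)
    show "simplicial_groupoid (decomp_of Y \<kappa>')" by (rule T.decomp_of_simplicial)
    show "restrict_cells (decomp_of X \<kappa>) (scell ?\<alpha>) = scell ?\<alpha>" by (simp add: decomp_map_scell restrict_cells_simps)
    show "is_functor (core (fibre X n)) (core (fibre Y n)) (core_func (fibre X n) (fibre_func c n))" for n by (rule comp)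
    show "nat_iso (core (fibre X (otgt h))) (core (fibre Y (osrc h)))
        (fcomp (core (fibre X (otgt h))) (core_func (fibre Y (otgt h)) (act Y \<kappa>' h)) (core_func (fibre X (otgt h)) (fibre_func c (otgt h))))
        (fcomp (core (fibre X (otgt h))) (core_func (fibre X (osrc h)) (fibre_func c (osrc h))) (core_func (fibre X (otgt h)) (act X \<kappa> h)))
        (scell ?\<alpha> h)" if h: "h \<in> Ar Delta" for h
      by (rule nat_iso_cong[OF core_nat_iso[OF act_cell_nat_iso[OF h], unfolded core_fcomp[OF fibre_func_functor] core_fcomp[OF S.act_functor[OF h]]]])
        (simp add: decomp_map_scell_app[OF h] core_simps)
  next
    fix h h' x assume h: "h \<in> Ar Delta" "h' \<in> Ar Delta" "otgt h = osrc h'" and "x \<in> Ob (core (fibre X (otgt h')))"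
    then have x: "x \<in> Ob (fibre X (otgt h'))" by (simp add: core_simps)
    have k: "h' \<cdot>\<^bsub>Delta\<^esub> h \<in> Ar Delta" by (rule Delta_closed(2)[OF h])
    have xk: "x \<in> Ob (fibre X (otgt (h' \<cdot>\<^bsub>Delta\<^esub> h)))" using x by simp
    have y: "Tgt S.E (S.rgt h' x) \<in> Ob (fibre X (otgt h))" using S.right_props(5)[OF h(2) x] h(3) by simp
    note cx = c_fibre_Ob[OF x]
    have "compositor X \<kappa> h' h x \<in> Ar (fibre X (osrc h))" "is_iso (fibre X (osrc h)) (compositor X \<kappa> h' h x)"
      using S.compositor_hom[OF h x] S.compositor_transport(2)[OF h x] by (simp_all only: in_hom)
    \<comment> \<open>Compositors and cells are isomorphisms, hence arrows of the maximal
      subgroupoids, on which the restricted functors agree with the original ones.\<close>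
    then have 1: "FAr (core_func (fibre X (osrc h)) (fibre_func c (osrc h))) (compositor X \<kappa> h' h x) = cA (compositor X \<kappa> h' h x)"
      by (simp add: core_func_simps(2) fibre_func_simps(2) del: S.fibre_Ar)
    have "act_cell c \<kappa> \<kappa>' h' x \<in> Ar (fibre Y (otgt h))" "is_iso (fibre Y (otgt h)) (act_cell c \<kappa> \<kappa>' h' x)"
      using act_cell_hom[OF h(2) x] act_cell_span_map(2)[OF h(2) x] h(3) by (simp_all only: in_hom)
    then have 2: "FAr (core_func (fibre Y (otgt h)) (act Y \<kappa>' h)) (act_cell c \<kappa> \<kappa>' h' x) = FAr (act Y \<kappa>' h) (act_cell c \<kappa> \<kappa>' h' x)"
      by (rule core_func_simps(2))
    show "FAr (core_func (fibre X (osrc h)) (fibre_func c (osrc h))) (compositor X \<kappa> h' h x)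
        \<cdot>\<^bsub>core (fibre Y (osrc h))\<^esub> scell ?\<alpha> (h' \<cdot>\<^bsub>Delta\<^esub> h) x
      = scell ?\<alpha> h (FOb (core_func (fibre X (otgt h')) (act X \<kappa> h')) x)
        \<cdot>\<^bsub>core (fibre Y (osrc h))\<^esub> FAr (core_func (fibre Y (otgt h)) (act Y \<kappa>' h)) (scell ?\<alpha> h' x)
        \<cdot>\<^bsub>core (fibre Y (osrc h))\<^esub> compositor Y \<kappa>' h' h (FOb (core_func (fibre X (otgt h')) (fibre_func c (otgt h'))) x)"
      unfolding 1 core_func_simps(1)[OF x] fibre_func_simps(1)[OF x] S.act_Ob[OF h(2) x] decomp_map_scell_app[OF k xk]
        decomp_map_scell_app[OF h(1) y] decomp_map_scell_app[OF h(2) x] 2 core_simps T.fibre_simps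
      by (rule act_cell_coherence[OF h x])
  next
    fix n x assume "x \<in> Ob (core (fibre X n))"
    then have x: "x \<in> Ob (fibre X n)" by (simp add: core_simps)
    have x': "x \<in> Ob (fibre X (otgt (Ident Delta n)))" using x by simp
    note cx = c_fibre_Ob[OF x]
    have cE: "cO x \<in> Ob T.E" using cx by (simp add: T.fibre_Ob)
    have "FAr (core_func (fibre X n) (fibre_func c n)) (Ident S.E x) = Ident T.E (cO x)"
      using functor_simps(5)[OF comp, of x n] x by (simp add: core_simps core_func_simps(1) fibre_func_simps(1))
    then show "FAr (core_func (fibre X n) (fibre_func c n)) (Ident S.E x) =
        scell ?\<alpha> (Ident Delta n) x \<cdot>\<^bsub>core (fibre Y n)\<^esub> Ident T.E (FOb (core_func (fibre X n) (fibre_func c n)) x)"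
      using hom_Ident[OF T.E_cat Ident_hom[OF T.E_cat cE]]
      by (simp add: decomp_map_scell_app[OF Delta_closed(1) x'] act_cell_Ident_Delta[OF x] core_simps core_func_simps(1)[OF x] fibre_func_simps(1)[OF x])
  qed
  moreover have "homotopy_pullback (core (fibre X (otgt g))) (core (fibre Y (otgt g))) (core (fibre X (osrc g))) (core (fibre Y (osrc g)))
      (core_func (fibre X (otgt g)) (fibre_func c (otgt g))) (core_func (fibre X (otgt g)) (act X \<kappa> g))
      (core_func (fibre Y (otgt g)) (act Y \<kappa>' g)) (core_func (fibre X (osrc g)) (fibre_func c (osrc g))) (scell ?\<alpha> g)"
    if g: "generic g" for g
  proof -
    have u: "under_gen g \<in> Ar uDelta" using push_map_Ar[OF generic_Ar[OF g]] generic_push_pull(1)[OF g] by simp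
    have us: "osrc (under_gen g) = otgt g" "otgt (under_gen g) = osrc g" by (simp_all add: under_gen_def)
    \<comment> \<open>The pullback condition of \<open>c\<close> along \<open>under_gen g\<close>,
      with the two pushforwards rewritten as actions of \<open>g\<close>. It still concerns whole
      fibres and is restricted to maximal subgroupoids below.\<close>
    have hp: "homotopy_pullback (fibre X (otgt g)) (fibre Y (otgt g)) (fibre X (osrc g)) (fibre Y (osrc g))
        (fibre_func c (otgt g)) (act X \<kappa> g) (act Y \<kappa>' g) (fibre_func c (osrc g)) (push_cell c \<kappa> \<kappa>' (under_gen g))"
      using sesq_functor_pullback[OF sesq_functor u, of \<kappa> \<kappa>'] S.cleavage T.cleavage
      by (simp add: src tgt us S.act_generic[OF g] T.act_generic[OF g])
    show ?thesis
      by (rule homotopy_pullback_cong[OF core_homotopy_pullback[OF hp]])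
        (simp add: core_simps decomp_map_scell_app[OF generic_Ar[OF g]] act_cell_generic[OF g])
  qed
  ultimately show ?thesis by (simp add: culf_def)
qed

end

text \<open>The same cleavage stands on both sides, so the two chosen spans coincide and are
  compared by identities.\<close>

lemma act_cell_Ident_map:
  assumes X: "normal_sesquicartesian X \<kappa>" and h: "h \<in> Ar Delta" and x: "x \<in> Ob (fibre X (otgt h))"
  shows "act_cell (Ident IesqSesq X) \<kappa> \<kappa> h x = Ident (total X) (FOb (act X \<kappa> h) x)"
proof -
  interpret N: normal_sesquicartesian X \<kappa> by (rule X)
  interpret M: bicartesian_morphism X \<kappa> X \<kappa> "Ident IesqSesq X"
    using bicartesian_morphismI[of "Ident IesqSesq X" \<kappa> \<kappa>] N.over N.cleavage Ident_bicartesian[OF N.over] by simp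
  have i: "M.cO y = y" if "y \<in> Ob N.E" for y using that by (simp add: idf_simps)
  have i': "M.cA v = v" if "v \<in> Ar N.E" for v using that by (simp add: idf_simps)
  note L = N.left_props[OF h x] and R = N.right_props[OF h x] and lh = N.left_hom[OF h x] and rh = N.right_hom[OF h x]
  have ob: "x \<in> Ob N.E" "Src N.E (N.lft h x) \<in> Ob N.E" "Tgt N.E (N.rgt h x) \<in> Ob N.E"
    using N.fibre_ObE[OF x] N.fibre_ObE[OF L(5)] N.fibre_ObE[OF R(5)] by auto
  have "act_cell (Ident IesqSesq X) \<kappa> \<kappa> h x = Ident N.E (Tgt N.E (N.rgt h x))"
    by (rule M.act_cell_eqI[OF h x, of _ "Ident N.E (Src N.E (N.lft h x))"])
      (simp_all only: i[OF ob(1)] i[OF ob(2)] i[OF ob(3)] i'[OF L(2)] i'[OF R(2)] N.fibre_Ident_hom[OF R(5)]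
        Ident_hom[OF N.E_cat ob(2)] hom_Ident[OF N.E_cat lh] hom_Ident[OF N.E_cat rh] Ident_hom_cmp[OF N.E_cat rh])
  then show ?thesis by (simp add: N.act_Ob[OF h x])
qed

text \<open>Maps of spans compose, with \<open>D.cA u\<close> after \<open>v\<close> as the
  component between apexes. The right side passes through the chosen spans of \<open>Y\<close>,
  whereas the left side does not mention \<open>\<kappa>'\<close>; strict functoriality of the cells
  rests on this.\<close>

lemma act_cell_cmp:
  assumes "bicartesian_morphism X \<kappa> Y \<kappa>' c" "bicartesian_morphism Y \<kappa>' Z \<kappa>'' d"
    and h: "h \<in> Ar Delta" and x: "x \<in> Ob (fibre X (otgt h))"
  shows "act_cell (d \<cdot>\<^bsub>IesqSesq\<^esub> c) \<kappa> \<kappa>'' h x =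
    FAr (fmap d) (act_cell c \<kappa> \<kappa>' h x) \<cdot>\<^bsub>total Z\<^esub> act_cell d \<kappa>' \<kappa>'' h (FOb (fmap c) x)"
proof -
  interpret C: bicartesian_morphism X \<kappa> Y \<kappa>' c by fact
  interpret D: bicartesian_morphism Y \<kappa>' Z \<kappa>'' d by fact
  interpret DC: bicartesian_morphism X \<kappa> Z \<kappa>'' "d \<cdot>\<^bsub>IesqSesq\<^esub> c"
    using bicartesian_morphismI[of "d \<cdot>\<^bsub>IesqSesq\<^esub> c" \<kappa> \<kappa>''] cmp_bicartesian[OF C.bicart D.bicart]
      C.src C.tgt D.src D.tgt C.S.over C.S.cleavage D.T.over D.T.cleavage by simp
  note cx = C.c_fibre_Ob[OF x] and dcx = D.c_fibre_Ob[OF C.c_fibre_Ob[OF x]]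
  note L = C.S.left_props[OF h x] and R = C.S.right_props[OF h x]
  have o: "DC.cO y = D.cO (C.cO y)" if "y \<in> Ob C.S.E" for y using that by (simp add: fcomp_simps C.src)
  have a: "DC.cA v = D.cA (C.cA v)" if "v \<in> Ar C.S.E" for v using that by (simp add: fcomp_simps C.src)
  have ob: "x \<in> Ob C.S.E" "Src C.S.E (C.S.lft h x) \<in> Ob C.S.E" "Tgt C.S.E (C.S.rgt h x) \<in> Ob C.S.E"
    using x L(5) R(5) by (simp_all add: C.S.fibre_Ob)
  obtain u where u: "u \<in> hom C.T.E (Src C.T.E (C.T.lft h (C.cO x))) (C.cO (Src C.S.E (C.S.lft h x)))"
    "C.cA (C.S.lft h x) \<cdot>\<^bsub>C.T.E\<^esub> u = C.T.lft h (C.cO x)"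
    "act_cell c \<kappa> \<kappa>' h x \<cdot>\<^bsub>C.T.E\<^esub> C.T.rgt h (C.cO x) = C.cA (C.S.rgt h x) \<cdot>\<^bsub>C.T.E\<^esub> u" by (rule C.act_cellE[OF h x])
  obtain v where v: "v \<in> hom D.T.E (Src D.T.E (D.T.lft h (D.cO (C.cO x)))) (D.cO (Src C.T.E (C.T.lft h (C.cO x))))"
    "D.cA (C.T.lft h (C.cO x)) \<cdot>\<^bsub>D.T.E\<^esub> v = D.T.lft h (D.cO (C.cO x))"
    "act_cell d \<kappa>' \<kappa>'' h (C.cO x) \<cdot>\<^bsub>D.T.E\<^esub> D.T.rgt h (D.cO (C.cO x)) = D.cA (C.T.rgt h (C.cO x)) \<cdot>\<^bsub>D.T.E\<^esub> v"
    by (rule D.act_cellE[OF h cx])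
  note pc = C.act_cell_hom[OF h x] and pd = D.act_cell_hom[OF h cx]
  note verC = C.T.fibre_hom[THEN iffD1, THEN conjunct1] and verD = D.T.fibre_hom[THEN iffD1, THEN conjunct1]
  note du = D.c_hom[OF u(1)]
  note cl = C.c_left(2)[OF h x] and cr = C.c_right(2)[OF h x]
  show ?thesis
  proof (rule DC.act_cell_eqI[OF h x], unfold o[OF ob(1)] o[OF ob(2)] o[OF ob(3)] a[OF L(2)] a[OF R(2)])
    show "D.cA (act_cell c \<kappa> \<kappa>' h x) \<cdot>\<^bsub>D.T.E\<^esub> act_cell d \<kappa>' \<kappa>'' h (C.cO x) \<in>
        hom (fibre Z (osrc h)) (Tgt D.T.E (D.T.rgt h (D.cO (C.cO x)))) (D.cO (C.cO (Tgt C.S.E (C.S.rgt h x))))"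
      using cmp_hom[OF D.T.fibre_category pd D.c_fibre_hom[OF pc]] by simp
    show "D.cA u \<cdot>\<^bsub>D.T.E\<^esub> v \<in> hom D.T.E (Src D.T.E (D.T.lft h (D.cO (C.cO x)))) (D.cO (C.cO (Src C.S.E (C.S.lft h x))))"
      by (rule cmp_hom[OF D.T.E_cat v(1) du])
    show "D.cA (C.cA (C.S.lft h x)) \<cdot>\<^bsub>D.T.E\<^esub> (D.cA u \<cdot>\<^bsub>D.T.E\<^esub> v) = D.T.lft h (D.cO (C.cO x))"
      using hom_assoc[OF D.T.E_cat v(1) du D.c_hom[OF cl]] D.c_cmp[OF u(1) cl] u(2) v(2) by simp
    have e: "D.cA (act_cell c \<kappa> \<kappa>' h x) \<cdot>\<^bsub>D.T.E\<^esub> D.cA (C.T.rgt h (C.cO x)) = D.cA (C.cA (C.S.rgt h x)) \<cdot>\<^bsub>D.T.E\<^esub> D.cA u"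
      using D.c_cmp[OF C.T.right_hom[OF h cx] verC[OF pc]] D.c_cmp[OF u(1) cr] u(3) by simp
    show "(D.cA (act_cell c \<kappa> \<kappa>' h x) \<cdot>\<^bsub>D.T.E\<^esub> act_cell d \<kappa>' \<kappa>'' h (C.cO x)) \<cdot>\<^bsub>D.T.E\<^esub> D.T.rgt h (D.cO (C.cO x)) =
        D.cA (C.cA (C.S.rgt h x)) \<cdot>\<^bsub>D.T.E\<^esub> (D.cA u \<cdot>\<^bsub>D.T.E\<^esub> v)"
      by (rule square_paste[OF D.T.E_cat D.T.right_hom[OF h dcx] verD[OF pd] v(1) D.c_hom[OF C.T.right_hom[OF h cx]]
            D.c_hom[OF verC[OF pc]] du D.c_hom[OF cr] v(3) e])
  qed
qed

lemma normal_sesquicartesianI: "sesquicartesian X \<Longrightarrow> normal_cleavage X \<kappa> \<Longrightarrow> normal_sesquicartesian X \<kappa>"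
  using sesquicartesian_over[of X]
  by unfold_locales (auto simp: normal_cleavage_def)

text \<open>With one normal cleavage fixed per fibration the assignment is strictly functorial: an
  identity is compared with itself through a single cleavage, and the two factors of a composite use
  the same cleavage in the middle.\<close>

theorem theorem9p7:
  fixes \<kappa> :: "('o, 'a) fib \<Rightarrow> ('o, 'a) cleavage"
  assumes "\<forall>X \<in> Ob IesqSesq. normal_cleavage X (\<kappa> X)"
  shows "is_functor IesqSesq DecompCulf (decomp_functor \<kappa>) \<and>
    (\<forall>X \<in> Ob IesqSesq.
       (\<forall>n. sgrp (FOb (decomp_functor \<kappa>) X) n = core (fibre X n)) \<and>
       (\<forall>g. generic g \<longrightarrow> sact (FOb (decomp_functor \<kappa>) X) g
              = core_func (fibre X (otgt g)) (push X (\<kappa> X) (under_gen g))) \<and>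
       (\<forall>f. free f \<longrightarrow> sact (FOb (decomp_functor \<kappa>) X) f
              = core_func (fibre X (otgt f)) (pull X (\<kappa> X) (under_free f)))) \<and>
    (\<forall>c \<in> Ar IesqSesq. \<forall>n.
       scomponent (FAr (decomp_functor \<kappa>) c) n
         = core_func (fibre (fsrc c) n) (fibre_func c n))"
proof -
  have N: "normal_sesquicartesian X (\<kappa> X)" if "X \<in> Ob IesqSesq" for X
    using normal_sesquicartesianI[of X "\<kappa> X"] assms that by simp
  have M: "sesquicartesian_morphism X (\<kappa> X) Y (\<kappa> Y) c" if c: "c \<in> hom IesqSesq X Y" for c X Y
  proof -
    have c': "c \<in> Ar IesqSesq" "fsrc c = X" "ftgt c = Y" using c by (auto simp: in_hom)
    have ob: "X \<in> Ob IesqSesq" "Y \<in> Ob IesqSesq" using c' by (auto simp: IesqSesq_Ar)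
    have "bicartesian_functor c" using c'(1) sesq_functor_bicartesian by (auto simp: IesqSesq_Ar)
    interpret S: normal_sesquicartesian X "\<kappa> X" by (rule N[OF ob(1)])
    interpret T: normal_sesquicartesian Y "\<kappa> Y" by (rule N[OF ob(2)])
    interpret B: bicartesian_morphism X "\<kappa> X" Y "\<kappa> Y" c
      by unfold_locales (use c' \<open>bicartesian_functor c\<close> in auto)
    show ?thesis by unfold_locales (use c'(1) in \<open>simp add: IesqSesq_Ar\<close>)
  qed
  have FOb: "FOb (decomp_functor \<kappa>) X = decomp_of X (\<kappa> X)" if "X \<in> Ob IesqSesq" for X
    using that by (simp add: decomp_functor_def del: IesqSesq_simps)
  have FAr: "FAr (decomp_functor \<kappa>) c = decomp_map c (\<kappa> X) (\<kappa> Y)" if "c \<in> hom IesqSesq X Y" for c X Y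
    using that by (simp add: decomp_functor_def in_hom)
  have ds: "decomposition_space (decomp_of X (\<kappa> X))" if "X \<in> Ob IesqSesq" for X
    using normal_sesquicartesian.decomp_of_decomposition_space[OF N[OF that]] that by simp
  have "is_functor IesqSesq DecompCulf (decomp_functor \<kappa>)"
  proof (rule is_functorI[OF IesqSesq_category DecompCulf_category])
    show "FOb (decomp_functor \<kappa>) X \<in> Ob DecompCulf" if "X \<in> Ob IesqSesq" for X
      using ds[OF that] by (simp add: FOb[OF that])
    show "FOb (decomp_functor \<kappa>) \<in> extensional (Ob IesqSesq)" "FAr (decomp_functor \<kappa>) \<in> extensional (Ar IesqSesq)"
      by (simp_all add: decomp_functor_def del: IesqSesq_simps)
  next
    fix c and X Y :: "('o, 'a) fib" assume c: "c \<in> hom IesqSesq X Y"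
    interpret C: sesquicartesian_morphism X "\<kappa> X" Y "\<kappa> Y" c by (rule M[OF c])
    have ob: "X \<in> Ob IesqSesq" "Y \<in> Ob IesqSesq" using hom_Ob[OF IesqSesq_category c] by auto
    show "FAr (decomp_functor \<kappa>) c \<in> hom DecompCulf (FOb (decomp_functor \<kappa>) X) (FOb (decomp_functor \<kappa>) Y)"
      using C.decomp_map_culf ds[OF ob(1)] ds[OF ob(2)]
      by (simp add: FAr[OF c] FOb[OF ob(1)] FOb[OF ob(2)] in_hom DecompCulf_Ar)
  next
    fix X :: "('o, 'a) fib" assume X: "X \<in> Ob IesqSesq"
    interpret N: normal_sesquicartesian X "\<kappa> X" by (rule N[OF X])
    have I: "Ident IesqSesq X \<in> hom IesqSesq X X" by (rule Ident_hom[OF IesqSesq_category X])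
    interpret C: sesquicartesian_morphism X "\<kappa> X" X "\<kappa> X" "Ident IesqSesq X" by (rule M[OF I])
    show "FAr (decomp_functor \<kappa>) (Ident IesqSesq X) = Ident DecompCulf (FOb (decomp_functor \<kappa>) X)"
      unfolding FAr[OF I] FOb[OF X]
    proof (rule smap_eqI)
      show "scomponent (decomp_map (Ident IesqSesq X) (\<kappa> X) (\<kappa> X)) n = scomponent (Ident DecompCulf (decomp_of X (\<kappa> X))) n" for n
      proof -
        have "core_func (fibre X n) (fibre_func (Ident IesqSesq X) n) = core_func (fibre X n) (idf (fibre X n))"
          by (rule core_func_cong)
            (simp_all add: C.fibre_func_simps(1,2) idf_simps fibre_total del: N.fibre_Ar)
        then show ?thesis by (simp add: core_idf[OF N.fibre_category])
      qed
      show "scell (decomp_map (Ident IesqSesq X) (\<kappa> X) (\<kappa> X)) = scell (Ident DecompCulf (decomp_of X (\<kappa> X)))"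
        unfolding C.decomp_map_scell DecompCulf_scell
      proof (rule restrict_cells_cong)
        fix h x assume h: "h \<in> Ar Delta" and "x \<in> Ob (sgrp (decomp_of X (\<kappa> X)) (otgt h))"
        then have x: "x \<in> Ob (fibre X (otgt h))" by (simp add: core_simps)
        show "act_cell (Ident IesqSesq X) (\<kappa> X) (\<kappa> X) h x =
            Ident (sgrp (decomp_of X (\<kappa> X)) (osrc h)) (FOb (sact (decomp_of X (\<kappa> X)) h) x)"
          by (simp add: act_cell_Ident_map[OF N[OF X] h x] core_simps core_func_simps(1)[OF x])
      qed
    qed simp_all
  next
    fix c d and X Y Z :: "('o, 'a) fib" assume c: "c \<in> hom IesqSesq X Y" and d: "d \<in> hom IesqSesq Y Z"
    have dc: "d \<cdot>\<^bsub>IesqSesq\<^esub> c \<in> hom IesqSesq X Z" by (rule cmp_hom[OF IesqSesq_category c d])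
    interpret C: sesquicartesian_morphism X "\<kappa> X" Y "\<kappa> Y" c by (rule M[OF c])
    interpret D: sesquicartesian_morphism Y "\<kappa> Y" Z "\<kappa> Z" d by (rule M[OF d])
    interpret DC: sesquicartesian_morphism X "\<kappa> X" Z "\<kappa> Z" "d \<cdot>\<^bsub>IesqSesq\<^esub> c" by (rule M[OF dc])
    show "FAr (decomp_functor \<kappa>) (d \<cdot>\<^bsub>IesqSesq\<^esub> c) = FAr (decomp_functor \<kappa>) d \<cdot>\<^bsub>DecompCulf\<^esub> FAr (decomp_functor \<kappa>) c"
      unfolding FAr[OF c] FAr[OF d] FAr[OF dc]
    proof (rule smap_eqI)
      show "scomponent (decomp_map (d \<cdot>\<^bsub>IesqSesq\<^esub> c) (\<kappa> X) (\<kappa> Z)) n =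
          scomponent (decomp_map d (\<kappa> Y) (\<kappa> Z) \<cdot>\<^bsub>DecompCulf\<^esub> decomp_map c (\<kappa> X) (\<kappa> Y)) n" for n
        using core_fcomp[OF C.fibre_func_functor, of n "fibre_func d n"] fibre_func_cmp[of c n d] C.fibre_func_functor[of n] C.src D.src
        by simp
      show "scell (decomp_map (d \<cdot>\<^bsub>IesqSesq\<^esub> c) (\<kappa> X) (\<kappa> Z)) =
          scell (decomp_map d (\<kappa> Y) (\<kappa> Z) \<cdot>\<^bsub>DecompCulf\<^esub> decomp_map c (\<kappa> X) (\<kappa> Y))"
        unfolding DC.decomp_map_scell DecompCulf_scell C.decomp_map_simps D.decomp_map_simps
      proof (rule restrict_cells_cong)
        fix h x assume h: "h \<in> Ar Delta" and "x \<in> Ob (sgrp (decomp_of X (\<kappa> X)) (otgt h))"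
        then have x: "x \<in> Ob (fibre X (otgt h))" by (simp add: core_simps)
        have "act_cell c (\<kappa> X) (\<kappa> Y) h x \<in> Ar (fibre Y (osrc h))" "is_iso (fibre Y (osrc h)) (act_cell c (\<kappa> X) (\<kappa> Y) h x)"
          using C.act_cell_hom[OF h x] C.act_cell_span_map(2)[OF h x] by (simp_all only: in_hom)
        \<comment> \<open>The cell of \<open>c\<close> is an isomorphism of a fibre, so restricting
          \<open>d\<close> to that fibre and to its maximal subgroupoid does not change its value
          there.\<close>
        then have "FAr (core_func (fibre Y (osrc h)) (fibre_func d (osrc h))) (act_cell c (\<kappa> X) (\<kappa> Y) h x) =
            FAr (fmap d) (act_cell c (\<kappa> X) (\<kappa> Y) h x)"
          by (simp add: core_func_simps(2) D.fibre_func_simps(2) del: C.T.fibre_Ar)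
        then show "act_cell (d \<cdot>\<^bsub>IesqSesq\<^esub> c) (\<kappa> X) (\<kappa> Z) h x =
            FAr (core_func (fibre Y (osrc h)) (fibre_func d (osrc h))) (scell (decomp_map c (\<kappa> X) (\<kappa> Y)) h x)
            \<cdot>\<^bsub>sgrp (decomp_of Z (\<kappa> Z)) (osrc h)\<^esub>
            scell (decomp_map d (\<kappa> Y) (\<kappa> Z)) h (FOb (core_func (fibre X (otgt h)) (fibre_func c (otgt h))) x)"
          using act_cell_cmp[OF C.bicartesian_morphism_axioms D.bicartesian_morphism_axioms h x]
          by (simp add: C.decomp_map_scell_app[OF h x] D.decomp_map_scell_app[OF h C.c_fibre_Ob[OF x]]
              core_func_simps(1)[OF x] C.fibre_func_simps(1)[OF x] core_simps)
      qed
    qed simp_all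
  qed
  moreover have "sgrp (FOb (decomp_functor \<kappa>) X) n = core (fibre X n)"
    "generic g \<Longrightarrow> sact (FOb (decomp_functor \<kappa>) X) g = core_func (fibre X (otgt g)) (push X (\<kappa> X) (under_gen g))"
    "free f \<Longrightarrow> sact (FOb (decomp_functor \<kappa>) X) f = core_func (fibre X (otgt f)) (pull X (\<kappa> X) (under_free f))"
    if X: "X \<in> Ob IesqSesq" for X n g f
  proof -
    interpret N: normal_sesquicartesian X "\<kappa> X" by (rule N[OF X])
    show "sgrp (FOb (decomp_functor \<kappa>) X) n = core (fibre X n)" by (simp add: FOb[OF X])
    \<comment> \<open>Normality makes the action equal to \<open>push\<close>, rather than to
      \<open>push\<close> preceded by some pullback along an identity.\<close>
    show "generic g \<Longrightarrow> sact (FOb (decomp_functor \<kappa>) X) g = core_func (fibre X (otgt g)) (push X (\<kappa> X) (under_gen g))"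
      by (simp add: FOb[OF X] N.act_generic)
    show "free f \<Longrightarrow> sact (FOb (decomp_functor \<kappa>) X) f = core_func (fibre X (otgt f)) (pull X (\<kappa> X) (under_free f))"
      by (simp add: FOb[OF X] N.act_free)
  qed
  moreover have "scomponent (FAr (decomp_functor \<kappa>) c) n = core_func (fibre (fsrc c) n) (fibre_func c n)"
    if "c \<in> Ar IesqSesq" for c n
    using that by (simp add: decomp_functor_def decomp_map_def)
  ultimately show ?thesis by blast
qed

end
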